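(* Let $(A^{\rhd}, A^{\mathrm{Gr}}) \to (B^{\rhd}, B^{\mathrm{Gr}})$ and $(A^{\rhd}, A^{\mathrm{Gr}}) \to (C^{\rhd}, C^{\mathrm{Gr}})$ be morphisms of affinoid seminormed rings, and let $(D^{\rhd}, D^{\mathrm{Gr}}) = (B^{\rhd}, B^{\mathrm{Gr}}) \otimes_{(A^{\rhd}, A^{\mathrm{Gr}})} (C^{\rhd}, C^{\mathrm{Gr}})$. Then the natural map \[ \mathrm{Spra}(D^{\rhd}, D^{\mathrm{Gr}}) \to \mathrm{Spra}(B^{\rhd}, B^{\mathrm{Gr}}) \times_{\mathrm{Spra}(A^{\rhd}, A^{\mathrm{Gr}})} \mathrm{Spra}(C^{\rhd}, C^{\mathrm{Gr}}) \] (given by restriction of reified semivaluations) is surjective.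
   Context: A nonarchimedean seminormed ring is a commutative ring $A$ with $|\cdot|:A\to[0,\infty)$, $|0|=0$, $|x+y|\le\max\{|x|,|y|\}$, $|xy|\le|x||y|$. For $r>0$, $A^{\circ,r}$ (resp. $A^{\circ\circ,r}$) is the set of $a$ with $r^{-n}|a^n|$ bounded (resp. tending to $0$); $\mathrm{Gr}\,A=\bigoplus_{r>0}A^{\circ,r}/A^{\circ\circ,r}$. An affinoid seminormed ring $(A^{\rhd},A^{\mathrm{Gr}})$ consists of a nonarchimedean seminormed ring $A^{\rhd}$ and an integrally closed graded subring $A^{\mathrm{Gr}}\subseteq\mathrm{Gr}\,A^{\rhd}$; $A^{+,r}$ denotes the elements of $A^{\rhd,\circ,r}$ whose class in degree $r$ lies in $A^{\mathrm{Gr}}$. A morphism $(A^{\rhd},A^{\mathrm{Gr}})\to(B^{\rhd},B^{\mathrm{Gr}})$ is a bounded ring homomorphism $f:A^{\rhd}\to B^{\rhd}$ (i.e. $|f(a)|\le c|a|$ for some $c>0$) whose induced map on graded rings carries $A^{\mathrm{Gr}}$ into $B^{\mathrm{Gr}}$. The tensor product is $(D^{\rhd},D^{\mathrm{Gr}})$ with $D^{\rhd}=B^{\rhd}\otimes_{A^{\rhd}}C^{\rhd}$ equipped with the tensor product seminorm ($|x|$ = infimum over presentations $x=\sum y_i\otimes z_i$ of $\max_i |y_i||z_i|$) and $D^{\mathrm{Gr}}$ the integral closure in $\mathrm{Gr}\,D^{\rhd}$ of the image of $B^{\mathrm{Gr}}\otimes_{A^{\mathrm{Gr}}}C^{\mathrm{Gr}}$.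 A reified value group is a totally ordered abelian group $\Gamma$ (multiplicative) with an order-preserving homomorphism $\mathbb{R}^+\to\Gamma$ (write $q$ for the image of $q$); a reified semivaluation on a ring $A$ is a map $v:A\to\Gamma\cup\{0\}$ with $v(0)=0,v(1)=1$, $v(x+y)\le\max$, $v(xy)=v(x)v(y)$. $\Gamma_v$ is the subgroup generated by the image of $\mathbb{R}^+$ and nonzero values; equivalence is via isomorphisms of such groups compatible with $\mathbb{R}^+$. $v$ is bounded if $v(a)\le r$ for $a\in A^{\circ\circ,r}$, commensurable if bounded and every $\gamma\in\Gamma_v$ satisfies $r\le\gamma$ for some $r\in\mathbb{R}^+$. $\mathrm{Spra}(A^{\rhd},A^{\mathrm{Gr}})$ is the set of equivalence classes of commensurable reified semivaluations $v$ on $A^{\rhd}$ with $v(a)\le r$ for all $r>0$, $a\in A^{+,r}$, topologized by the sets $\{v: v(a)\le q v(b)\neq 0\}$. *)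

theory Defs
  imports Complex_Main "HOL-Algebra.Algebra" "HOL-Algebra.Free_Abelian_Groups"
begin

section \<open>Nonarchimedean seminormed rings and their graded reductions\<close>

record 'a snring = "'a ring" +
  snorm :: "'a \<Rightarrow> real"

locale nonarch_seminormed_ring = cring A
  for A :: "('a, 'm) snring_scheme" (structure) +
  assumes snorm_nonneg: "x \<in> carrier A \<Longrightarrow> 0 \<le> snorm A x"
    and snorm_zero: "snorm A \<zero> = 0"
    and snorm_add: "\<lbrakk>x \<in> carrier A; y \<in> carrier A\<rbrakk> \<Longrightarrow>
          snorm A (x \<oplus> y) \<le> max (snorm A x) (snorm A y)"
    and snorm_mult: "\<lbrakk>x \<in> carrier A; y \<in> carrier A\<rbrakk> \<Longrightarrow>
          snorm A (x \<otimes> y) \<le> snorm A x * snorm A y"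

definition circ :: "('a, 'm) snring_scheme \<Rightarrow> real \<Rightarrow> 'a set" where
  "circ A r = {a \<in> carrier A. Bseq (\<lambda>n::nat. snorm A (a [^]\<^bsub>A\<^esub> n) / r ^ n)}"

definition circcirc :: "('a, 'm) snring_scheme \<Rightarrow> real \<Rightarrow> 'a set" where
  "circcirc A r =
     {a \<in> carrier A. (\<lambda>n::nat. snorm A (a [^]\<^bsub>A\<^esub> n) / r ^ n) \<longlonglongrightarrow> 0}"

definition gr_piece :: "('a, 'm) snring_scheme \<Rightarrow> real \<Rightarrow> 'a set monoid" where
  "gr_piece A r = (add_monoid A)\<lparr>carrier := circ A r\<rparr> Mod circcirc A r"

text \<open>
  An element of the direct sum over all \<open>r > 0\<close> is a finitely supported family of cosets
  (\<^const>\<open>sum_group\<close>); the product is the convolution of such families. The zero of the piece of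
  degree \<open>s\<close> is the coset \<open>circcirc A s\<close> itself, so the product below runs over the
  finitely many degrees \<open>s\<close> that contribute.
\<close>

definition gr_mult ::
  "('a, 'm) snring_scheme \<Rightarrow> (real \<Rightarrow> 'a set) \<Rightarrow> (real \<Rightarrow> 'a set) \<Rightarrow> (real \<Rightarrow> 'a set)" where
  "gr_mult A x y = (\<lambda>r\<in>{0<..}.
     finprod (gr_piece A r)
       (\<lambda>s. rcoset_mult A (circcirc A r) (x s) (y (r / s)))
       {s. 0 < s \<and> x s \<noteq> circcirc A s \<and> y (r / s) \<noteq> circcirc A (r / s)})"

definition gr_homog :: "('a, 'm) snring_scheme \<Rightarrow> real \<Rightarrow> 'a set \<Rightarrow> (real \<Rightarrow> 'a set)" where
  "gr_homog A r P = (\<lambda>s\<in>{0<..}. if s = r then P else circcirc A s)"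

definition Gr :: "('a, 'm) snring_scheme \<Rightarrow> (real \<Rightarrow> 'a set) ring" where
  "Gr A =
     \<lparr>carrier = carrier (sum_group {0<..} (gr_piece A)),
      monoid.mult = gr_mult A,
      one = gr_homog A 1 (circcirc A 1 +>\<^bsub>A\<^esub> \<one>\<^bsub>A\<^esub>),
      ring.zero = \<one>\<^bsub>sum_group {0<..} (gr_piece A)\<^esub>,
      ring.add = monoid.mult (sum_group {0<..} (gr_piece A))\<rparr>"

definition graded_subring :: "('a, 'm) snring_scheme \<Rightarrow> (real \<Rightarrow> 'a set) set \<Rightarrow> bool" where
  "graded_subring A S \<longleftrightarrow>
     subring S (Gr A) \<and> (\<forall>x\<in>S. \<forall>r>0. gr_homog A r (x r) \<in> S)"

definition integral_closure :: "('r, 'm) ring_scheme \<Rightarrow> 'r set \<Rightarrow> 'r set" where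
  "integral_closure R S =
     {x \<in> carrier R. \<exists>(n::nat) c. c \<in> {..<n} \<rightarrow> S \<and>
        x [^]\<^bsub>R\<^esub> n \<oplus>\<^bsub>R\<^esub> (\<Oplus>\<^bsub>R\<^esub>i\<in>{..<n}. c i \<otimes>\<^bsub>R\<^esub> x [^]\<^bsub>R\<^esub> i) = \<zero>\<^bsub>R\<^esub>}"

text \<open>
  For bounded \<open>f\<close> the cosets in the union all coincide, because \<open>f\<close> maps \<open>circcirc A r\<close> into
  \<open>circcirc B r\<close>.
\<close>

definition gr_map ::
  "('b, 'n) snring_scheme \<Rightarrow> ('a \<Rightarrow> 'b) \<Rightarrow> (real \<Rightarrow> 'a set) \<Rightarrow> (real \<Rightarrow> 'b set)" where
  "gr_map B f x = (\<lambda>r\<in>{0<..}. \<Union>a\<in>x r. circcirc B r +>\<^bsub>B\<^esub> f a)"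


section \<open>Affinoid seminormed rings\<close>

record 'a affinoid = "'a snring" +
  gr_sub :: "(real \<Rightarrow> 'a set) set"

locale affinoid_seminormed_ring = nonarch_seminormed_ring A
  for A :: "'a affinoid" (structure) +
  assumes graded: "graded_subring A (gr_sub A)"
    and integrally_closed: "integral_closure (Gr A) (gr_sub A) \<subseteq> gr_sub A"

definition plus_part :: "'a affinoid \<Rightarrow> real \<Rightarrow> 'a set" where
  "plus_part A r = {a \<in> circ A r. gr_homog A r (circcirc A r +>\<^bsub>A\<^esub> a) \<in> gr_sub A}"

definition affinoid_morphism :: "'a affinoid \<Rightarrow> 'b affinoid \<Rightarrow> ('a \<Rightarrow> 'b) \<Rightarrow> bool" where
  "affinoid_morphism A B f \<longleftrightarrow>
     f \<in> ring_hom A B \<and>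
     (\<exists>c>0. \<forall>a\<in>carrier A. snorm B (f a) \<le> c * snorm A a) \<and>
     gr_map B f ` gr_sub A \<subseteq> gr_sub B"


section \<open>Tensor products\<close>

text \<open>
  The free abelian group on \<open>B \<times> C\<close>, with the biadditive multiplication that extends
  \<open>(b, c) (b', c') = (b b', c c')\<close>.
\<close>

definition pair_ring ::
  "('b, 'n) ring_scheme \<Rightarrow> ('c, 'k) ring_scheme \<Rightarrow> (('b \<times> 'c) \<Rightarrow>\<^sub>0 int) ring" where
  "pair_ring B C =
     \<lparr>carrier = carrier (free_Abelian_group (carrier B \<times> carrier C)),
      monoid.mult = (\<lambda>p q. frag_extend (\<lambda>(b, c).
                frag_extend (\<lambda>(b', c'). frag_of (b \<otimes>\<^bsub>B\<^esub> b', c \<otimes>\<^bsub>C\<^esub> c')) q) p),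
      one = frag_of (\<one>\<^bsub>B\<^esub>, \<one>\<^bsub>C\<^esub>),
      ring.zero = 0,
      ring.add = (+)\<rparr>"

definition tensor_relations ::
  "('a, 'm) ring_scheme \<Rightarrow> ('b, 'n) ring_scheme \<Rightarrow> ('c, 'k) ring_scheme \<Rightarrow>
   ('a \<Rightarrow> 'b) \<Rightarrow> ('a \<Rightarrow> 'c) \<Rightarrow> (('b \<times> 'c) \<Rightarrow>\<^sub>0 int) set" where
  "tensor_relations A B C f g =
     {frag_of (b \<oplus>\<^bsub>B\<^esub> b', c) - frag_of (b, c) - frag_of (b', c) | b b' c.
        b \<in> carrier B \<and> b' \<in> carrier B \<and> c \<in> carrier C}
   \<union> {frag_of (b, c \<oplus>\<^bsub>C\<^esub> c') - frag_of (b, c) - frag_of (b, c') | b c c'.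
        b \<in> carrier B \<and> c \<in> carrier C \<and> c' \<in> carrier C}
   \<union> {frag_of (f a \<otimes>\<^bsub>B\<^esub> b, c) - frag_of (b, g a \<otimes>\<^bsub>C\<^esub> c) | a b c.
        a \<in> carrier A \<and> b \<in> carrier B \<and> c \<in> carrier C}"

definition tensor_kernel ::
  "('a, 'm) ring_scheme \<Rightarrow> ('b, 'n) ring_scheme \<Rightarrow> ('c, 'k) ring_scheme \<Rightarrow>
   ('a \<Rightarrow> 'b) \<Rightarrow> ('a \<Rightarrow> 'c) \<Rightarrow> (('b \<times> 'c) \<Rightarrow>\<^sub>0 int) set" where
  "tensor_kernel A B C f g =
     generate (free_Abelian_group (carrier B \<times> carrier C)) (tensor_relations A B C f g)"

text \<open>
  The set of relations is stable under multiplication by pairs \<open>(b, c)\<close>, so the subgroup it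
  generates is an ideal of \<^const>\<open>pair_ring\<close>.
\<close>

definition tensor_ring ::
  "('a, 'm) ring_scheme \<Rightarrow> ('b, 'n) ring_scheme \<Rightarrow> ('c, 'k) ring_scheme \<Rightarrow>
   ('a \<Rightarrow> 'b) \<Rightarrow> ('a \<Rightarrow> 'c) \<Rightarrow> (('b \<times> 'c) \<Rightarrow>\<^sub>0 int) set ring" where
  "tensor_ring A B C f g = pair_ring B C Quot tensor_kernel A B C f g"

definition pure_tensor ::
  "('a, 'm) ring_scheme \<Rightarrow> ('b, 'n) ring_scheme \<Rightarrow> ('c, 'k) ring_scheme \<Rightarrow>
   ('a \<Rightarrow> 'b) \<Rightarrow> ('a \<Rightarrow> 'c) \<Rightarrow> 'b \<Rightarrow> 'c \<Rightarrow> (('b \<times> 'c) \<Rightarrow>\<^sub>0 int) set" where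
  "pure_tensor A B C f g b c =
     tensor_kernel A B C f g +>\<^bsub>pair_ring B C\<^esub> frag_of (b, c)"

text \<open>
  Inserting \<open>0\<close> fixes the maximum of the empty presentation (\<open>n = 0\<close>); it changes no other
  maximum, since seminorms are nonnegative.
\<close>

definition tensor_snorm ::
  "('a, 'm) snring_scheme \<Rightarrow> ('b, 'n) snring_scheme \<Rightarrow> ('c, 'k) snring_scheme \<Rightarrow>
   ('a \<Rightarrow> 'b) \<Rightarrow> ('a \<Rightarrow> 'c) \<Rightarrow> (('b \<times> 'c) \<Rightarrow>\<^sub>0 int) set \<Rightarrow> real" where
  "tensor_snorm A B C f g x =
     Inf {Max (insert 0 ((\<lambda>i. snorm B (y i) * snorm C (z i)) ` {..<n})) | (n::nat) y z.
            y \<in> {..<n} \<rightarrow> carrier B \<and> z \<in> {..<n} \<rightarrow> carrier C \<and>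
            x = (\<Oplus>\<^bsub>tensor_ring A B C f g\<^esub>i\<in>{..<n}. pure_tensor A B C f g (y i) (z i))}"

definition tensor_snring ::
  "('a, 'm) snring_scheme \<Rightarrow> ('b, 'n) snring_scheme \<Rightarrow> ('c, 'k) snring_scheme \<Rightarrow>
   ('a \<Rightarrow> 'b) \<Rightarrow> ('a \<Rightarrow> 'c) \<Rightarrow> (('b \<times> 'c) \<Rightarrow>\<^sub>0 int) set snring" where
  "tensor_snring A B C f g =
     ring.extend (tensor_ring A B C f g) (snring.fields (tensor_snorm A B C f g))"

definition tensor_left ::
  "('a, 'm) ring_scheme \<Rightarrow> ('b, 'n) ring_scheme \<Rightarrow> ('c, 'k) ring_scheme \<Rightarrow>
   ('a \<Rightarrow> 'b) \<Rightarrow> ('a \<Rightarrow> 'c) \<Rightarrow> 'b \<Rightarrow> (('b \<times> 'c) \<Rightarrow>\<^sub>0 int) set" where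
  "tensor_left A B C f g b = pure_tensor A B C f g b \<one>\<^bsub>C\<^esub>"

definition tensor_right ::
  "('a, 'm) ring_scheme \<Rightarrow> ('b, 'n) ring_scheme \<Rightarrow> ('c, 'k) ring_scheme \<Rightarrow>
   ('a \<Rightarrow> 'b) \<Rightarrow> ('a \<Rightarrow> 'c) \<Rightarrow> 'c \<Rightarrow> (('b \<times> 'c) \<Rightarrow>\<^sub>0 int) set" where
  "tensor_right A B C f g c = pure_tensor A B C f g \<one>\<^bsub>B\<^esub> c"

text \<open>
  The image of the tensor product of the graded subrings of \<open>B\<close> and \<open>C\<close>: the finite sums of the
  images of the pure tensors \<open>y \<otimes> z\<close>.
\<close>

definition tensor_gr_image ::
  "'a affinoid \<Rightarrow> 'b affinoid \<Rightarrow> 'c affinoid \<Rightarrow> ('a \<Rightarrow> 'b) \<Rightarrow> ('a \<Rightarrow> 'c) \<Rightarrow>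
   (real \<Rightarrow> (('b \<times> 'c) \<Rightarrow>\<^sub>0 int) set set) set" where
  "tensor_gr_image A B C f g =
     (let D = tensor_snring A B C f g in
      {\<Oplus>\<^bsub>Gr D\<^esub>i\<in>{..<n}. gr_map D (tensor_left A B C f g) (y i)
           \<otimes>\<^bsub>Gr D\<^esub> gr_map D (tensor_right A B C f g) (z i) | (n::nat) y z.
         y \<in> {..<n} \<rightarrow> gr_sub B \<and> z \<in> {..<n} \<rightarrow> gr_sub C})"

definition tensor_affinoid ::
  "'a affinoid \<Rightarrow> 'b affinoid \<Rightarrow> 'c affinoid \<Rightarrow> ('a \<Rightarrow> 'b) \<Rightarrow> ('a \<Rightarrow> 'c) \<Rightarrow>
   (('b \<times> 'c) \<Rightarrow>\<^sub>0 int) set affinoid" where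
  "tensor_affinoid A B C f g =
     (let D = tensor_snring A B C f g in
      snring.extend D
        (affinoid.fields (integral_closure (Gr D) (tensor_gr_image A B C f g))))"


section \<open>Reified semivaluations\<close>

text \<open>
  The homomorphism from the positive reals to the value group is required to be monotone, not
  strictly monotone. Whether it is injective is preserved by equivalence and by restriction.
\<close>

record 'g rvgroup = "'g monoid" +
  gle :: "'g \<Rightarrow> 'g \<Rightarrow> bool"
  reify :: "real \<Rightarrow> 'g"

locale reified_value_group = comm_group G
  for G :: "'g rvgroup" (structure) +
  assumes total_order:
      "linear_order_on (carrier G) {(x, y). x \<in> carrier G \<and> y \<in> carrier G \<and> gle G x y}"
    and gle_mult: "\<lbrakk>x \<in> carrier G; y \<in> carrier G; z \<in> carrier G; gle G x y\<rbrakk> \<Longrightarrow>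
          gle G (x \<otimes> z) (y \<otimes> z)"
    and reify_closed: "0 < r \<Longrightarrow> reify G r \<in> carrier G"
    and reify_mult: "\<lbrakk>0 < r; 0 < s\<rbrakk> \<Longrightarrow> reify G (r * s) = reify G r \<otimes> reify G s"
    and reify_mono: "\<lbrakk>0 < r; r \<le> s\<rbrakk> \<Longrightarrow> gle G (reify G r) (reify G s)"

text \<open>The set \<open>\<Gamma> \<union> {0}\<close> is modelled by \<^typ>\<open>'g option\<close>, with \<^const>\<open>None\<close> as \<open>0\<close>.\<close>

fun gle0 :: "'g rvgroup \<Rightarrow> 'g option \<Rightarrow> 'g option \<Rightarrow> bool" where
  "gle0 G None y = True"
| "gle0 G (Some a) None = False"
| "gle0 G (Some a) (Some b) = gle G a b"

fun mult0 :: "'g rvgroup \<Rightarrow> 'g option \<Rightarrow> 'g option \<Rightarrow> 'g option" where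
  "mult0 G (Some a) (Some b) = Some (a \<otimes>\<^bsub>G\<^esub> b)"
| "mult0 G x y = None"

text \<open>
  A semivaluation is stored together with its value group. The group and the map are only
  constrained on the respective carriers.
\<close>

type_synonym ('a, 'g) rsval = "'g rvgroup \<times> ('a \<Rightarrow> 'g option)"

definition reified_semivaluation :: "('a, 'm) ring_scheme \<Rightarrow> ('a, 'g) rsval \<Rightarrow> bool" where
  "reified_semivaluation A V \<longleftrightarrow> (case V of (G, v) \<Rightarrow>
     reified_value_group G \<and>
     v \<in> carrier A \<rightarrow> insert None (Some ` carrier G) \<and>
     v \<zero>\<^bsub>A\<^esub> = None \<and> v \<one>\<^bsub>A\<^esub> = Some \<one>\<^bsub>G\<^esub> \<and>
     (\<forall>x\<in>carrier A. \<forall>y\<in>carrier A.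
        (gle0 G (v (x \<oplus>\<^bsub>A\<^esub> y)) (v x) \<or> gle0 G (v (x \<oplus>\<^bsub>A\<^esub> y)) (v y)) \<and>
        v (x \<otimes>\<^bsub>A\<^esub> y) = mult0 G (v x) (v y)))"

definition value_subgroup :: "('a, 'm) ring_scheme \<Rightarrow> ('a, 'g) rsval \<Rightarrow> 'g set" where
  "value_subgroup A V = (case V of (G, v) \<Rightarrow>
     generate G (reify G ` {0<..} \<union> {\<gamma>. \<exists>a\<in>carrier A. v a = Some \<gamma>}))"

definition rsval_equiv ::
  "('a, 'm) ring_scheme \<Rightarrow> ('a, 'g) rsval \<Rightarrow> ('a, 'h) rsval \<Rightarrow> bool" where
  "rsval_equiv A V W \<longleftrightarrow> (case (V, W) of ((G, v), (H, w)) \<Rightarrow>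
     \<exists>\<phi> \<in> iso (G\<lparr>carrier := value_subgroup A V\<rparr>) (H\<lparr>carrier := value_subgroup A W\<rparr>).
       (\<forall>x\<in>value_subgroup A V. \<forall>y\<in>value_subgroup A V. gle G x y \<longleftrightarrow> gle H (\<phi> x) (\<phi> y)) \<and>
       (\<forall>r>0. \<phi> (reify G r) = reify H r) \<and>
       (\<forall>a\<in>carrier A. w a = map_option \<phi> (v a)))"

definition rsval_bounded :: "('a, 'm) snring_scheme \<Rightarrow> ('a, 'g) rsval \<Rightarrow> bool" where
  "rsval_bounded A V \<longleftrightarrow> (case V of (G, v) \<Rightarrow>
     \<forall>r>0. \<forall>a\<in>circcirc A r. gle0 G (v a) (Some (reify G r)))"

definition rsval_commensurable :: "('a, 'm) snring_scheme \<Rightarrow> ('a, 'g) rsval \<Rightarrow> bool" where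
  "rsval_commensurable A V \<longleftrightarrow> rsval_bounded A V \<and> (case V of (G, v) \<Rightarrow>
     \<forall>\<gamma>\<in>value_subgroup A V. \<exists>r>0. gle G (reify G r) \<gamma>)"


section \<open>The reified adic spectrum as a set\<close>

definition spra_vals :: "'a affinoid \<Rightarrow> ('a, 'g) rsval set" where
  "spra_vals A =
     {(G, v). reified_semivaluation A (G, v) \<and> rsval_commensurable A (G, v) \<and>
        (\<forall>r>0. \<forall>a\<in>plus_part A r. gle0 G (v a) (Some (reify G r)))}"

text \<open>
  Equivalence classes are formed among semivaluations whose value groups live in one fixed type.
  No class is lost: every element of \<open>\<Gamma>\<^sub>v\<close> has the form \<open>r v(a) / v(b)\<close>, so sending
  \<open>\<gamma>\<close> to the set of all \<open>(r, a, b)\<close> that represent it embeds \<open>\<Gamma>\<^sub>v\<close> into the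
  type \<^typ>\<open>(real \<times> 'a \<times> 'a) set\<close>. Hence every reified semivaluation, with values
  in any type, is equivalent to one with values in this type.
\<close>

definition Spra :: "'a affinoid \<Rightarrow> ('a, (real \<times> 'a \<times> 'a) set) rsval set set" where
  "Spra A = spra_vals A //
     {(V, W). V \<in> spra_vals A \<and> W \<in> spra_vals A \<and> rsval_equiv A V W}"

text \<open>
  Restriction of a class along \<open>f : A \<rightarrow> B\<close>. The composite \<open>v \<circ> f\<close> has its values in the type used
  for \<open>B\<close>; its class is represented by the equivalent semivaluations in the type used for \<open>A\<close>.
\<close>

definition spra_map ::
  "'a affinoid \<Rightarrow> ('a \<Rightarrow> 'b) \<Rightarrow> ('b, (real \<times> 'b \<times> 'b) set) rsval set \<Rightarrow>
   ('a, (real \<times> 'a \<times> 'a) set) rsval set" where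
  "spra_map A f K = {W \<in> spra_vals A. \<exists>(G, v)\<in>K. rsval_equiv A (G, v \<circ> f) W}"

end

theory Submission
  imports Defs "HOL-Computational_Algebra.Polynomial"
begin

text \<open>
  A reified semivaluation \<open>v\<close> matters only through the relation \<open>{(r, a, b). v(a) \<le> r v(b)}\<close>, which determines its
  class and can be axiomatized as an order; conversely each such order comes from a semivaluation. Surjectivity
  thus asks for a common extension to \<open>D = B \<otimes> C\<close> of orders \<open>v\<close> on \<open>B\<close> and \<open>w\<close> on \<open>C\<close> that agree on \<open>A\<close>.

  Adjoin to \<open>D\<close> formal monomials \<open>r (b \<otimes> c) / (s \<otimes> t)\<close>. Call a monomial small if \<open>v(b)/v(s) \<le> \<gamma>\<close> and
  \<open>r w(c)/w(t) \<le> \<gamma>\<inverse>\<close> for some \<open>\<gamma>\<close> in the value group of \<open>A\<close>, tiny if moreover one inequality is strict, and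
  exact if both are equalities. The small monomials generate a ring in which the tiny ones generate an ideal, and
  a Manis valuation with \<open>1\<close> bounding this ring and dominating this ideal strictly restricts to the required order.
  By Zorn's lemma it exists as soon as no exact monomial \<open>m\<close> is congruent to a combination of tiny ones. For
  this, eliminate finitely many relations: there is a map \<open>\<lambda>\<close> from \<open>B\<close> to \<open>A\<close> that is \<open>A\<close>-linear up to elements of
  value \<open>0\<close> on the elements involved and has \<open>v(\<lambda>(b)) / v(b)\<close> maximal at the \<open>B\<close>-part of \<open>m\<close>; the contraction
  \<open>b \<otimes> c \<mapsto> \<lambda>(b) c\<close> turns the congruence into a violation of the ultrametric inequality in \<open>C\<close>.

  A horizontal specialization makes the extension commensurable. It is bounded and at most \<open>r\<close> on the elements
  of \<open>D\<^sup>+\<close> in degree \<open>r\<close>, because elements integral over the image of the two graded subrings satisfy the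
  bounds inherited from \<open>B\<close> and \<open>C\<close>.
\<close>

section \<open>Manis valuations\<close>

text \<open>The obstacle is that \<open>D\<close> may have zero divisors and contains no
  denominators, while elements of \<open>B\<close> and \<open>C\<close> can be compared only through
  the value group of \<open>A\<close>. Over a valuation ring torsion-free modules are flat, which
  would keep an exact tensor from collapsing into tiny ones; the almost linear map is an elementwise
  substitute for that flatness, available over \<open>A\<close> itself, and equality up to elements
  of value \<open>0\<close> replaces division by the support. Its bound relative to the
  \<open>B\<close>-part of \<open>m\<close> is what carries strictness from \<open>B\<close> over to
  \<open>C\<close>.

  Formal monomials supply the denominators. Their additive relations never change the denominator,
  so a congruence can be tested on one denominator at a time.

  Zero divisors are the reason for Manis pairs, which extend a subring with a prime ideal inside an
  arbitrary commutative ring.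

  The Manis valuation guarantees only that elements of value \<open>0\<close> in \<open>B\<close>
  and \<open>C\<close> become smaller than every scalar. The specialization sends them to
  \<open>0\<close>, and commensurability on \<open>B\<close> and \<open>C\<close> protects all other
  values; so it also restores the exact restrictions.\<close>

definition is_subring :: "'e::comm_ring_1 set \<Rightarrow> bool" where
  "is_subring R \<longleftrightarrow> 1 \<in> R \<and> (\<forall>x\<in>R. \<forall>y\<in>R. x - y \<in> R \<and> x * y \<in> R)"

definition is_ideal :: "'e::comm_ring_1 set \<Rightarrow> 'e set \<Rightarrow> bool" where
  "is_ideal R I \<longleftrightarrow> I \<subseteq> R \<and> 0 \<in> I \<and> (\<forall>x\<in>I. \<forall>y\<in>I. x + y \<in> I) \<and> (\<forall>r\<in>R. \<forall>x\<in>I. r * x \<in> I)"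

definition is_prime :: "'e::comm_ring_1 set \<Rightarrow> 'e set \<Rightarrow> bool" where
  "is_prime R q \<longleftrightarrow> is_ideal R q \<and> 1 \<notin> q \<and> (\<forall>x\<in>R. \<forall>y\<in>R. x * y \<in> q \<longrightarrow> x \<in> q \<or> y \<in> q)"

lemma is_subringD:
  assumes "is_subring R"
  shows "1 \<in> R" "0 \<in> R" "x \<in> R \<Longrightarrow> y \<in> R \<Longrightarrow> x - y \<in> R" "x \<in> R \<Longrightarrow> y \<in> R \<Longrightarrow> x * y \<in> R"
    "x \<in> R \<Longrightarrow> - x \<in> R" "x \<in> R \<Longrightarrow> y \<in> R \<Longrightarrow> x + y \<in> R" "x \<in> R \<Longrightarrow> x ^ n \<in> R"
proof -
  show 1: "1 \<in> R" and d: "x \<in> R \<Longrightarrow> y \<in> R \<Longrightarrow> x - y \<in> R" and m: "x \<in> R \<Longrightarrow> y \<in> R \<Longrightarrow> x * y \<in> R" for x y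
    using assms by (auto simp: is_subring_def)
  show 0: "0 \<in> R" using d[OF 1 1] by simp
  show n: "x \<in> R \<Longrightarrow> - x \<in> R" for x using d[OF 0] by fastforce
  show "x \<in> R \<Longrightarrow> y \<in> R \<Longrightarrow> x + y \<in> R" using d[OF _ n] by fastforce
  show "x \<in> R \<Longrightarrow> x ^ n \<in> R" by (induction n) (auto simp: 1 m)
qed

lemma is_idealD:
  assumes "is_ideal R I"
  shows "x \<in> I \<Longrightarrow> x \<in> R" "0 \<in> I" "x \<in> I \<Longrightarrow> y \<in> I \<Longrightarrow> x + y \<in> I"
    "r \<in> R \<Longrightarrow> x \<in> I \<Longrightarrow> r * x \<in> I" "r \<in> R \<Longrightarrow> x \<in> I \<Longrightarrow> x * r \<in> I"
  using assms by (auto simp: is_ideal_def mult.commute)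

lemma sum_in_additive:
  assumes "0 \<in> M" "\<And>x y. x \<in> M \<Longrightarrow> y \<in> M \<Longrightarrow> x + y \<in> M" "\<And>i. i \<in> A \<Longrightarrow> f i \<in> M"
  shows "sum f A \<in> M"
  using assms(3) by (induction A rule: infinite_finite_induct) (auto simp: assms(1,2))

text \<open>Krull's argument: an ideal maximal among those that contain \<open>I\<close> and miss
  \<open>S\<close> is prime. Rings are subsets of one type here, so that a later application of
  Zorn's lemma can vary the ring as well.\<close>

lemma prime_avoiding:
  assumes R: "is_subring R" and I: "is_ideal R I"
    and S: "1 \<in> S" "S \<subseteq> R" "\<And>x y. x \<in> S \<Longrightarrow> y \<in> S \<Longrightarrow> x * y \<in> S" and IS: "I \<inter> S = {}"
  obtains q where "is_prime R q" "I \<subseteq> q" "q \<inter> S = {}"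
proof -
  define \<A> where "\<A> = {J. is_ideal R J \<and> I \<subseteq> J \<and> J \<inter> S = {}}"
  have "\<exists>M\<in>\<A>. \<forall>Z\<in>\<A>. M \<subseteq> Z \<longrightarrow> Z = M"
  proof (rule subset_Zorn_nonempty)
    show "\<A> \<noteq> {}" using I IS by (auto simp: \<A>_def)
    fix \<C> assume ne: "\<C> \<noteq> {}" and ch: "subset.chain \<A> \<C>"
    then have sub: "\<C> \<subseteq> \<A>" and tot: "\<And>Z Y. Z \<in> \<C> \<Longrightarrow> Y \<in> \<C> \<Longrightarrow> Z \<subseteq> Y \<or> Y \<subseteq> Z"
      by (auto simp: subset.chain_def)
    have "is_ideal R (\<Union>\<C>)"
      unfolding is_ideal_def
    proof (intro conjI ballI)
      show "\<Union>\<C> \<subseteq> R" using sub by (auto simp: \<A>_def dest: is_idealD)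
      show "0 \<in> \<Union>\<C>" using sub ne is_idealD(2) unfolding \<A>_def by blast
      show "x + y \<in> \<Union>\<C>" if xy: "x \<in> \<Union>\<C>" "y \<in> \<Union>\<C>" for x y
      proof -
        obtain Z Y where XY: "Z \<in> \<C>" "Y \<in> \<C>" "x \<in> Z" "y \<in> Y" using xy by blast
        then obtain Z where "Z \<in> \<C>" "x \<in> Z" "y \<in> Z" using tot by blast
        then show ?thesis using sub is_idealD(3) unfolding \<A>_def by blast
      qed
      show "r * x \<in> \<Union>\<C>" if "r \<in> R" "x \<in> \<Union>\<C>" for r x
        using that sub is_idealD(4) unfolding \<A>_def by blast
    qed
    then show "\<Union>\<C> \<in> \<A>" using sub ne by (auto simp: \<A>_def)
  qed
  then obtain q where q: "q \<in> \<A>" and max: "\<And>Z. Z \<in> \<A> \<Longrightarrow> q \<subseteq> Z \<Longrightarrow> Z = q" by blast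
  then have qi: "is_ideal R q" and Iq: "I \<subseteq> q" and qS: "q \<inter> S = {}" by (auto simp: \<A>_def)
  note RD = is_subringD[OF R] and qD = is_idealD[OF qi]
  \<comment> \<open>Maximality of \<open>q\<close>: the ideal generated by \<open>q\<close> and an
    element outside \<open>q\<close> meets \<open>S\<close>.\<close>
  have hit: "\<exists>r\<in>R. \<exists>i\<in>q. i + r * x \<in> S" if x: "x \<in> R" "x \<notin> q" for x
  proof (rule ccontr)
    assume no: "\<not> ?thesis"
    define Z where "Z = {i + r * x | i r. i \<in> q \<and> r \<in> R}"
    have "is_ideal R Z"
      unfolding is_ideal_def
    proof (intro conjI ballI)
      show "Z \<subseteq> R" using x qD(1) RD(4,6) by (auto simp: Z_def)
      have "0 = 0 + 0 * x" by simp
      then show "0 \<in> Z" unfolding Z_def using qD(2) RD(2) by blast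
      show "a + b \<in> Z" if ab: "a \<in> Z" "b \<in> Z" for a b
      proof -
        obtain i r j s where "a = i + r * x" "b = j + s * x" "i \<in> q" "r \<in> R" "j \<in> q" "s \<in> R"
          using ab unfolding Z_def by blast
        then have "a + b = (i + j) + (r + s) * x" "i + j \<in> q" "r + s \<in> R"
          by (auto simp: algebra_simps intro: qD RD)
        then show ?thesis unfolding Z_def by blast
      qed
      show "c * a \<in> Z" if ca: "c \<in> R" "a \<in> Z" for c a
      proof -
        obtain i r where "a = i + r * x" "i \<in> q" "r \<in> R" using ca unfolding Z_def by blast
        then have "c * a = c * i + (c * r) * x" "c * i \<in> q" "c * r \<in> R"
          using ca by (auto simp: algebra_simps intro: qD RD)
        then show ?thesis unfolding Z_def by blast
      qed
    qed
    moreover have qX: "q \<subseteq> Z"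
    proof
      fix i assume "i \<in> q"
      moreover have "i = i + 0 * x" by simp
      ultimately show "i \<in> Z" unfolding Z_def using RD(2) by blast
    qed
    moreover have "Z \<inter> S = {}" using no by (auto simp: Z_def)
    ultimately have "Z = q" using Iq by (intro max) (auto simp: \<A>_def)
    moreover have "x \<in> Z"
    proof -
      have "x = 0 + 1 * x" by simp
      then show ?thesis unfolding Z_def using qD(2) RD(1) by blast
    qed
    ultimately show False using x by blast
  qed
  have "is_prime R q"
    unfolding is_prime_def
  proof (intro conjI ballI impI)
    show "1 \<notin> q" using S qS by blast
    show "x \<in> q \<or> y \<in> q" if xy: "x \<in> R" "y \<in> R" "x * y \<in> q" for x y
    proof (rule ccontr)
      assume "\<not> ?thesis"
      then obtain r i s j where h: "r \<in> R" "i \<in> q" "i + r * x \<in> S" "s \<in> R" "j \<in> q" "j + s * y \<in> S"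
        using hit xy by metis
      \<comment> \<open>With \<open>x * y\<close> in \<open>q\<close>, every term of this product of
        two elements of \<open>S\<close> lies in \<open>q\<close>.\<close>
      have "(i + r * x) * (j + s * y) = i * (j + s * y) + ((r * x) * j + (r * s) * (x * y))"
        by (simp add: algebra_simps)
      also have "\<dots> \<in> q" using h xy S(2) by (intro qD(3) qD(5)[OF _ h(2)] qD(4)[OF _ h(5)] qD(4)[OF _ xy(3)] RD(4)) auto
      finally show False using S(3)[OF h(3,6)] qS by blast
    qed
  qed (fact qi)
  then show thesis using Iq qS that by blast
qed

text \<open>For a subring \<open>M\<close> this is \<open>M[x]\<close>; for an ideal
  \<open>q\<close> of \<open>R\<close> it is the extended ideal \<open>q R[x]\<close>. Polynomials
  carry the coefficients, so that both cases share one definition.\<close>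

definition adjoin :: "'e::comm_ring_1 set \<Rightarrow> 'e \<Rightarrow> 'e set" where
  "adjoin M x = {poly p x | p. \<forall>i. coeff p i \<in> M}"

lemma adjoin_mult:
  assumes "0 \<in> K" "\<And>x y. x \<in> K \<Longrightarrow> y \<in> K \<Longrightarrow> x + y \<in> K"
    and "\<And>m n. m \<in> M \<Longrightarrow> n \<in> N \<Longrightarrow> m * n \<in> K" and "a \<in> adjoin M x" "b \<in> adjoin N x"
  shows "a * b \<in> adjoin K x"
proof -
  obtain p r where "a = poly p x" "\<forall>i. coeff p i \<in> M" "b = poly r x" "\<forall>i. coeff r i \<in> N"
    using assms unfolding adjoin_def by blast
  then have "a * b = poly (p * r) x" "\<forall>i. coeff (p * r) i \<in> K"
    using assms by (auto simp: coeff_mult intro!: sum_in_additive)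
  then show ?thesis unfolding adjoin_def by blast
qed

lemma adjoin_base:
  assumes "0 \<in> M" "a \<in> M"
  shows "a \<in> adjoin M x"
  unfolding adjoin_def using assms by (intro CollectI exI[of _ "[:a:]"]) (auto simp: coeff_pCons split: nat.splits)

text \<open>A relation of bounded degree showing that the extension of \<open>q\<close> to
  \<open>R[x]\<close> meets \<open>R - q\<close>: the obstruction to enlarging the pair
  \<open>(R, q)\<close> by \<open>x\<close>.\<close>

definition unit_relation :: "'e::comm_ring_1 set \<Rightarrow> 'e set \<Rightarrow> 'e \<Rightarrow> nat \<Rightarrow> bool" where
  "unit_relation R q x n \<longleftrightarrow> (\<exists>p. degree p \<le> n \<and> (\<forall>i. coeff p i \<in> q) \<and> poly p x \<in> R - q)"

text \<open>In the absence of relations the extended ideal \<open>q R[x]\<close> misses the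
  multiplicative set \<open>R - q\<close>, and a prime ideal of \<open>R[x]\<close> that contains
  the former and misses the latter dominates \<open>q\<close>.\<close>

lemma unit_relation_exists_or_extends:
  assumes R: "is_subring R" and q: "is_prime R q" and none: "\<And>n. \<not> unit_relation R q x n"
  obtains R' q' where "is_subring R'" "is_prime R' q'" "R \<subseteq> R'" "q \<subseteq> q'" "q' \<inter> (R - q) = {}" "x \<in> R'"
proof -
  have qi: "is_ideal R q" using q by (simp add: is_prime_def)
  note RD = is_subringD[OF R] and qD = is_idealD[OF qi]
  have R': "is_subring (adjoin R x)"
    unfolding is_subring_def
  proof (intro conjI ballI)
    show "1 \<in> adjoin R x" by (intro adjoin_base RD)
    show "a - b \<in> adjoin R x" if ab: "a \<in> adjoin R x" "b \<in> adjoin R x" for a b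
    proof -
      obtain p r where pr: "a = poly p x" "b = poly r x" "\<forall>i. coeff p i \<in> R" "\<forall>i. coeff r i \<in> R"
        using ab unfolding adjoin_def by blast
      then have "a - b = poly (p - r) x" "\<forall>i. coeff (p - r) i \<in> R" by (auto intro: RD)
      then show ?thesis unfolding adjoin_def by blast
    qed
    show "a * b \<in> adjoin R x" if "a \<in> adjoin R x" "b \<in> adjoin R x" for a b
      by (rule adjoin_mult[OF _ _ _ that]) (auto intro: RD)
  qed
  moreover have "is_ideal (adjoin R x) (adjoin q x)"
    unfolding is_ideal_def
  proof (intro conjI ballI)
    show "adjoin q x \<subseteq> adjoin R x" using qD(1) unfolding adjoin_def by blast
    show "0 \<in> adjoin q x" by (intro adjoin_base qD)
    show "a + b \<in> adjoin q x" if ab: "a \<in> adjoin q x" "b \<in> adjoin q x" for a b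
    proof -
      obtain p r where pr: "a = poly p x" "b = poly r x" "\<forall>i. coeff p i \<in> q" "\<forall>i. coeff r i \<in> q"
        using ab unfolding adjoin_def by blast
      then have "a + b = poly (p + r) x" "\<forall>i. coeff (p + r) i \<in> q" by (auto intro: qD)
      then show ?thesis unfolding adjoin_def by blast
    qed
    show "a * b \<in> adjoin q x" if "a \<in> adjoin R x" "b \<in> adjoin q x" for a b
      by (rule adjoin_mult[OF _ _ _ that]) (auto intro: qD)
  qed
  moreover have "1 \<in> R - q" "R - q \<subseteq> adjoin R x" "\<And>x y. x \<in> R - q \<Longrightarrow> y \<in> R - q \<Longrightarrow> x * y \<in> R - q"
    using q RD by (auto simp: is_prime_def intro: adjoin_base)
  moreover have "adjoin q x \<inter> (R - q) = {}"
    using none unfolding unit_relation_def adjoin_def by blast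
  ultimately obtain q' where q': "is_prime (adjoin R x) q'" "adjoin q x \<subseteq> q'" "q' \<inter> (R - q) = {}"
    using prime_avoiding by metis
  show thesis
  proof (rule that[OF R' q'(1) _ _ q'(3)])
    show "R \<subseteq> adjoin R x" by (auto intro: adjoin_base RD)
    show "q \<subseteq> q'" using q'(2) by (auto intro: adjoin_base qD)
    show "x \<in> adjoin R x" unfolding adjoin_def
      by (intro CollectI exI[of _ "[:0, 1:]"]) (auto simp: coeff_pCons RD split: nat.splits)
  qed
qed

lemma poly_altdef_le:
  fixes p :: "'e::comm_ring_1 poly"
  assumes "degree p \<le> n"
  shows "poly p x = (\<Sum>i\<le>n. coeff p i * x ^ i)"
proof -
  have "(\<Sum>i\<le>n. coeff p i * x ^ i) = (\<Sum>i\<le>degree p. coeff p i * x ^ i)"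
    using assms by (intro sum.mono_neutral_right) (auto simp: coeff_eq_0)
  then show ?thesis by (simp add: poly_altdef)
qed

text \<open>Degree reduction behind the theorem of Manis. Take a relation of minimal degree for
  \<open>x\<close> and let \<open>u\<close> be its leading coefficient times \<open>x\<close>. Then
  \<open>u\<close> satisfies a monic equation over \<open>R\<close>; this equation and minimality
  force \<open>u\<close> into \<open>R\<close> and out of \<open>q\<close>, so the leading
  coefficient is the required \<open>y\<close>.\<close>

lemma unit_relation_linear:
  assumes R: "is_subring R" and q: "is_prime R q"
    and rel: "\<And>z. z \<notin> R \<Longrightarrow> \<exists>n. unit_relation R q z n" and x: "x \<notin> R"
  shows "\<exists>y\<in>q. x * y \<in> R - q"
proof -
  have qi: "is_ideal R q" using q by (simp add: is_prime_def)
  note RD = is_subringD[OF R] and qD = is_idealD[OF qi]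
  define n where "n = (LEAST n. unit_relation R q x n)"
  have n: "unit_relation R q x n" and nmin: "\<And>m. unit_relation R q x m \<Longrightarrow> n \<le> m"
    unfolding n_def using rel[OF x] by (auto intro: LeastI Least_le)
  obtain p where p: "degree p \<le> n" "\<And>i. coeff p i \<in> q" "poly p x \<in> R - q"
    using n unfolding unit_relation_def by blast
  have "n \<noteq> 0"
  proof
    assume "n = 0"
    then have "poly p x = coeff p 0" using poly_altdef_le[OF p(1), of x] by simp
    then show False using p(2,3) by (metis DiffD2)
  qed
  define c u where "c = coeff p n" and "u = c * x"
  have c: "c \<in> q" by (simp add: c_def p)
  \<comment> \<open>Coefficients of the monic equation for \<open>u\<close> that results from
    multiplying the relation by \<open>c ^ (n - 1)\<close>; the constant coefficient also absorbs
    the value \<open>poly p x\<close> of the relation.\<close>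
  define r where "r i = - (coeff p i * c ^ (n - 1 - i)) + (if i = 0 then poly p x * c ^ (n - 1) else 0)" for i
  have rR: "r i \<in> R" for i
    unfolding r_def using p(2,3) qD(1) c by (intro RD) (auto intro!: RD)
  have monic: "u ^ n = (\<Sum>i<n. r i * u ^ i)"
  proof -
    have "poly p x * c ^ (n - 1) = (\<Sum>i\<le>n. coeff p i * x ^ i) * c ^ (n - 1)"
      using poly_altdef_le[OF p(1)] by simp
    also have "\<dots> = (\<Sum>i<n. coeff p i * x ^ i * c ^ (n - 1)) + coeff p n * x ^ n * c ^ (n - 1)"
      by (simp add: lessThan_Suc_atMost[symmetric] sum_distrib_right distrib_right)
    also have "coeff p n * x ^ n * c ^ (n - 1) = u ^ n"
      unfolding c_def[symmetric] u_def power_mult_distrib using \<open>n \<noteq> 0\<close>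
      by (cases n) (auto simp: algebra_simps)
    also have "(\<Sum>i<n. coeff p i * x ^ i * c ^ (n - 1)) = (\<Sum>i<n. coeff p i * c ^ (n - 1 - i) * u ^ i)"
    proof (rule sum.cong)
      fix i assume "i \<in> {..<n}"
      then have "c ^ (n - 1) = c ^ (n - 1 - i) * c ^ i" by (simp add: power_add[symmetric])
      then show "coeff p i * x ^ i * c ^ (n - 1) = coeff p i * c ^ (n - 1 - i) * u ^ i"
        by (simp add: u_def power_mult_distrib algebra_simps)
    qed simp
    finally have "u ^ n = poly p x * c ^ (n - 1) - (\<Sum>i<n. coeff p i * c ^ (n - 1 - i) * u ^ i)"
      by (simp add: algebra_simps)
    moreover have "(\<Sum>i<n. (if i = 0 then poly p x * c ^ (n - 1) else 0) * u ^ i) = poly p x * c ^ (n - 1)"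
      using \<open>n \<noteq> 0\<close> by (subst sum.cong[OF refl, of _ _ "\<lambda>i. if i = 0 then poly p x * c ^ (n - 1) else 0"]) auto
    ultimately show ?thesis
      unfolding r_def distrib_right sum.distrib by (simp add: sum_negf)
  qed
  have uR: "u \<in> R"
  proof (rule ccontr)
    assume u: "u \<notin> R"
    define m where "m = (LEAST m. unit_relation R q u m)"
    have m: "unit_relation R q u m" and mmin: "\<And>k. unit_relation R q u k \<Longrightarrow> m \<le> k"
      unfolding m_def using rel[OF u] by (auto intro: LeastI Least_le)
    obtain p' where p': "degree p' \<le> m" "\<And>i. coeff p' i \<in> q" "poly p' u \<in> R - q"
      using m unfolding unit_relation_def by blast
    \<comment> \<open>A relation for \<open>u\<close> of degree at least \<open>n\<close> could be
      shortened by rewriting its top term with the monic equation. The new coefficients stay in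
      \<open>q\<close>, being changed by multiples of \<open>d\<close>.\<close>
    have "m < n"
    proof (rule ccontr)
      assume mn: "\<not> m < n"
      define d where "d = coeff p' m"
      define p2 where "p2 = p' - monom d m + (\<Sum>i<n. monom (d * r i) (m - n + i))"
      have "poly p2 u = poly p' u - d * u ^ m + (\<Sum>i<n. d * r i * u ^ (m - n + i))"
        by (simp add: p2_def poly_monom poly_sum)
      also have "(\<Sum>i<n. d * r i * u ^ (m - n + i)) = d * u ^ (m - n) * (\<Sum>i<n. r i * u ^ i)"
        by (simp add: sum_distrib_left power_add algebra_simps)
      also have "\<dots> = d * u ^ m"
        using mn by (simp add: monic[symmetric] mult.assoc power_add[symmetric])
      finally have e: "poly p2 u = poly p' u" by simp
      have dq: "d \<in> q" by (simp add: d_def p')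
      have co: "coeff p2 i = (if i = m then 0 else coeff p' i) + (\<Sum>j<n. if m - n + j = i then d * r j else 0)" for i
        by (simp add: p2_def coeff_sum) (simp add: d_def)
      have "coeff p2 i \<in> q" for i
        unfolding co by (intro qD sum_in_additive) (auto intro: qD p'(2) rR dq)
      moreover have "degree p2 \<le> m - 1"
      proof (rule degree_le, intro allI impI)
        fix i assume i: "m - 1 < i"
        have "(\<Sum>j<n. if m - n + j = i then d * r j else 0) = 0"
          using i mn by (intro sum.neutral) auto
        moreover have "(if i = m then 0 else coeff p' i) = 0"
          using i p'(1) by (auto intro: coeff_eq_0)
        ultimately show "coeff p2 i = 0" by (simp add: co)
      qed
      ultimately have "unit_relation R q u (m - 1)"
        unfolding unit_relation_def using e p'(3) by metis
      then have "m \<le> m - 1" by (rule mmin)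
      then show False using mn \<open>n \<noteq> 0\<close> by simp
    qed
    \<comment> \<open>Substituting \<open>u = c * x\<close> turns the relation for \<open>u\<close>
      into one for \<open>x\<close> of the same degree \<open>m\<close>, against the minimality of
      \<open>n\<close>.\<close>
    define p2 where "p2 = (\<Sum>i\<le>m. monom (coeff p' i * c ^ i) i)"
    have "poly p2 x = poly p' u"
      by (simp add: p2_def poly_sum poly_monom poly_altdef_le[OF p'(1)] u_def power_mult_distrib algebra_simps)
    moreover have "coeff p2 i = (if i \<le> m then coeff p' i * c ^ i else 0)" for i
      by (simp add: p2_def coeff_sum)
    then have "coeff p2 i \<in> q" "i > m \<Longrightarrow> coeff p2 i = 0" for i
      using p'(2) c by (auto intro!: qD RD)
    moreover from this have "degree p2 \<le> m" by (intro degree_le) auto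
    ultimately have "unit_relation R q x m"
      unfolding unit_relation_def using p'(3) by metis
    then show False using nmin \<open>m < n\<close> by fastforce
  qed
  \<comment> \<open>Otherwise the top term \<open>c * x ^ n\<close> could be rewritten as
    \<open>u * x ^ (n - 1)\<close>, which lowers the degree of the relation.\<close>
  have "u \<notin> q"
  proof
    assume uq: "u \<in> q"
    define p2 where "p2 = p - monom c n + monom u (n - 1)"
    have "poly p2 x = poly p x"
      using \<open>n \<noteq> 0\<close> by (cases n) (auto simp: p2_def poly_monom u_def algebra_simps)
    moreover have co: "coeff p2 i = (if i = n then 0 else coeff p i) + (if i = n - 1 then u else 0)" for i
      by (simp add: p2_def c_def)
    have "coeff p2 i \<in> q" for i
      unfolding co by (intro qD) (auto intro: p qD uq)
    moreover have "degree p2 \<le> n - 1"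
      using p(1) \<open>n \<noteq> 0\<close> by (intro degree_le) (auto simp: co intro: coeff_eq_0)
    ultimately have "unit_relation R q x (n - 1)"
      unfolding unit_relation_def using p(3) by metis
    then have "n \<le> n - 1" by (rule nmin)
    then show False using \<open>n \<noteq> 0\<close> by simp
  qed
  then show ?thesis using uR c by (intro bexI[of _ c]) (auto simp: u_def mult.commute)
qed

text \<open>Zorn's lemma for pairs ordered by domination, \<open>R \<subseteq> R'\<close> and
  \<open>q' \<inter> R = q\<close>. A maximal pair admits a relation for each element outside its
  ring, and the degree reduction makes this relation linear.\<close>

lemma Manis_pair_exists:
  assumes R: "is_subring R" and q: "is_prime R q"
  obtains R' q' where "is_subring R'" "is_prime R' q'" "R \<subseteq> R'" "q \<subseteq> q'" "q' \<inter> (R - q) = {}"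
    "\<And>x. x \<notin> R' \<Longrightarrow> \<exists>y\<in>q'. x * y \<in> R' - q'"
proof -
  \<comment> \<open>Tagging each element of the ring by whether it lies in the ideal turns
    domination of pairs into inclusion of sets, so that chains have their unions as bounds.\<close>
  define enc :: "'a set \<Rightarrow> 'a set \<Rightarrow> ('a \<times> bool) set" where "enc R q = q \<times> {False} \<union> (R - q) \<times> {True}" for R q
  define RR :: "('a \<times> bool) set \<Rightarrow> 'a set" where "RR P = fst ` P" for P
  define qq where "qq P = {x. (x, False) \<in> P}" for P :: "('a \<times> bool) set"
  define \<A> where "\<A> = {enc R' q' | R' q'. is_subring R' \<and> is_prime R' q' \<and> enc R q \<subseteq> enc R' q'}"
  have enc: "RR (enc R' q') = R'" "qq (enc R' q') = q'" if "q' \<subseteq> R'" for R' q'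
    using that by (auto simp: RR_def qq_def enc_def image_Un)
  have sub: "q' \<subseteq> R'" if "is_prime R' q'" for R' q'
    using that by (auto simp: is_prime_def is_ideal_def)
  have A: "P \<in> \<A> \<longleftrightarrow> is_subring (RR P) \<and> is_prime (RR P) (qq P) \<and> enc R q \<subseteq> P \<and> P = enc (RR P) (qq P)" for P
    unfolding \<A>_def using enc sub by (smt (verit) mem_Collect_eq)
  have "\<exists>M\<in>\<A>. \<forall>Z\<in>\<A>. M \<subseteq> Z \<longrightarrow> Z = M"
  proof (rule subset_Zorn_nonempty)
    show "\<A> \<noteq> {}" using R q by (auto simp: \<A>_def)
    fix \<C> assume ne: "\<C> \<noteq> {}" and ch: "subset.chain \<A> \<C>"
    then have sb: "\<C> \<subseteq> \<A>" and tot: "\<And>Z Y. Z \<in> \<C> \<Longrightarrow> Y \<in> \<C> \<Longrightarrow> Z \<subseteq> Y \<or> Y \<subseteq> Z"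
      by (auto simp: subset.chain_def)
    have mono: "RR Z \<subseteq> RR Y" "qq Z \<subseteq> qq Y" if "Z \<subseteq> Y" for Z Y using that by (auto simp: RR_def qq_def)
    have RU: "RR (\<Union>\<C>) = (\<Union>P\<in>\<C>. RR P)" and qU: "qq (\<Union>\<C>) = (\<Union>P\<in>\<C>. qq P)"
      by (auto simp: RR_def qq_def)
    have CA: "is_subring (RR P)" "is_prime (RR P) (qq P)" "enc R q \<subseteq> P" "P = enc (RR P) (qq P)" if "P \<in> \<C>" for P
      using that sb A by blast+
    have two: "\<exists>P\<in>\<C>. x \<in> RR P \<and> y \<in> RR P" if xy: "x \<in> RR (\<Union>\<C>)" "y \<in> RR (\<Union>\<C>)" for x y
    proof -
      obtain Z Y where XY: "Z \<in> \<C>" "Y \<in> \<C>" "x \<in> RR Z" "y \<in> RR Y" using xy RU by auto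
      then show ?thesis using tot mono by (metis subsetD)
    qed
    \<comment> \<open>An element has only one tag in each encoded pair, and any two members of the
      chain are comparable; so its tag does not depend on the member.\<close>
    have comp: "qq P = qq (\<Union>\<C>) \<inter> RR P" if P: "P \<in> \<C>" for P
    proof -
      have "x \<in> qq P" if x: "x \<in> qq P'" "P' \<in> \<C>" "x \<in> RR P" for x P'
      proof (rule ccontr)
        assume "x \<notin> qq P"
        then have t: "(x, True) \<in> P" using x CA(4)[OF P] by (auto simp: enc_def)
        have f: "(x, False) \<in> P'" using x by (simp add: qq_def)
        obtain Z where "Z \<in> \<C>" "(x, True) \<in> Z" "(x, False) \<in> Z" using t f tot[OF P x(2)] P x(2) by blast
        then show False using CA(4)[of Z] by (auto simp: enc_def)
      qed
      moreover have "qq P \<subseteq> RR P" by (force simp: qq_def RR_def)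
      ultimately show ?thesis using P qU by auto
    qed
    have "is_subring (RR (\<Union>\<C>))"
      unfolding is_subring_def
    proof (intro conjI ballI)
      show "1 \<in> RR (\<Union>\<C>)" using ne CA(1) RU is_subringD(1) by (metis UN_I ex_in_conv)
      show "x - y \<in> RR (\<Union>\<C>)" if xy: "x \<in> RR (\<Union>\<C>)" "y \<in> RR (\<Union>\<C>)" for x y
        using two[OF xy] CA(1) is_subringD(3) RU by (metis UN_I)
      show "x * y \<in> RR (\<Union>\<C>)" if xy: "x \<in> RR (\<Union>\<C>)" "y \<in> RR (\<Union>\<C>)" for x y
        using two[OF xy] CA(1) is_subringD(4) RU by (metis UN_I)
    qed
    moreover have qR: "qq (\<Union>\<C>) \<subseteq> RR (\<Union>\<C>)" by (force simp: qq_def RR_def)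
    have "is_prime (RR (\<Union>\<C>)) (qq (\<Union>\<C>))"
      unfolding is_prime_def is_ideal_def
    proof (intro conjI ballI impI qR)
      have q0: "is_ideal (RR P) (qq P)" if "P \<in> \<C>" for P using CA(2)[OF that] by (simp add: is_prime_def)
      show "0 \<in> qq (\<Union>\<C>)" using ne q0 is_idealD(2) qU by (metis UN_I ex_in_conv)
      show "1 \<notin> qq (\<Union>\<C>)" using CA(2) qU by (auto simp: is_prime_def)
      show "x + y \<in> qq (\<Union>\<C>)" if xy: "x \<in> qq (\<Union>\<C>)" "y \<in> qq (\<Union>\<C>)" for x y
      proof -
        obtain P where "P \<in> \<C>" "x \<in> RR P" "y \<in> RR P" using two xy qR by (meson subsetD)
        then show ?thesis using comp[of P] q0[of P] is_idealD(3) xy by (metis IntD1 IntI)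
      qed
      show "x * y \<in> qq (\<Union>\<C>)" if xy: "x \<in> RR (\<Union>\<C>)" "y \<in> qq (\<Union>\<C>)" for x y
      proof -
        obtain P where "P \<in> \<C>" "x \<in> RR P" "y \<in> RR P" using two xy qR by (meson subsetD)
        then show ?thesis using comp[of P] q0[of P] is_idealD(4) xy by (metis IntD1 IntI)
      qed
      show "x \<in> qq (\<Union>\<C>) \<or> y \<in> qq (\<Union>\<C>)"
        if xy: "x \<in> RR (\<Union>\<C>)" "y \<in> RR (\<Union>\<C>)" "x * y \<in> qq (\<Union>\<C>)" for x y
      proof -
        obtain P where P: "P \<in> \<C>" "x \<in> RR P" "y \<in> RR P" using two xy by meson
        then have "x * y \<in> RR P" using CA(1) is_subringD(4) by blast
        then have "x * y \<in> qq P" using comp[of P] P xy by blast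
        then show ?thesis using CA(2)[OF P(1)] P qU unfolding is_prime_def by blast
      qed
    qed
    moreover have "enc R q \<subseteq> \<Union>\<C>" using ne CA(3) by blast
    moreover have "\<Union>\<C> = enc (RR (\<Union>\<C>)) (qq (\<Union>\<C>))"
    proof (intro equalityI subsetI)
      fix z assume "z \<in> \<Union>\<C>"
      then obtain P where P: "P \<in> \<C>" "z \<in> P" by blast
      then have "fst z \<in> RR P" by (simp add: RR_def)
      have "z \<in> enc (RR P) (qq P)" using P CA(4) by simp
      then show "z \<in> enc (RR (\<Union>\<C>)) (qq (\<Union>\<C>))"
        using comp[OF P(1)] P(1) RU by (auto simp: enc_def)
    next
      fix z assume z: "z \<in> enc (RR (\<Union>\<C>)) (qq (\<Union>\<C>))"
      show "z \<in> \<Union>\<C>"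
      proof (cases "z \<in> qq (\<Union>\<C>) \<times> {False}")
        case True then show ?thesis by (auto simp: qq_def)
      next
        case False
        then have "fst z \<in> RR (\<Union>\<C>)" "fst z \<notin> qq (\<Union>\<C>)" "snd z" using z by (auto simp: enc_def)
        then obtain P where "P \<in> \<C>" "fst z \<in> RR P - qq P" using RU qU by auto
        then show ?thesis using CA(4)[of P] \<open>snd z\<close> by (cases z) (auto simp: enc_def)
      qed
    qed
    ultimately show "\<Union>\<C> \<in> \<A>" by (simp add: A)
  qed
  then obtain M where M: "M \<in> \<A>" and max: "\<And>Z. Z \<in> \<A> \<Longrightarrow> M \<subseteq> Z \<Longrightarrow> Z = M" by blast
  then have s: "is_subring (RR M)" and p: "is_prime (RR M) (qq M)" and d: "enc R q \<subseteq> M" and eq: "M = enc (RR M) (qq M)"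
    using A by blast+
  have "\<exists>n. unit_relation (RR M) (qq M) z n" if z: "z \<notin> RR M" for z
  proof (rule ccontr)
    assume "\<not> ?thesis"
    then obtain R' q' where R': "is_subring R'" "is_prime R' q'" "RR M \<subseteq> R'" "qq M \<subseteq> q'"
      "q' \<inter> (RR M - qq M) = {}" "z \<in> R'"
      using unit_relation_exists_or_extends[OF s p] by metis
    have "M \<subseteq> enc R' q'" using R' by (subst eq) (auto simp: enc_def)
    moreover have "enc R' q' \<in> \<A>" using R' d \<open>M \<subseteq> enc R' q'\<close> unfolding \<A>_def by blast
    ultimately have "enc R' q' = M" by (rule max[rotated])
    then show False using enc[OF sub[OF R'(2)]] R' z by metis
  qed
  then have "\<exists>y\<in>qq M. x * y \<in> RR M - qq M" if "x \<notin> RR M" for x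
    using unit_relation_linear[OF s p _ that] by blast
  moreover have "R \<subseteq> RR M"
  proof
    fix x assume "x \<in> R"
    then have "\<exists>b. (x, b) \<in> enc R q" by (auto simp: enc_def)
    then show "x \<in> RR M" using d by (force simp: RR_def)
  qed
  moreover have "q \<subseteq> qq M" using d by (auto simp: qq_def enc_def)
  moreover have "qq M \<inter> (R - q) = {}"
  proof -
    have "(x, False) \<notin> M" if "x \<in> R - q" for x
    proof -
      have "(x, True) \<in> M" using that d by (auto simp: enc_def)
      then show ?thesis by (subst eq, subst (asm) eq) (auto simp: enc_def)
    qed
    then show ?thesis by (auto simp: qq_def)
  qed
  ultimately show thesis using s p that by blast
qed

text \<open>The relation \<open>v(x) \<le> v(y)\<close> of a valuation with support
  \<open>{x. leq x 0}\<close>. Cancellation outside the support makes the classes outside it embed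
  into an ordered group.\<close>

definition valuation_preorder :: "('e::comm_ring_1 \<Rightarrow> 'e \<Rightarrow> bool) \<Rightarrow> bool" where
  "valuation_preorder leq \<longleftrightarrow>
     (\<forall>x y. leq x y \<or> leq y x) \<and> (\<forall>x y z. leq x y \<longrightarrow> leq y z \<longrightarrow> leq x z) \<and>
     (\<forall>x y z. leq x y \<longrightarrow> leq (x * z) (y * z)) \<and>
     (\<forall>x y z. leq (x * z) (y * z) \<longrightarrow> \<not> leq z 0 \<longrightarrow> leq x y) \<and>
     (\<forall>x y z. leq x z \<longrightarrow> leq y z \<longrightarrow> leq (x + y) z) \<and> \<not> leq 1 0 \<and> (\<forall>x. leq 0 x)"

text \<open>A prime over \<open>I\<close> that misses \<open>S\<close> is dominated by a Manis pair,
  and such a pair defines a valuation. Elements of \<open>S\<close> end up in \<open>R' - q\<close>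
  and so have value \<open>1\<close>. The last clause puts into the support whatever the whole type
  multiplies into \<open>I\<close>; it will serve for relations.\<close>

theorem valuation_preorder_exists:
  assumes R: "is_subring R" and I: "is_ideal R I"
    and S: "1 \<in> S" "S \<subseteq> R" "\<And>x y. x \<in> S \<Longrightarrow> y \<in> S \<Longrightarrow> x * y \<in> S" and IS: "I \<inter> S = {}"
  obtains leq where "valuation_preorder leq" "\<And>x. x \<in> R \<Longrightarrow> leq x 1" "\<And>x. x \<in> I \<Longrightarrow> \<not> leq 1 x"
    "\<And>x. x \<in> S \<Longrightarrow> leq 1 x" "\<And>x. (\<And>z. z * x \<in> I) \<Longrightarrow> leq x 0"
proof -
  obtain q0 where q0: "is_prime R q0" "I \<subseteq> q0" "q0 \<inter> S = {}"
    using prime_avoiding[OF assms] by blast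
  obtain R' q where R': "is_subring R'" and q: "is_prime R' q" and RR: "R \<subseteq> R'" "q0 \<subseteq> q" "q \<inter> (R - q0) = {}"
    and M: "\<And>x. x \<notin> R' \<Longrightarrow> \<exists>y\<in>q. x * y \<in> R' - q"
    using Manis_pair_exists[OF R q0(1)] by blast
  have qi: "is_ideal R' q" and one: "1 \<notin> q"
    and pr: "\<And>x y. x \<in> R' \<Longrightarrow> y \<in> R' \<Longrightarrow> x * y \<in> q \<Longrightarrow> x \<in> q \<or> y \<in> q" using q by (auto simp: is_prime_def)
  note RD = is_subringD[OF R'] and qD = is_idealD[OF qi]
  \<comment> \<open>The Manis condition in a uniform shape: each element outside \<open>q\<close>
    has a multiple in \<open>R' - q\<close>, whose elements have value \<open>1\<close>.\<close>
  have unit: "\<exists>d\<in>R'. d * a \<in> R' - q" if a: "a \<notin> q" for a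
  proof (cases "a \<in> R'")
    case True then show ?thesis using a RD(1) by (intro bexI[of _ 1]) auto
  next
    case False then show ?thesis using M[OF False] qD(1) by (auto simp: mult.commute)
  qed
  \<comment> \<open>Elements of value \<open>1\<close> cancel from membership in \<open>q\<close>,
    even if the other factor lies outside \<open>R'\<close>.\<close>
  have canc: "u \<in> q" if u: "u * s \<in> q" "s \<in> R' - q" for u s
  proof (cases "u \<in> R'")
    case True then show ?thesis using pr[OF True] u by blast
  next
    case False
    then obtain y where y: "y \<in> q" "u * y \<in> R' - q" using M by blast
    then have "(u * y) * s \<notin> q" using pr u by blast
    moreover have "(u * y) * s = (u * s) * y" by (simp add: algebra_simps)
    ultimately show ?thesis using u y qD by auto
  qed
  \<comment> \<open>Comparison of multipliers into \<open>q\<close>: the smaller the value of an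
    element, the more of its multiples lie in \<open>q\<close>.\<close>
  define leq where "leq x y \<longleftrightarrow> (\<forall>z. z * y \<in> q \<longrightarrow> z * x \<in> q)" for x y
  have "valuation_preorder leq"
    unfolding valuation_preorder_def
  proof (intro conjI allI impI)
    fix x y z
    show "leq x y \<or> leq y x"
    proof (rule ccontr)
      assume "\<not> ?thesis"
      then obtain z w where zw: "z * y \<in> q" "z * x \<notin> q" "w * x \<in> q" "w * y \<notin> q" by (auto simp: leq_def)
      then obtain d e where de: "d \<in> R'" "e \<in> R'" "d * (z * x) \<in> R' - q" "e * (w * y) \<in> R' - q"
        using unit by metis
      have "(d * (z * x)) * (e * (w * y)) = (d * (z * y)) * (e * (w * x))" by (simp add: algebra_simps)
      also have "\<dots> \<in> q" using de zw qD(1,4) by blast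
      finally show False using pr de by blast
    qed
    show "leq x y \<Longrightarrow> leq y z \<Longrightarrow> leq x z" by (simp add: leq_def)
    show "leq x y \<Longrightarrow> leq (x * z) (y * z)"
      unfolding leq_def by (metis mult.assoc mult.commute)
    show "leq x y" if h: "leq (x * z) (y * z)" "\<not> leq z 0"
    proof -
      obtain c where "c * z \<notin> q" using h(2) by (auto simp: leq_def)
      then obtain d where d: "d * (c * z) \<in> R' - q" using unit by blast
      show ?thesis unfolding leq_def
      proof (intro allI impI)
        fix w assume w: "w * y \<in> q"
        have "(w * (d * c)) * (y * z) = (w * y) * (d * (c * z))" by (simp add: algebra_simps)
        also have "\<dots> \<in> q" using w d qD by auto
        finally have "(w * (d * c)) * (x * z) \<in> q" using h(1) by (simp add: leq_def)
        moreover have "(w * (d * c)) * (x * z) = (w * x) * (d * (c * z))" by (simp add: algebra_simps)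
        ultimately show "w * x \<in> q" using canc d by metis
      qed
    qed
    show "leq x z \<Longrightarrow> leq y z \<Longrightarrow> leq (x + y) z" by (auto simp: leq_def distrib_left intro: qD)
    show "\<not> leq 1 0" using one qD(2) by (auto simp: leq_def intro: exI[of _ 1])
    show "leq 0 x" using qD(2) by (auto simp: leq_def)
  qed
  moreover have "leq x 1" if "x \<in> R" for x using that RR by (auto simp: leq_def intro: qD)
  moreover have "\<not> leq 1 x" if "x \<in> I" for x
    using that q0 RR one unfolding leq_def by (metis mult_1 subsetD)
  moreover have "leq 1 x" if "x \<in> S" for x
    using that S(2) q0(3) RR(1,3) canc unfolding leq_def by (simp, blast)
  moreover have "leq x 0" if "\<And>z. z * x \<in> I" for x using that q0(2) RR(2) by (auto simp: leq_def)
  ultimately show thesis using that by blast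
qed

section \<open>Reified semivaluations as order relations\<close>

text \<open>\<open>(r, a, b) \<in> Q\<close> reads \<open>v(a) \<le> r v(b)\<close>, so that
  \<open>(1, c, \<zero>) \<in> Q\<close> says that \<open>c\<close> lies in the support. The real
  factor keeps the scalars inside the relation; \<open>mono_one\<close> and \<open>trans\<close>
  together give monotonicity in \<open>r\<close>.\<close>

locale reified_order = cring A for A :: "('a, 'm) ring_scheme" (structure) +
  fixes Q :: "(real \<times> 'a \<times> 'a) set"
  assumes dom: "(r, a, b) \<in> Q \<Longrightarrow> 0 < r \<and> a \<in> carrier A \<and> b \<in> carrier A"
    and total: "\<lbrakk>0 < r; a \<in> carrier A; b \<in> carrier A\<rbrakk> \<Longrightarrow> (r, a, b) \<in> Q \<or> (1 / r, b, a) \<in> Q"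
    and trans: "\<lbrakk>(r, a, b) \<in> Q; (s, b, c) \<in> Q\<rbrakk> \<Longrightarrow> (r * s, a, c) \<in> Q"
    and mult: "\<lbrakk>(r, a, b) \<in> Q; c \<in> carrier A\<rbrakk> \<Longrightarrow> (r, a \<otimes> c, b \<otimes> c) \<in> Q"
    and cancel: "\<lbrakk>(r, a \<otimes> c, b \<otimes> c) \<in> Q; (1, c, \<zero>) \<notin> Q; a \<in> carrier A; b \<in> carrier A; c \<in> carrier A\<rbrakk> \<Longrightarrow>
          (r, a, b) \<in> Q"
    and add: "\<lbrakk>(r, a, c) \<in> Q; (r, b, c) \<in> Q\<rbrakk> \<Longrightarrow> (r, a \<oplus> b, c) \<in> Q"
    and nontrivial: "(1, \<one>, \<zero>) \<notin> Q"
    and zero: "\<lbrakk>0 < r; b \<in> carrier A\<rbrakk> \<Longrightarrow> (r, \<zero>, b) \<in> Q"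
    and mono_one: "1 \<le> r \<Longrightarrow> (r, \<one>, \<one>) \<in> Q"
begin

lemma mono_scale:
  assumes "(r, a, b) \<in> Q" "r \<le> s"
  shows "(s, a, b) \<in> Q"
proof -
  have "0 < r" "b \<in> carrier A" using dom assms by auto
  moreover have "(s / r, \<one> \<otimes> b, \<one> \<otimes> b) \<in> Q"
    using assms calculation by (intro mult mono_one) auto
  ultimately show ?thesis using trans[OF assms(1), of "s / r" b] by simp
qed

lemma refl_Q: "a \<in> carrier A \<Longrightarrow> (1, a, a) \<in> Q"
  using mult[OF mono_one[of 1], of a] by simp

lemma mult2:
  assumes "(r, a, b) \<in> Q" "(s, c, d) \<in> Q"
  shows "(r * s, a \<otimes> c, b \<otimes> d) \<in> Q"
proof -
  have "(r, a \<otimes> c, b \<otimes> c) \<in> Q" "(s, c \<otimes> b, d \<otimes> b) \<in> Q" using mult assms dom by auto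
  then show ?thesis using trans m_comm dom assms by metis
qed

lemma cancel_left:
  "\<lbrakk>(r, c \<otimes> a, c \<otimes> b) \<in> Q; (1, c, \<zero>) \<notin> Q; a \<in> carrier A; b \<in> carrier A; c \<in> carrier A\<rbrakk> \<Longrightarrow> (r, a, b) \<in> Q"
  using cancel[of r a c b] by (simp add: m_comm)

lemma supp_scale: "(r, a, \<zero>) \<in> Q \<Longrightarrow> (1, a, \<zero>) \<in> Q"
  using trans[of r a \<zero> "1 / r" \<zero>] zero[of "1 / r" \<zero>] dom[of r a \<zero>] by simp

lemma supp_le: "\<lbrakk>(1, a, \<zero>) \<in> Q; 0 < r; b \<in> carrier A\<rbrakk> \<Longrightarrow> (r, a, b) \<in> Q"
  using trans[of 1 a \<zero> r b] zero by simp

lemma le_supp: "\<lbrakk>(r, a, b) \<in> Q; (1, b, \<zero>) \<in> Q\<rbrakk> \<Longrightarrow> (1, a, \<zero>) \<in> Q"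
  using trans[of r a b 1 \<zero>] supp_scale by simp

lemma supp_zero: "(1, \<zero>, \<zero>) \<in> Q"
  using zero by simp

lemma supp_mult_iff:
  "\<lbrakk>a \<in> carrier A; b \<in> carrier A\<rbrakk> \<Longrightarrow> (1, a \<otimes> b, \<zero>) \<in> Q \<longleftrightarrow> (1, a, \<zero>) \<in> Q \<or> (1, b, \<zero>) \<in> Q"
  using cancel[of 1 a b \<zero>] mult[of 1 a \<zero> b] mult[of 1 b \<zero> a] by (auto simp: m_comm)

lemma one_minus_Q: "(1, \<ominus> \<one>, \<one>) \<in> Q"
proof -
  consider "(1, \<ominus> \<one>, \<one>) \<in> Q" | "(1, \<one>, \<ominus> \<one>) \<in> Q" using total[of 1 "\<ominus> \<one>" \<one>] by auto
  then show ?thesis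
  proof cases
    case 2
    then have "(1, \<one> \<otimes> \<ominus> \<one>, \<ominus> \<one> \<otimes> \<ominus> \<one>) \<in> Q" by (rule mult) simp
    then show ?thesis by (simp add: l_minus r_minus)
  qed
qed

lemma minus: "(r, a, c) \<in> Q \<Longrightarrow> (r, \<ominus> a, c) \<in> Q"
  using mult2[OF one_minus_Q, of r a c] dom[of r a c] by (simp add: l_minus)

lemma diff: "\<lbrakk>(r, a, c) \<in> Q; (r, b, c) \<in> Q\<rbrakk> \<Longrightarrow> (r, a \<ominus> b, c) \<in> Q"
  unfolding a_minus_def by (intro add minus)

lemma pow_Q: "(r, a, b) \<in> Q \<Longrightarrow> (r ^ n, a [^] n, b [^] (n::nat)) \<in> Q"
proof (induction n)
  case 0
  then show ?case using refl_Q by simp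
next
  case (Suc n)
  then show ?case using mult2[of "r ^ n" "a [^] n" "b [^] n" r a b] by (simp add: mult.commute)
qed

lemma supp_pow_iff: "a \<in> carrier A \<Longrightarrow> (1, a [^] (n::nat), \<zero>) \<in> Q \<longleftrightarrow> n \<noteq> 0 \<and> (1, a, \<zero>) \<in> Q"
  by (induction n) (auto simp: nontrivial supp_mult_iff)

text \<open>If the conclusion fails, the reverse inequality holds, and combining its power with the
  hypothesis leaves the desired inequality multiplied by a power of \<open>b\<close>. This power
  cancels unless everything lies in the support. The lemma extracts roots in the bound for
  \<open>circcirc\<close>.\<close>

lemma pow_cancel:
  assumes "(r ^ n, a [^] n, b [^] (n::nat)) \<in> Q" "n \<noteq> 0" "0 < r" "a \<in> carrier A" "b \<in> carrier A"
  shows "(r, a, b) \<in> Q"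
  using assms(1,2)
proof (induction n)
  case (Suc n)
  show ?case
  proof (rule ccontr)
    assume no: "(r, a, b) \<notin> Q"
    then have "(1 / r, b, a) \<in> Q" using total assms by blast
    then have "((1 / r) ^ n, b [^] n, a [^] n) \<in> Q" by (rule pow_Q)
    then have "((1 / r) ^ n, b [^] n \<otimes> a, a [^] n \<otimes> a) \<in> Q" using assms mult by blast
    from trans[OF this, of "r ^ Suc n" "b [^] n \<otimes> b"] have "(r, b [^] n \<otimes> a, b [^] n \<otimes> b) \<in> Q"
      using Suc.prems assms by (simp add: power_one_over field_simps)
    moreover have "(1, b [^] n, \<zero>) \<notin> Q"
    proof
      assume "(1, b [^] n, \<zero>) \<in> Q"
      then have "(1, b [^] Suc n, \<zero>) \<in> Q" using supp_pow_iff assms by blast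
      then have "(1, a [^] Suc n, \<zero>) \<in> Q" using le_supp Suc.prems by blast
      then have "(1, a, \<zero>) \<in> Q" using supp_pow_iff assms by blast
      then show False using no supp_le assms by blast
    qed
    ultimately show False using no cancel_left assms by auto
  qed
qed simp

end

text \<open>The value group disappears from the type of this relation, so semivaluations with values
  in different types can be compared by equality of sets.\<close>

definition sig :: "('a, 'm) ring_scheme \<Rightarrow> ('a, 'g) rsval \<Rightarrow> (real \<times> 'a \<times> 'a) set" where
  "sig A V = (case V of (G, v) \<Rightarrow> {(r, a, b). 0 < r \<and> a \<in> carrier A \<and> b \<in> carrier A \<and>
     gle0 G (v a) (mult0 G (Some (reify G r)) (v b))})"

lemma sig_iff: "(r, a, b) \<in> sig A (G, v) \<longleftrightarrow> 0 < r \<and> a \<in> carrier A \<and> b \<in> carrier A \<and>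
     gle0 G (v a) (mult0 G (Some (reify G r)) (v b))"
  by (simp add: sig_def)

context reified_value_group
begin

lemma gle_refl: "x \<in> carrier G \<Longrightarrow> gle G x x"
  using total_order by (auto simp: order_on_defs refl_on_def)

lemma gle_trans: "\<lbrakk>gle G x y; gle G y z; x \<in> carrier G; y \<in> carrier G; z \<in> carrier G\<rbrakk> \<Longrightarrow> gle G x z"
  using total_order unfolding order_on_defs trans_def by blast

lemma gle_antisym: "\<lbrakk>gle G x y; gle G y x; x \<in> carrier G; y \<in> carrier G\<rbrakk> \<Longrightarrow> x = y"
  using total_order unfolding order_on_defs antisym_def by blast

lemma gle_total: "\<lbrakk>x \<in> carrier G; y \<in> carrier G\<rbrakk> \<Longrightarrow> gle G x y \<or> gle G y x"
  using total_order gle_refl unfolding order_on_defs total_on_def by (cases "x = y") blast+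

lemma gle_mult_iff: "\<lbrakk>x \<in> carrier G; y \<in> carrier G; z \<in> carrier G\<rbrakk> \<Longrightarrow> gle G (x \<otimes> z) (y \<otimes> z) \<longleftrightarrow> gle G x y"
  using gle_mult[of x y z] gle_mult[of "x \<otimes> z" "y \<otimes> z" "inv z"] by (auto simp: m_assoc)

lemma reify_one: "reify G 1 = \<one>"
  using reify_mult[of 1 1] reify_closed[of 1] by (simp add: r_cancel_one)

lemma reify_inverse: "0 < r \<Longrightarrow> reify G (1 / r) = inv (reify G r)"
  using reify_mult[of "1 / r" r] reify_closed[of "1 / r"] reify_closed[of r] inv_equality
  by (metis divide_pos_pos less_numeral_extra(1) nonzero_divide_eq_eq order_less_irrefl reify_one)

end

lemma reified_semivaluationD:
  assumes "reified_semivaluation A (G, v)"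
  shows "reified_value_group G" "a \<in> carrier A \<Longrightarrow> v a = Some x \<Longrightarrow> x \<in> carrier G"
    "v \<zero>\<^bsub>A\<^esub> = None" "v \<one>\<^bsub>A\<^esub> = Some \<one>\<^bsub>G\<^esub>"
    "\<lbrakk>a \<in> carrier A; b \<in> carrier A\<rbrakk> \<Longrightarrow> gle0 G (v (a \<oplus>\<^bsub>A\<^esub> b)) (v a) \<or> gle0 G (v (a \<oplus>\<^bsub>A\<^esub> b)) (v b)"
    "\<lbrakk>a \<in> carrier A; b \<in> carrier A\<rbrakk> \<Longrightarrow> v (a \<otimes>\<^bsub>A\<^esub> b) = mult0 G (v a) (v b)"
  using assms by (auto simp: reified_semivaluation_def Pi_def)

lemma supp_sig: "(1, a, \<zero>\<^bsub>A\<^esub>) \<in> sig A (G, v) \<longleftrightarrow> a \<in> carrier A \<and> v a = None"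
  if "reified_semivaluation A (G, v)" "cring A"
proof -
  interpret cring A by fact
  show ?thesis using reified_semivaluationD(3)[OF that(1)] by (cases "v a") (auto simp: sig_iff)
qed

lemma reified_order_sig:
  assumes "cring A" and V: "reified_semivaluation A (G, v)"
  shows "reified_order A (sig A (G, v))"
proof -
  interpret cring A by fact
  note VD = reified_semivaluationD[OF V]
  interpret G: reified_value_group G by (rule VD)
  note c = VD(2)
  show ?thesis
  proof (unfold_locales, goal_cases)
    case (1 r a b) then show ?case by (simp add: sig_iff)
  next
    case (2 r a b)
    show ?case
    proof (cases "v a"; cases "v b")
      fix x y assume h: "v a = Some x" "v b = Some y"
      have xy: "x \<in> carrier G" "y \<in> carrier G" using c h 2 by auto
      have "gle G y (inv\<^bsub>G\<^esub> reify G r \<otimes>\<^bsub>G\<^esub> x) \<longleftrightarrow> gle G (reify G r \<otimes>\<^bsub>G\<^esub> y) x"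
        using G.gle_mult_iff[of y "inv\<^bsub>G\<^esub> reify G r \<otimes>\<^bsub>G\<^esub> x" "reify G r"] xy G.reify_closed[OF \<open>0 < r\<close>]
        by (simp add: G.m_ac)
      then show ?thesis using G.gle_total[of x "reify G r \<otimes>\<^bsub>G\<^esub> y"] h xy 2 G.reify_closed[OF \<open>0 < r\<close>]
        by (auto simp: sig_iff G.reify_inverse)
    qed (use 2 in \<open>auto simp: sig_iff\<close>)
  next
    case (3 r a b s d)
    then have pos: "0 < r" "0 < s" "a \<in> carrier A" "b \<in> carrier A" "d \<in> carrier A" by (auto simp: sig_iff)
    show ?case
    proof (cases "v a")
      case None then show ?thesis using pos by (simp add: sig_iff)
    next
      case (Some x)
      then obtain y where y: "v b = Some y" using 3 by (cases "v b") (auto simp: sig_iff)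
      then obtain z where z: "v d = Some z" using 3 by (cases "v d") (auto simp: sig_iff)
      have car: "x \<in> carrier G" "y \<in> carrier G" "z \<in> carrier G" using c Some y z pos by auto
      note rc = G.reify_closed[OF pos(1)] G.reify_closed[OF pos(2)]
      have "gle G x (reify G r \<otimes>\<^bsub>G\<^esub> y)" "gle G y (reify G s \<otimes>\<^bsub>G\<^esub> z)" using 3 Some y z by (auto simp: sig_iff)
      moreover from this have "gle G (reify G r \<otimes>\<^bsub>G\<^esub> y) (reify G r \<otimes>\<^bsub>G\<^esub> (reify G s \<otimes>\<^bsub>G\<^esub> z))"
        using G.gle_mult[of y "reify G s \<otimes>\<^bsub>G\<^esub> z" "reify G r"] car rc by (simp add: G.m_ac)
      ultimately have "gle G x (reify G r \<otimes>\<^bsub>G\<^esub> (reify G s \<otimes>\<^bsub>G\<^esub> z))" using G.gle_trans[of x "reify G r \<otimes>\<^bsub>G\<^esub> y"] car rc by simp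
      then show ?thesis using pos Some z car rc by (simp add: sig_iff G.reify_mult G.m_assoc)
    qed
  next
    case (4 r a b d)
    then have pos: "0 < r" "a \<in> carrier A" "b \<in> carrier A" "d \<in> carrier A" by (auto simp: sig_iff)
    show ?case
    proof (cases "v a")
      case None then show ?thesis using pos VD(6) by (simp add: sig_iff)
    next
      case (Some x)
      then obtain y where y: "v b = Some y" using 4 by (cases "v b") (auto simp: sig_iff)
      show ?thesis
      proof (cases "v d")
        case None then show ?thesis using pos VD(6) Some by (simp add: sig_iff)
      next
        case (Some z)
        have car: "x \<in> carrier G" "y \<in> carrier G" "z \<in> carrier G" using c \<open>v a = Some x\<close> y Some pos by auto
        note rc = G.reify_closed[OF pos(1)]
        have "gle G x (reify G r \<otimes>\<^bsub>G\<^esub> y)" using 4 \<open>v a = Some x\<close> y by (auto simp: sig_iff)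
        then have "gle G (x \<otimes>\<^bsub>G\<^esub> z) (reify G r \<otimes>\<^bsub>G\<^esub> y \<otimes>\<^bsub>G\<^esub> z)" using G.gle_mult[of x "reify G r \<otimes>\<^bsub>G\<^esub> y" z] car rc by simp
        then show ?thesis using pos VD(6) Some \<open>v a = Some x\<close> y car rc by (simp add: sig_iff G.m_assoc)
      qed
    qed
  next
    case (5 r a d b)
    then have pos: "0 < r" by (auto simp: sig_iff)
    note rc = G.reify_closed[OF pos]
    obtain z where z: "v d = Some z" using supp_sig[OF V \<open>cring A\<close>, of d] 5 by (cases "v d") auto
    then have zc: "z \<in> carrier G" using c 5 by auto
    show ?case
    proof (cases "v a")
      case None then show ?thesis using pos 5 by (simp add: sig_iff)
    next
      case (Some x)
      then obtain y where y: "v b = Some y" using 5 z VD(6) by (cases "v b") (auto simp: sig_iff)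
      have car: "x \<in> carrier G" "y \<in> carrier G" using c Some y 5 by auto
      have "gle G (x \<otimes>\<^bsub>G\<^esub> z) (reify G r \<otimes>\<^bsub>G\<^esub> (y \<otimes>\<^bsub>G\<^esub> z))" using 5 Some y z VD(6) by (auto simp: sig_iff)
      then have "gle G x (reify G r \<otimes>\<^bsub>G\<^esub> y)"
        using G.gle_mult_iff[of x "reify G r \<otimes>\<^bsub>G\<^esub> y" z] car rc zc by (simp add: G.m_assoc)
      then show ?thesis using pos 5 Some y by (simp add: sig_iff)
    qed
  next
    case (6 r a d b)
    then have pos: "0 < r" "a \<in> carrier A" "b \<in> carrier A" "d \<in> carrier A" by (auto simp: sig_iff)
    have t: "gle0 G (v (a \<oplus>\<^bsub>A\<^esub> b)) (mult0 G (Some (reify G r)) (v d))"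
      if e: "gle0 G (v (a \<oplus>\<^bsub>A\<^esub> b)) (v e)" "gle0 G (v e) (mult0 G (Some (reify G r)) (v d))" "e \<in> carrier A" for e
    proof (cases "v (a \<oplus>\<^bsub>A\<^esub> b)")
      case None then show ?thesis by simp
    next
      case (Some x)
      then obtain y where y: "v e = Some y" using e by (cases "v e") auto
      then obtain z where z: "v d = Some z" using e by (cases "v d") auto
      have car: "x \<in> carrier G" "y \<in> carrier G" "z \<in> carrier G" using c[OF a_closed[OF pos(2,3)]] c Some y z pos e by auto
      show ?thesis using e Some y z car G.reify_closed[OF pos(1)] G.gle_trans[of x y "reify G r \<otimes>\<^bsub>G\<^esub> z"] by auto
    qed
    show ?case using VD(5)[of a b] t[of a] t[of b] 6 pos by (auto simp: sig_iff)
  next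
    case 7 then show ?case using VD(3,4) by (simp add: sig_iff)
  next
    case (8 r b) then show ?case using VD(3) by (simp add: sig_iff)
  next
    case (9 r)
    have "gle G \<one>\<^bsub>G\<^esub> (reify G r)" using G.reify_mono[of 1 r] 9 by (simp add: G.reify_one)
    then show ?case using 9 VD(4) G.reify_closed[of r] by (simp add: sig_iff)
  qed
qed

text \<open>The triple \<open>(r, a, b)\<close> stands for the element \<open>r v(a) / v(b)\<close> of the value group.\<close>

definition fracs :: "('a, 'm) ring_scheme \<Rightarrow> (real \<times> 'a \<times> 'a) set \<Rightarrow> (real \<times> 'a \<times> 'a) set" where
  "fracs A Q = {(r, a, b). 0 < r \<and> a \<in> carrier A \<and> b \<in> carrier A \<and> (1, a, \<zero>\<^bsub>A\<^esub>) \<notin> Q \<and> (1, b, \<zero>\<^bsub>A\<^esub>) \<notin> Q}"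

text \<open>Comparison of \<open>r v(a) / v(b)\<close> with \<open>s v(c) / v(d)\<close> after
  clearing denominators.\<close>

fun frac_le :: "('a, 'm) ring_scheme \<Rightarrow> (real \<times> 'a \<times> 'a) set \<Rightarrow> real \<times> 'a \<times> 'a \<Rightarrow> real \<times> 'a \<times> 'a \<Rightarrow> bool" where
  "frac_le A Q (r, a, b) (s, c, d) \<longleftrightarrow> (s / r, a \<otimes>\<^bsub>A\<^esub> d, c \<otimes>\<^bsub>A\<^esub> b) \<in> Q"

fun frac_mult :: "('a, 'm) ring_scheme \<Rightarrow> real \<times> 'a \<times> 'a \<Rightarrow> real \<times> 'a \<times> 'a \<Rightarrow> real \<times> 'a \<times> 'a" where
  "frac_mult A (r, a, b) (s, c, d) = (r * s, a \<otimes>\<^bsub>A\<^esub> c, b \<otimes>\<^bsub>A\<^esub> d)"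

fun frac_inv :: "real \<times> 'a \<times> 'a \<Rightarrow> real \<times> 'a \<times> 'a" where
  "frac_inv (r, a, b) = (1 / r, b, a)"

context reified_order
begin

lemma frac_mult_closed: "\<lbrakk>u \<in> fracs A Q; w \<in> fracs A Q\<rbrakk> \<Longrightarrow> frac_mult A u w \<in> fracs A Q"
  by (cases u; cases w) (auto simp: fracs_def supp_mult_iff)

lemma frac_inv_closed: "u \<in> fracs A Q \<Longrightarrow> frac_inv u \<in> fracs A Q"
  by (cases u) (auto simp: fracs_def)

lemma frac_scalar_closed: "0 < r \<Longrightarrow> (r, \<one>, \<one>) \<in> fracs A Q"
  by (auto simp: fracs_def nontrivial)

lemma frac_value_closed: "\<lbrakk>a \<in> carrier A; (1, a, \<zero>) \<notin> Q\<rbrakk> \<Longrightarrow> (1, a, \<one>) \<in> fracs A Q"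
  by (auto simp: fracs_def nontrivial)

text \<open>The product of the two inequalities contains the common factor
  \<open>a' \<otimes> b'\<close>, which is outside the support and cancels.\<close>

lemma frac_le_trans:
  assumes "u \<in> fracs A Q" "u' \<in> fracs A Q" "u'' \<in> fracs A Q" "frac_le A Q u u'" "frac_le A Q u' u''"
  shows "frac_le A Q u u''"
proof -
  obtain r a b r' a' b' r'' a'' b'' where u: "u = (r, a, b)" "u' = (r', a', b')" "u'' = (r'', a'', b'')"
    by (cases u; cases u'; cases u'')
  have c: "a \<in> carrier A" "b \<in> carrier A" "a' \<in> carrier A" "b' \<in> carrier A" "a'' \<in> carrier A" "b'' \<in> carrier A"
    and pos: "0 < r" "0 < r'" "0 < r''" and s: "(1, a', \<zero>) \<notin> Q" "(1, b', \<zero>) \<notin> Q"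
    using assms(1-3) by (auto simp: u fracs_def)
  have "(r' / r, a \<otimes> b', a' \<otimes> b) \<in> Q" "(r'' / r', a' \<otimes> b'', a'' \<otimes> b') \<in> Q" using assms(4,5) by (auto simp: u)
  from mult2[OF this] have "(r'' / r, (a \<otimes> b'') \<otimes> (a' \<otimes> b'), (a'' \<otimes> b) \<otimes> (a' \<otimes> b')) \<in> Q"
    using pos c by (simp add: m_ac)
  then show ?thesis using c s by (auto simp: u supp_mult_iff intro: cancel)
qed

lemma frac_le_total: "\<lbrakk>u \<in> fracs A Q; w \<in> fracs A Q\<rbrakk> \<Longrightarrow> frac_le A Q u w \<or> frac_le A Q w u"
proof (cases u; cases w)
  fix r a b s c d assume "u \<in> fracs A Q" "w \<in> fracs A Q" "u = (r, a, b)" "w = (s, c, d)"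
  then show ?thesis using total[of "s / r" "a \<otimes> d" "c \<otimes> b"] by (auto simp: fracs_def)
qed

lemma frac_le_refl: "u \<in> fracs A Q \<Longrightarrow> frac_le A Q u u"
  using frac_le_total by blast

lemma frac_le_mult:
  assumes "u \<in> fracs A Q" "w \<in> fracs A Q" "z \<in> fracs A Q" "frac_le A Q u w"
  shows "frac_le A Q (frac_mult A u z) (frac_mult A w z)"
proof (cases u; cases w; cases z)
  fix r a b s c d t e f assume u: "u = (r, a, b)" "w = (s, c, d)" "z = (t, e, f)"
  have c: "a \<in> carrier A" "b \<in> carrier A" "c \<in> carrier A" "d \<in> carrier A" "e \<in> carrier A" "f \<in> carrier A" "0 < t"
    using assms by (auto simp: u fracs_def)
  have "(s / r, a \<otimes> d \<otimes> (e \<otimes> f), c \<otimes> b \<otimes> (e \<otimes> f)) \<in> Q" using assms c by (auto simp: u intro: mult)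
  then show ?thesis using c by (simp add: u m_ac)
qed

end

locale rsval = G: reified_value_group G + cring A
  for G :: "'g rvgroup" and A :: "('a, 'm) ring_scheme" and v +
  assumes semival: "reified_semivaluation A (G, v)"
begin

sublocale order: reified_order A "sig A (G, v)"
  by (rule reified_order_sig[OF cring_axioms semival])

definition frac_value where
  "frac_value u = (case u of (r, a, b) \<Rightarrow> reify G r \<otimes>\<^bsub>G\<^esub> the (v a) \<otimes>\<^bsub>G\<^esub> inv\<^bsub>G\<^esub> the (v b))"

lemma value_closed: "\<lbrakk>a \<in> carrier A; (1, a, \<zero>\<^bsub>A\<^esub>) \<notin> sig A (G, v)\<rbrakk> \<Longrightarrow> the (v a) \<in> carrier G \<and> v a = Some (the (v a))"
  using reified_semivaluationD(2)[OF semival] supp_sig[OF semival cring_axioms] by (cases "v a") auto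

lemma frac_value_closed': "u \<in> fracs A (sig A (G, v)) \<Longrightarrow> frac_value u \<in> carrier G"
  using value_closed G.reify_closed by (auto simp: frac_value_def fracs_def)

lemma frac_value_le:
  assumes "u \<in> fracs A (sig A (G, v))" "w \<in> fracs A (sig A (G, v))"
  shows "gle G (frac_value u) (frac_value w) \<longleftrightarrow> frac_le A (sig A (G, v)) u w"
proof (cases u; cases w)
  fix r a b s c d assume u: "u = (r, a, b)" "w = (s, c, d)"
  note VD = reified_semivaluationD[OF semival]
  have pos: "0 < r" "0 < s" and rc: "a \<in> carrier A" "b \<in> carrier A" "c \<in> carrier A" "d \<in> carrier A"
    using assms by (auto simp: u fracs_def)
  obtain x y z t where v: "v a = Some x" "v b = Some y" "v c = Some z" "v d = Some t"
    and car: "x \<in> carrier G" "y \<in> carrier G" "z \<in> carrier G" "t \<in> carrier G"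
    using assms value_closed[of a] value_closed[of b] value_closed[of c] value_closed[of d]
    unfolding u fracs_def by blast
  note rs = G.reify_closed[OF pos(1)] G.reify_closed[OF pos(2)]
  have e: "reify G (s / r) = reify G s \<otimes>\<^bsub>G\<^esub> inv\<^bsub>G\<^esub> reify G r"
    using G.reify_mult[of s "1 / r"] G.reify_inverse pos by simp
  have "gle G (frac_value u) (frac_value w) \<longleftrightarrow>
      gle G (reify G r \<otimes>\<^bsub>G\<^esub> x \<otimes>\<^bsub>G\<^esub> inv\<^bsub>G\<^esub> y) (reify G s \<otimes>\<^bsub>G\<^esub> z \<otimes>\<^bsub>G\<^esub> inv\<^bsub>G\<^esub> t)"
    by (simp add: frac_value_def u v)
  also have "\<dots> \<longleftrightarrow> gle G (reify G r \<otimes>\<^bsub>G\<^esub> x \<otimes>\<^bsub>G\<^esub> inv\<^bsub>G\<^esub> y \<otimes>\<^bsub>G\<^esub> (y \<otimes>\<^bsub>G\<^esub> t \<otimes>\<^bsub>G\<^esub> inv\<^bsub>G\<^esub> reify G r))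
      (reify G s \<otimes>\<^bsub>G\<^esub> z \<otimes>\<^bsub>G\<^esub> inv\<^bsub>G\<^esub> t \<otimes>\<^bsub>G\<^esub> (y \<otimes>\<^bsub>G\<^esub> t \<otimes>\<^bsub>G\<^esub> inv\<^bsub>G\<^esub> reify G r))"
    using car rs by (subst G.gle_mult_iff) auto
  also have "reify G r \<otimes>\<^bsub>G\<^esub> x \<otimes>\<^bsub>G\<^esub> inv\<^bsub>G\<^esub> y \<otimes>\<^bsub>G\<^esub> (y \<otimes>\<^bsub>G\<^esub> t \<otimes>\<^bsub>G\<^esub> inv\<^bsub>G\<^esub> reify G r)
      = x \<otimes>\<^bsub>G\<^esub> t \<otimes>\<^bsub>G\<^esub> (reify G r \<otimes>\<^bsub>G\<^esub> inv\<^bsub>G\<^esub> reify G r) \<otimes>\<^bsub>G\<^esub> (y \<otimes>\<^bsub>G\<^esub> inv\<^bsub>G\<^esub> y)"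
    using car rs by (simp only: G.m_ac G.m_closed G.inv_closed)
  also have "\<dots> = x \<otimes>\<^bsub>G\<^esub> t" using car rs by (simp add: G.r_inv)
  also have "reify G s \<otimes>\<^bsub>G\<^esub> z \<otimes>\<^bsub>G\<^esub> inv\<^bsub>G\<^esub> t \<otimes>\<^bsub>G\<^esub> (y \<otimes>\<^bsub>G\<^esub> t \<otimes>\<^bsub>G\<^esub> inv\<^bsub>G\<^esub> reify G r)
      = reify G (s / r) \<otimes>\<^bsub>G\<^esub> (z \<otimes>\<^bsub>G\<^esub> y) \<otimes>\<^bsub>G\<^esub> (t \<otimes>\<^bsub>G\<^esub> inv\<^bsub>G\<^esub> t)"
    using car rs unfolding e by (simp only: G.m_ac G.m_closed G.inv_closed)
  also have "\<dots> = reify G (s / r) \<otimes>\<^bsub>G\<^esub> (z \<otimes>\<^bsub>G\<^esub> y)" using car rs e by (simp add: G.r_inv)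
  also have "gle G (x \<otimes>\<^bsub>G\<^esub> t) (reify G (s / r) \<otimes>\<^bsub>G\<^esub> (z \<otimes>\<^bsub>G\<^esub> y)) \<longleftrightarrow> frac_le A (sig A (G, v)) u w"
    using rc pos by (simp add: u sig_iff VD(6) v)
  finally show ?thesis .
qed

lemma frac_value_mult:
  assumes "u \<in> fracs A (sig A (G, v))" "w \<in> fracs A (sig A (G, v))"
  shows "frac_value (frac_mult A u w) = frac_value u \<otimes>\<^bsub>G\<^esub> frac_value w"
proof (cases u; cases w)
  fix r a b s c d assume u: "u = (r, a, b)" "w = (s, c, d)"
  note VD = reified_semivaluationD[OF semival]
  have pos: "0 < r" "0 < s" and rc: "a \<in> carrier A" "b \<in> carrier A" "c \<in> carrier A" "d \<in> carrier A"
    using assms by (auto simp: u fracs_def)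
  obtain x y z t where v: "v a = Some x" "v b = Some y" "v c = Some z" "v d = Some t"
    and car: "x \<in> carrier G" "y \<in> carrier G" "z \<in> carrier G" "t \<in> carrier G"
    using assms value_closed[of a] value_closed[of b] value_closed[of c] value_closed[of d]
    unfolding u fracs_def by blast
  show ?thesis using car rc G.reify_closed[OF pos(1)] G.reify_closed[OF pos(2)]
    by (simp add: u frac_value_def VD(6) v G.reify_mult[OF pos] G.m_ac G.inv_mult_group)
qed

lemma frac_value_scalar: "0 < r \<Longrightarrow> frac_value (r, \<one>\<^bsub>A\<^esub>, \<one>\<^bsub>A\<^esub>) = reify G r"
  using G.reify_closed by (simp add: frac_value_def reified_semivaluationD(4)[OF semival])

lemma frac_value_value: "\<lbrakk>a \<in> carrier A; v a = Some x\<rbrakk> \<Longrightarrow> frac_value (1, a, \<one>\<^bsub>A\<^esub>) = x"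
  using reified_semivaluationD(2)[OF semival, of a x]
  by (simp add: frac_value_def reified_semivaluationD(4)[OF semival] G.reify_one)

lemma frac_value_inv:
  assumes "u \<in> fracs A (sig A (G, v))"
  shows "frac_value (frac_inv u) = inv\<^bsub>G\<^esub> frac_value u"
proof (cases u)
  fix r a b assume u: "u = (r, a, b)"
  have pos: "0 < r" using assms by (auto simp: u fracs_def)
  obtain x y where v: "v a = Some x" "v b = Some y" and car: "x \<in> carrier G" "y \<in> carrier G"
    using assms value_closed by (auto simp: u fracs_def)
  show ?thesis using car G.reify_closed[OF pos]
    by (simp add: u frac_value_def v G.reify_inverse[OF pos] G.m_ac G.inv_mult_group)
qed

text \<open>Fractions contain the generators and are closed under products and inverses. This
  replaces the generated subgroup by an explicit set in all later arguments.\<close>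

lemma value_subgroup_eq: "value_subgroup A (G, v) = frac_value ` fracs A (sig A (G, v))"
proof
  let ?U = "fracs A (sig A (G, v))"
  show "value_subgroup A (G, v) \<subseteq> frac_value ` ?U"
  proof
    fix g assume "g \<in> value_subgroup A (G, v)"
    then have "g \<in> generate G (reify G ` {0<..} \<union> {\<gamma>. \<exists>a\<in>carrier A. v a = Some \<gamma>})"
      by (simp add: value_subgroup_def)
    moreover have base: "\<exists>u\<in>?U. frac_value u = h"
      if h: "h \<in> reify G ` {0<..} \<union> {\<gamma>. \<exists>a\<in>carrier A. v a = Some \<gamma>}" for h
      using h
    proof
      assume "h \<in> reify G ` {0<..}"
      then show ?thesis using order.frac_scalar_closed frac_value_scalar by auto
    next
      assume "h \<in> {\<gamma>. \<exists>a\<in>carrier A. v a = Some \<gamma>}"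
      then obtain a where a: "a \<in> carrier A" "v a = Some h" by blast
      then have "(1, a, \<zero>\<^bsub>A\<^esub>) \<notin> sig A (G, v)" using supp_sig[OF semival cring_axioms] by simp
      then show ?thesis using order.frac_value_closed frac_value_value a by blast
    qed
    ultimately have "\<exists>u\<in>?U. frac_value u = g"
    proof (induction g rule: generate.induct)
      case one
      then show ?case using order.frac_scalar_closed[of 1] frac_value_scalar[of 1] G.reify_one by auto
    next
      case (incl h) then show ?case using base by blast
    next
      case (inv h)
      then obtain u where "u \<in> ?U" "frac_value u = h" using base by blast
      then show ?case using frac_value_inv[of u] order.frac_inv_closed[of u] by auto
    next
      case (eng h1 h2)
      then obtain u w where "u \<in> ?U" "w \<in> ?U" "frac_value u = h1" "frac_value w = h2" by blast
      then show ?case using frac_value_mult[of u w] order.frac_mult_closed[of u w] by auto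
    qed
    then show "g \<in> frac_value ` ?U" by blast
  qed
  show "frac_value ` ?U \<subseteq> value_subgroup A (G, v)"
  proof
    fix g assume "g \<in> frac_value ` ?U"
    then obtain r a b where u: "(r, a, b) \<in> ?U" "g = frac_value (r, a, b)" by auto
    let ?S = "reify G ` {0<..} \<union> {\<gamma>. \<exists>a\<in>carrier A. v a = Some \<gamma>}"
    have "reify G r \<in> ?S" "the (v a) \<in> ?S" "the (v b) \<in> ?S" using u value_closed by (auto simp: fracs_def)
    then have "reify G r \<otimes>\<^bsub>G\<^esub> the (v a) \<otimes>\<^bsub>G\<^esub> inv\<^bsub>G\<^esub> the (v b) \<in> generate G ?S"
      by (intro generate.eng generate.incl generate.inv)
    then show "g \<in> value_subgroup A (G, v)" by (simp add: u value_subgroup_def frac_value_def)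
  qed
qed

end

lemma rsvalI: "cring A \<Longrightarrow> reified_semivaluation A (G, v) \<Longrightarrow> rsval G A v"
  using reified_semivaluationD(1) by (intro rsval.intro rsval_axioms.intro) auto

text \<open>Both value groups are images of the same set of fractions, and equality and order of
  fractions can be read off from \<open>sig\<close>; so matching fractions defines the isomorphism.
  Conversely an isomorphism transports the inequality that defines \<open>sig\<close>.\<close>

lemma rsval_equiv_iff_sig:
  assumes A: "cring A" and V: "reified_semivaluation A (G, v)" and W: "reified_semivaluation A (H, w)"
  shows "rsval_equiv A (G, v) (H, w) \<longleftrightarrow> sig A (G, v) = sig A (H, w)"
proof
  interpret V: rsval G A v by (rule rsvalI[OF A V])
  interpret W: rsval H A w by (rule rsvalI[OF A W])
  let ?V = "value_subgroup A (G, v)" and ?W = "value_subgroup A (H, w)"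
  {
    assume "rsval_equiv A (G, v) (H, w)"
    then obtain \<phi> where iso: "\<phi> \<in> iso (G\<lparr>carrier := ?V\<rparr>) (H\<lparr>carrier := ?W\<rparr>)"
      and ord: "\<And>x y. x \<in> ?V \<Longrightarrow> y \<in> ?V \<Longrightarrow> gle G x y \<longleftrightarrow> gle H (\<phi> x) (\<phi> y)"
      and re: "\<And>r. r > 0 \<Longrightarrow> \<phi> (reify G r) = reify H r"
      and val: "\<And>a. a \<in> carrier A \<Longrightarrow> w a = map_option \<phi> (v a)"
      by (auto simp: rsval_equiv_def)
    have hom: "\<phi> (x \<otimes>\<^bsub>G\<^esub> y) = \<phi> x \<otimes>\<^bsub>H\<^esub> \<phi> y" if "x \<in> ?V" "y \<in> ?V" for x y
      using iso that by (auto simp: iso_def hom_def)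
    have inV: "reify G r \<in> ?V" if "0 < r" for r
      using that by (auto simp: value_subgroup_def intro: generate.incl)
    have inV2: "x \<in> ?V" if "a \<in> carrier A" "v a = Some x" for a x
      using that by (auto simp: value_subgroup_def intro: generate.incl)
    have mV: "x \<otimes>\<^bsub>G\<^esub> y \<in> ?V" if "x \<in> ?V" "y \<in> ?V" for x y
      using that by (auto simp: value_subgroup_def intro: generate.eng)
    have "gle0 G (v a) (mult0 G (Some (reify G r)) (v b)) \<longleftrightarrow> gle0 H (w a) (mult0 H (Some (reify H r)) (w b))"
      if "0 < r" "a \<in> carrier A" "b \<in> carrier A" for r a b
    proof (cases "v a"; cases "v b")
      fix x y assume h: "v a = Some x" "v b = Some y"
      then have "x \<in> ?V" "y \<in> ?V" "reify G r \<in> ?V" using that inV inV2 by auto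
      then show ?thesis using h that by (simp add: val ord mV hom re)
    qed (use that in \<open>simp_all add: val\<close>)
    then show "sig A (G, v) = sig A (H, w)" by (auto simp: sig_def)
  }
  assume eq: "sig A (G, v) = sig A (H, w)"
  let ?Q = "sig A (G, v)"
  let ?U = "fracs A ?Q"
  have vg: "?V = V.frac_value ` ?U" "?W = W.frac_value ` ?U"
    using V.value_subgroup_eq W.value_subgroup_eq eq by auto
  \<comment> \<open>Any fraction that represents \<open>x\<close> may be chosen: by
    \<open>inj\<close> below, its value in \<open>H\<close> does not depend on the choice.\<close>
  define \<phi> where "\<phi> x = W.frac_value (SOME u. u \<in> ?U \<and> V.frac_value u = x)" for x
  have le: "gle G (V.frac_value u) (V.frac_value u') \<longleftrightarrow> gle H (W.frac_value u) (W.frac_value u')"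
    if "u \<in> ?U" "u' \<in> ?U" for u u'
    using that V.frac_value_le W.frac_value_le eq by simp
  have VU: "V.frac_value u \<in> carrier G" "W.frac_value u \<in> carrier H" if "u \<in> ?U" for u
    using V.frac_value_closed' W.frac_value_closed' eq that by auto
  have inj: "V.frac_value u = V.frac_value u' \<longleftrightarrow> W.frac_value u = W.frac_value u'" if "u \<in> ?U" "u' \<in> ?U" for u u'
    using le[of u u'] le[of u' u] that VU V.G.gle_antisym W.G.gle_antisym V.G.gle_refl W.G.gle_refl by metis
  have phi: "\<phi> (V.frac_value u) = W.frac_value u" if u: "u \<in> ?U" for u
  proof -
    have "\<exists>u'. u' \<in> ?U \<and> V.frac_value u' = V.frac_value u" using u by blast
    from someI_ex[OF this] show ?thesis unfolding \<phi>_def using inj u by blast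
  qed
  have "\<phi> \<in> iso (G\<lparr>carrier := ?V\<rparr>) (H\<lparr>carrier := ?W\<rparr>)"
  proof (rule isoI)
    show "\<phi> \<in> hom (G\<lparr>carrier := ?V\<rparr>) (H\<lparr>carrier := ?W\<rparr>)"
    proof (rule homI)
      show "\<phi> x \<in> carrier (H\<lparr>carrier := ?W\<rparr>)" if "x \<in> carrier (G\<lparr>carrier := ?V\<rparr>)" for x
        using that by (auto simp: vg phi)
      show "\<phi> (x \<otimes>\<^bsub>G\<lparr>carrier := ?V\<rparr>\<^esub> y) = \<phi> x \<otimes>\<^bsub>H\<lparr>carrier := ?W\<rparr>\<^esub> \<phi> y"
        if xy: "x \<in> carrier (G\<lparr>carrier := ?V\<rparr>)" "y \<in> carrier (G\<lparr>carrier := ?V\<rparr>)" for x y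
      proof -
        obtain u u' where u: "u \<in> ?U" "u' \<in> ?U" "x = V.frac_value u" "y = V.frac_value u'" using xy by (auto simp: vg)
        then have "x \<otimes>\<^bsub>G\<^esub> y = V.frac_value (frac_mult A u u')" by (simp add: V.frac_value_mult)
        then show ?thesis using u V.order.frac_mult_closed W.frac_value_mult eq phi by simp
      qed
    qed
    have "inj_on \<phi> ?V" unfolding vg(1) by (rule inj_onI) (auto simp: phi inj)
    moreover have "\<phi> ` ?V = ?W" unfolding vg by (auto simp: phi image_iff)
    ultimately show "bij_betw \<phi> (carrier (G\<lparr>carrier := ?V\<rparr>)) (carrier (H\<lparr>carrier := ?W\<rparr>))"
      by (simp add: bij_betw_def)
  qed
  moreover have "gle G x y \<longleftrightarrow> gle H (\<phi> x) (\<phi> y)" if "x \<in> ?V" "y \<in> ?V" for x y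
    using that by (auto simp: vg(1) phi le)
  moreover have "\<phi> (reify G r) = reify H r" if "0 < r" for r
    using phi[OF V.order.frac_scalar_closed[OF that]] that by (simp add: V.frac_value_scalar W.frac_value_scalar)
  moreover have "w a = map_option \<phi> (v a)" if a: "a \<in> carrier A" for a
  proof -
    have n: "v a = None \<longleftrightarrow> w a = None" using supp_sig[OF V A, of a] supp_sig[OF W A, of a] a eq by simp
    show ?thesis
    proof (cases "v a")
      case None then show ?thesis using n by simp
    next
      case (Some x)
      then obtain y where y: "w a = Some y" using n by auto
      have "(1, a, \<one>\<^bsub>A\<^esub>) \<in> ?U" using Some a supp_sig[OF V A, of a] by (intro V.order.frac_value_closed) auto
      then show ?thesis using phi[of "(1, a, \<one>\<^bsub>A\<^esub>)"] V.frac_value_value[OF a Some] W.frac_value_value[OF a y] Some y by simp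
    qed
  qed
  ultimately show "rsval_equiv A (G, v) (H, w)" by (auto simp: rsval_equiv_def)
qed

section \<open>Realization of an order by a semivaluation\<close>

context reified_order
begin

definition frac_class where
  "frac_class u = {w \<in> fracs A Q. frac_le A Q u w \<and> frac_le A Q w u}"

definition frac_rep :: "(real \<times> 'a \<times> 'a) set \<Rightarrow> real \<times> 'a \<times> 'a" where
  "frac_rep U = (SOME u. u \<in> U)"

lemma frac_class_eq: "\<lbrakk>u \<in> fracs A Q; w \<in> fracs A Q\<rbrakk> \<Longrightarrow> frac_class u = frac_class w \<longleftrightarrow> frac_le A Q u w \<and> frac_le A Q w u"
proof
  assume u: "u \<in> fracs A Q" "w \<in> fracs A Q" and "frac_class u = frac_class w"
  then have "u \<in> frac_class w" using frac_le_refl[OF u(1)] unfolding frac_class_def by blast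
  then show "frac_le A Q u w \<and> frac_le A Q w u" by (simp add: frac_class_def)
next
  assume u: "u \<in> fracs A Q" "w \<in> fracs A Q" and le: "frac_le A Q u w \<and> frac_le A Q w u"
  have "frac_class u' \<subseteq> frac_class w'"
    if "u' \<in> fracs A Q" "w' \<in> fracs A Q" "frac_le A Q u' w'" "frac_le A Q w' u'" for u' w'
  proof
    fix t assume "t \<in> frac_class u'"
    then have t: "t \<in> fracs A Q" "frac_le A Q u' t" "frac_le A Q t u'" by (auto simp: frac_class_def)
    show "t \<in> frac_class w'"
      using t(1) frac_le_trans[OF that(2,1) t(1) that(4) t(2)] frac_le_trans[OF t(1) that(1,2) t(3) that(3)]
      by (simp add: frac_class_def)
  qed
  then show "frac_class u = frac_class w" using u le by blast
qed

lemma frac_rep_class: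
  assumes "u \<in> fracs A Q"
  shows "frac_rep (frac_class u) \<in> fracs A Q" "frac_le A Q u (frac_rep (frac_class u))" "frac_le A Q (frac_rep (frac_class u)) u"
proof -
  have "u \<in> frac_class u" using assms frac_le_refl by (simp add: frac_class_def)
  then have "frac_rep (frac_class u) \<in> frac_class u" unfolding frac_rep_def by (rule someI)
  then show "frac_rep (frac_class u) \<in> fracs A Q" "frac_le A Q u (frac_rep (frac_class u))" "frac_le A Q (frac_rep (frac_class u)) u"
    by (auto simp: frac_class_def)
qed

text \<open>A class of fractions is a set of triples, hence an element of exactly the type over
  which \<open>Spra\<close> forms its semivaluations.\<close>

definition frac_group :: "(real \<times> 'a \<times> 'a) set rvgroup" where
  "frac_group = \<lparr>carrier = frac_class ` fracs A Q,
     monoid.mult = (\<lambda>U W. frac_class (frac_mult A (frac_rep U) (frac_rep W))),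
     one = frac_class (1, \<one>, \<one>),
     gle = (\<lambda>U W. frac_le A Q (frac_rep U) (frac_rep W)),
     reify = (\<lambda>r. frac_class (r, \<one>, \<one>))\<rparr>"

definition frac_val :: "'a \<Rightarrow> (real \<times> 'a \<times> 'a) set option" where
  "frac_val a = (if (1, a, \<zero>) \<in> Q then None else Some (frac_class (1, a, \<one>)))"

lemma frac_mult_comm: "\<lbrakk>u \<in> fracs A Q; w \<in> fracs A Q\<rbrakk> \<Longrightarrow> frac_mult A u w = frac_mult A w u"
  by (cases u; cases w) (auto simp: fracs_def m_comm)

lemma frac_group_mult:
  assumes "u \<in> fracs A Q" "w \<in> fracs A Q"
  shows "frac_class u \<otimes>\<^bsub>frac_group\<^esub> frac_class w = frac_class (frac_mult A u w)"
proof -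
  let ?u = "frac_rep (frac_class u)" and ?w = "frac_rep (frac_class w)"
  note r = frac_rep_class[OF assms(1)] frac_rep_class[OF assms(2)]
  note c = frac_mult_closed[OF r(1,4)] frac_mult_closed[OF assms(1) r(4)] frac_mult_closed[OF assms]
    frac_mult_closed[OF r(1) assms(2)]
  have "frac_le A Q (frac_mult A ?u ?w) (frac_mult A u w)"
    using frac_le_trans[OF c(1,2,3) frac_le_mult[OF r(1) assms(1) r(4) r(3)]]
      frac_le_mult[OF r(4) assms(2) assms(1) r(6)]
    by (simp add: frac_mult_comm[OF assms] frac_mult_comm[OF assms(1) r(4)])
  moreover have "frac_le A Q (frac_mult A u w) (frac_mult A ?u ?w)"
    using frac_le_trans[OF c(3,4,1) frac_le_mult[OF assms(1) r(1) assms(2) r(2)]]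
      frac_le_mult[OF assms(2) r(4) r(1) r(5)]
    by (simp add: frac_mult_comm[OF r(1,4)] frac_mult_comm[OF r(1) assms(2)])
  ultimately show ?thesis using assms r by (simp add: frac_group_def frac_class_eq frac_mult_closed)
qed

lemma frac_group_le:
  assumes "u \<in> fracs A Q" "w \<in> fracs A Q"
  shows "gle frac_group (frac_class u) (frac_class w) \<longleftrightarrow> frac_le A Q u w"
proof -
  note r = frac_rep_class[OF assms(1)] frac_rep_class[OF assms(2)]
  have "frac_le A Q (frac_rep (frac_class u)) (frac_rep (frac_class w)) \<longleftrightarrow> frac_le A Q u w"
    using frac_le_trans[OF r(1,4) assms(2)] frac_le_trans[OF assms(1) r(1) assms(2) r(2)]
      frac_le_trans[OF r(1) assms(1) r(4) r(3)] frac_le_trans[OF assms r(4) _ r(5)] r(6) by blast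
  then show ?thesis by (simp add: frac_group_def)
qed

lemma frac_group_simps:
  "carrier frac_group = frac_class ` fracs A Q" "\<one>\<^bsub>frac_group\<^esub> = frac_class (1, \<one>, \<one>)"
  "reify frac_group r = frac_class (r, \<one>, \<one>)"
  by (simp_all add: frac_group_def)

lemma reified_value_group_frac: "reified_value_group frac_group"
proof -
  have "comm_group frac_group"
  proof (rule comm_groupI)
    show "x \<otimes>\<^bsub>frac_group\<^esub> y \<in> carrier frac_group" if h: "x \<in> carrier frac_group" "y \<in> carrier frac_group" for x y
    proof -
      obtain u w where "x = frac_class u" "u \<in> fracs A Q" "y = frac_class w" "w \<in> fracs A Q"
        using h unfolding frac_group_simps by blast
      then show ?thesis by (simp add: frac_group_mult frac_group_simps frac_mult_closed)
    qed
    show "\<one>\<^bsub>frac_group\<^esub> \<in> carrier frac_group" by (auto simp: frac_group_simps frac_scalar_closed)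
    show "x \<otimes>\<^bsub>frac_group\<^esub> y \<otimes>\<^bsub>frac_group\<^esub> z = x \<otimes>\<^bsub>frac_group\<^esub> (y \<otimes>\<^bsub>frac_group\<^esub> z)"
      if h: "x \<in> carrier frac_group" "y \<in> carrier frac_group" "z \<in> carrier frac_group" for x y z
    proof -
      obtain u w t where u: "x = frac_class u" "u \<in> fracs A Q" "y = frac_class w" "w \<in> fracs A Q" "z = frac_class t" "t \<in> fracs A Q"
        using h by (auto simp: frac_group_simps)
      have "frac_mult A (frac_mult A u w) t = frac_mult A u (frac_mult A w t)"
        using u by (cases u; cases w; cases t) (auto simp: fracs_def m_assoc)
      then show ?thesis using u by (simp add: frac_group_mult frac_mult_closed)
    qed
    show "x \<otimes>\<^bsub>frac_group\<^esub> y = y \<otimes>\<^bsub>frac_group\<^esub> x" if h: "x \<in> carrier frac_group" "y \<in> carrier frac_group" for x y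
    proof -
      obtain u w where "x = frac_class u" "u \<in> fracs A Q" "y = frac_class w" "w \<in> fracs A Q"
        using h unfolding frac_group_simps by blast
      then show ?thesis using frac_mult_comm[of u w] by (simp add: frac_group_mult)
    qed
    show "\<one>\<^bsub>frac_group\<^esub> \<otimes>\<^bsub>frac_group\<^esub> x = x" if x: "x \<in> carrier frac_group" for x
    proof -
      obtain u where u: "x = frac_class u" "u \<in> fracs A Q" using x by (auto simp: frac_group_simps)
      have "frac_mult A (1, \<one>, \<one>) u = u" using u by (cases u) (auto simp: fracs_def)
      then show ?thesis using u frac_scalar_closed[of 1] by (simp add: frac_group_simps frac_group_mult)
    qed
    show "\<exists>y\<in>carrier frac_group. y \<otimes>\<^bsub>frac_group\<^esub> x = \<one>\<^bsub>frac_group\<^esub>" if x: "x \<in> carrier frac_group" for x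
    proof -
      obtain u where u: "x = frac_class u" "u \<in> fracs A Q" using x by (auto simp: frac_group_simps)
      obtain r a b where uu: "u = (r, a, b)" by (cases u)
      have "frac_class (frac_mult A (frac_inv u) u) = frac_class (1, \<one>, \<one>)"
        using u frac_inv_closed[OF u(2)] frac_mult_closed frac_scalar_closed[of 1] refl_Q[of "a \<otimes> b"]
        by (subst frac_class_eq) (auto simp: uu fracs_def m_comm)
      then have "frac_class (frac_inv u) \<otimes>\<^bsub>frac_group\<^esub> x = \<one>\<^bsub>frac_group\<^esub>"
        using u frac_inv_closed by (simp add: frac_group_simps frac_group_mult)
      moreover have "frac_class (frac_inv u) \<in> carrier frac_group"
        using frac_inv_closed[OF u(2)] unfolding frac_group_simps by (rule imageI)
      ultimately show ?thesis by blast
    qed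
  qed
  then interpret comm_group frac_group .
  show ?thesis
  proof (unfold_locales, goal_cases)
    case 1
    let ?R = "{(x, y). x \<in> frac_class ` fracs A Q \<and> y \<in> frac_class ` fracs A Q \<and> gle frac_group x y}"
    have R: "(frac_class u, frac_class w) \<in> ?R \<longleftrightarrow> frac_le A Q u w" if "u \<in> fracs A Q" "w \<in> fracs A Q" for u w
      using that by (simp add: frac_group_le)
    have ex: "\<exists>u. x = frac_class u \<and> u \<in> fracs A Q" if "x \<in> frac_class ` fracs A Q" for x
      using that by (elim imageE) (intro exI conjI)
    have dom_R: "x \<in> frac_class ` fracs A Q \<and> y \<in> frac_class ` fracs A Q" if "(x, y) \<in> ?R" for x y
      using that by simp
    have "refl_on (frac_class ` fracs A Q) ?R"
      using frac_le_refl by (auto simp: refl_on_def frac_group_le)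
    moreover have "Relation.trans ?R"
    proof (rule transI)
      fix x y z assume h: "(x, y) \<in> ?R" "(y, z) \<in> ?R"
      obtain u where u: "x = frac_class u" "u \<in> fracs A Q" using ex dom_R[OF h(1)] by metis
      obtain w where w: "y = frac_class w" "w \<in> fracs A Q" using ex dom_R[OF h(1)] by metis
      obtain t where t: "z = frac_class t" "t \<in> fracs A Q" using ex dom_R[OF h(2)] by metis
      show "(x, z) \<in> ?R"
        using h frac_le_trans[OF u(2) w(2) t(2)] R[OF u(2) w(2)] R[OF w(2) t(2)] R[OF u(2) t(2)]
        unfolding u(1) w(1) t(1) by iprover
    qed
    moreover have "antisym ?R"
    proof (rule antisymI)
      fix x y assume h: "(x, y) \<in> ?R" "(y, x) \<in> ?R"
      obtain u where u: "x = frac_class u" "u \<in> fracs A Q" using ex dom_R[OF h(1)] by metis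
      obtain w where w: "y = frac_class w" "w \<in> fracs A Q" using ex dom_R[OF h(1)] by metis
      show "x = y"
        using h R[OF u(2) w(2)] R[OF w(2) u(2)] frac_class_eq[OF u(2) w(2)] unfolding u(1) w(1) by iprover
    qed
    moreover have "total_on (frac_class ` fracs A Q) ?R"
    proof (rule total_onI)
      fix x y assume "x \<in> frac_class ` fracs A Q" "y \<in> frac_class ` fracs A Q"
      then obtain u w where u: "x = frac_class u" "u \<in> fracs A Q" and w: "y = frac_class w" "w \<in> fracs A Q"
        using ex by metis
      show "(x, y) \<in> ?R \<or> (y, x) \<in> ?R"
        using frac_le_total[OF u(2) w(2)] R[OF u(2) w(2)] R[OF w(2) u(2)] unfolding u(1) w(1) by iprover
    qed
    ultimately show ?case
      unfolding order_on_defs frac_group_simps by auto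
  next
    case (2 x y z)
    then obtain u w t where "x = frac_class u" "u \<in> fracs A Q" "y = frac_class w" "w \<in> fracs A Q"
        "z = frac_class t" "t \<in> fracs A Q"
      unfolding frac_group_simps by blast
    then show ?case using 2 by (simp add: frac_group_mult frac_group_le frac_mult_closed frac_le_mult)
  next
    case (3 r) then show ?case by (auto simp: frac_group_simps frac_scalar_closed)
  next
    case (4 r s) then show ?case by (simp add: frac_group_simps frac_scalar_closed frac_group_mult)
  next
    case (5 r s) then show ?case by (simp add: frac_group_simps frac_scalar_closed frac_group_le mono_one)
  qed
qed

text \<open>Values are taken in the group of fractions of the order itself, so that comparison of
  values unfolds to the order. Together with \<open>reified_order_sig\<close> this identifies orders
  with classes of semivaluations.\<close>

lemma realization: "reified_semivaluation A (frac_group, frac_val)" "sig A (frac_group, frac_val) = Q"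
proof -
  have val: "frac_val a = Some (frac_class (1, a, \<one>)) \<and> (1, a, \<one>) \<in> fracs A Q" if "a \<in> carrier A" "(1, a, \<zero>) \<notin> Q" for a
    using that frac_value_closed by (simp add: frac_val_def)
  have none: "frac_val a = None \<longleftrightarrow> (1, a, \<zero>) \<in> Q" for a by (simp add: frac_val_def)
  have mlt: "frac_val (x \<otimes> y) = mult0 frac_group (frac_val x) (frac_val y)" if "x \<in> carrier A" "y \<in> carrier A" for x y
    using that val[of x] val[of y] by (auto simp: frac_val_def supp_mult_iff frac_group_mult)
  have le: "gle0 frac_group (frac_val a) (mult0 frac_group (Some (reify frac_group r)) (frac_val b)) \<longleftrightarrow> (r, a, b) \<in> Q"
    if r: "0 < r" "a \<in> carrier A" "b \<in> carrier A" for r a b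
  proof (cases "(1, a, \<zero>) \<in> Q \<or> (1, b, \<zero>) \<in> Q")
    case True
    show ?thesis
    proof (cases "(1, a, \<zero>) \<in> Q")
      case True then show ?thesis using supp_le r by (simp add: frac_val_def)
    next
      case False then show ?thesis using True le_supp r by (auto simp: frac_val_def)
    qed
  next
    case False
    have "frac_mult A (r, \<one>, \<one>) (1, b, \<one>) \<in> fracs A Q"
      using False r by (intro frac_mult_closed frac_scalar_closed frac_value_closed) auto
    then show ?thesis using r val[of a] val[of b] False frac_scalar_closed[of r]
      by (simp add: frac_group_simps frac_group_mult frac_group_le)
  qed
  show "sig A (frac_group, frac_val) = Q"
    using le dom by (auto simp: sig_def)
  have le1: "gle0 frac_group (frac_val a) (frac_val b) \<longleftrightarrow> (1, a, b) \<in> Q" if "a \<in> carrier A" "b \<in> carrier A" for a b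
  proof -
    interpret G: reified_value_group frac_group by (rule reified_value_group_frac)
    have "mult0 frac_group (Some (reify frac_group 1)) (frac_val b) = frac_val b"
      using that by (cases "frac_val b") (auto simp: G.reify_one frac_val_def frac_group_simps frac_value_closed split: if_splits intro!: G.l_one[unfolded frac_group_simps])
    then show ?thesis using le[of 1 a b] that by simp
  qed
  show "reified_semivaluation A (frac_group, frac_val)"
    unfolding reified_semivaluation_def prod.case
  proof (intro conjI ballI)
    show "reified_value_group frac_group" by (rule reified_value_group_frac)
    show "frac_val \<in> carrier A \<rightarrow> insert None (Some ` carrier frac_group)"
      using val none by (auto simp: frac_group_simps frac_val_def intro: frac_value_closed)
    show "frac_val \<zero> = None" by (simp add: none supp_zero)
    show "frac_val \<one> = Some \<one>\<^bsub>frac_group\<^esub>" using val[of \<one>] nontrivial by (simp add: frac_group_simps)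
    show "frac_val (x \<otimes> y) = mult0 frac_group (frac_val x) (frac_val y)" if "x \<in> carrier A" "y \<in> carrier A" for x y
      using mlt that by blast
    show "gle0 frac_group (frac_val (x \<oplus> y)) (frac_val x) \<or> gle0 frac_group (frac_val (x \<oplus> y)) (frac_val y)"
      if xy: "x \<in> carrier A" "y \<in> carrier A" for x y
    proof -
      have "(1, x, y) \<in> Q \<or> (1, y, x) \<in> Q" using total[of 1 x y] xy by simp
      then have "(1, x \<oplus> y, y) \<in> Q \<or> (1, x \<oplus> y, x) \<in> Q" using add refl_Q xy by blast
      then show ?thesis using le1 xy by auto
    qed
  qed
qed

end

section \<open>The spectrum as a set of orders\<close>

definition spra_order :: "'a affinoid \<Rightarrow> (real \<times> 'a \<times> 'a) set \<Rightarrow> bool" where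
  "spra_order A Q \<longleftrightarrow> reified_order A Q \<and>
     (\<forall>r>0. \<forall>a\<in>circcirc A r. (r, a, \<one>\<^bsub>A\<^esub>) \<in> Q) \<and>
     (\<forall>r>0. \<forall>a\<in>plus_part A r. (r, a, \<one>\<^bsub>A\<^esub>) \<in> Q) \<and>
     (\<forall>a\<in>carrier A. (1, a, \<zero>\<^bsub>A\<^esub>) \<notin> Q \<longrightarrow> (\<exists>r. (r, \<one>\<^bsub>A\<^esub>, a) \<in> Q) \<and> (\<exists>r. (r, a, \<one>\<^bsub>A\<^esub>) \<in> Q))"

definition spra_class :: "'a affinoid \<Rightarrow> (real \<times> 'a \<times> 'a) set \<Rightarrow> ('a, (real \<times> 'a \<times> 'a) set) rsval set" where
  "spra_class A Q = {W \<in> spra_vals A. sig A W = Q}"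

definition pullback :: "('a, 'm) ring_scheme \<Rightarrow> ('a \<Rightarrow> 'b) \<Rightarrow> (real \<times> 'b \<times> 'b) set \<Rightarrow> (real \<times> 'a \<times> 'a) set" where
  "pullback A f Q = {(r, a, b). 0 < r \<and> a \<in> carrier A \<and> b \<in> carrier A \<and> (r, f a, f b) \<in> Q}"

context rsval
begin

lemma sig_one_iff: "(r, a, \<one>\<^bsub>A\<^esub>) \<in> sig A (G, v) \<longleftrightarrow> 0 < r \<and> a \<in> carrier A \<and> gle0 G (v a) (Some (reify G r))"
  using G.reify_closed[of r] reified_semivaluationD(4)[OF semival] by (auto simp: sig_iff)

text \<open>Elements of the value group are fractions \<open>r v(a) / v(b)\<close>, so lower bounds
  for all of them amount to lower bounds for the \<open>v(a)\<close> and upper bounds for the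
  \<open>v(b)\<close>.\<close>

lemma value_subgroup_bounded_iff:
  "(\<forall>\<gamma>\<in>value_subgroup A (G, v). \<exists>r>0. gle G (reify G r) \<gamma>) \<longleftrightarrow>
   (\<forall>a\<in>carrier A. (1, a, \<zero>\<^bsub>A\<^esub>) \<notin> sig A (G, v) \<longrightarrow>
      (\<exists>r. (r, \<one>\<^bsub>A\<^esub>, a) \<in> sig A (G, v)) \<and> (\<exists>r. (r, a, \<one>\<^bsub>A\<^esub>) \<in> sig A (G, v)))" (is "?L \<longleftrightarrow> ?R")
proof
  let ?Q = "sig A (G, v)"
  have le: "gle G (reify G r) (frac_value u) \<longleftrightarrow> frac_le A ?Q (r, \<one>\<^bsub>A\<^esub>, \<one>\<^bsub>A\<^esub>) u" if "0 < r" "u \<in> fracs A ?Q" for r u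
    using frac_value_le[OF order.frac_scalar_closed[OF that(1)] that(2)] frac_value_scalar[OF that(1)] by simp
  have mem: "frac_value u \<in> value_subgroup A (G, v)" if "u \<in> fracs A ?Q" for u
    unfolding value_subgroup_eq using that by (rule imageI)
  {
    assume L: ?L
    show ?R
    proof (intro ballI impI conjI)
      fix a assume a: "a \<in> carrier A" "(1, a, \<zero>\<^bsub>A\<^esub>) \<notin> ?Q"
      have u: "(1, a, \<one>\<^bsub>A\<^esub>) \<in> fracs A ?Q" "(1, \<one>\<^bsub>A\<^esub>, a) \<in> fracs A ?Q"
        using order.frac_value_closed[OF a] order.frac_inv_closed[of "(1, a, \<one>\<^bsub>A\<^esub>)"] by auto
      obtain r where "0 < r" "gle G (reify G r) (frac_value (1, a, \<one>\<^bsub>A\<^esub>))"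
        using bspec[OF L mem[OF u(1)]] by blast
      then have "(1 / r, \<one>\<^bsub>A\<^esub>, a) \<in> ?Q" using le[OF _ u(1), of r] a by simp
      then show "\<exists>r. (r, \<one>\<^bsub>A\<^esub>, a) \<in> ?Q" ..
      obtain s where "0 < s" "gle G (reify G s) (frac_value (1, \<one>\<^bsub>A\<^esub>, a))"
        using bspec[OF L mem[OF u(2)]] by blast
      then have "(1 / s, a, \<one>\<^bsub>A\<^esub>) \<in> ?Q" using le[OF _ u(2), of s] a by simp
      then show "\<exists>r. (r, a, \<one>\<^bsub>A\<^esub>) \<in> ?Q" ..
    qed
  }
  assume R: ?R
  show ?L
  proof
    fix \<gamma> assume "\<gamma> \<in> value_subgroup A (G, v)"
    then obtain s a b where u: "(s, a, b) \<in> fracs A ?Q" "\<gamma> = frac_value (s, a, b)"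
      unfolding value_subgroup_eq by auto
    then have ab: "0 < s" "a \<in> carrier A" "b \<in> carrier A" "(1, a, \<zero>\<^bsub>A\<^esub>) \<notin> ?Q" "(1, b, \<zero>\<^bsub>A\<^esub>) \<notin> ?Q"
      by (auto simp: fracs_def)
    then obtain r1 r2 where r: "(r1, \<one>\<^bsub>A\<^esub>, a) \<in> ?Q" "(r2, b, \<one>\<^bsub>A\<^esub>) \<in> ?Q" using R by blast
    then have pos: "0 < r1" "0 < r2" using order.dom by auto
    have "(r2 * r1, b, a) \<in> ?Q" by (rule order.trans[OF r(2,1)])
    then have "frac_le A ?Q (s / (r2 * r1), \<one>\<^bsub>A\<^esub>, \<one>\<^bsub>A\<^esub>) (s, a, b)" using ab pos by simp
    then show "\<exists>r>0. gle G (reify G r) \<gamma>"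
      using le[of "s / (r2 * r1)" "(s, a, b)"] u ab pos by (intro exI[of _ "s / (r2 * r1)"]) auto
  qed
qed

end

lemma spra_vals_iff:
  assumes "cring A"
  shows "(G, v) \<in> spra_vals A \<longleftrightarrow> reified_semivaluation A (G, v) \<and> spra_order A (sig A (G, v))"
proof (cases "reified_semivaluation A (G, v)")
  case True
  interpret rsval G A v by (rule rsvalI[OF assms True])
  have "a \<in> carrier A" if "a \<in> circcirc A r \<or> a \<in> plus_part A r" for a r
    using that by (auto simp: circcirc_def plus_part_def circ_def)
  then show ?thesis
    using True order.reified_order_axioms value_subgroup_bounded_iff
    by (auto simp: spra_vals_def rsval_commensurable_def rsval_bounded_def spra_order_def sig_one_iff)
qed (simp add: spra_vals_def)

lemma spra_class_nonempty:
  assumes "spra_order A Q"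
  shows "spra_class A Q \<noteq> {}"
proof -
  interpret reified_order A Q using assms by (simp add: spra_order_def)
  have "(frac_group, frac_val) \<in> spra_class A Q"
    using spra_vals_iff[OF cring_axioms, of frac_group frac_val] realization assms by (simp add: spra_class_def)
  then show ?thesis by blast
qed

lemma spra_class_inject: "spra_order A Q \<Longrightarrow> spra_class A Q = spra_class A Q' \<Longrightarrow> Q = Q'"
  using spra_class_nonempty[of A Q] by (auto simp: spra_class_def)

text \<open>Equivalence is equality of \<open>sig\<close>, so a class is determined by its order,
  and realization supplies a member for each order.\<close>

lemma Spra_eq:
  assumes "cring A"
  shows "Spra A = spra_class A ` {Q. spra_order A Q}"
proof -
  let ?E = "{(V :: ('a, (real \<times> 'a \<times> 'a) set) rsval, W :: ('a, (real \<times> 'a \<times> 'a) set) rsval). V \<in> spra_vals A \<and> W \<in> spra_vals A \<and> rsval_equiv A V W}"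
  have eq: "rsval_equiv A V W \<longleftrightarrow> sig A W = sig A V" if "V \<in> spra_vals A" "W \<in> spra_vals A"
    for V W :: "('a, (real \<times> 'a \<times> 'a) set) rsval"
  proof -
    obtain G v H w where "V = (G, v)" "W = (H, w)" by (cases V; cases W)
    then show ?thesis
      using that spra_vals_iff[OF assms, of G v] spra_vals_iff[OF assms, of H w] rsval_equiv_iff_sig[OF assms, of G v H w]
      by auto
  qed
  have cls: "?E `` {V} = spra_class A (sig A V)" if "V \<in> spra_vals A"
    for V :: "('a, (real \<times> 'a \<times> 'a) set) rsval"
    using that eq[OF that] by (auto simp: spra_class_def)
  have ord: "spra_order A (sig A V)" if "V \<in> spra_vals A" for V :: "('a, (real \<times> 'a \<times> 'a) set) rsval"
    using that spra_vals_iff[OF assms, of "fst V" "snd V"] by simp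
  let ?V = "spra_vals A :: ('a, (real \<times> 'a \<times> 'a) set) rsval set"
  have "?V // ?E = (\<lambda>V. ?E `` {V}) ` ?V"
    unfolding quotient_def by (simp add: UNION_singleton_eq_range)
  also have "\<dots> = (\<lambda>V. spra_class A (sig A V)) ` ?V" by (rule image_cong[OF refl cls])
  also have "\<dots> = spra_class A ` sig A ` ?V" by (simp add: image_image)
  also have "sig A ` ?V = {Q. spra_order A Q}"
  proof (intro equalityI subsetI)
    fix Q assume "Q \<in> {Q. spra_order A Q}"
    then have "spra_class A Q \<noteq> {}" using spra_class_nonempty by simp
    then show "Q \<in> sig A ` ?V"
      unfolding spra_class_def by blast
  qed (use ord in auto)
  finally show ?thesis by (simp add: Spra_def)
qed

lemma restricted_semivaluation:
  assumes f: "f \<in> ring_hom A B" and "cring A" "cring B" and V: "reified_semivaluation B (G, v)"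
  shows "reified_semivaluation A (G, v \<circ> f)" "sig A (G, v \<circ> f) = pullback A f (sig B (G, v))"
proof -
  interpret A: cring A by fact
  interpret B: cring B by fact
  have f0: "f \<zero>\<^bsub>A\<^esub> = \<zero>\<^bsub>B\<^esub>" using f A.ring_axioms B.ring_axioms by (rule ring_hom_zero)
  note h = ring_hom_closed[OF f] ring_hom_mult[OF f] ring_hom_add[OF f] ring_hom_one[OF f] f0
  show "reified_semivaluation A (G, v \<circ> f)"
    using V h unfolding reified_semivaluation_def by (auto simp: Pi_def)
  show "sig A (G, v \<circ> f) = pullback A f (sig B (G, v))"
    using h by (auto simp: sig_def pullback_def)
qed

text \<open>Composition with \<open>f\<close> changes the order by pullback, and the change of value
  type hidden in \<open>spra_map\<close> is invisible to orders.\<close>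

lemma spra_map_class:
  assumes f: "f \<in> ring_hom A B" and A: "cring A" and B: "cring B" and Q: "spra_order B Q"
  shows "spra_map A f (spra_class B Q) = spra_class A (pullback A f Q)"
proof -
  have e: "rsval_equiv A (G, v \<circ> f) W \<longleftrightarrow> sig A W = pullback A f Q"
    if V: "(G, v) \<in> spra_class B Q" and W: "W \<in> spra_vals A"
    for G v and W :: "('a, (real \<times> 'a \<times> 'a) set) rsval"
  proof -
    obtain H w where w: "W = (H, w)" by (cases W)
    have V': "reified_semivaluation B (G, v)" "sig B (G, v) = Q"
      using V spra_vals_iff[OF B, of G v] by (auto simp: spra_class_def)
    have "reified_semivaluation A (H, w)" using W spra_vals_iff[OF A, of H w] w by simp
    then have "rsval_equiv A (G, v \<circ> f) (H, w) \<longleftrightarrow> sig A (G, v \<circ> f) = sig A (H, w)"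
      by (intro rsval_equiv_iff_sig A restricted_semivaluation[OF f A B V'(1)])
    then show ?thesis using restricted_semivaluation(2)[OF f A B V'(1)] V'(2) w by auto
  qed
  obtain G v where ne: "(G, v) \<in> spra_class B Q" using spra_class_nonempty[OF Q] by auto
  show ?thesis
  proof (intro equalityI subsetI)
    fix W assume "W \<in> spra_map A f (spra_class B Q)"
    then obtain G v where "W \<in> spra_vals A" "(G, v) \<in> spra_class B Q" "rsval_equiv A (G, v \<circ> f) W"
      by (auto simp: spra_map_def)
    then show "W \<in> spra_class A (pullback A f Q)" using e[of G v W] by (simp add: spra_class_def)
  next
    fix W assume W: "W \<in> spra_class A (pullback A f Q)"
    then have "rsval_equiv A (G, v \<circ> f) W" using e[OF ne, of W] by (simp add: spra_class_def)
    then show "W \<in> spra_map A f (spra_class B Q)" using ne W by (auto simp: spra_map_def spra_class_def)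
  qed
qed

lemma pullback_comp:
  assumes "f \<in> carrier A \<rightarrow> carrier B"
  shows "pullback A f (pullback B h Q) = pullback A (\<lambda>a. h (f a)) Q"
  using assms by (auto simp: pullback_def)

text \<open>From here on only orders have to be considered: surjectivity becomes the lifting
  property \<open>lift\<close>, and the other hypotheses make the restriction maps well defined and
  compatible.\<close>

lemma Spra_fiber_product:
  assumes "cring A" "cring B" "cring C" "cring D"
    and f: "f \<in> ring_hom A B" and g: "g \<in> ring_hom A C" and h: "h \<in> ring_hom B D" and k: "k \<in> ring_hom C D"
    and fA: "\<And>Q. spra_order B Q \<Longrightarrow> spra_order A (pullback A f Q)"
    and gA: "\<And>Q. spra_order C Q \<Longrightarrow> spra_order A (pullback A g Q)"
    and hB: "\<And>Q. spra_order D Q \<Longrightarrow> spra_order B (pullback B h Q)"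
    and kC: "\<And>Q. spra_order D Q \<Longrightarrow> spra_order C (pullback C k Q)"
    and comm: "\<And>a. a \<in> carrier A \<Longrightarrow> h (f a) = k (g a)"
    and lift: "\<And>Q R. spra_order B Q \<Longrightarrow> spra_order C R \<Longrightarrow> pullback A f Q = pullback A g R \<Longrightarrow>
        \<exists>P. spra_order D P \<and> pullback B h P = Q \<and> pullback C k P = R"
  shows "(\<lambda>x. (spra_map B h x, spra_map C k x)) ` Spra D
         = {(y, z). y \<in> Spra B \<and> z \<in> Spra C \<and> spra_map A f y = spra_map A g z}"
proof (intro equalityI subsetI)
  fix p assume "p \<in> (\<lambda>x. (spra_map B h x, spra_map C k x)) ` Spra D"
  then obtain P where P: "spra_order D P" "p = (spra_map B h (spra_class D P), spra_map C k (spra_class D P))"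
    using Spra_eq[OF \<open>cring D\<close>] by auto
  have p: "p = (spra_class B (pullback B h P), spra_class C (pullback C k P))"
    using P spra_map_class[OF h \<open>cring B\<close> \<open>cring D\<close>] spra_map_class[OF k \<open>cring C\<close> \<open>cring D\<close>] by simp
  have "pullback A f (pullback B h P) = pullback A (\<lambda>a. h (f a)) P"
    by (rule pullback_comp) (use ring_hom_closed[OF f] in auto)
  also have "\<dots> = pullback A (\<lambda>a. k (g a)) P" using comm by (auto simp: pullback_def)
  also have "\<dots> = pullback A g (pullback C k P)"
    by (rule pullback_comp[symmetric]) (use ring_hom_closed[OF g] in auto)
  finally have "spra_map A f (spra_class B (pullback B h P)) = spra_map A g (spra_class C (pullback C k P))"
    using spra_map_class[OF f \<open>cring A\<close> \<open>cring B\<close> hB[OF P(1)]] spra_map_class[OF g \<open>cring A\<close> \<open>cring C\<close> kC[OF P(1)]]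
    by simp
  then show "p \<in> {(y, z). y \<in> Spra B \<and> z \<in> Spra C \<and> spra_map A f y = spra_map A g z}"
    using p hB[OF P(1)] kC[OF P(1)] Spra_eq[OF \<open>cring B\<close>] Spra_eq[OF \<open>cring C\<close>] by simp
next
  fix p assume "p \<in> {(y, z). y \<in> Spra B \<and> z \<in> Spra C \<and> spra_map A f y = spra_map A g z}"
  then obtain Q R where p: "p = (spra_class B Q, spra_class C R)" and Q: "spra_order B Q" and R: "spra_order C R"
    and eq: "spra_map A f (spra_class B Q) = spra_map A g (spra_class C R)"
    using Spra_eq[OF \<open>cring B\<close>] Spra_eq[OF \<open>cring C\<close>] by auto
  have "spra_class A (pullback A f Q) = spra_class A (pullback A g R)"
    using eq spra_map_class[OF f \<open>cring A\<close> \<open>cring B\<close> Q] spra_map_class[OF g \<open>cring A\<close> \<open>cring C\<close> R] by simp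
  then have "pullback A f Q = pullback A g R" by (rule spra_class_inject[OF fA[OF Q]])
  then obtain P where P: "spra_order D P" "pullback B h P = Q" "pullback C k P = R" using lift Q R by blast
  have "p = (spra_map B h (spra_class D P), spra_map C k (spra_class D P))"
    using p P spra_map_class[OF h \<open>cring B\<close> \<open>cring D\<close>] spra_map_class[OF k \<open>cring C\<close> \<open>cring D\<close>] by simp
  then show "p \<in> (\<lambda>x. (spra_map B h x, spra_map C k x)) ` Spra D"
    using P(1) Spra_eq[OF \<open>cring D\<close>] by blast
qed

section \<open>Graded reductions\<close>

abbreviation gr_class where "gr_class A r a \<equiv> circcirc A r +>\<^bsub>A\<^esub> a"

context nonarch_seminormed_ring
begin

lemma snorm_pow_le: "\<lbrakk>a \<in> carrier A; n \<noteq> 0\<rbrakk> \<Longrightarrow> snorm A (a [^] (n::nat)) \<le> snorm A a ^ n"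
proof (induction n)
  case (Suc n)
  show ?case
  proof (cases "n = 0")
    case False
    have "snorm A (a [^] n \<otimes> a) \<le> snorm A (a [^] n) * snorm A a" using Suc snorm_mult by simp
    also have "\<dots> \<le> snorm A a ^ n * snorm A a" using Suc False snorm_nonneg by (intro mult_right_mono) auto
    finally show ?thesis by (simp add: mult.commute)
  qed (use Suc in simp)
qed simp

lemma circ_iff: "0 < r \<Longrightarrow> a \<in> circ A r \<longleftrightarrow> a \<in> carrier A \<and> (\<exists>M>0. \<forall>n. snorm A (a [^] (n::nat)) \<le> M * r ^ n)"
  using snorm_nonneg by (auto simp: circ_def Bseq_def divide_le_eq)

lemma circcirc_iff:
  "0 < r \<Longrightarrow> a \<in> circcirc A r \<longleftrightarrow>
     a \<in> carrier A \<and> (\<forall>e>0. \<exists>N. \<forall>n\<ge>N. snorm A (a [^] (n::nat)) < e * r ^ n)"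
  using snorm_nonneg by (auto simp: circcirc_def LIMSEQ_iff divide_less_eq)

lemma circ_carrier: "a \<in> circ A r \<Longrightarrow> a \<in> carrier A"
  by (simp add: circ_def)

lemma circcirc_circ: "a \<in> circcirc A r \<Longrightarrow> a \<in> circ A r"
  unfolding circcirc_def circ_def by (auto intro: convergent_imp_Bseq convergentI)

lemma circcirc_pow:
  assumes "0 < r" "a \<in> circcirc A r"
  obtains n :: nat where "n \<noteq> 0" "snorm A (a [^] n) < r ^ n"
proof -
  obtain N where "\<forall>n\<ge>N. snorm A (a [^] (n::nat)) < 1 * r ^ n"
    using assms circcirc_iff[of r a] zero_less_one by blast
  then have "snorm A (a [^] Suc N) < r ^ Suc N" by (metis le_SucI le_refl mult_1)
  then show thesis using that[of "Suc N"] by blast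
qed

lemma circcircI:
  assumes "0 < r" "a \<in> carrier A" "snorm A a < r"
  shows "a \<in> circcirc A r"
proof -
  have "(\<lambda>n. (snorm A a / r) ^ n) \<longlonglongrightarrow> 0"
    using assms snorm_nonneg by (intro LIMSEQ_power_zero) auto
  moreover have "\<forall>\<^sub>F n in sequentially. snorm A (a [^] n) / r ^ n \<le> (snorm A a / r) ^ n"
  \<comment> \<open>The comparison starts at \<open>n = 1\<close> because
    \<open>snorm A \<one>\<close> may exceed \<open>1\<close>.\<close>
  proof (rule eventually_sequentiallyI[of 1])
    fix n :: nat assume "1 \<le> n"
    then show "snorm A (a [^] n) / r ^ n \<le> (snorm A a / r) ^ n"
      using snorm_pow_le[of a n] assms by (simp add: power_divide divide_right_mono)
  qed
  moreover have "\<forall>\<^sub>F n in sequentially. 0 \<le> snorm A (a [^] n) / r ^ n"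
    using assms snorm_nonneg by (intro always_eventually) auto
  ultimately have "(\<lambda>n. snorm A (a [^] n) / r ^ n) \<longlonglongrightarrow> 0"
    using tendsto_sandwich[of "\<lambda>_. 0"] by fastforce
  then show ?thesis using assms by (simp add: circcirc_def)
qed

text \<open>The role of the binomial theorem: splitting off one factor at a time keeps integer
  coefficients out, and the ultrametric inequality bounds the sum by its terms. The factor
  \<open>c\<close> collects what has been split off.\<close>

lemma snorm_add_pow:
  assumes "a \<in> carrier A" "b \<in> carrier A" "c \<in> carrier A"
    and "\<And>i j. i + j = n \<Longrightarrow> snorm A (c \<otimes> (a [^] i \<otimes> b [^] j)) \<le> T"
  shows "snorm A (c \<otimes> (a \<oplus> b) [^] (n::nat)) \<le> T"
  using assms
proof (induction n arbitrary: c)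
  case 0
  then show ?case using "0.prems"(4)[of 0 0] by simp
next
  case (Suc n)
  have "snorm A (c \<otimes> a \<otimes> (a \<oplus> b) [^] n) \<le> T"
  proof (rule Suc.IH)
    show "snorm A (c \<otimes> a \<otimes> (a [^] i \<otimes> b [^] j)) \<le> T" if "i + j = n" for i j
    proof -
      have "c \<otimes> a \<otimes> (a [^] i \<otimes> b [^] j) = c \<otimes> (a [^] Suc i \<otimes> b [^] j)"
        using Suc.prems by (simp add: m_ac)
      then show ?thesis using Suc.prems(4)[of "Suc i" j] that by simp
    qed
  qed (use Suc.prems in auto)
  moreover have "snorm A (c \<otimes> b \<otimes> (a \<oplus> b) [^] n) \<le> T"
  proof (rule Suc.IH)
    show "snorm A (c \<otimes> b \<otimes> (a [^] i \<otimes> b [^] j)) \<le> T" if "i + j = n" for i j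
    proof -
      have "c \<otimes> b \<otimes> (a [^] i \<otimes> b [^] j) = c \<otimes> (a [^] i \<otimes> b [^] Suc j)"
        using Suc.prems by (simp add: m_ac)
      then show ?thesis using Suc.prems(4)[of i "Suc j"] that by simp
    qed
  qed (use Suc.prems in auto)
  moreover have "c \<otimes> (a \<oplus> b) [^] Suc n = c \<otimes> a \<otimes> (a \<oplus> b) [^] n \<oplus> c \<otimes> b \<otimes> (a \<oplus> b) [^] n"
  proof -
    have "c \<otimes> (a \<oplus> b) [^] Suc n = (c \<otimes> (a \<oplus> b)) \<otimes> (a \<oplus> b) [^] n"
      using Suc.prems by (simp add: m_ac)
    then show ?thesis using Suc.prems by (simp add: r_distr l_distr)
  qed
  ultimately show ?case
    using snorm_add[of "c \<otimes> a \<otimes> (a \<oplus> b) [^] n" "c \<otimes> b \<otimes> (a \<oplus> b) [^] n"] Suc.prems by simp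
qed

lemma snorm_add_pow':
  assumes "a \<in> carrier A" "b \<in> carrier A"
    and "\<And>i j. i + j = n \<Longrightarrow> snorm A (a [^] i) * snorm A (b [^] j) \<le> T"
  shows "snorm A ((a \<oplus> b) [^] (n::nat)) \<le> T"
proof -
  have "snorm A (\<one> \<otimes> (a \<oplus> b) [^] n) \<le> T"
  proof (rule snorm_add_pow)
    show "snorm A (\<one> \<otimes> (a [^] i \<otimes> b [^] j)) \<le> T" if "i + j = n" for i j
      using snorm_mult[of "a [^] i" "b [^] j"] assms(3)[OF that] assms(1,2) by simp
  qed (use assms in auto)
  then show ?thesis using assms by simp
qed

lemma circ_add:
  assumes "0 < r" "a \<in> circ A r" "b \<in> circ A r"
  shows "a \<oplus> b \<in> circ A r"
proof -
  obtain M N where M: "0 < M" "\<And>n. snorm A (a [^] (n::nat)) \<le> M * r ^ n"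
    and N: "0 < N" "\<And>n. snorm A (b [^] (n::nat)) \<le> N * r ^ n" and c: "a \<in> carrier A" "b \<in> carrier A"
    using assms unfolding circ_iff[OF assms(1)] by blast
  have "snorm A ((a \<oplus> b) [^] n) \<le> M * N * r ^ n" for n :: nat
  proof (rule snorm_add_pow'[OF c])
    fix i j assume "i + j = n"
    have "snorm A (a [^] i) * snorm A (b [^] j) \<le> (M * r ^ i) * (N * r ^ j)"
      using M N snorm_nonneg c assms by (intro mult_mono) auto
    then show "snorm A (a [^] i) * snorm A (b [^] j) \<le> M * N * r ^ n"
      using \<open>i + j = n\<close> by (auto simp: power_add algebra_simps)
  qed
  moreover have "0 < M * N" using M N by simp
  ultimately show ?thesis unfolding circ_iff[OF assms(1)] using c by (intro conjI exI[of _ "M * N"]) auto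
qed

lemma circcirc_add:
  assumes "0 < r" "a \<in> circcirc A r" "b \<in> circcirc A r"
  shows "a \<oplus> b \<in> circcirc A r"
proof -
  obtain M N where M: "0 < M" "\<And>n. snorm A (a [^] (n::nat)) \<le> M * r ^ n"
    and N: "0 < N" "\<And>n. snorm A (b [^] (n::nat)) \<le> N * r ^ n" and c: "a \<in> carrier A" "b \<in> carrier A"
    using circcirc_circ[OF assms(2)] circcirc_circ[OF assms(3)] unfolding circ_iff[OF assms(1)] by blast
  have "\<exists>K. \<forall>n\<ge>K. snorm A ((a \<oplus> b) [^] (n::nat)) < e * r ^ n" if e: "0 < e" for e
  proof -
    \<comment> \<open>With this \<open>d\<close> both cases below give at most \<open>e / 2\<close>,
      which leaves room for a strict inequality.\<close>
    define d where "d = e / (2 * (M + N))"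
    have d: "0 < d" using M N e by (simp add: d_def)
    obtain K L where K: "\<And>n. n \<ge> K \<Longrightarrow> snorm A (a [^] (n::nat)) < d * r ^ n"
      and L: "\<And>n. n \<ge> L \<Longrightarrow> snorm A (b [^] (n::nat)) < d * r ^ n"
      using d assms(2,3) unfolding circcirc_iff[OF assms(1)] by meson
    have "snorm A ((a \<oplus> b) [^] n) \<le> (e / 2) * r ^ n" if n: "n \<ge> K + L" for n :: nat
    proof (rule snorm_add_pow'[OF c])
      fix i j assume ij: "i + j = n"
      have "snorm A (a [^] i) * snorm A (b [^] j) \<le> d * (M + N) * r ^ n"
      \<comment> \<open>Since \<open>i + j \<ge> K + L\<close>, one of the two exponents is in the
        range where its factor is small; the other factor is merely bounded.\<close>
      proof (cases "i \<ge> K")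
        case True
        have "snorm A (a [^] i) * snorm A (b [^] j) \<le> (d * r ^ i) * (N * r ^ j)"
          using K[OF True] N snorm_nonneg c assms d by (intro mult_mono) auto
        also have "\<dots> = d * N * r ^ n" using ij by (auto simp: power_add algebra_simps)
        also have "\<dots> \<le> d * (M + N) * r ^ n" using d M N assms by (intro mult_right_mono) auto
        finally show ?thesis .
      next
        case False
        then have "j \<ge> L" using ij n by simp
        have "snorm A (a [^] i) * snorm A (b [^] j) \<le> (M * r ^ i) * (d * r ^ j)"
          using L[OF \<open>j \<ge> L\<close>] M snorm_nonneg c assms d by (intro mult_mono) auto
        also have "\<dots> = d * M * r ^ n" using ij by (auto simp: power_add algebra_simps)
        also have "\<dots> \<le> d * (M + N) * r ^ n" using d M N assms by (intro mult_right_mono) auto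
        finally show ?thesis .
      qed
      moreover have "d * (M + N) = e / 2" using M N by (simp add: d_def field_simps)
      ultimately show "snorm A (a [^] i) * snorm A (b [^] j) \<le> e / 2 * r ^ n" by simp
    qed
    moreover have "e / 2 * r ^ n < e * r ^ n" for n :: nat using e assms by simp
    ultimately show ?thesis by (meson le_less_trans)
  qed
  then show ?thesis using circcirc_iff assms c by simp
qed

lemma circ_mult:
  assumes "0 < r" "0 < s" "a \<in> circ A r" "b \<in> circ A s"
  shows "a \<otimes> b \<in> circ A (r * s)"
proof -
  obtain M N where M: "0 < M" "\<And>n. snorm A (a [^] (n::nat)) \<le> M * r ^ n"
    and N: "0 < N" "\<And>n. snorm A (b [^] (n::nat)) \<le> N * s ^ n" and c: "a \<in> carrier A" "b \<in> carrier A"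
    using assms unfolding circ_iff[OF assms(1)] circ_iff[OF assms(2)] by blast
  have "snorm A ((a \<otimes> b) [^] n) \<le> M * N * (r * s) ^ n" for n :: nat
  proof -
    have "snorm A ((a \<otimes> b) [^] n) \<le> snorm A (a [^] n) * snorm A (b [^] n)"
      using snorm_mult c by (simp add: pow_mult_distrib[OF m_comm[OF c]] c)
    also have "\<dots> \<le> (M * r ^ n) * (N * s ^ n)" using M N snorm_nonneg c assms by (intro mult_mono) auto
    finally show ?thesis by (simp add: power_mult_distrib algebra_simps)
  qed
  moreover have "0 < M * N" using M N by simp
  moreover have rs: "0 < r * s" using assms by simp
  ultimately show ?thesis unfolding circ_iff[OF rs] using c by (intro conjI exI[of _ "M * N"]) auto
qed

lemma circcirc_mult:
  assumes "0 < r" "0 < s" "a \<in> circcirc A r" "b \<in> circ A s"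
  shows "a \<otimes> b \<in> circcirc A (r * s)"
proof -
  obtain N where N: "0 < N" "\<And>n. snorm A (b [^] (n::nat)) \<le> N * s ^ n" and c: "a \<in> carrier A" "b \<in> carrier A"
    using assms(3,4) unfolding circcirc_iff[OF assms(1)] circ_iff[OF assms(2)] by blast
  have "\<exists>K. \<forall>n\<ge>K. snorm A ((a \<otimes> b) [^] (n::nat)) < e * (r * s) ^ n" if e: "0 < e" for e
  proof -
    have "0 < e / N" using e N by simp
    then obtain K where K: "\<And>n. n \<ge> K \<Longrightarrow> snorm A (a [^] (n::nat)) < e / N * r ^ n"
      using assms(3) unfolding circcirc_iff[OF assms(1)] by meson
    have "snorm A ((a \<otimes> b) [^] n) < e * (r * s) ^ n" if "n \<ge> K" for n
    proof -
      have "snorm A ((a \<otimes> b) [^] n) \<le> snorm A (a [^] n) * snorm A (b [^] n)"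
        using snorm_mult c by (simp add: pow_mult_distrib[OF m_comm[OF c]] c)
      also have "\<dots> \<le> snorm A (a [^] n) * (N * s ^ n)"
        using N snorm_nonneg c assms by (intro mult_left_mono) auto
      also have "\<dots> < (e / N * r ^ n) * (N * s ^ n)"
        using K[OF that] N assms by (intro mult_strict_right_mono) auto
      also have "\<dots> = e * (r * s) ^ n" using N by (simp add: power_mult_distrib)
      finally show ?thesis .
    qed
    then show ?thesis by blast
  qed
  moreover have rs: "0 < r * s" using assms by simp
  ultimately show ?thesis unfolding circcirc_iff[OF rs] using c by simp
qed

lemma zero_circcirc: "0 < r \<Longrightarrow> \<zero> \<in> circcirc A r"
  using snorm_zero by (intro circcircI) auto

text \<open>The axioms of a seminorm allow \<open>snorm A (\<ominus> x)\<close> to differ from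
  \<open>snorm A x\<close>. But the powers of \<open>\<ominus> \<one>\<close> take only two values,
  hence are bounded, and multiplication by \<open>\<ominus> \<one>\<close> then gives closure under
  negation.\<close>

lemma minus_one_circ: "\<ominus> \<one> \<in> circ A 1"
proof -
  have p: "(\<ominus> \<one>) [^] (n::nat) = \<one> \<or> (\<ominus> \<one>) [^] n = \<ominus> \<one>" for n
    by (induction n) (auto simp: l_minus r_minus)
  have "snorm A ((\<ominus> \<one>) [^] (n::nat)) \<le> snorm A \<one> + snorm A (\<ominus> \<one>) + 1" for n
    using p[of n] snorm_nonneg[of \<one>] snorm_nonneg[of "\<ominus> \<one>"] by auto
  moreover have "0 < snorm A \<one> + snorm A (\<ominus> \<one>) + 1"
    using snorm_nonneg[of \<one>] snorm_nonneg[of "\<ominus> \<one>"] by auto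
  ultimately show ?thesis using circ_iff[of 1 "\<ominus> \<one>"] by auto
qed

lemma circ_minus: "\<lbrakk>0 < r; a \<in> circ A r\<rbrakk> \<Longrightarrow> \<ominus> a \<in> circ A r"
  using circ_mult[of r 1 a "\<ominus> \<one>"] minus_one_circ circ_carrier[of a r] by (simp add: r_minus)

lemma circcirc_minus: "\<lbrakk>0 < r; a \<in> circcirc A r\<rbrakk> \<Longrightarrow> \<ominus> a \<in> circcirc A r"
  using circcirc_mult[of r 1 a "\<ominus> \<one>"] minus_one_circ circ_carrier[OF circcirc_circ, of a r] by (simp add: r_minus)

lemma one_circ: "\<one> \<in> circ A 1"
  using circ_minus[OF _ minus_one_circ] by simp

lemma circ_pow: "\<lbrakk>0 < r; a \<in> circ A r\<rbrakk> \<Longrightarrow> a [^] (n::nat) \<in> circ A (r ^ n)"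
proof (induction n)
  case (Suc n)
  then show ?case using circ_mult[of "r ^ n" r "a [^] n" a] by (simp add: mult.commute)
qed (simp add: one_circ)

lemma circ_group: "0 < r \<Longrightarrow> comm_group ((add_monoid A)\<lparr>carrier := circ A r\<rparr>)"
  by (rule comm_groupI)
    (auto simp: a_ac circ_add circ_carrier circcirc_circ zero_circcirc intro!: bexI[of _ "\<ominus> _"] circ_minus r_neg)

lemma circcirc_normal: "0 < r \<Longrightarrow> circcirc A r \<lhd> (add_monoid A)\<lparr>carrier := circ A r\<rparr>"
proof -
  assume r: "0 < r"
  let ?R = "(add_monoid A)\<lparr>carrier := circ A r\<rparr>"
  interpret R: comm_group ?R by (rule circ_group[OF r])
  have "inv\<^bsub>?R\<^esub> a = \<ominus> a" if "a \<in> circ A r" for a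
    using that r circ_carrier circ_minus by (intro R.inv_equality) (auto simp: l_neg)
  then have "subgroup (circcirc A r) ?R"
    using r by unfold_locales (auto simp: circcirc_circ circcirc_add circcirc_minus zero_circcirc)
  then show ?thesis by (rule R.subgroup_imp_normal)
qed

lemma mem_gr_class: "x \<in> gr_class A r a \<longleftrightarrow> (\<exists>h\<in>circcirc A r. x = h \<oplus> a)"
  by (auto simp: a_r_coset_def r_coset_def)

lemma gr_class_coset: "gr_class A r a = circcirc A r #>\<^bsub>(add_monoid A)\<lparr>carrier := circ A r\<rparr>\<^esub> a"
  by (simp add: a_r_coset_def r_coset_def)

lemma gr_piece_group: "0 < r \<Longrightarrow> comm_group (gr_piece A r)"
  unfolding gr_piece_def using circcirc_normal circ_group
  by (intro comm_group.abelian_FactGroup normal_imp_subgroup) auto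

lemma gr_piece_simps:
  shows "carrier (gr_piece A r) = gr_class A r ` circ A r" "\<one>\<^bsub>gr_piece A r\<^esub> = circcirc A r"
    "U \<otimes>\<^bsub>gr_piece A r\<^esub> W = {u \<oplus> w | u w. u \<in> U \<and> w \<in> W}"
  by (auto simp: gr_piece_def FactGroup_def RCOSETS_def set_mult_def gr_class_coset image_iff)

lemma gr_class_add:
  assumes "0 < r" "a \<in> circ A r" "b \<in> circ A r"
  shows "gr_class A r a \<otimes>\<^bsub>gr_piece A r\<^esub> gr_class A r b = gr_class A r (a \<oplus> b)"
  using normal.rcos_sum[OF circcirc_normal[OF assms(1)], of a b] assms
  by (simp add: gr_piece_def FactGroup_def gr_class_coset)

lemma gr_class_zero: "0 < r \<Longrightarrow> gr_class A r \<zero> = circcirc A r"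
  using circ_carrier[OF circcirc_circ] by (auto simp: set_eq_iff mem_gr_class)

lemma gr_class_eq:
  assumes "0 < r" "a \<in> circ A r" "x \<in> gr_class A r a"
  shows "x \<in> circ A r" "gr_class A r x = gr_class A r a"
proof -
  let ?R = "(add_monoid A)\<lparr>carrier := circ A r\<rparr>"
  interpret R: comm_group ?R by (rule circ_group[OF assms(1)])
  have sg: "subgroup (circcirc A r) ?R" by (rule normal_imp_subgroup[OF circcirc_normal[OF assms(1)]])
  show "x \<in> circ A r" using assms circcirc_circ circ_add by (auto simp: mem_gr_class)
  show "gr_class A r x = gr_class A r a"
    using R.repr_independence[OF _ _ sg, of x a] assms by (simp add: gr_class_coset)
qed

lemma gr_class_self: "\<lbrakk>0 < r; a \<in> circ A r\<rbrakk> \<Longrightarrow> a \<in> gr_class A r a"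
  using zero_circcirc circ_carrier[of a r] by (force simp: mem_gr_class)

lemma gr_class_trivial: "\<lbrakk>0 < r; a \<in> circ A r\<rbrakk> \<Longrightarrow> gr_class A r a = circcirc A r \<longleftrightarrow> a \<in> circcirc A r"
  using gr_class_self[of r a] gr_class_eq(2)[of r \<zero> a] gr_class_zero[of r] circcirc_circ[OF zero_circcirc] by auto

text \<open>For \<open>x = h \<oplus> a\<close> and \<open>y = k \<oplus> b\<close> the product
  differs from \<open>a \<otimes> b\<close> by \<open>h \<otimes> y \<oplus> k \<otimes> a\<close>,
  and both summands contain a factor from \<open>circcirc\<close>.\<close>

lemma rcoset_mult_gr_class:
  assumes "0 < r" "0 < s" "a \<in> circ A r" "b \<in> circ A s"
  shows "rcoset_mult A (circcirc A (r * s)) (gr_class A r a) (gr_class A s b) = gr_class A (r * s) (a \<otimes> b)"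
proof -
  have "gr_class A (r * s) (x \<otimes> y) = gr_class A (r * s) (a \<otimes> b)"
    if xy: "x \<in> gr_class A r a" "y \<in> gr_class A s b" for x y
  proof -
    obtain h k where h: "h \<in> circcirc A r" "x = h \<oplus> a" and k: "k \<in> circcirc A s" "y = k \<oplus> b"
      using xy by (auto simp: mem_gr_class)
    note c = circ_carrier[OF assms(3)] circ_carrier[OF assms(4)] circ_carrier[OF circcirc_circ[OF h(1)]] circ_carrier[OF circcirc_circ[OF k(1)]]
    have "x \<otimes> y = (h \<otimes> y \<oplus> k \<otimes> a) \<oplus> a \<otimes> b"
      using c h(2) k(2) by (simp add: l_distr r_distr m_ac a_ac)
    moreover have "h \<otimes> y \<in> circcirc A (r * s)"
      using assms h gr_class_eq(1)[OF assms(2,4) xy(2)] by (intro circcirc_mult)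
    moreover have "k \<otimes> a \<in> circcirc A (r * s)"
      using circcirc_mult[OF assms(2,1) k(1) assms(3)] by (simp add: mult.commute)
    ultimately have "x \<otimes> y \<in> gr_class A (r * s) (a \<otimes> b)"
      using circcirc_add[of "r * s"] assms by (auto simp: mem_gr_class)
    then show ?thesis using gr_class_eq(2) circ_mult assms by (meson mult_pos_pos)
  qed
  moreover have "a \<in> gr_class A r a" "b \<in> gr_class A s b" using assms gr_class_self by auto
  ultimately show ?thesis unfolding rcoset_mult_def by blast
qed

lemma carrier_Gr:
  "x \<in> carrier (Gr A) \<longleftrightarrow> x \<in> extensional {0<..} \<and> (\<forall>r>0. x r \<in> gr_class A r ` circ A r) \<and>
     finite {r \<in> {0<..}. x r \<noteq> circcirc A r}"
proof -
  have "carrier (sum_group {0<..} (gr_piece A)) =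
      {x \<in> \<Pi>\<^sub>E r\<in>{0<..}. carrier (gr_piece A r). finite {r \<in> {0<..}. x r \<noteq> \<one>\<^bsub>gr_piece A r\<^esub>}}"
    by (rule carrier_sum_group) (use gr_piece_group in \<open>auto intro: comm_group.axioms\<close>)
  then show ?thesis by (auto simp: Gr_def PiE_iff gr_piece_simps)
qed

lemma Gr_simps: "monoid.mult (Gr A) = gr_mult A" "\<one>\<^bsub>Gr A\<^esub> = gr_homog A 1 (gr_class A 1 \<one>)"
  "\<zero>\<^bsub>Gr A\<^esub> = (\<lambda>r\<in>{0<..}. circcirc A r)"
  "x \<oplus>\<^bsub>Gr A\<^esub> y = (\<lambda>r\<in>{0<..}. x r \<otimes>\<^bsub>gr_piece A r\<^esub> y r)"
  by (simp_all add: Gr_def gr_piece_simps)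

lemma abelian_group_Gr: "abelian_group (Gr A)"
proof -
  have g: "group (gr_piece A r)" if "r \<in> {0<..}" for r
    using gr_piece_group that by (auto intro: comm_group.axioms)
  have "group (sum_group {0<..} (gr_piece A))" by (rule sum_group[OF g])
  moreover have "x \<otimes>\<^bsub>sum_group {0<..} (gr_piece A)\<^esub> y = y \<otimes>\<^bsub>sum_group {0<..} (gr_piece A)\<^esub> x"
    if xy: "x \<in> carrier (sum_group {0<..} (gr_piece A))" "y \<in> carrier (sum_group {0<..} (gr_piece A))" for x y
  proof -
    have "x r \<otimes>\<^bsub>gr_piece A r\<^esub> y r = y r \<otimes>\<^bsub>gr_piece A r\<^esub> x r" if "r \<in> {0<..}" for r
    proof -
      interpret comm_group "gr_piece A r" using gr_piece_group that by simp
      have "carrier (sum_group {0<..} (gr_piece A)) =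
          {x \<in> \<Pi>\<^sub>E r\<in>{0<..}. carrier (gr_piece A r). finite {r \<in> {0<..}. x r \<noteq> \<one>\<^bsub>gr_piece A r\<^esub>}}"
        by (rule carrier_sum_group[OF g])
      then show ?thesis using xy that by (intro m_comm) (auto simp: PiE_iff)
    qed
    then show ?thesis unfolding mult_sum_group by (rule restrict_ext)
  qed
  ultimately have "comm_group (sum_group {0<..} (gr_piece A))" by (rule group.group_comm_groupI)
  moreover have "add_monoid (Gr A) = sum_group {0<..} (gr_piece A)"
    by (simp add: Gr_def)
  ultimately show ?thesis by (simp add: abelian_group_def abelian_group_axioms_def abelian_monoid_def comm_group_def)
qed

text \<open>Elements of a product of cosets are sums of elements of its factors, so an additive
  property can be checked on the factors. The hypothesis \<open>zero\<close> covers the empty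
  product, which is the coset \<open>circcirc A r\<close>.\<close>

lemma gr_piece_finprod:
  assumes r: "0 < r" and I: "\<And>i. i \<in> I \<Longrightarrow> F i \<in> gr_class A r ` circ A r"
    and zero: "\<And>a. a \<in> circcirc A r \<Longrightarrow> P a"
    and P: "\<And>i a. i \<in> I \<Longrightarrow> a \<in> F i \<Longrightarrow> P a"
    and add: "\<And>a b. a \<in> carrier A \<Longrightarrow> b \<in> carrier A \<Longrightarrow> P a \<Longrightarrow> P b \<Longrightarrow> P (a \<oplus> b)"
    and a: "a \<in> finprod (gr_piece A r) F I"
  shows "P a"
proof -
  interpret comm_group "gr_piece A r" by (rule gr_piece_group[OF r])
  have "\<forall>a\<in>finprod (gr_piece A r) F I. P a"
    using I P
  proof (induction I rule: infinite_finite_induct)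
    case (insert i I)
    have F: "F \<in> I \<rightarrow> carrier (gr_piece A r)" "F i \<in> carrier (gr_piece A r)"
      using insert.prems by (auto simp: gr_piece_simps)
    then have "finprod (gr_piece A r) F I \<in> carrier (gr_piece A r)" by simp
    then have c: "u \<in> carrier A" if "u \<in> F i \<or> u \<in> finprod (gr_piece A r) F I" for u
      using that F(2) circ_carrier[OF gr_class_eq(1)[OF r]] unfolding gr_piece_simps by blast
    have "P u" if "u \<in> F i" for u using insert.prems(2)[OF insertI1 that] .
    moreover have "P w" if "w \<in> finprod (gr_piece A r) F I" for w using insert.IH insert.prems that by blast
    ultimately show ?case using insert.hyps F c by (auto simp: gr_piece_simps intro!: add)
  qed (use zero in \<open>auto simp: gr_piece_simps\<close>)
  then show ?thesis using a by blast
qed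

lemma gr_mult_component:
  assumes x: "x \<in> carrier (Gr A)" and y: "y \<in> carrier (Gr A)" and r: "0 < r" and s: "0 < s"
  obtains a b where "a \<in> circ A s" "b \<in> circ A (r / s)" "x s = gr_class A s a" "y (r / s) = gr_class A (r / s) b"
    "rcoset_mult A (circcirc A r) (x s) (y (r / s)) = gr_class A r (a \<otimes> b)" "a \<otimes> b \<in> circ A r"
proof -
  have rs: "0 < r / s" using r s by simp
  obtain a b where ab: "a \<in> circ A s" "b \<in> circ A (r / s)" "x s = gr_class A s a" "y (r / s) = gr_class A (r / s) b"
  proof -
    have "x s \<in> gr_class A s ` circ A s" "y (r / s) \<in> gr_class A (r / s) ` circ A (r / s)"
      using x y s rs by (auto simp: carrier_Gr)
    then show ?thesis using that by (elim imageE) blast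
  qed
  moreover have "s * (r / s) = r" using s by simp
  ultimately show thesis
    using that[OF ab] rcoset_mult_gr_class[OF s rs ab(1,2)] circ_mult[OF s rs ab(1,2)] by simp
qed

lemma gr_mult_closed:
  assumes x: "x \<in> carrier (Gr A)" and y: "y \<in> carrier (Gr A)"
  shows "x \<otimes>\<^bsub>Gr A\<^esub> y \<in> carrier (Gr A)"
proof -
  let ?I = "\<lambda>r. {s. 0 < s \<and> x s \<noteq> circcirc A s \<and> y (r / s) \<noteq> circcirc A (r / s)}"
  let ?F = "\<lambda>r s. rcoset_mult A (circcirc A r) (x s) (y (r / s))"
  have fin: "finite {r \<in> {0<..}. x r \<noteq> circcirc A r}" "finite {r \<in> {0<..}. y r \<noteq> circcirc A r}"
    using x y by (auto simp: carrier_Gr)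
  have F: "?F r s \<in> gr_class A r ` circ A r" if "0 < r" "0 < s" for r s
    using gr_mult_component[OF x y that] by (metis imageI)
  have "finprod (gr_piece A r) (?F r) (?I r) \<in> gr_class A r ` circ A r" if r: "0 < r" for r
  proof -
    interpret comm_group "gr_piece A r" by (rule gr_piece_group[OF r])
    have "finprod (gr_piece A r) (?F r) (?I r) \<in> carrier (gr_piece A r)"
      using F[OF r] by (intro finprod_closed) (auto simp: gr_piece_simps)
    then show ?thesis by (simp add: gr_piece_simps)
  qed
  \<comment> \<open>A nonzero component in degree \<open>r\<close> requires a factorization of
    \<open>r\<close> into two degrees in which \<open>x\<close> and \<open>y\<close> are nonzero,
    and there are finitely many of these.\<close>
  moreover have "{r \<in> {0<..}. gr_mult A x y r \<noteq> circcirc A r} \<subseteq>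
      (\<lambda>(s, t). s * t) ` ({r \<in> {0<..}. x r \<noteq> circcirc A r} \<times> {r \<in> {0<..}. y r \<noteq> circcirc A r})"
  proof
    fix r assume r: "r \<in> {r \<in> {0<..}. gr_mult A x y r \<noteq> circcirc A r}"
    interpret comm_group "gr_piece A r" using gr_piece_group r by simp
    have "?I r \<noteq> {}"
    proof
      assume I: "?I r = {}"
      have "gr_mult A x y r = finprod (gr_piece A r) (?F r) (?I r)" using r by (simp add: gr_mult_def)
      then have "gr_mult A x y r = circcirc A r" unfolding I finprod_empty gr_piece_simps .
      then show False using r by simp
    qed
    then obtain s where "0 < s" "x s \<noteq> circcirc A s" "y (r / s) \<noteq> circcirc A (r / s)" by blast
    then show "r \<in> (\<lambda>(s, t). s * t) ` ({r \<in> {0<..}. x r \<noteq> circcirc A r} \<times> {r \<in> {0<..}. y r \<noteq> circcirc A r})"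
      using r by (intro image_eqI[of _ _ "(s, r / s)"]) auto
  qed
  then have "finite {r \<in> {0<..}. gr_mult A x y r \<noteq> circcirc A r}"
    by (rule finite_subset[OF _ finite_imageI[OF finite_cartesian_product[OF fin]]])
  ultimately show ?thesis by (simp add: Gr_simps carrier_Gr) (simp add: gr_mult_def)
qed

lemma gr_homog_closed: "\<lbrakk>0 < r; a \<in> circ A r\<rbrakk> \<Longrightarrow> gr_homog A r (gr_class A r a) \<in> carrier (Gr A)"
proof -
  assume r: "0 < r" "a \<in> circ A r"
  have "finite {s \<in> {0<..}. gr_homog A r (gr_class A r a) s \<noteq> circcirc A s}"
    by (rule finite_subset[of _ "{r}"]) (auto simp: gr_homog_def)
  moreover have "circcirc A s \<in> gr_class A s ` circ A s" if "0 < s" for s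
    using gr_class_zero[OF that] circcirc_circ[OF zero_circcirc[OF that]] by (metis imageI)
  ultimately show ?thesis using r by (auto simp: carrier_Gr gr_homog_def)
qed

text \<open>Only the factorization \<open>t = r * s\<close> can contribute to degree
  \<open>t\<close>. If one factor is already zero in the graded ring, the index set is empty, and
  \<open>a \<otimes> b\<close> lies in \<open>circcirc\<close> as well.\<close>

lemma gr_homog_mult:
  assumes "0 < r" "0 < s" "a \<in> circ A r" "b \<in> circ A s"
  shows "gr_homog A r (gr_class A r a) \<otimes>\<^bsub>Gr A\<^esub> gr_homog A s (gr_class A s b) =
      gr_homog A (r * s) (gr_class A (r * s) (a \<otimes> b))"
proof
  fix t
  let ?x = "gr_homog A r (gr_class A r a)" and ?y = "gr_homog A s (gr_class A s b)"
  show "(?x \<otimes>\<^bsub>Gr A\<^esub> ?y) t = gr_homog A (r * s) (gr_class A (r * s) (a \<otimes> b)) t"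
  proof (cases "0 < t")
    case False then show ?thesis by (simp add: Gr_simps gr_mult_def gr_homog_def)
  next
    case t: True
    interpret G: comm_group "gr_piece A t" by (rule gr_piece_group[OF t])
    let ?I = "{u. 0 < u \<and> ?x u \<noteq> circcirc A u \<and> ?y (t / u) \<noteq> circcirc A (t / u)}"
    let ?F = "\<lambda>u. rcoset_mult A (circcirc A t) (?x u) (?y (t / u))"
    have e: "(?x \<otimes>\<^bsub>Gr A\<^esub> ?y) t = finprod (gr_piece A t) ?F ?I" using t by (simp add: Gr_simps gr_mult_def)
    have hx: "?x u = (if u = r then gr_class A r a else circcirc A u)" if "0 < u" for u
      using that by (simp add: gr_homog_def)
    have hy: "?y u = (if u = s then gr_class A s b else circcirc A u)" if "0 < u" for u
      using that by (simp add: gr_homog_def)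
    have sub: "u = r \<and> t = r * s" if u: "u \<in> ?I" for u
    proof -
      have "0 < u" "0 < t / u" "?x u \<noteq> circcirc A u" "?y (t / u) \<noteq> circcirc A (t / u)" using u t by auto
      then have "u = r" "t / u = s" using hx[of u] hy[of "t / u"] by presburger+
      then show ?thesis using assms by (simp add: field_simps)
    qed
    show ?thesis
    proof (cases "t = r * s \<and> a \<notin> circcirc A r \<and> b \<notin> circcirc A s")
      case True
      have "r \<in> ?I"
        using True assms gr_class_trivial[OF assms(1,3)] gr_class_trivial[OF assms(2,4)] hx[of r] hy[of s] by simp
      then have "?I = {r}" using sub by blast
      moreover have "?F r = gr_class A t (a \<otimes> b)"
        using True assms rcoset_mult_gr_class[OF assms] by (simp add: gr_homog_def)
      moreover have "gr_class A t (a \<otimes> b) \<in> carrier (gr_piece A t)"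
        using circ_mult[OF assms] True by (simp add: gr_piece_simps)
      ultimately have "finprod (gr_piece A t) ?F ?I = gr_class A t (a \<otimes> b)" by simp
      then show ?thesis using e True t by (simp add: gr_homog_def)
    next
      case False
      have "?I = {}"
      proof (rule ccontr)
        assume "?I \<noteq> {}"
        then obtain u where u: "u \<in> ?I" by blast
        then have "?x u \<noteq> circcirc A u" "?y (t / u) \<noteq> circcirc A (t / u)" by auto
        moreover have "t / u = s" using sub[OF u] assms by simp
        ultimately show False
          using sub[OF u] False assms gr_class_trivial[OF assms(1,3)] gr_class_trivial[OF assms(2,4)] hx[of r] hy[of s]
          by simp
      qed
      then have "finprod (gr_piece A t) ?F ?I = circcirc A t" by (simp only: G.finprod_empty gr_piece_simps)
      moreover have "gr_class A t (a \<otimes> b) = circcirc A t" if tt: "t = r * s"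
      proof -
        consider "a \<in> circcirc A r" | "b \<in> circcirc A s" using False tt by blast
        then have "a \<otimes> b \<in> circcirc A (r * s)"
        proof cases
          case 1 then show ?thesis by (rule circcirc_mult[OF assms(1,2) _ assms(4)])
        next
          case 2
          have "b \<otimes> a \<in> circcirc A (s * r)" using 2 by (rule circcirc_mult[OF assms(2,1) _ assms(3)])
          then show ?thesis
            by (simp add: m_comm[OF circ_carrier[OF assms(3)] circ_carrier[OF assms(4)]] mult.commute)
        qed
        then show ?thesis using gr_class_trivial[OF t, of "a \<otimes> b"] circ_mult[OF assms] tt by simp
      qed
      ultimately show ?thesis using e t by (simp add: gr_homog_def)
    qed
  qed
qed

lemma gr_homog_add:
  assumes "0 < r" "a \<in> circ A r" "b \<in> circ A r"
  shows "gr_homog A r (gr_class A r a) \<oplus>\<^bsub>Gr A\<^esub> gr_homog A r (gr_class A r b) = gr_homog A r (gr_class A r (a \<oplus> b))"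
proof -
  have "circcirc A s \<otimes>\<^bsub>gr_piece A s\<^esub> circcirc A s = circcirc A s" if "0 < s" for s
    using gr_class_add[OF that, of \<zero> \<zero>] gr_class_zero[OF that] circcirc_circ[OF zero_circcirc[OF that]] by simp
  then show ?thesis using gr_class_add[OF assms] by (auto simp: Gr_simps gr_homog_def intro!: restrict_ext)
qed

lemma gr_homog_zero: "0 < r \<Longrightarrow> gr_homog A r (gr_class A r \<zero>) = \<zero>\<^bsub>Gr A\<^esub>"
  unfolding Gr_simps gr_homog_def by (rule restrict_ext) (simp add: gr_class_zero)

lemma gr_homog_pow:
  assumes "0 < r" "a \<in> circ A r"
  shows "gr_homog A r (gr_class A r a) [^]\<^bsub>Gr A\<^esub> (n::nat) = gr_homog A (r ^ n) (gr_class A (r ^ n) (a [^] n))"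
proof (induction n)
  case 0 then show ?case by (simp add: nat_pow_def Gr_simps)
next
  case (Suc n)
  have "gr_homog A r (gr_class A r a) [^]\<^bsub>Gr A\<^esub> Suc n =
      gr_homog A r (gr_class A r a) [^]\<^bsub>Gr A\<^esub> n \<otimes>\<^bsub>Gr A\<^esub> gr_homog A r (gr_class A r a)"
    by (simp add: nat_pow_def)
  then show ?case using gr_homog_mult[OF _ assms(1) circ_pow[OF assms] assms(2)] assms
    by (simp add: Suc mult.commute)
qed

text \<open>The class of \<open>a\<close> solves the monic linear equation with constant coefficient
  the class of \<open>\<ominus> a\<close>. Coefficients of an integral equation are added, hence the
  sign in the hypothesis on \<open>S\<close>.\<close>

lemma gr_homog_integral:
  assumes r: "0 < r" "a \<in> circ A r" and S: "gr_homog A r (gr_class A r (\<ominus> a)) \<in> S"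
  shows "gr_homog A r (gr_class A r a) \<in> integral_closure (Gr A) S"
proof -
  let ?x = "gr_homog A r (gr_class A r a)" and ?c = "\<lambda>i::nat. gr_homog A r (gr_class A r (\<ominus> a))"
  interpret Gr: abelian_group "Gr A" by (rule abelian_group_Gr)
  have m: "\<ominus> a \<in> circ A r" using circ_minus r by blast
  have "?c 0 \<otimes>\<^bsub>Gr A\<^esub> ?x [^]\<^bsub>Gr A\<^esub> (0::nat) = ?c 0"
    using gr_homog_mult[OF r(1) _ m one_circ] circ_carrier[OF m] gr_homog_pow[OF r, of 0] by simp
  moreover have "?x [^]\<^bsub>Gr A\<^esub> (1::nat) = ?x" using gr_homog_pow[OF r, of 1] circ_carrier[OF r(2)] by simp
  moreover have "?c 0 \<in> carrier (Gr A)" using gr_homog_closed r m by blast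
  moreover have "?x \<oplus>\<^bsub>Gr A\<^esub> ?c 0 = \<zero>\<^bsub>Gr A\<^esub>"
    using gr_homog_add[OF r m] gr_homog_zero[OF r(1)] circ_carrier[OF r(2)] by (simp add: r_neg)
  ultimately have "?x [^]\<^bsub>Gr A\<^esub> (1::nat) \<oplus>\<^bsub>Gr A\<^esub>
      (\<Oplus>\<^bsub>Gr A\<^esub>i\<in>{..<1}. ?c i \<otimes>\<^bsub>Gr A\<^esub> ?x [^]\<^bsub>Gr A\<^esub> i) = \<zero>\<^bsub>Gr A\<^esub>"
    by (simp add: lessThan_Suc)
  then show ?thesis unfolding integral_closure_def using S gr_homog_closed[OF r]
    by (intro CollectI conjI exI[of _ 1] exI[of _ ?c]) auto
qed

end

text \<open>An affinoid morphism stripped of its graded condition: the maps into the tensor product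
  are treated in this form before its graded subring enters.\<close>

definition bounded_hom :: "('a, 'm) snring_scheme \<Rightarrow> ('b, 'n) snring_scheme \<Rightarrow> ('a \<Rightarrow> 'b) \<Rightarrow> bool" where
  "bounded_hom A B f \<longleftrightarrow> f \<in> ring_hom A B \<and> (\<exists>c>0. \<forall>a\<in>carrier A. snorm B (f a) \<le> c * snorm A a)"

lemma ring_hom_nat_pow:
  assumes "f \<in> ring_hom A B" "ring A" "a \<in> carrier A"
  shows "f (a [^]\<^bsub>A\<^esub> (n::nat)) = f a [^]\<^bsub>B\<^esub> n"
proof -
  interpret ring A by fact
  show ?thesis
  proof (induction n)
    case 0 then show ?case using assms ring_hom_one by (simp add: nat_pow_def)
  next
    case (Suc n)
    have "f (a [^]\<^bsub>A\<^esub> Suc n) = f (a [^]\<^bsub>A\<^esub> n) \<otimes>\<^bsub>B\<^esub> f a" using assms by (simp add: ring_hom_mult)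
    then show ?case using Suc.IH by (simp add: nat_pow_def)
  qed
qed

lemma bounded_hom_circ:
  assumes "nonarch_seminormed_ring A" "nonarch_seminormed_ring B" "bounded_hom A B f" "0 < r"
  shows "a \<in> circ A r \<Longrightarrow> f a \<in> circ B r" "a \<in> circcirc A r \<Longrightarrow> f a \<in> circcirc B r"
proof -
  interpret A: nonarch_seminormed_ring A by fact
  interpret B: nonarch_seminormed_ring B by fact
  obtain c where f: "f \<in> ring_hom A B" and c: "0 < c" "\<And>a. a \<in> carrier A \<Longrightarrow> snorm B (f a) \<le> c * snorm A a"
    using assms by (auto simp: bounded_hom_def)
  have le: "snorm B (f a [^]\<^bsub>B\<^esub> n) \<le> c * snorm A (a [^]\<^bsub>A\<^esub> n)" if "a \<in> carrier A" for n :: nat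
    using c(2)[of "a [^]\<^bsub>A\<^esub> n"] that ring_hom_nat_pow[OF f A.ring_axioms that, of n] by simp
  show "f a \<in> circ B r" if a: "a \<in> circ A r"
  proof -
    obtain M where M: "0 < M" "\<And>n. snorm A (a [^]\<^bsub>A\<^esub> (n::nat)) \<le> M * r ^ n" and ac: "a \<in> carrier A"
      using a A.circ_iff[OF assms(4)] by blast
    have "snorm B (f a [^]\<^bsub>B\<^esub> n) \<le> c * M * r ^ n" for n :: nat
    proof -
      have "c * snorm A (a [^]\<^bsub>A\<^esub> n) \<le> c * (M * r ^ n)" using M c by (intro mult_left_mono) auto
      then show ?thesis using le[OF ac, of n] by simp
    qed
    then show ?thesis unfolding B.circ_iff[OF assms(4)] using M c ring_hom_closed[OF f ac]
      by (intro conjI exI[of _ "c * M"]) auto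
  qed
  show "f a \<in> circcirc B r" if a: "a \<in> circcirc A r"
  proof -
    have ac: "a \<in> carrier A" using a by (simp add: circcirc_def)
    have "\<exists>N. \<forall>n\<ge>N. snorm B (f a [^]\<^bsub>B\<^esub> (n::nat)) < e * r ^ n" if "0 < e" for e
    proof -
      have "0 < e / c" using that c by simp
      then obtain N where N: "\<And>n. n \<ge> N \<Longrightarrow> snorm A (a [^]\<^bsub>A\<^esub> (n::nat)) < e / c * r ^ n"
        using a unfolding A.circcirc_iff[OF assms(4)] by blast
      have "snorm B (f a [^]\<^bsub>B\<^esub> n) < e * r ^ n" if "n \<ge> N" for n
      proof -
        have "c * snorm A (a [^]\<^bsub>A\<^esub> n) < c * (e / c * r ^ n)" using N[OF that] c by (intro mult_strict_left_mono) auto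
        then show ?thesis using le[OF ac, of n] c by simp
      qed
      then show ?thesis by blast
    qed
    then show ?thesis unfolding B.circcirc_iff[OF assms(4)] using ring_hom_closed[OF f ac] by blast
  qed
qed

lemma gr_map_component:
  assumes A: "nonarch_seminormed_ring A" and B: "nonarch_seminormed_ring B" and f: "bounded_hom A B f"
    and s: "0 < s" and a: "a \<in> circ A s" "x s = gr_class A s a"
  shows "gr_map B f x s = gr_class B s (f a)"
proof -
  interpret A: nonarch_seminormed_ring A by fact
  interpret B: nonarch_seminormed_ring B by fact
  have fr: "f \<in> ring_hom A B" using f by (simp add: bounded_hom_def)
  have "gr_class B s (f u) = gr_class B s (f a)" if u: "u \<in> x s" for u
  proof -
    obtain h where h: "h \<in> circcirc A s" "u = h \<oplus>\<^bsub>A\<^esub> a" using u unfolding a(2) A.mem_gr_class by blast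
    then have "f u = f h \<oplus>\<^bsub>B\<^esub> f a"
      using ring_hom_add[OF fr A.circ_carrier[OF A.circcirc_circ[OF h(1)]] A.circ_carrier[OF a(1)]] by simp
    then have "f u \<in> gr_class B s (f a)"
      using bounded_hom_circ(2)[OF A B f s h(1)] unfolding B.mem_gr_class by blast
    then show ?thesis using B.gr_class_eq(2)[OF s bounded_hom_circ(1)[OF A B f s a(1)]] by blast
  qed
  then have "gr_map B f x s = (\<Union>u\<in>x s. gr_class B s (f a))" using s by (simp add: gr_map_def)
  moreover have "a \<in> x s" using A.gr_class_self[OF s a(1)] a(2) by simp
  ultimately show ?thesis by (simp add: UN_constant) blast
qed

lemma gr_map_homog:
  assumes A: "nonarch_seminormed_ring A" and B: "nonarch_seminormed_ring B" and f: "bounded_hom A B f"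
    and r: "0 < r" and a: "a \<in> circ A r"
  shows "gr_map B f (gr_homog A r (gr_class A r a)) = gr_homog B r (gr_class B r (f a))"
proof
  interpret A: nonarch_seminormed_ring A by fact
  interpret B: nonarch_seminormed_ring B by fact
  have f0: "f \<zero>\<^bsub>A\<^esub> = \<zero>\<^bsub>B\<^esub>"
    using f A.ring_axioms B.ring_axioms by (intro ring_hom_zero) (auto simp: bounded_hom_def)
  fix s
  show "gr_map B f (gr_homog A r (gr_class A r a)) s = gr_homog B r (gr_class B r (f a)) s"
  proof (cases "0 < s")
    case s: True
    have e: "gr_homog A r (gr_class A r a) s = gr_class A s (if s = r then a else \<zero>\<^bsub>A\<^esub>)"
      using s A.gr_class_zero[OF s] by (simp add: gr_homog_def)
    have c: "(if s = r then a else \<zero>\<^bsub>A\<^esub>) \<in> circ A s"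
      using a A.circcirc_circ[OF A.zero_circcirc[OF s]] by simp
    show ?thesis
      using gr_map_component[where x = "gr_homog A r (gr_class A r a)", OF A B f s c e] s B.gr_class_zero[OF s] f0 by (simp add: gr_homog_def split: if_splits)
  qed (simp add: gr_map_def gr_homog_def)
qed

lemma gr_map_closed:
  assumes A: "nonarch_seminormed_ring A" and B: "nonarch_seminormed_ring B" and f: "bounded_hom A B f"
    and x: "x \<in> carrier (Gr A)"
  shows "gr_map B f x \<in> carrier (Gr B)"
proof -
  interpret A: nonarch_seminormed_ring A by fact
  interpret B: nonarch_seminormed_ring B by fact
  have f0: "f \<zero>\<^bsub>A\<^esub> = \<zero>\<^bsub>B\<^esub>"
    using f A.ring_axioms B.ring_axioms by (intro ring_hom_zero) (auto simp: bounded_hom_def)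
  have "gr_map B f x s \<in> gr_class B s ` circ B s" if s: "0 < s" for s
  proof -
    obtain a where a: "a \<in> circ A s" "x s = gr_class A s a" using x s unfolding A.carrier_Gr by blast
    show ?thesis using gr_map_component[where x = x, OF A B f s a] bounded_hom_circ(1)[OF A B f s a(1)] by simp
  qed
  moreover have "x s \<noteq> circcirc A s" if s: "0 < s" and ne: "gr_map B f x s \<noteq> circcirc B s" for s
  proof
    assume "x s = circcirc A s"
    then have "x s = gr_class A s \<zero>\<^bsub>A\<^esub>" using A.gr_class_zero[OF s] by simp
    then show False
      using gr_map_component[where x = x, OF A B f s A.circcirc_circ[OF A.zero_circcirc[OF s]]] f0 B.gr_class_zero[OF s] ne by simp
  qed
  then have "{s \<in> {0<..}. gr_map B f x s \<noteq> circcirc B s} \<subseteq> {s \<in> {0<..}. x s \<noteq> circcirc A s}" by auto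
  then have "finite {s \<in> {0<..}. gr_map B f x s \<noteq> circcirc B s}"
    by (rule finite_subset) (use x A.carrier_Gr in auto)
  ultimately show ?thesis unfolding B.carrier_Gr by (simp add: gr_map_def)
qed

lemma reified_order_pullback:
  assumes f: "f \<in> ring_hom A B" and A: "cring A" and Q: "reified_order B Q"
  shows "reified_order A (pullback A f Q)"
proof -
  interpret A: cring A by fact
  interpret B: reified_order B Q by fact
  have f0: "f \<zero>\<^bsub>A\<^esub> = \<zero>\<^bsub>B\<^esub>" by (rule ring_hom_zero[OF f A.ring_axioms B.ring_axioms])
  note h = ring_hom_closed[OF f] ring_hom_mult[OF f] ring_hom_add[OF f] ring_hom_one[OF f] f0
  show ?thesis
  proof (unfold_locales, goal_cases)
    case (2 r a b) then show ?case using B.total[of r "f a" "f b"] h by (auto simp: pullback_def)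
  next
    case (3 r a b s c) then show ?case using B.trans[of r "f a" "f b" s "f c"] by (auto simp: pullback_def)
  next
    case (5 r a c b) then show ?case using B.cancel[of r "f a" "f c" "f b"] h by (auto simp: pullback_def)
  qed (use h in \<open>auto simp: pullback_def B.mult B.add B.nontrivial B.zero B.mono_one\<close>)
qed

lemma spra_order_pullback:
  assumes A: "nonarch_seminormed_ring A" and B: "nonarch_seminormed_ring B" and f: "bounded_hom A B f"
    and plus: "\<And>r a. 0 < r \<Longrightarrow> a \<in> plus_part A r \<Longrightarrow> f a \<in> plus_part B r" and Q: "spra_order B Q"
  shows "spra_order A (pullback A f Q)"
proof -
  interpret A: nonarch_seminormed_ring A by fact
  interpret B: nonarch_seminormed_ring B by fact
  have fr: "f \<in> ring_hom A B" using f by (simp add: bounded_hom_def)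
  have f0: "f \<zero>\<^bsub>A\<^esub> = \<zero>\<^bsub>B\<^esub>" by (rule ring_hom_zero[OF fr A.ring_axioms B.ring_axioms])
  note h = ring_hom_closed[OF fr] ring_hom_one[OF fr] f0
  have Qr: "reified_order B Q" and Qc: "\<And>r a. 0 < r \<Longrightarrow> a \<in> circcirc B r \<Longrightarrow> (r, a, \<one>\<^bsub>B\<^esub>) \<in> Q"
    and Qp: "\<And>r a. 0 < r \<Longrightarrow> a \<in> plus_part B r \<Longrightarrow> (r, a, \<one>\<^bsub>B\<^esub>) \<in> Q"
    and Qs: "\<And>a. a \<in> carrier B \<Longrightarrow> (1, a, \<zero>\<^bsub>B\<^esub>) \<notin> Q \<Longrightarrow> (\<exists>r. (r, \<one>\<^bsub>B\<^esub>, a) \<in> Q) \<and> (\<exists>r. (r, a, \<one>\<^bsub>B\<^esub>) \<in> Q)"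
    using Q by (auto simp: spra_order_def)
  interpret Q: reified_order B Q by fact
  show ?thesis
    unfolding spra_order_def
  proof (intro conjI allI impI ballI)
    show "reified_order A (pullback A f Q)" by (rule reified_order_pullback[OF fr A.cring_axioms Qr])
    fix r :: real assume r: "0 < r"
    show "(r, a, \<one>\<^bsub>A\<^esub>) \<in> pullback A f Q" if "a \<in> circcirc A r" for a
      using that Qc[OF r bounded_hom_circ(2)[OF A B f r that]] r h by (auto simp: pullback_def circcirc_def)
    show "(r, a, \<one>\<^bsub>A\<^esub>) \<in> pullback A f Q" if "a \<in> plus_part A r" for a
      using that Qp[OF r plus[OF r that]] r h by (auto simp: pullback_def plus_part_def circ_def)
  next
    fix a assume a: "a \<in> carrier A" "(1, a, \<zero>\<^bsub>A\<^esub>) \<notin> pullback A f Q"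
    then have "f a \<in> carrier B" "(1, f a, \<zero>\<^bsub>B\<^esub>) \<notin> Q" using h by (auto simp: pullback_def)
    then obtain r s where rs: "(r, \<one>\<^bsub>B\<^esub>, f a) \<in> Q" "(s, f a, \<one>\<^bsub>B\<^esub>) \<in> Q" using Qs by blast
    have "(r, \<one>\<^bsub>A\<^esub>, a) \<in> pullback A f Q" "(s, a, \<one>\<^bsub>A\<^esub>) \<in> pullback A f Q"
      using a h rs Q.dom[OF rs(1)] Q.dom[OF rs(2)] by (simp_all add: pullback_def)
    then show "\<exists>r. (r, \<one>\<^bsub>A\<^esub>, a) \<in> pullback A f Q" "\<exists>r. (r, a, \<one>\<^bsub>A\<^esub>) \<in> pullback A f Q" by blast+
  qed
qed

lemma affinoid_morphism_plus_part:
  assumes A: "affinoid_seminormed_ring A" and B: "affinoid_seminormed_ring B" and f: "affinoid_morphism A B f"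
    and r: "0 < r" and a: "a \<in> plus_part A r"
  shows "f a \<in> plus_part B r"
proof -
  interpret A: affinoid_seminormed_ring A by fact
  interpret B: affinoid_seminormed_ring B by fact
  have bf: "bounded_hom A B f" using f by (auto simp: affinoid_morphism_def bounded_hom_def)
  have "a \<in> circ A r" "gr_homog A r (gr_class A r a) \<in> gr_sub A" using a by (auto simp: plus_part_def)
  then show ?thesis
    using bounded_hom_circ(1)[OF A.nonarch_seminormed_ring_axioms B.nonarch_seminormed_ring_axioms bf r, of a]
      gr_map_homog[OF A.nonarch_seminormed_ring_axioms B.nonarch_seminormed_ring_axioms bf r, of a] f
    by (auto simp: plus_part_def affinoid_morphism_def)
qed

section \<open>Orders bounded by a seminorm, and integral elements\<close>

locale seminorm_bounded_order = nonarch_seminormed_ring A + reified_order A Q for A (structure) and Q +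
  assumes circcirc_le: "\<lbrakk>0 < r; a \<in> circcirc A r\<rbrakk> \<Longrightarrow> (r, a, \<one>) \<in> Q"
begin

text \<open>
  For \<open>v(d) \<ge> r\<close>, the component of \<open>x\<close> in each degree \<open>s\<close> has values at most \<open>s (v(d) / r)\<^sup>k\<close>.
\<close>

definition gr_bounded :: "real \<Rightarrow> 'a \<Rightarrow> nat \<Rightarrow> (real \<Rightarrow> 'a set) \<Rightarrow> bool" where
  "gr_bounded r d k x \<longleftrightarrow> (\<forall>s>0. \<forall>a\<in>x s. (s / r ^ k, a, d [^] k) \<in> Q)"

text \<open>The hypothesis \<open>(1 / r, \<one>, d) \<in> Q\<close> says
  \<open>v(d) / r \<ge> 1\<close>, so raising the exponent weakens the bound.\<close>

lemma gr_bounded_mono: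
  assumes d: "0 < r" "(1 / r, \<one>, d) \<in> Q" and "gr_bounded r d k x" "k \<le> l"
  shows "gr_bounded r d l x"
  unfolding gr_bounded_def
proof (intro allI impI ballI)
  fix s a assume "0 < s" "a \<in> x s"
  then have q: "(s / r ^ k, a, d [^] k) \<in> Q" using assms by (simp add: gr_bounded_def)
  have dc: "d \<in> carrier A" "a \<in> carrier A" using d dom q by auto
  have "((1 / r) ^ (l - k), \<one> [^] (l - k), d [^] (l - k)) \<in> Q" using pow_Q[OF d(2)] .
  from mult2[OF q this] have "(s / r ^ k * (1 / r) ^ (l - k), a, d [^] k \<otimes> d [^] (l - k)) \<in> Q"
    using dc by simp
  moreover have "d [^] k \<otimes> d [^] (l - k) = d [^] l" using dc assms by (simp add: nat_pow_mult)
  moreover have "s / r ^ k * (1 / r) ^ (l - k) = s / r ^ l"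
    using d assms(4) by (simp add: power_one_over power_add[symmetric] divide_simps)
  ultimately show "(s / r ^ l, a, d [^] l) \<in> Q" by simp
qed

lemma circcirc_bounded:
  assumes d: "0 < r" "(1 / r, \<one>, d) \<in> Q" and "0 < s" "a \<in> circcirc A s"
  shows "(s / r ^ k, a, d [^] k) \<in> Q"
proof -
  have "gr_bounded r d 0 (\<lambda>s. circcirc A s)" using circcirc_le by (simp add: gr_bounded_def)
  from gr_bounded_mono[OF d this, of k] show ?thesis using assms by (simp add: gr_bounded_def)
qed

lemma gr_bounded_add:
  assumes "gr_bounded r d k x" "gr_bounded r d k y"
  shows "gr_bounded r d k (x \<oplus>\<^bsub>Gr A\<^esub> y)"
  using assms by (auto simp: gr_bounded_def Gr_simps gr_piece_simps intro!: add)

lemma gr_bounded_sum: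
  assumes d: "0 < r" "(1 / r, \<one>, d) \<in> Q"
    and I: "\<And>i. i \<in> I \<Longrightarrow> x i \<in> carrier (Gr A) \<and> gr_bounded r d k (x i)"
  shows "gr_bounded r d k (\<Oplus>\<^bsub>Gr A\<^esub>i\<in>I. x i)"
proof -
  interpret Gr: abelian_group "Gr A" by (rule abelian_group_Gr)
  have z: "gr_bounded r d k \<zero>\<^bsub>Gr A\<^esub>" using circcirc_bounded[OF d] by (auto simp: gr_bounded_def Gr_simps)
  show ?thesis using I
  proof (induction I rule: infinite_finite_induct)
    case (insert i I)
    then have "(\<Oplus>\<^bsub>Gr A\<^esub>i\<in>insert i I. x i) = x i \<oplus>\<^bsub>Gr A\<^esub> (\<Oplus>\<^bsub>Gr A\<^esub>i\<in>I. x i)"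
      by (intro Gr.finsum_insert) auto
    then show ?case using insert by (auto intro: gr_bounded_add)
  qed (use z in auto)
qed

text \<open>A component of the product is a sum of products of components, whose bounds multiply;
  the terms from \<open>circcirc\<close> obey the bound for every exponent.\<close>

lemma gr_bounded_mult:
  assumes d: "0 < r" "(1 / r, \<one>, d) \<in> Q" and x: "x \<in> carrier (Gr A)" and y: "y \<in> carrier (Gr A)"
    and bound: "gr_bounded r d k x" "gr_bounded r d l y"
  shows "gr_bounded r d (k + l) (x \<otimes>\<^bsub>Gr A\<^esub> y)"
  unfolding gr_bounded_def
proof (intro allI impI ballI)
  fix s u assume s: "0 < s" and u: "u \<in> (x \<otimes>\<^bsub>Gr A\<^esub> y) s"
  let ?I = "{t. 0 < t \<and> x t \<noteq> circcirc A t \<and> y (s / t) \<noteq> circcirc A (s / t)}"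
  let ?F = "\<lambda>t. rcoset_mult A (circcirc A s) (x t) (y (s / t))"
  have dc: "d \<in> carrier A" using d dom by auto
  have "u \<in> finprod (gr_piece A s) ?F ?I" using u s by (simp add: Gr_simps gr_mult_def)
  then show "(s / r ^ (k + l), u, d [^] (k + l)) \<in> Q"
  proof (rule gr_piece_finprod[OF s, rotated -1])
    fix t assume t: "t \<in> ?I"
    then have t0: "0 < t" by simp
    obtain a b where ab: "a \<in> circ A t" "b \<in> circ A (s / t)" "x t = gr_class A t a" "y (s / t) = gr_class A (s / t) b"
      "?F t = gr_class A s (a \<otimes> b)" "a \<otimes> b \<in> circ A s"
      using gr_mult_component[OF x y s t0] .
    show "?F t \<in> gr_class A s ` circ A s" using ab by simp
    fix c assume "c \<in> ?F t"
    then obtain h where h: "h \<in> circcirc A s" "c = h \<oplus> a \<otimes> b" using ab mem_gr_class by auto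
    have st: "0 < s / t" using s t0 by simp
    have "a \<in> x t" "b \<in> y (s / t)" using gr_class_self[OF t0 ab(1)] gr_class_self[OF st ab(2)] ab by auto
    then have "(t / r ^ k, a, d [^] k) \<in> Q" "((s / t) / r ^ l, b, d [^] l) \<in> Q"
      using bound t0 st unfolding gr_bounded_def by blast+
    from mult2[OF this] have "(s / r ^ (k + l), a \<otimes> b, d [^] (k + l)) \<in> Q"
      using t0 dc by (simp add: nat_pow_mult power_add mult.commute)
    then show "(s / r ^ (k + l), c, d [^] (k + l)) \<in> Q"
      using h circcirc_bounded[OF d s] by (auto intro: add)
  next
    show "(s / r ^ (k + l), a, d [^] (k + l)) \<in> Q" if "a \<in> circcirc A s" for a
      by (rule circcirc_bounded[OF d s that])
  qed (rule add)
qed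

text \<open>Suppose \<open>v(d) > r\<close>. In degree \<open>r ^ n\<close> the lower terms of an
  integral equation of degree \<open>n\<close> have value at most
  \<open>r ^ n * (v(d) / r) ^ (n - 1)\<close>. The equation gives the same bound for
  \<open>d [^] n\<close>, and cancelling yields \<open>v(d) \<le> r\<close>.\<close>

lemma integral_closure_bounded:
  assumes S: "S \<subseteq> carrier (Gr A)" "\<And>x s a. x \<in> S \<Longrightarrow> 0 < s \<Longrightarrow> a \<in> x s \<Longrightarrow> (s, a, \<one>) \<in> Q"
    and r: "0 < r" and d: "d \<in> circ A r"
    and int: "gr_homog A r (gr_class A r d) \<in> integral_closure (Gr A) S"
  shows "(r, d, \<one>) \<in> Q"
proof (rule ccontr)
  assume no: "(r, d, \<one>) \<notin> Q"
  have dc: "d \<in> carrier A" using d circ_carrier by blast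
  have dr: "(1 / r, \<one>, d) \<in> Q" using total[OF r dc, of \<one>] no by auto
  let ?x = "gr_homog A r (gr_class A r d)"
  interpret Gr: abelian_group "Gr A" by (rule abelian_group_Gr)
  obtain n :: nat and c where c: "c \<in> {..<n} \<rightarrow> S"
    and eq: "?x [^]\<^bsub>Gr A\<^esub> n \<oplus>\<^bsub>Gr A\<^esub> (\<Oplus>\<^bsub>Gr A\<^esub>i\<in>{..<n}. c i \<otimes>\<^bsub>Gr A\<^esub> ?x [^]\<^bsub>Gr A\<^esub> i) = \<zero>\<^bsub>Gr A\<^esub>"
    using int unfolding integral_closure_def by blast
  have xp: "?x [^]\<^bsub>Gr A\<^esub> i = gr_homog A (r ^ i) (gr_class A (r ^ i) (d [^] i))" for i :: nat
    by (rule gr_homog_pow[OF r d])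
  have rp: "0 < r ^ i" and dp: "d [^] i \<in> circ A (r ^ i)" for i :: nat using r circ_pow[OF r d] by auto
  have xc: "?x [^]\<^bsub>Gr A\<^esub> i \<in> carrier (Gr A)" for i :: nat unfolding xp by (rule gr_homog_closed[OF rp dp])
  have xb: "gr_bounded r d i (?x [^]\<^bsub>Gr A\<^esub> i)" for i :: nat
    unfolding gr_bounded_def xp
  proof (intro allI impI ballI)
    fix s a assume s: "0 < s" and a: "a \<in> gr_homog A (r ^ i) (gr_class A (r ^ i) (d [^] i)) s"
    show "(s / r ^ i, a, d [^] i) \<in> Q"
    proof (cases "s = r ^ i")
      case True
      then obtain h where "h \<in> circcirc A s" "a = h \<oplus> d [^] i" using a s mem_gr_class by (auto simp: gr_homog_def)
      then show ?thesis using circcirc_bounded[OF r dr s, of h i] refl_Q[of "d [^] i"] dc True r by (auto intro: add)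
    next
      case False
      then show ?thesis using a s circcirc_bounded[OF r dr s] by (simp add: gr_homog_def)
    qed
  qed
  show False
  proof (cases "n = 0")
    \<comment> \<open>The empty equation says \<open>1 = 0\<close> in the graded ring. Then
      \<open>snorm A \<one> < 1\<close>, submultiplicativity makes it \<open>0\<close>, and the
      seminorm vanishes on \<open>d\<close>, which is therefore in
      \<open>circcirc A r\<close>.\<close>
    case True
    then have "gr_homog A 1 (gr_class A 1 \<one>) = \<zero>\<^bsub>Gr A\<^esub>" using eq xp[of 0] xc[of 0] by simp
    then have "gr_class A 1 \<one> = circcirc A 1" by (simp add: gr_homog_def Gr_simps fun_eq_iff) (metis zero_less_one)
    then have "\<one> \<in> circcirc A 1" using gr_class_trivial[OF _ one_circ] by simp
    then obtain m where "snorm A (\<one> [^] (m::nat)) < 1 ^ m" by (rule circcirc_pow[OF zero_less_one])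
    then have "snorm A \<one> < 1" by simp
    then have "\<not> 0 < snorm A \<one>" if "snorm A \<one> \<le> snorm A \<one> * snorm A \<one>"
      using that mult_strict_right_mono[of "snorm A \<one>" 1 "snorm A \<one>"] by auto
    moreover have "snorm A \<one> \<le> snorm A \<one> * snorm A \<one>" using snorm_mult[of \<one> \<one>] by simp
    ultimately have "snorm A \<one> = 0"
      using snorm_nonneg[of \<one>] by auto
    then have "snorm A d \<le> 0" using snorm_mult[of \<one> d] dc by simp
    then have "d \<in> circcirc A r" using circcircI[OF r dc] r by simp
    then show False using circcirc_le[OF r] no by blast
  next
    case False
    then obtain m where m: "n = Suc m" using not0_implies_Suc by blast
    let ?y = "\<Oplus>\<^bsub>Gr A\<^esub>i\<in>{..<n}. c i \<otimes>\<^bsub>Gr A\<^esub> ?x [^]\<^bsub>Gr A\<^esub> i"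
    have ci: "c i \<otimes>\<^bsub>Gr A\<^esub> ?x [^]\<^bsub>Gr A\<^esub> i \<in> carrier (Gr A) \<and> gr_bounded r d m (c i \<otimes>\<^bsub>Gr A\<^esub> ?x [^]\<^bsub>Gr A\<^esub> i)"
      if "i \<in> {..<n}" for i
    proof
      have cS: "c i \<in> S" using c that by blast
      then have cc: "c i \<in> carrier (Gr A)" using S by blast
      show "c i \<otimes>\<^bsub>Gr A\<^esub> ?x [^]\<^bsub>Gr A\<^esub> i \<in> carrier (Gr A)" by (rule gr_mult_closed[OF cc xc])
      have "gr_bounded r d 0 (c i)" using S(2)[OF cS] by (simp add: gr_bounded_def)
      from gr_bounded_mult[OF r dr cc xc this xb[of i]]
      have "gr_bounded r d i (c i \<otimes>\<^bsub>Gr A\<^esub> ?x [^]\<^bsub>Gr A\<^esub> i)" by simp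
      then show "gr_bounded r d m (c i \<otimes>\<^bsub>Gr A\<^esub> ?x [^]\<^bsub>Gr A\<^esub> i)"
        by (rule gr_bounded_mono[OF r dr]) (use that m in auto)
    qed
    then have yb: "gr_bounded r d m ?y" by (intro gr_bounded_sum[OF r dr]) blast
    \<comment> \<open>Only the component of degree \<open>r ^ n\<close> of the equation matters;
      \<open>b\<close> will represent the sum of the lower terms there.\<close>
    have "?y \<in> carrier (Gr A)" using ci by (intro Gr.finsum_closed) blast
    then have "?y (r ^ n) \<in> gr_class A (r ^ n) ` circ A (r ^ n)" unfolding carrier_Gr using rp[of n] by blast
    then obtain b where b: "b \<in> circ A (r ^ n)" "?y (r ^ n) = gr_class A (r ^ n) b" by (elim imageE)
    have "(?x [^]\<^bsub>Gr A\<^esub> n \<oplus>\<^bsub>Gr A\<^esub> ?y) (r ^ n) = gr_class A (r ^ n) (d [^] n) \<otimes>\<^bsub>gr_piece A (r ^ n)\<^esub> gr_class A (r ^ n) b"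
    proof -
      have "(?x [^]\<^bsub>Gr A\<^esub> n \<oplus>\<^bsub>Gr A\<^esub> ?y) (r ^ n) =
          (?x [^]\<^bsub>Gr A\<^esub> n) (r ^ n) \<otimes>\<^bsub>gr_piece A (r ^ n)\<^esub> ?y (r ^ n)"
        unfolding Gr_simps(4) using rp[of n] by simp
      moreover have "(?x [^]\<^bsub>Gr A\<^esub> n) (r ^ n) = gr_class A (r ^ n) (d [^] n)"
        unfolding xp using rp[of n] by (simp add: gr_homog_def)
      ultimately show ?thesis unfolding b(2) by metis
    qed
    then have "gr_class A (r ^ n) (d [^] n \<oplus> b) = circcirc A (r ^ n)"
      using gr_class_add[OF rp dp b(1)] rp[of n] unfolding eq Gr_simps(3) by simp
    then have "d [^] n \<oplus> b \<in> circcirc A (r ^ n)" using gr_class_trivial[OF rp circ_add[OF rp dp b(1)]] by simp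
    then have "(r ^ n / r ^ m, d [^] n \<oplus> b, d [^] m) \<in> Q" by (rule circcirc_bounded[OF r dr rp])
    moreover have "(r ^ n / r ^ m, b, d [^] m) \<in> Q"
      using yb rp[of n] b gr_class_self[OF rp b(1)] unfolding gr_bounded_def by blast
    ultimately have "(r ^ n / r ^ m, (d [^] n \<oplus> b) \<ominus> b, d [^] m) \<in> Q" by (rule diff)
    moreover have "(d [^] n \<oplus> b) \<ominus> b = d \<otimes> d [^] m"
      using dc circ_carrier[OF b(1)] by (simp add: m a_minus_def a_assoc r_neg m_comm)
    moreover have "r ^ n / r ^ m = r" using r m by simp
    ultimately have "(r, d \<otimes> d [^] m, \<one> \<otimes> d [^] m) \<in> Q" using dc by simp
    moreover have "(1, d [^] m, \<zero>) \<notin> Q"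
    proof
      assume "(1, d [^] m, \<zero>) \<in> Q"
      moreover have "((1 / r) ^ m, \<one> [^] m, d [^] m) \<in> Q" by (rule pow_Q[OF dr])
      ultimately have "(1, \<one> [^] m, \<zero>) \<in> Q" using le_supp by blast
      then show False using nontrivial by simp
    qed
    ultimately show False using cancel[of r d "d [^] m" \<one>] dc no by auto
  qed
qed

end

section \<open>Tensor products\<close>

lemma frag_extend_fun_diff: "frag_extend (\<lambda>x. f x - g x) p = frag_extend f p - frag_extend g p"
  by (rule frag_induction[of p UNIV]) (auto simp: frag_extend_diff)

lemma frag_extend_fun_zero: "frag_extend (\<lambda>x. 0) p = 0"
  by (rule frag_induction[of p UNIV]) (auto simp: frag_extend_diff)

text \<open>A separate name keeps the nested \<open>frag_extend\<close> folded, so that the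
  bilinearity rules can serve as rewrite rules.\<close>

definition pair_mult :: "('b, 'n) ring_scheme \<Rightarrow> ('c, 'k) ring_scheme \<Rightarrow> (('b \<times> 'c) \<Rightarrow>\<^sub>0 int) \<Rightarrow> (('b \<times> 'c) \<Rightarrow>\<^sub>0 int) \<Rightarrow> (('b \<times> 'c) \<Rightarrow>\<^sub>0 int)" where
  "pair_mult B C p q = p \<otimes>\<^bsub>pair_ring B C\<^esub> q"

lemma pair_mult_of: "pair_mult B C (frag_of (b, c)) (frag_of (b', c')) = frag_of (b \<otimes>\<^bsub>B\<^esub> b', c \<otimes>\<^bsub>C\<^esub> c')"
  by (simp add: pair_mult_def pair_ring_def)

lemma pair_mult_diff_left: "pair_mult B C (p - p') q = pair_mult B C p q - pair_mult B C p' q"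
  by (simp add: pair_mult_def pair_ring_def frag_extend_diff)

lemma pair_mult_diff_right: "pair_mult B C p (q - q') = pair_mult B C p q - pair_mult B C p q'"
  by (simp add: pair_mult_def pair_ring_def frag_extend_diff case_prod_unfold frag_extend_fun_diff)

lemma pair_mult_zero: "pair_mult B C 0 q = 0" "pair_mult B C p 0 = 0"
  by (simp_all add: pair_mult_def pair_ring_def case_prod_unfold frag_extend_fun_zero)

lemma pair_ring_simps:
  "p \<in> carrier (pair_ring B C) \<longleftrightarrow> Poly_Mapping.keys p \<subseteq> carrier B \<times> carrier C"
  "p \<otimes>\<^bsub>pair_ring B C\<^esub> q = pair_mult B C p q" "\<one>\<^bsub>pair_ring B C\<^esub> = frag_of (\<one>\<^bsub>B\<^esub>, \<one>\<^bsub>C\<^esub>)"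
  "\<zero>\<^bsub>pair_ring B C\<^esub> = 0" "p \<oplus>\<^bsub>pair_ring B C\<^esub> q = p + q"
  by (simp add: pair_ring_def) (simp add: pair_mult_def, simp_all add: pair_ring_def)

lemma frag_additive:
  fixes h :: "('x \<Rightarrow>\<^sub>0 int) \<Rightarrow> 'y::ab_group_add"
  assumes "\<And>p q. h (p - q) = h p - h q"
  shows "h 0 = 0" "h (- p) = - h p" "h (p + q) = h p + h q"
proof -
  show 0: "h 0 = 0" using assms[of 0 0] by simp
  show m: "h (- p) = - h p" for p using assms[of 0 p] 0 by simp
  show "h (p + q) = h p + h q" using assms[of p "- q"] m by simp
qed

lemma pair_ring_induct [consumes 1, case_names zero one diff]:
  assumes "Poly_Mapping.keys p \<subseteq> carrier B \<times> carrier C"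
    and "P 0" and "\<And>b c. b \<in> carrier B \<Longrightarrow> c \<in> carrier C \<Longrightarrow> P (frag_of (b, c))" and "\<And>p q. P p \<Longrightarrow> P q \<Longrightarrow> P (p - q)"
  shows "P p"
  using assms(1) by (rule frag_induction) (use assms in auto)

lemma keys_diff_subset: "Poly_Mapping.keys p \<subseteq> S \<Longrightarrow> Poly_Mapping.keys q \<subseteq> S \<Longrightarrow> Poly_Mapping.keys (p - q) \<subseteq> S"
  using keys_diff[of p q] by blast

lemma keys_add_subset: "Poly_Mapping.keys p \<subseteq> S \<Longrightarrow> Poly_Mapping.keys q \<subseteq> S \<Longrightarrow> Poly_Mapping.keys (p + q) \<subseteq> S"
  using keys_add[of p q] by blast

locale tensor = A: cring A + B: cring B + C: cring C
  for A :: "('a, 'm) ring_scheme" and B :: "('b, 'n) ring_scheme" and C :: "('c, 'k) ring_scheme" +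
  fixes f :: "'a \<Rightarrow> 'b" and g :: "'a \<Rightarrow> 'c"
  assumes f: "f \<in> ring_hom A B" and g: "g \<in> ring_hom A C"
begin

abbreviation "PR \<equiv> pair_ring B C"
abbreviation "KR \<equiv> tensor_kernel A B C f g"
abbreviation "TR \<equiv> tensor_ring A B C f g"
abbreviation "pure \<equiv> pure_tensor A B C f g"
abbreviation "pairs \<equiv> carrier B \<times> carrier C"

lemma pair_mult_keys:
  assumes "Poly_Mapping.keys p \<subseteq> pairs" "Poly_Mapping.keys q \<subseteq> pairs"
  shows "Poly_Mapping.keys (pair_mult B C p q) \<subseteq> pairs"
  using assms(1)
proof (induction p rule: pair_ring_induct)
  case (one b c)
  then have bc: "b \<in> carrier B" "c \<in> carrier C" by auto
  show ?case using assms(2)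
    by (induction q rule: pair_ring_induct)
      (simp_all add: pair_mult_of pair_mult_zero pair_mult_diff_right bc keys_diff_subset)
qed (simp_all add: pair_mult_zero pair_mult_diff_left keys_diff_subset)

lemma pair_mult_comm:
  assumes "Poly_Mapping.keys p \<subseteq> pairs" "Poly_Mapping.keys q \<subseteq> pairs"
  shows "pair_mult B C p q = pair_mult B C q p"
  using assms(1)
proof (induction p rule: pair_ring_induct)
  case (one b c)
  then have bc: "b \<in> carrier B" "c \<in> carrier C" by auto
  show ?case using assms(2)
    by (induction q rule: pair_ring_induct)
      (simp_all add: pair_mult_of pair_mult_zero pair_mult_diff_right pair_mult_diff_left bc B.m_comm C.m_comm)
qed (simp_all add: pair_mult_zero pair_mult_diff_left pair_mult_diff_right)

lemma pair_mult_assoc: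
  assumes "Poly_Mapping.keys p \<subseteq> pairs" "Poly_Mapping.keys q \<subseteq> pairs" "Poly_Mapping.keys s \<subseteq> pairs"
  shows "pair_mult B C (pair_mult B C p q) s = pair_mult B C p (pair_mult B C q s)"
  using assms(1)
proof (induction p rule: pair_ring_induct)
  case (one b c)
  then have bc: "b \<in> carrier B" "c \<in> carrier C" by auto
  show ?case using assms(2)
  proof (induction q rule: pair_ring_induct)
    case (one b' c')
    then have bc': "b' \<in> carrier B" "c' \<in> carrier C" by auto
    show ?case using assms(3)
      by (induction s rule: pair_ring_induct)
        (simp_all add: pair_mult_of pair_mult_zero pair_mult_diff_right bc bc' B.m_assoc C.m_assoc)
  qed (simp_all add: pair_mult_zero pair_mult_diff_left pair_mult_diff_right)
qed (simp_all add: pair_mult_zero pair_mult_diff_left pair_mult_diff_right)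

lemma pair_mult_one:
  assumes "Poly_Mapping.keys p \<subseteq> pairs"
  shows "pair_mult B C (frag_of (\<one>\<^bsub>B\<^esub>, \<one>\<^bsub>C\<^esub>)) p = p"
  using assms by (induction p rule: pair_ring_induct) (simp_all add: pair_mult_of pair_mult_zero pair_mult_diff_right)

lemma cring_pair_ring: "cring PR"
proof (rule cringI)
  show "abelian_group PR"
  proof (rule abelian_groupI)
    show "\<exists>y\<in>carrier PR. y \<oplus>\<^bsub>PR\<^esub> x = \<zero>\<^bsub>PR\<^esub>" if "x \<in> carrier PR" for x
      using that by (intro bexI[of _ "- x"]) (simp_all add: pair_ring_simps)
  qed (simp_all add: pair_ring_simps keys_add_subset ac_simps)
  show "comm_monoid PR"
  proof (rule comm_monoidI)
    show "x \<otimes>\<^bsub>PR\<^esub> y = y \<otimes>\<^bsub>PR\<^esub> x" if "x \<in> carrier PR" "y \<in> carrier PR" for x y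
      using that unfolding pair_ring_simps by (rule pair_mult_comm)
  qed (simp_all add: pair_ring_simps pair_mult_assoc pair_mult_one pair_mult_keys)
  show "(x \<oplus>\<^bsub>PR\<^esub> y) \<otimes>\<^bsub>PR\<^esub> z = x \<otimes>\<^bsub>PR\<^esub> z \<oplus>\<^bsub>PR\<^esub> y \<otimes>\<^bsub>PR\<^esub> z" for x y z
    using frag_additive(3)[of "\<lambda>p. pair_mult B C p z"] by (simp add: pair_ring_simps pair_mult_diff_left)
qed

sublocale P: cring PR by (rule cring_pair_ring)

lemma relation_cases [consumes 1, case_names left right middle]:
  assumes "r \<in> tensor_relations A B C f g"
  obtains b b' c where "r = frag_of (b \<oplus>\<^bsub>B\<^esub> b', c) - frag_of (b, c) - frag_of (b', c)"
      "b \<in> carrier B" "b' \<in> carrier B" "c \<in> carrier C"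
    | b c c' where "r = frag_of (b, c \<oplus>\<^bsub>C\<^esub> c') - frag_of (b, c) - frag_of (b, c')"
      "b \<in> carrier B" "c \<in> carrier C" "c' \<in> carrier C"
    | a b c where "r = frag_of (f a \<otimes>\<^bsub>B\<^esub> b, c) - frag_of (b, g a \<otimes>\<^bsub>C\<^esub> c)"
      "a \<in> carrier A" "b \<in> carrier B" "c \<in> carrier C"
  using assms unfolding tensor_relations_def by blast

lemma relations_keys:
  assumes "r \<in> tensor_relations A B C f g"
  shows "Poly_Mapping.keys r \<subseteq> pairs"
  using assms
proof (cases rule: relation_cases)
  case (left b b' c)
  show ?thesis unfolding left(1) by (intro keys_diff_subset) (simp_all add: left)
next
  case (right b c c')
  show ?thesis unfolding right(1) by (intro keys_diff_subset) (simp_all add: right)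
next
  case (middle a b c)
  show ?thesis unfolding middle(1)
    by (intro keys_diff_subset) (simp_all add: middle ring_hom_closed[OF f] ring_hom_closed[OF g])
qed

lemma kernel_subgroup: "subgroup KR (free_Abelian_group pairs)"
  unfolding tensor_kernel_def using relations_keys
  by (intro group.generate_is_subgroup group_free_Abelian_group) auto

lemma kernel_closed:
  "0 \<in> KR" "x \<in> KR \<Longrightarrow> Poly_Mapping.keys x \<subseteq> pairs" "x \<in> KR \<Longrightarrow> y \<in> KR \<Longrightarrow> x + y \<in> KR"
  "x \<in> KR \<Longrightarrow> - x \<in> KR" "x \<in> KR \<Longrightarrow> y \<in> KR \<Longrightarrow> x - y \<in> KR" "r \<in> tensor_relations A B C f g \<Longrightarrow> r \<in> KR"
proof -
  interpret subgroup KR "free_Abelian_group pairs" by (rule kernel_subgroup)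
  show "0 \<in> KR" using one_closed by simp
  show k: "x \<in> KR \<Longrightarrow> Poly_Mapping.keys x \<subseteq> pairs" for x using subsetD[OF subset, of x] by simp
  show p: "x \<in> KR \<Longrightarrow> y \<in> KR \<Longrightarrow> x + y \<in> KR" for x y using m_closed[of x y] by simp
  show m: "x \<in> KR \<Longrightarrow> - x \<in> KR" for x using m_inv_closed[of x] k[of x] by simp
  show "x \<in> KR \<Longrightarrow> y \<in> KR \<Longrightarrow> x - y \<in> KR" using p[OF _ m, of x y] by simp
  show "r \<in> tensor_relations A B C f g \<Longrightarrow> r \<in> KR" unfolding tensor_kernel_def by (rule generate.incl)
qed

lemma kernel_induct [consumes 1, case_names zero relation diff]:
  assumes "x \<in> KR" and zero: "P 0" and rel: "\<And>r. r \<in> tensor_relations A B C f g \<Longrightarrow> P r"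
    and diff: "\<And>x y. P x \<Longrightarrow> P y \<Longrightarrow> P (x - y)"
  shows "P x"
proof -
  have m: "P (- x)" if "P x" for x using diff[OF zero that] by simp
  have "x \<in> generate (free_Abelian_group pairs) (tensor_relations A B C f g)"
    using assms(1) by (simp add: tensor_kernel_def)
  then show ?thesis
  proof (induction x rule: generate.induct)
    case (inv h) then show ?case using m[OF rel] relations_keys[of h] by simp
  next
    case (eng h1 h2) then show ?case using diff[of h1 "- h2"] m[of h2] by simp
  qed (auto simp: zero rel)
qed

lemma relation_intros:
  "\<lbrakk>b \<in> carrier B; b' \<in> carrier B; c \<in> carrier C\<rbrakk> \<Longrightarrow>
     frag_of (b \<oplus>\<^bsub>B\<^esub> b', c) - frag_of (b, c) - frag_of (b', c) \<in> tensor_relations A B C f g"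
  "\<lbrakk>b \<in> carrier B; c \<in> carrier C; c' \<in> carrier C\<rbrakk> \<Longrightarrow>
     frag_of (b, c \<oplus>\<^bsub>C\<^esub> c') - frag_of (b, c) - frag_of (b, c') \<in> tensor_relations A B C f g"
  "\<lbrakk>a \<in> carrier A; b \<in> carrier B; c \<in> carrier C\<rbrakk> \<Longrightarrow>
     frag_of (f a \<otimes>\<^bsub>B\<^esub> b, c) - frag_of (b, g a \<otimes>\<^bsub>C\<^esub> c) \<in> tensor_relations A B C f g"
  unfolding tensor_relations_def by blast+

lemma relation_mult:
  assumes r: "r \<in> tensor_relations A B C f g" and bc: "b0 \<in> carrier B" "c0 \<in> carrier C"
  shows "pair_mult B C (frag_of (b0, c0)) r \<in> tensor_relations A B C f g"
  using r
proof (cases rule: relation_cases)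
  case (left b b' c)
  then show ?thesis using bc relation_intros(1)[of "b0 \<otimes>\<^bsub>B\<^esub> b" "b0 \<otimes>\<^bsub>B\<^esub> b'" "c0 \<otimes>\<^bsub>C\<^esub> c"]
    by (simp add: pair_mult_diff_right pair_mult_of B.r_distr)
next
  case (right b c c')
  then show ?thesis using bc relation_intros(2)[of "b0 \<otimes>\<^bsub>B\<^esub> b" "c0 \<otimes>\<^bsub>C\<^esub> c" "c0 \<otimes>\<^bsub>C\<^esub> c'"]
    by (simp add: pair_mult_diff_right pair_mult_of C.r_distr)
next
  case (middle a b c)
  then show ?thesis using bc relation_intros(3)[of a "b0 \<otimes>\<^bsub>B\<^esub> b" "c0 \<otimes>\<^bsub>C\<^esub> c"]
      ring_hom_closed[OF f middle(2)] ring_hom_closed[OF g middle(2)]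
    by (simp add: pair_mult_diff_right pair_mult_of B.m_lcomm C.m_lcomm)
qed

lemma kernel_mult:
  assumes "Poly_Mapping.keys p \<subseteq> pairs" "x \<in> KR"
  shows "pair_mult B C p x \<in> KR"
  using assms(1)
proof (induction p rule: pair_ring_induct)
  case (one b c)
  then have bc: "b \<in> carrier B" "c \<in> carrier C" by auto
  show ?case using assms(2)
    by (induction x rule: kernel_induct)
      (simp_all add: pair_mult_zero pair_mult_diff_right kernel_closed relation_mult bc)
qed (simp_all add: pair_mult_zero pair_mult_diff_left kernel_closed)

lemma kernel_ideal: "ideal KR PR"
proof (rule idealI)
  show "subgroup KR (add_monoid PR)"
  proof (rule group.subgroupI)
    show "group (add_monoid PR)" by (rule P.add.is_group)
    show "inv\<^bsub>add_monoid PR\<^esub> x \<in> KR" if "x \<in> KR" for x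
    proof -
      have "\<ominus>\<^bsub>PR\<^esub> x = - x"
        using kernel_closed(2)[OF that] by (intro P.minus_equality) (simp_all add: pair_ring_simps)
      then show ?thesis using kernel_closed(4)[OF that] by (simp add: a_inv_def)
    qed
  qed (use kernel_closed in \<open>auto simp: pair_ring_simps\<close>)
  show "x \<otimes>\<^bsub>PR\<^esub> a \<in> KR" if "a \<in> KR" "x \<in> carrier PR" for a x
    using kernel_mult that by (simp add: pair_ring_simps)
  show "a \<otimes>\<^bsub>PR\<^esub> x \<in> KR" if "a \<in> KR" "x \<in> carrier PR" for a x
    using kernel_mult[of x a] kernel_closed(2)[of a] that by (simp add: pair_ring_simps pair_mult_comm)
qed (rule P.ring_axioms)

sublocale K: ideal KR PR by (rule kernel_ideal)

lemma cring_tensor_ring: "cring TR"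
  unfolding tensor_ring_def by (rule K.quotient_is_cring[OF P.cring_axioms])

sublocale T: cring TR by (rule cring_tensor_ring)

definition cls :: "(('b \<times> 'c) \<Rightarrow>\<^sub>0 int) \<Rightarrow> (('b \<times> 'c) \<Rightarrow>\<^sub>0 int) set" where
  "cls p = KR +>\<^bsub>PR\<^esub> p"

lemma cls_hom: "cls \<in> ring_hom PR TR"
  using K.rcos_ring_hom by (simp add: tensor_ring_def cls_def[abs_def])

lemma tensor_carrier: "x \<in> carrier TR \<longleftrightarrow> (\<exists>p. Poly_Mapping.keys p \<subseteq> pairs \<and> x = cls p)"
proof -
  have "carrier TR = cls ` carrier PR"
    by (auto simp: tensor_ring_def FactRing_def A_RCOSETS_def' a_r_coset_def' cls_def)
  then show ?thesis by (simp add: pair_ring_simps image_iff Bex_def)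
qed

lemma mem_cls: "x \<in> cls p \<longleftrightarrow> x - p \<in> KR"
  by (force simp: cls_def a_r_coset_def' pair_ring_simps)

lemma cls_eq: "cls p = cls q \<longleftrightarrow> p - q \<in> KR"
proof
  assume "cls p = cls q"
  moreover have "p \<in> cls p" using kernel_closed(1) by (simp add: mem_cls)
  ultimately show "p - q \<in> KR" by (simp add: mem_cls)
next
  assume pq: "p - q \<in> KR"
  have "x - p \<in> KR \<longleftrightarrow> x - q \<in> KR" for x
    using kernel_closed(3)[OF _ pq, of "x - p"] kernel_closed(5)[OF _ pq, of "x - q"] by (auto simp: algebra_simps)
  then show "cls p = cls q" by (auto simp: mem_cls)
qed

lemma cls_simps:
  assumes "Poly_Mapping.keys p \<subseteq> pairs" "Poly_Mapping.keys q \<subseteq> pairs"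
  shows "cls p \<in> carrier TR" "cls p \<oplus>\<^bsub>TR\<^esub> cls q = cls (p + q)" "cls p \<otimes>\<^bsub>TR\<^esub> cls q = cls (pair_mult B C p q)"
    "\<ominus>\<^bsub>TR\<^esub> cls p = cls (- p)" "cls p \<ominus>\<^bsub>TR\<^esub> cls q = cls (p - q)"
proof -
  have c: "p \<in> carrier PR" "q \<in> carrier PR" using assms by (auto simp: pair_ring_simps)
  show "cls p \<in> carrier TR" using ring_hom_closed[OF cls_hom c(1)] .
  show a: "cls p \<oplus>\<^bsub>TR\<^esub> cls q = cls (p + q)"
    using ring_hom_add[OF cls_hom c] by (simp add: pair_ring_simps)
  show "cls p \<otimes>\<^bsub>TR\<^esub> cls q = cls (pair_mult B C p q)"
    using ring_hom_mult[OF cls_hom c] by (simp add: pair_ring_simps)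
  have z: "cls 0 = \<zero>\<^bsub>TR\<^esub>"
    using ring_hom_zero[OF cls_hom P.ring_axioms T.ring_axioms] by (simp add: pair_ring_simps)
  have m: "\<ominus>\<^bsub>TR\<^esub> cls s = cls (- s)" if "Poly_Mapping.keys s \<subseteq> pairs" for s
  proof -
    have s: "s \<in> carrier PR" "- s \<in> carrier PR" using that by (auto simp: pair_ring_simps)
    have "cls (- s) \<oplus>\<^bsub>TR\<^esub> cls s = \<zero>\<^bsub>TR\<^esub>" using ring_hom_add[OF cls_hom s(2,1)] z by (simp add: pair_ring_simps)
    then show ?thesis using T.minus_equality ring_hom_closed[OF cls_hom] s by metis
  qed
  show "\<ominus>\<^bsub>TR\<^esub> cls p = cls (- p)" using m assms by blast
  show "cls p \<ominus>\<^bsub>TR\<^esub> cls q = cls (p - q)"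
    using ring_hom_add[OF cls_hom c(1), of "- q"] m[OF assms(2)] c by (simp add: a_minus_def pair_ring_simps)
qed

lemma cls_zero: "cls 0 = \<zero>\<^bsub>TR\<^esub>"
  using ring_hom_zero[OF cls_hom P.ring_axioms T.ring_axioms] by (simp add: pair_ring_simps)

lemma cls_one: "cls (frag_of (\<one>\<^bsub>B\<^esub>, \<one>\<^bsub>C\<^esub>)) = \<one>\<^bsub>TR\<^esub>"
  using ring_hom_one[OF cls_hom] by (simp add: pair_ring_simps)

lemma pure_eq: "pure b c = cls (frag_of (b, c))"
  by (simp add: pure_tensor_def cls_def)

lemma pure_closed: "\<lbrakk>b \<in> carrier B; c \<in> carrier C\<rbrakk> \<Longrightarrow> pure b c \<in> carrier TR"
  unfolding pure_eq by (rule cls_simps(1)) auto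

lemma pure_mult:
  "\<lbrakk>b \<in> carrier B; c \<in> carrier C; b' \<in> carrier B; c' \<in> carrier C\<rbrakk> \<Longrightarrow>
     pure b c \<otimes>\<^bsub>TR\<^esub> pure b' c' = pure (b \<otimes>\<^bsub>B\<^esub> b') (c \<otimes>\<^bsub>C\<^esub> c')"
  unfolding pure_eq by (subst cls_simps(3)) (auto simp: pair_mult_of)

lemma pure_add_left:
  assumes "b \<in> carrier B" "b' \<in> carrier B" "c \<in> carrier C"
  shows "pure (b \<oplus>\<^bsub>B\<^esub> b') c = pure b c \<oplus>\<^bsub>TR\<^esub> pure b' c"
proof -
  have "pure b c \<oplus>\<^bsub>TR\<^esub> pure b' c = cls (frag_of (b, c) + frag_of (b', c))"
    unfolding pure_eq using assms by (intro cls_simps) auto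
  also have "\<dots> = pure (b \<oplus>\<^bsub>B\<^esub> b') c"
    unfolding pure_eq using kernel_closed(4)[OF kernel_closed(6)[OF relation_intros(1)[OF assms]]]
    by (simp add: cls_eq algebra_simps)
  finally show ?thesis by simp
qed

lemma pure_add_right:
  assumes "b \<in> carrier B" "c \<in> carrier C" "c' \<in> carrier C"
  shows "pure b (c \<oplus>\<^bsub>C\<^esub> c') = pure b c \<oplus>\<^bsub>TR\<^esub> pure b c'"
proof -
  have "pure b c \<oplus>\<^bsub>TR\<^esub> pure b c' = cls (frag_of (b, c) + frag_of (b, c'))"
    unfolding pure_eq using assms by (intro cls_simps) auto
  also have "\<dots> = pure b (c \<oplus>\<^bsub>C\<^esub> c')"
    unfolding pure_eq using kernel_closed(4)[OF kernel_closed(6)[OF relation_intros(2)[OF assms]]]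
    by (simp add: cls_eq algebra_simps)
  finally show ?thesis by simp
qed

lemma pure_balanced:
  "\<lbrakk>a \<in> carrier A; b \<in> carrier B; c \<in> carrier C\<rbrakk> \<Longrightarrow> pure (f a \<otimes>\<^bsub>B\<^esub> b) c = pure b (g a \<otimes>\<^bsub>C\<^esub> c)"
  unfolding pure_eq cls_eq by (intro kernel_closed relation_intros)

lemma pure_one: "pure \<one>\<^bsub>B\<^esub> \<one>\<^bsub>C\<^esub> = \<one>\<^bsub>TR\<^esub>"
  by (simp add: pure_eq cls_one)

lemma left_hom: "tensor_left A B C f g \<in> ring_hom B TR"
  by (rule ring_hom_memI)
    (auto simp: tensor_left_def pure_closed pure_mult pure_add_left pure_one)

lemma right_hom: "tensor_right A B C f g \<in> ring_hom C TR"
  by (rule ring_hom_memI)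
    (auto simp: tensor_right_def pure_closed pure_mult pure_add_right pure_one)

lemma left_right_commute: "a \<in> carrier A \<Longrightarrow> tensor_left A B C f g (f a) = tensor_right A B C f g (g a)"
  using pure_balanced[of a "\<one>\<^bsub>B\<^esub>" "\<one>\<^bsub>C\<^esub>"] ring_hom_closed[OF f] ring_hom_closed[OF g]
  by (simp add: tensor_left_def tensor_right_def)

lemma pure_left_right:
  "\<lbrakk>b \<in> carrier B; c \<in> carrier C\<rbrakk> \<Longrightarrow> pure b c = tensor_left A B C f g b \<otimes>\<^bsub>TR\<^esub> tensor_right A B C f g c"
  by (simp add: tensor_left_def tensor_right_def pure_mult)

lemma tensor_induct [consumes 1, case_names zero pure diff]:
  assumes "x \<in> carrier TR" and zero: "P \<zero>\<^bsub>TR\<^esub>"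
    and pure: "\<And>b c. b \<in> carrier B \<Longrightarrow> c \<in> carrier C \<Longrightarrow> P (pure b c)"
    and diff: "\<And>x y. x \<in> carrier TR \<Longrightarrow> y \<in> carrier TR \<Longrightarrow> P x \<Longrightarrow> P y \<Longrightarrow> P (x \<ominus>\<^bsub>TR\<^esub> y)"
  shows "P x"
proof -
  obtain p where p: "Poly_Mapping.keys p \<subseteq> pairs" "x = cls p" using assms(1) tensor_carrier by blast
  have "Poly_Mapping.keys p \<subseteq> pairs \<and> P (cls p)"
    using p(1)
  proof (induction p rule: pair_ring_induct)
    case zero then show ?case using \<open>P \<zero>\<^bsub>TR\<^esub>\<close> by (simp add: cls_zero)
  next
    case (one b c) then show ?case using pure[of b c] by (simp add: pure_eq)
  next
    case (diff p q)
    then have k: "Poly_Mapping.keys p \<subseteq> pairs" "Poly_Mapping.keys q \<subseteq> pairs" "P (cls p)" "P (cls q)" by auto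
    then show ?case using assms(4)[OF cls_simps(1)[OF k(1,1)] cls_simps(1)[OF k(2,2)]] cls_simps(5)[OF k(1,2)]
      by (simp add: keys_diff_subset)
  qed
  then show ?thesis using p by simp
qed

end

lemma cring_cong:
  fixes R :: "('a, 'm) ring_scheme" and R' :: "('a, 'n) ring_scheme"
  assumes "cring R" and eq: "carrier R' = carrier R" "monoid.mult R' = monoid.mult R" "one R' = one R"
    "ring.add R' = ring.add R" "ring.zero R' = ring.zero R"
  shows "cring R'"
proof -
  interpret R: cring R by fact
  show ?thesis
  proof (rule cringI)
    show "abelian_group R'"
      by (rule abelian_groupI) (auto simp: eq R.a_ac intro: bexI[of _ "\<ominus>\<^bsub>R\<^esub> _"] R.l_neg)
    show "comm_monoid R'"
      by (rule comm_monoidI) (simp_all add: eq R.m_ac)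
    show "(x \<oplus>\<^bsub>R'\<^esub> y) \<otimes>\<^bsub>R'\<^esub> z = x \<otimes>\<^bsub>R'\<^esub> z \<oplus>\<^bsub>R'\<^esub> y \<otimes>\<^bsub>R'\<^esub> z"
      if "x \<in> carrier R'" "y \<in> carrier R'" "z \<in> carrier R'" for x y z
      using that by (simp add: eq R.l_distr)
  qed
qed

lemma reified_order_cong:
  fixes R :: "('a, 'm) ring_scheme" and R' :: "('a, 'n) ring_scheme"
  assumes ord: "reified_order R Q" and R': "cring R'"
    and eq: "carrier R' = carrier R" "monoid.mult R' = monoid.mult R" "one R' = one R"
    "ring.add R' = ring.add R" "ring.zero R' = ring.zero R"
  shows "reified_order R' Q"
  unfolding reified_order_def reified_order_axioms_def eq
  by (rule conjI[OF R' conjunct2[OF ord[unfolded reified_order_def reified_order_axioms_def]]])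

text \<open>Let \<open>a\<close> and \<open>b\<close> decrease to \<open>A\<close> and
  \<open>B\<close>. The slack is required because the infimum in the tensor seminorm may fail to be
  attained.\<close>

lemma le_mult_limit:
  fixes x :: real
  assumes "0 \<le> A" "0 \<le> B" "\<And>a b. A < a \<Longrightarrow> B < b \<Longrightarrow> x \<le> a * b"
  shows "x \<le> A * B"
proof (rule tendsto_lowerbound)
  show "((\<lambda>e. (A + e) * (B + e)) \<longlongrightarrow> A * B) (at_right 0)"
    by (rule tendsto_eq_rhs[of _ "(A + 0) * (B + 0)"]) (intro tendsto_intros, simp)
  show "\<forall>\<^sub>F e in at_right 0. x \<le> (A + e) * (B + e)"
    unfolding eventually_at_right_field using assms(3) by (intro exI[of _ 1]) auto
qed simp

section \<open>The tensor product seminorm\<close>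

locale normed_tensor = tensor A B C f g + NB: nonarch_seminormed_ring B + NC: nonarch_seminormed_ring C
  for A :: "('a, 'm) snring_scheme" and B :: "('b, 'n) snring_scheme" and C :: "('c, 'k) snring_scheme" and f g
begin

abbreviation "DR \<equiv> tensor_snring A B C f g"
abbreviation "TN \<equiv> tensor_snorm A B C f g"

lemma pure_zero_left: "c \<in> carrier C \<Longrightarrow> pure \<zero>\<^bsub>B\<^esub> c = \<zero>\<^bsub>TR\<^esub>"
  using pure_add_left[of "\<zero>\<^bsub>B\<^esub>" "\<zero>\<^bsub>B\<^esub>" c] pure_closed[of "\<zero>\<^bsub>B\<^esub>" c]
  by (simp add: T.add.r_cancel_one)

lemma pure_minus_left:
  assumes "b \<in> carrier B" "c \<in> carrier C"
  shows "pure (\<ominus>\<^bsub>B\<^esub> b) c = \<ominus>\<^bsub>TR\<^esub> pure b c"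
proof -
  have "pure (\<ominus>\<^bsub>B\<^esub> b) c \<oplus>\<^bsub>TR\<^esub> pure b c = \<zero>\<^bsub>TR\<^esub>"
    using pure_add_left[of "\<ominus>\<^bsub>B\<^esub> b" b c] pure_zero_left assms by (simp add: B.l_neg)
  then show ?thesis using T.minus_equality pure_closed assms by fastforce
qed

text \<open>Tensors with a presentation whose terms all have size at most \<open>t\<close>. The
  inductive form gives easy access to sums and products, and the tensor seminorm is the infimum of
  the nonnegative \<open>t\<close> that occur.\<close>

inductive_set presented :: "real \<Rightarrow> (('b \<times> 'c) \<Rightarrow>\<^sub>0 int) set set" for t where
  presented_zero: "\<zero>\<^bsub>TR\<^esub> \<in> presented t"
| presented_add: "\<lbrakk>x \<in> presented t; b \<in> carrier B; c \<in> carrier C; snorm B b * snorm C c \<le> t\<rbrakk> \<Longrightarrow>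
     x \<oplus>\<^bsub>TR\<^esub> pure b c \<in> presented t"

lemma presented_carrier: "x \<in> presented t \<Longrightarrow> x \<in> carrier TR"
  by (induction rule: presented.induct) (auto simp: pure_closed)

lemma presented_mono:
  assumes "x \<in> presented t" "t \<le> u"
  shows "x \<in> presented u"
  using assms(1) by induction (use assms(2) in \<open>auto intro: presented.intros\<close>)

lemma presented_plus:
  assumes x: "x \<in> presented t" and "y \<in> presented t"
  shows "x \<oplus>\<^bsub>TR\<^esub> y \<in> presented t"
  using assms(2)
proof induction
  case presented_zero then show ?case using x presented_carrier by simp
next
  case (presented_add y b c)
  have "x \<oplus>\<^bsub>TR\<^esub> (y \<oplus>\<^bsub>TR\<^esub> pure b c) = (x \<oplus>\<^bsub>TR\<^esub> y) \<oplus>\<^bsub>TR\<^esub> pure b c"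
    using presented_carrier x presented_add by (simp add: T.a_assoc pure_closed)
  then show ?case using presented_add presented.presented_add by simp
qed

lemma presented_pure: "\<lbrakk>b \<in> carrier B; c \<in> carrier C; snorm B b * snorm C c \<le> t\<rbrakk> \<Longrightarrow> pure b c \<in> presented t"
  using presented_add[OF presented_zero, of b c t] pure_closed by simp

lemma presented_mult:
  assumes x: "x \<in> presented t" and y: "y \<in> presented u" and t: "0 \<le> t" "0 \<le> u"
  shows "x \<otimes>\<^bsub>TR\<^esub> y \<in> presented (t * u)"
  using x
proof induction
  case presented_zero then show ?case using y presented_carrier presented.presented_zero by simp
next
  case (presented_add x b c)
  have "pure b c \<otimes>\<^bsub>TR\<^esub> y \<in> presented (t * u)"
    using y
  proof induction
    case presented_zero
    then show ?case using presented_add pure_closed presented.presented_zero by simp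
  next
    case (presented_add y b' c')
    note 1 = \<open>b \<in> carrier B\<close> \<open>c \<in> carrier C\<close> \<open>snorm B b * snorm C c \<le> t\<close>
    have "snorm B (b \<otimes>\<^bsub>B\<^esub> b') * snorm C (c \<otimes>\<^bsub>C\<^esub> c') \<le> (snorm B b * snorm B b') * (snorm C c * snorm C c')"
      using 1 presented_add NB.snorm_mult NC.snorm_mult NB.snorm_nonneg NC.snorm_nonneg by (intro mult_mono) auto
    also have "\<dots> = (snorm B b * snorm C c) * (snorm B b' * snorm C c')" by simp
    also have "\<dots> \<le> t * u"
      using 1 presented_add t NB.snorm_nonneg NC.snorm_nonneg by (intro mult_mono) auto
    finally have "pure b c \<otimes>\<^bsub>TR\<^esub> pure b' c' \<in> presented (t * u)"
      using 1 presented_add by (simp add: pure_mult presented_pure)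
    moreover have "pure b c \<otimes>\<^bsub>TR\<^esub> (y \<oplus>\<^bsub>TR\<^esub> pure b' c') = pure b c \<otimes>\<^bsub>TR\<^esub> y \<oplus>\<^bsub>TR\<^esub> pure b c \<otimes>\<^bsub>TR\<^esub> pure b' c'"
      using 1 presented_add presented_carrier by (simp add: T.r_distr pure_closed)
    ultimately show ?case using presented_add presented_plus by simp
  qed
  moreover have "(x \<oplus>\<^bsub>TR\<^esub> pure b c) \<otimes>\<^bsub>TR\<^esub> y = x \<otimes>\<^bsub>TR\<^esub> y \<oplus>\<^bsub>TR\<^esub> pure b c \<otimes>\<^bsub>TR\<^esub> y"
    using presented_add presented_carrier y by (simp add: T.l_distr pure_closed)
  ultimately show ?case using presented_add presented_plus by simp
qed

text \<open>The bound may grow, since negating \<open>b\<close> can change its seminorm. Some bound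
  is enough to see that every tensor has a presentation.\<close>

lemma presented_minus:
  assumes "x \<in> presented t"
  shows "\<exists>u. \<ominus>\<^bsub>TR\<^esub> x \<in> presented u"
  using assms
proof induction
  case presented_zero
  then show ?case using presented.presented_zero by auto
next
  case (presented_add x b c)
  then obtain u where u: "\<ominus>\<^bsub>TR\<^esub> x \<in> presented u" by blast
  let ?w = "max u (snorm B (\<ominus>\<^bsub>B\<^esub> b) * snorm C c)"
  have "\<ominus>\<^bsub>TR\<^esub> x \<oplus>\<^bsub>TR\<^esub> pure (\<ominus>\<^bsub>B\<^esub> b) c \<in> presented ?w"
    using presented_add presented_mono[OF u, of ?w] by (intro presented.presented_add) auto
  moreover have "\<ominus>\<^bsub>TR\<^esub> (x \<oplus>\<^bsub>TR\<^esub> pure b c) = \<ominus>\<^bsub>TR\<^esub> x \<oplus>\<^bsub>TR\<^esub> pure (\<ominus>\<^bsub>B\<^esub> b) c"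
    using presented_add presented_carrier by (simp add: pure_minus_left pure_closed T.minus_add)
  ultimately show ?case by metis
qed

lemma presented_exists:
  assumes "x \<in> carrier TR"
  shows "\<exists>t\<ge>0. x \<in> presented t"
proof -
  have "\<exists>t. x \<in> presented t"
    using assms
  proof (induction rule: tensor_induct)
    case zero then show ?case using presented_zero by blast
  next
    case (pure b c) then show ?case using presented_pure by blast
  next
    case (diff x y)
    then obtain t u where t: "x \<in> presented t" "\<ominus>\<^bsub>TR\<^esub> y \<in> presented u" using presented_minus by blast
    have "x \<oplus>\<^bsub>TR\<^esub> \<ominus>\<^bsub>TR\<^esub> y \<in> presented (max t u)"
      using presented_mono[OF t(1)] presented_mono[OF t(2)] by (intro presented_plus) auto
    then show ?case by (auto simp: a_minus_def)
  qed
  then obtain t where "x \<in> presented t" by blast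
  then have "x \<in> presented (max t 0)" by (rule presented_mono) simp
  then show ?thesis by (intro exI[of _ "max t 0"]) simp
qed

lemma presented_iff:
  "x \<in> presented t \<longleftrightarrow> (\<exists>(n::nat) y z. y \<in> {..<n} \<rightarrow> carrier B \<and> z \<in> {..<n} \<rightarrow> carrier C \<and>
     (\<forall>i<n. snorm B (y i) * snorm C (z i) \<le> t) \<and> x = (\<Oplus>\<^bsub>TR\<^esub>i\<in>{..<n}. pure (y i) (z i)))"
proof
  assume "x \<in> presented t"
  then show "\<exists>(n::nat) y z. y \<in> {..<n} \<rightarrow> carrier B \<and> z \<in> {..<n} \<rightarrow> carrier C \<and>
     (\<forall>i<n. snorm B (y i) * snorm C (z i) \<le> t) \<and> x = (\<Oplus>\<^bsub>TR\<^esub>i\<in>{..<n}. pure (y i) (z i))"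
  proof induction
    case presented_zero
    show ?case by (intro exI[of _ 0]) auto
  next
    case (presented_add x b c)
    then obtain n :: nat and y z where n: "y \<in> {..<n} \<rightarrow> carrier B" "z \<in> {..<n} \<rightarrow> carrier C"
      "\<forall>i<n. snorm B (y i) * snorm C (z i) \<le> t" "x = (\<Oplus>\<^bsub>TR\<^esub>i\<in>{..<n}. pure (y i) (z i))" by blast
    let ?y = "y(n := b)" and ?z = "z(n := c)"
    have cl: "(\<lambda>i. pure (?y i) (?z i)) \<in> {..<n} \<rightarrow> carrier TR" using n by (auto intro!: pure_closed)
    have "(\<Oplus>\<^bsub>TR\<^esub>i\<in>{..<Suc n}. pure (?y i) (?z i)) = pure b c \<oplus>\<^bsub>TR\<^esub> (\<Oplus>\<^bsub>TR\<^esub>i\<in>{..<n}. pure (?y i) (?z i))"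
      unfolding lessThan_Suc using T.finsum_insert[OF _ _ cl, of n] presented_add by (simp add: pure_closed)
    also have "(\<Oplus>\<^bsub>TR\<^esub>i\<in>{..<n}. pure (?y i) (?z i)) = x"
      unfolding n(4) by (rule T.finsum_cong') (use n in \<open>auto intro!: pure_closed\<close>)
    finally have "x \<oplus>\<^bsub>TR\<^esub> pure b c = (\<Oplus>\<^bsub>TR\<^esub>i\<in>{..<Suc n}. pure (?y i) (?z i))"
      using presented_add presented_carrier by (simp add: T.a_comm pure_closed)
    moreover have "?y \<in> {..<Suc n} \<rightarrow> carrier B" "?z \<in> {..<Suc n} \<rightarrow> carrier C"
      "\<forall>i<Suc n. snorm B (?y i) * snorm C (?z i) \<le> t" using n presented_add by (auto simp: less_Suc_eq)
    ultimately show ?case by blast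
  qed
next
  assume "\<exists>(n::nat) y z. y \<in> {..<n} \<rightarrow> carrier B \<and> z \<in> {..<n} \<rightarrow> carrier C \<and>
     (\<forall>i<n. snorm B (y i) * snorm C (z i) \<le> t) \<and> x = (\<Oplus>\<^bsub>TR\<^esub>i\<in>{..<n}. pure (y i) (z i))"
  then obtain n :: nat and y z where n: "y \<in> {..<n} \<rightarrow> carrier B" "z \<in> {..<n} \<rightarrow> carrier C"
      "\<forall>i<n. snorm B (y i) * snorm C (z i) \<le> t" and x: "x = (\<Oplus>\<^bsub>TR\<^esub>i\<in>{..<n}. pure (y i) (z i))" by blast
  have "(\<Oplus>\<^bsub>TR\<^esub>i\<in>{..<n}. pure (y i) (z i)) \<in> presented t"
    using n
  proof (induction n)
    case 0 then show ?case using presented_zero by simp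
  next
    case (Suc n)
    have cl: "(\<lambda>i. pure (y i) (z i)) \<in> {..<n} \<rightarrow> carrier TR" "y n \<in> carrier B" "z n \<in> carrier C"
      using Suc.prems by (auto intro!: pure_closed)
    have "(\<Oplus>\<^bsub>TR\<^esub>i\<in>{..<Suc n}. pure (y i) (z i)) = pure (y n) (z n) \<oplus>\<^bsub>TR\<^esub> (\<Oplus>\<^bsub>TR\<^esub>i\<in>{..<n}. pure (y i) (z i))"
      unfolding lessThan_Suc using T.finsum_insert[OF _ _ cl(1), of n] cl by (simp add: pure_closed)
    also have "\<dots> = (\<Oplus>\<^bsub>TR\<^esub>i\<in>{..<n}. pure (y i) (z i)) \<oplus>\<^bsub>TR\<^esub> pure (y n) (z n)"
      using cl T.finsum_closed[OF cl(1)] by (simp add: T.a_comm pure_closed)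
    also have "\<dots> \<in> presented t"
    proof (rule presented_add[OF Suc.IH])
      show "y \<in> {..<n} \<rightarrow> carrier B" "z \<in> {..<n} \<rightarrow> carrier C" using Suc.prems by auto
    qed (use Suc.prems cl in auto)
    finally show ?case .
  qed
  then show "x \<in> presented t" using x by simp
qed

text \<open>The bridge between the set in \<open>tensor_snorm\<close> and \<open>presented\<close>:
  members of the set bound a presentation, and each nonnegative bound of a presentation is at least
  some member.\<close>

lemma snorm_set:
  fixes x
  defines "S \<equiv> {Max (insert 0 ((\<lambda>i. snorm B (y i) * snorm C (z i)) ` {..<n})) | (n::nat) y z.
            y \<in> {..<n} \<rightarrow> carrier B \<and> z \<in> {..<n} \<rightarrow> carrier C \<and> x = (\<Oplus>\<^bsub>TR\<^esub>i\<in>{..<n}. pure (y i) (z i))}"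
  shows "TN x = Inf S" "t \<in> S \<Longrightarrow> 0 \<le> t \<and> x \<in> presented t" "x \<in> presented t \<Longrightarrow> 0 \<le> t \<Longrightarrow> \<exists>u\<in>S. u \<le> t"
proof -
  show "TN x = Inf S" by (simp add: tensor_snorm_def S_def)
  show "0 \<le> t \<and> x \<in> presented t" if tS: "t \<in> S"
  proof -
    obtain n :: nat and y z where n: "t = Max (insert 0 ((\<lambda>i. snorm B (y i) * snorm C (z i)) ` {..<n}))"
      "y \<in> {..<n} \<rightarrow> carrier B" "z \<in> {..<n} \<rightarrow> carrier C" "x = (\<Oplus>\<^bsub>TR\<^esub>i\<in>{..<n}. pure (y i) (z i))"
      using tS unfolding S_def by blast
    have "0 \<le> t" unfolding n(1) by (intro Max_ge) auto
    moreover have "snorm B (y i) * snorm C (z i) \<le> t" if "i < n" for i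
      unfolding n(1) using that by (intro Max_ge) auto
    ultimately show ?thesis unfolding presented_iff using n by blast
  qed
  show "\<exists>u\<in>S. u \<le> t" if x: "x \<in> presented t" and t: "0 \<le> t"
  proof -
    obtain n :: nat and y z where n: "y \<in> {..<n} \<rightarrow> carrier B" "z \<in> {..<n} \<rightarrow> carrier C"
      "\<forall>i<n. snorm B (y i) * snorm C (z i) \<le> t" "x = (\<Oplus>\<^bsub>TR\<^esub>i\<in>{..<n}. pure (y i) (z i))"
      using x unfolding presented_iff by blast
    have "Max (insert 0 ((\<lambda>i. snorm B (y i) * snorm C (z i)) ` {..<n})) \<in> S" unfolding S_def using n by blast
    moreover have "Max (insert 0 ((\<lambda>i. snorm B (y i) * snorm C (z i)) ` {..<n})) \<le> t" using n t by auto
    ultimately show ?thesis by blast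
  qed
qed

lemma snorm_le: "x \<in> presented t \<Longrightarrow> 0 \<le> t \<Longrightarrow> TN x \<le> t"
proof -
  assume "x \<in> presented t" "0 \<le> t"
  then obtain u where u: "u \<in> {Max (insert 0 ((\<lambda>i. snorm B (y i) * snorm C (z i)) ` {..<n})) | (n::nat) y z.
            y \<in> {..<n} \<rightarrow> carrier B \<and> z \<in> {..<n} \<rightarrow> carrier C \<and> x = (\<Oplus>\<^bsub>TR\<^esub>i\<in>{..<n}. pure (y i) (z i))}" "u \<le> t"
    using snorm_set(3) by blast
  have "TN x \<le> u" unfolding snorm_set(1) using u(1) snorm_set(2) by (intro cInf_lower bdd_belowI[of _ 0]) auto
  then show "TN x \<le> t" using u by simp
qed

lemma snorm_nonneg: "x \<in> carrier TR \<Longrightarrow> 0 \<le> TN x"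
  unfolding snorm_set(1) using presented_exists[of x] snorm_set(2,3)[where x = x] by (intro cInf_greatest) fastforce+

lemma snorm_less: "x \<in> carrier TR \<Longrightarrow> TN x < t \<Longrightarrow> x \<in> presented t"
proof -
  assume x: "x \<in> carrier TR" "TN x < t"
  let ?S = "{Max (insert 0 ((\<lambda>i. snorm B (y i) * snorm C (z i)) ` {..<n})) | (n::nat) y z.
            y \<in> {..<n} \<rightarrow> carrier B \<and> z \<in> {..<n} \<rightarrow> carrier C \<and> x = (\<Oplus>\<^bsub>TR\<^esub>i\<in>{..<n}. pure (y i) (z i))}"
  have "?S \<noteq> {}" using presented_exists[OF x(1)] snorm_set(3)[of x] by blast
  moreover have "bdd_below ?S" using snorm_set(2) by (intro bdd_belowI[of _ 0]) auto
  ultimately obtain u where u: "u \<in> ?S" "u < t" using x(2) unfolding snorm_set(1) by (meson cInf_less_iff)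
  then show "x \<in> presented t" using snorm_set(2) presented_mono by (meson less_imp_le)
qed

lemma DR_simps: "carrier DR = carrier TR" "monoid.mult DR = monoid.mult TR" "one DR = one TR"
  "ring.add DR = ring.add TR" "ring.zero DR = ring.zero TR" "snorm DR = TN"
  by (simp_all add: tensor_snring_def ring.defs snring.defs)

lemma nonarch_tensor: "nonarch_seminormed_ring DR"
proof -
  interpret D: cring DR by (rule cring_cong[OF cring_tensor_ring]) (simp_all add: DR_simps)
  show ?thesis
  proof (unfold_locales, unfold DR_simps)
    fix x assume x: "x \<in> carrier TR"
    show "0 \<le> TN x" by (rule snorm_nonneg[OF x])
    fix y assume y: "y \<in> carrier TR"
    show "TN (x \<oplus>\<^bsub>TR\<^esub> y) \<le> max (TN x) (TN y)"
    proof (rule field_le_epsilon)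
      fix e :: real assume e: "0 < e"
      have "x \<oplus>\<^bsub>TR\<^esub> y \<in> presented (max (TN x) (TN y) + e)"
        using x y e by (intro presented_plus snorm_less) auto
      then show "TN (x \<oplus>\<^bsub>TR\<^esub> y) \<le> max (TN x) (TN y) + e"
        using snorm_nonneg[OF x] e by (intro snorm_le) auto
    qed
    show "TN (x \<otimes>\<^bsub>TR\<^esub> y) \<le> TN x * TN y"
    proof (rule le_mult_limit)
      fix a b assume ab: "TN x < a" "TN y < b"
      have "0 \<le> a" "0 \<le> b" using ab snorm_nonneg[OF x] snorm_nonneg[OF y] by auto
      then show "TN (x \<otimes>\<^bsub>TR\<^esub> y) \<le> a * b"
        using ab x y by (intro snorm_le presented_mult snorm_less) auto
    qed (use snorm_nonneg x y in auto)
  next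
    show "TN \<zero>\<^bsub>TR\<^esub> = 0"
      using snorm_le[OF presented_zero, of 0] snorm_nonneg[of "\<zero>\<^bsub>TR\<^esub>"] by simp
  qed
qed

lemma left_bounded: "bounded_hom B DR (tensor_left A B C f g)"
proof -
  have "TN (tensor_left A B C f g b) \<le> (snorm C \<one>\<^bsub>C\<^esub> + 1) * snorm B b" if b: "b \<in> carrier B" for b
  proof -
    have nn: "0 \<le> snorm B b" "0 \<le> snorm C \<one>\<^bsub>C\<^esub>" using b NB.snorm_nonneg NC.snorm_nonneg by auto
    have "TN (pure b \<one>\<^bsub>C\<^esub>) \<le> snorm B b * snorm C \<one>\<^bsub>C\<^esub>"
      using b nn by (intro snorm_le presented_pure) auto
    also have "\<dots> \<le> (snorm C \<one>\<^bsub>C\<^esub> + 1) * snorm B b" using nn by (simp add: algebra_simps)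
    finally show ?thesis by (simp add: tensor_left_def)
  qed
  moreover have "0 < snorm C \<one>\<^bsub>C\<^esub> + 1" using NC.snorm_nonneg[of "\<one>\<^bsub>C\<^esub>"] by simp
  moreover have "tensor_left A B C f g \<in> ring_hom B DR"
    using left_hom by (simp add: ring_hom_def DR_simps)
  ultimately show ?thesis unfolding bounded_hom_def DR_simps by blast
qed

lemma right_bounded: "bounded_hom C DR (tensor_right A B C f g)"
proof -
  have "TN (tensor_right A B C f g c) \<le> (snorm B \<one>\<^bsub>B\<^esub> + 1) * snorm C c" if c: "c \<in> carrier C" for c
  proof -
    have nn: "0 \<le> snorm C c" "0 \<le> snorm B \<one>\<^bsub>B\<^esub>" using c NB.snorm_nonneg NC.snorm_nonneg by auto
    have "TN (pure \<one>\<^bsub>B\<^esub> c) \<le> snorm B \<one>\<^bsub>B\<^esub> * snorm C c"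
      using c nn by (intro snorm_le presented_pure) auto
    also have "\<dots> \<le> (snorm B \<one>\<^bsub>B\<^esub> + 1) * snorm C c" using nn by (simp add: algebra_simps)
    finally show ?thesis by (simp add: tensor_right_def)
  qed
  moreover have "0 < snorm B \<one>\<^bsub>B\<^esub> + 1" using NB.snorm_nonneg[of "\<one>\<^bsub>B\<^esub>"] by simp
  moreover have "tensor_right A B C f g \<in> ring_hom C DR"
    using right_hom by (simp add: ring_hom_def DR_simps)
  ultimately show ?thesis unfolding bounded_hom_def DR_simps by blast
qed

end

text \<open>Prepares for \<open>gr_homog_integral\<close>, which asks for the class of the
  negative.\<close>

lemma affinoid_gr_minus:
  assumes "affinoid_seminormed_ring B" "0 < r" "b \<in> plus_part B r"
  shows "gr_homog B r (gr_class B r (\<ominus>\<^bsub>B\<^esub> b)) \<in> gr_sub B"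
proof -
  interpret B: affinoid_seminormed_ring B by fact
  interpret Gr: abelian_group "Gr B" by (rule B.abelian_group_Gr)
  have b: "b \<in> circ B r" "gr_homog B r (gr_class B r b) \<in> gr_sub B" using assms by (auto simp: plus_part_def)
  interpret S: subring "gr_sub B" "Gr B" using B.graded by (simp add: graded_subring_def)
  have m: "\<ominus>\<^bsub>B\<^esub> b \<in> circ B r" by (rule B.circ_minus[OF assms(2) b(1)])
  have "gr_homog B r (gr_class B r (\<ominus>\<^bsub>B\<^esub> b)) \<oplus>\<^bsub>Gr B\<^esub> gr_homog B r (gr_class B r b) = \<zero>\<^bsub>Gr B\<^esub>"
    using B.gr_homog_add[OF assms(2) m b(1)] B.gr_homog_zero[OF assms(2)] B.circ_carrier[OF b(1)]
    by (simp add: B.l_neg)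
  then have "\<ominus>\<^bsub>Gr B\<^esub> gr_homog B r (gr_class B r b) = gr_homog B r (gr_class B r (\<ominus>\<^bsub>B\<^esub> b))"
    using Gr.minus_equality B.gr_homog_closed assms(2) b(1) m by blast
  then show ?thesis using S.m_inv_closed[OF b(2)] by (simp add: a_inv_def)
qed

lemma affinoid_gr_component:
  assumes "affinoid_seminormed_ring B" "y \<in> gr_sub B" "0 < s"
  obtains b where "b \<in> plus_part B s" "y s = gr_class B s b"
proof -
  interpret B: affinoid_seminormed_ring B by fact
  interpret S: subring "gr_sub B" "Gr B" using B.graded by (simp add: graded_subring_def)
  have "y \<in> carrier (Gr B)" using S.subset assms(2) by auto
  then have "y s \<in> gr_class B s ` circ B s" unfolding B.carrier_Gr using assms(3) by blast
  then obtain b where b: "b \<in> circ B s" "y s = gr_class B s b" by (elim imageE)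
  moreover have "gr_homog B s (y s) \<in> gr_sub B" using B.graded assms by (simp add: graded_subring_def)
  ultimately show thesis using that[of b] by (simp add: plus_part_def)
qed

text \<open>\<open>tensor_affinoid\<close> extends the record \<open>tensor_snring\<close> by a
  field, so the two have different types and the derived notions have to be transferred between
  them.\<close>

lemma snring_cong:
  fixes R :: "('a, 'm) snring_scheme" and R' :: "('a, 'n) snring_scheme"
  assumes eq: "carrier R' = carrier R" "monoid.mult R' = monoid.mult R" "one R' = one R"
    "ring.add R' = ring.add R" "ring.zero R' = ring.zero R" "snorm R' = snorm R"
  shows "circ R' r = circ R r" "circcirc R' r = circcirc R r" "gr_class R' r a = gr_class R r a"
    "gr_homog R' r P = gr_homog R r P"
proof -
  have p: "a [^]\<^bsub>R'\<^esub> (n::nat) = a [^]\<^bsub>R\<^esub> n" for a n by (simp add: nat_pow_def eq)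
  show "circ R' r = circ R r" by (simp add: circ_def eq p)
  have cc: "circcirc R' r = circcirc R r" for r by (simp add: circcirc_def eq p)
  show "circcirc R' r = circcirc R r" by (rule cc)
  show "gr_class R' r a = gr_class R r a" by (simp add: a_r_coset_def r_coset_def eq cc)
  show "gr_homog R' r P = gr_homog R r P" unfolding gr_homog_def cc by (rule refl)
qed

section \<open>The affinoid structure of the tensor product\<close>

locale affinoid_tensor = normed_tensor A B C f g + BA: affinoid_seminormed_ring B + CA: affinoid_seminormed_ring C
  for A :: "'a affinoid" and B :: "'b affinoid" and C :: "'c affinoid" and f g
begin

abbreviation "DA \<equiv> tensor_affinoid A B C f g"
abbreviation "IM \<equiv> tensor_gr_image A B C f g"

sublocale D: nonarch_seminormed_ring DR by (rule nonarch_tensor)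

lemma DA_simps: "carrier DA = carrier DR" "monoid.mult DA = monoid.mult DR" "one DA = one DR"
  "ring.add DA = ring.add DR" "ring.zero DA = ring.zero DR" "snorm DA = snorm DR"
  "gr_sub DA = integral_closure (Gr DR) IM"
  by (simp_all add: tensor_affinoid_def snring.defs affinoid.defs Let_def)

lemma DA_cong: "circ DA r = circ DR r" "circcirc DA r = circcirc DR r" "gr_class DA r a = gr_class DR r a"
    "gr_homog DA r P = gr_homog DR r P"
  by (rule snring_cong; simp add: DA_simps)+

lemma cring_DA: "cring DA"
  by (rule cring_cong[OF D.cring_axioms]) (simp_all add: DA_simps)

lemma nonarch_DA: "nonarch_seminormed_ring DA"
proof -
  interpret DA: cring DA by (rule cring_DA)
  show ?thesis
    by unfold_locales (use D.snorm_nonneg D.snorm_zero D.snorm_add D.snorm_mult in \<open>auto simp: DA_simps\<close>)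
qed

lemma left_bounded_DA: "bounded_hom B DA (tensor_left A B C f g)"
  using left_bounded by (simp add: bounded_hom_def DA_simps ring_hom_def)

lemma right_bounded_DA: "bounded_hom C DA (tensor_right A B C f g)"
  using right_bounded by (simp add: bounded_hom_def DA_simps ring_hom_def)

lemma plus_part_DA:
  "d \<in> plus_part DA r \<longleftrightarrow> d \<in> circ DR r \<and> gr_homog DR r (gr_class DR r d) \<in> integral_closure (Gr DR) IM"
  unfolding plus_part_def DA_cong(3) unfolding DA_cong DA_simps(7) by simp

lemma gr_image_single:
  assumes "y \<in> gr_sub B" "z \<in> gr_sub C"
    and "gr_map DR (tensor_left A B C f g) y \<otimes>\<^bsub>Gr DR\<^esub> gr_map DR (tensor_right A B C f g) z = x"
    and "x \<in> carrier (Gr DR)"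
  shows "x \<in> IM"
proof -
  interpret Gr: abelian_group "Gr DR" by (rule D.abelian_group_Gr)
  have "(\<Oplus>\<^bsub>Gr DR\<^esub>i\<in>{..<1::nat}. gr_map DR (tensor_left A B C f g) y \<otimes>\<^bsub>Gr DR\<^esub> gr_map DR (tensor_right A B C f g) z) = x"
    using assms(3,4) by (simp add: lessThan_Suc)
  then show ?thesis unfolding tensor_gr_image_def Let_def using assms(1,2)
    by (intro CollectI exI[of _ "1::nat"] exI[of _ "\<lambda>_. y"] exI[of _ "\<lambda>_. z"]) auto
qed

lemma one_gr_sub: "gr_homog B 1 (gr_class B 1 \<one>\<^bsub>B\<^esub>) \<in> gr_sub B" "gr_homog C 1 (gr_class C 1 \<one>\<^bsub>C\<^esub>) \<in> gr_sub C"
proof -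
  interpret SB: subring "gr_sub B" "Gr B" using BA.graded by (simp add: graded_subring_def)
  interpret SC: subring "gr_sub C" "Gr C" using CA.graded by (simp add: graded_subring_def)
  show "gr_homog B 1 (gr_class B 1 \<one>\<^bsub>B\<^esub>) \<in> gr_sub B" using SB.one_closed by (simp add: NB.Gr_simps)
  show "gr_homog C 1 (gr_class C 1 \<one>\<^bsub>C\<^esub>) \<in> gr_sub C" using SC.one_closed by (simp add: NC.Gr_simps)
qed

text \<open>The class of the image of \<open>b\<close> is integral over the graded image, because
  the class of its negative is the image of a pure tensor whose second factor is the unit of the
  graded ring.\<close>

lemma left_plus_part:
  assumes r: "0 < r" and b: "b \<in> plus_part B r"
  shows "tensor_left A B C f g b \<in> plus_part DA r"
proof -
  let ?l = "tensor_left A B C f g" and ?k = "tensor_right A B C f g"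
  note NBx = NB.nonarch_seminormed_ring_axioms and NCx = NC.nonarch_seminormed_ring_axioms
    and ND = D.nonarch_seminormed_ring_axioms
  have bc: "b \<in> circ B r" using b by (simp add: plus_part_def)
  have mb: "\<ominus>\<^bsub>B\<^esub> b \<in> circ B r" by (rule NB.circ_minus[OF r bc])
  have lb: "?l b \<in> circ DR r" "?l (\<ominus>\<^bsub>B\<^esub> b) \<in> circ DR r"
    using bounded_hom_circ(1)[OF NBx ND left_bounded r] bc mb by auto
  have k1: "?k \<one>\<^bsub>C\<^esub> = \<one>\<^bsub>DR\<^esub>" using right_bounded ring_hom_one by (auto simp: bounded_hom_def)
  have lm: "?l (\<ominus>\<^bsub>B\<^esub> b) = \<ominus>\<^bsub>DR\<^esub> ?l b"
  proof -
    interpret h: ring_hom_ring B DR ?l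
      using left_bounded by (intro ring_hom_ringI2) (auto simp: bounded_hom_def B.ring_axioms D.ring_axioms)
    show ?thesis using NB.circ_carrier[OF bc] by simp
  qed
  have "gr_map DR ?l (gr_homog B r (gr_class B r (\<ominus>\<^bsub>B\<^esub> b))) \<otimes>\<^bsub>Gr DR\<^esub> gr_map DR ?k (gr_homog C 1 (gr_class C 1 \<one>\<^bsub>C\<^esub>))
      = gr_homog DR r (gr_class DR r (\<ominus>\<^bsub>DR\<^esub> ?l b))"
    using gr_map_homog[OF NBx ND left_bounded r mb] gr_map_homog[OF NCx ND right_bounded zero_less_one NC.one_circ]
      D.gr_homog_mult[OF r zero_less_one lb(2) D.one_circ] D.circ_carrier[OF lb(2)] by (simp add: k1 lm)
  moreover have "gr_homog DR r (gr_class DR r (\<ominus>\<^bsub>DR\<^esub> ?l b)) \<in> carrier (Gr DR)"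
    using D.gr_homog_closed[OF r lb(2)] lm by simp
  ultimately have "gr_homog DR r (gr_class DR r (\<ominus>\<^bsub>DR\<^esub> ?l b)) \<in> IM"
    using gr_image_single[OF affinoid_gr_minus[OF BA.affinoid_seminormed_ring_axioms r b] one_gr_sub(2)] by blast
  then show ?thesis unfolding plus_part_DA using lb(1) D.gr_homog_integral[OF r lb(1)] by blast
qed

lemma right_plus_part:
  assumes r: "0 < r" and c: "c \<in> plus_part C r"
  shows "tensor_right A B C f g c \<in> plus_part DA r"
proof -
  let ?l = "tensor_left A B C f g" and ?k = "tensor_right A B C f g"
  note NBx = NB.nonarch_seminormed_ring_axioms and NCx = NC.nonarch_seminormed_ring_axioms
    and ND = D.nonarch_seminormed_ring_axioms
  have cc: "c \<in> circ C r" using c by (simp add: plus_part_def)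
  have mc: "\<ominus>\<^bsub>C\<^esub> c \<in> circ C r" by (rule NC.circ_minus[OF r cc])
  have kc: "?k c \<in> circ DR r" "?k (\<ominus>\<^bsub>C\<^esub> c) \<in> circ DR r"
    using bounded_hom_circ(1)[OF NCx ND right_bounded r] cc mc by auto
  have l1: "?l \<one>\<^bsub>B\<^esub> = \<one>\<^bsub>DR\<^esub>" using left_bounded ring_hom_one by (auto simp: bounded_hom_def)
  have km: "?k (\<ominus>\<^bsub>C\<^esub> c) = \<ominus>\<^bsub>DR\<^esub> ?k c"
  proof -
    interpret h: ring_hom_ring C DR ?k
      using right_bounded by (intro ring_hom_ringI2) (auto simp: bounded_hom_def C.ring_axioms D.ring_axioms)
    show ?thesis using NC.circ_carrier[OF cc] by simp
  qed
  have "gr_map DR ?l (gr_homog B 1 (gr_class B 1 \<one>\<^bsub>B\<^esub>)) \<otimes>\<^bsub>Gr DR\<^esub> gr_map DR ?k (gr_homog C r (gr_class C r (\<ominus>\<^bsub>C\<^esub> c)))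
      = gr_homog DR r (gr_class DR r (\<ominus>\<^bsub>DR\<^esub> ?k c))"
    using gr_map_homog[OF NCx ND right_bounded r mc] gr_map_homog[OF NBx ND left_bounded zero_less_one NB.one_circ]
      D.gr_homog_mult[OF zero_less_one r D.one_circ kc(2)] D.circ_carrier[OF kc(2)] by (simp add: l1 km)
  moreover have "gr_homog DR r (gr_class DR r (\<ominus>\<^bsub>DR\<^esub> ?k c)) \<in> carrier (Gr DR)"
    using D.gr_homog_closed[OF r kc(2)] km by simp
  ultimately have "gr_homog DR r (gr_class DR r (\<ominus>\<^bsub>DR\<^esub> ?k c)) \<in> IM"
    using gr_image_single[OF one_gr_sub(1) affinoid_gr_minus[OF CA.affinoid_seminormed_ring_axioms r c]] by blast
  then show ?thesis unfolding plus_part_DA using kc(1) D.gr_homog_integral[OF r kc(1)] by blast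
qed

lemma gr_image_cases:
  assumes "x \<in> IM"
  obtains n :: nat and y z where "y \<in> {..<n} \<rightarrow> gr_sub B" "z \<in> {..<n} \<rightarrow> gr_sub C"
    "x = (\<Oplus>\<^bsub>Gr DR\<^esub>i\<in>{..<n}. gr_map DR (tensor_left A B C f g) (y i)
           \<otimes>\<^bsub>Gr DR\<^esub> gr_map DR (tensor_right A B C f g) (z i))"
  using assms unfolding tensor_gr_image_def Let_def by blast

lemma gr_sub_closed: "y \<in> gr_sub B \<Longrightarrow> y \<in> carrier (Gr B)" "z \<in> gr_sub C \<Longrightarrow> z \<in> carrier (Gr C)"
proof -
  interpret SB: subring "gr_sub B" "Gr B" using BA.graded by (simp add: graded_subring_def)
  interpret SC: subring "gr_sub C" "Gr C" using CA.graded by (simp add: graded_subring_def)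
  show "y \<in> gr_sub B \<Longrightarrow> y \<in> carrier (Gr B)" "z \<in> gr_sub C \<Longrightarrow> z \<in> carrier (Gr C)"
    using SB.subset SC.subset by auto
qed

lemma gr_map_closed_DR:
  "y \<in> gr_sub B \<Longrightarrow> gr_map DR (tensor_left A B C f g) y \<in> carrier (Gr DR)"
  "z \<in> gr_sub C \<Longrightarrow> gr_map DR (tensor_right A B C f g) z \<in> carrier (Gr DR)"
  using gr_map_closed[OF NB.nonarch_seminormed_ring_axioms D.nonarch_seminormed_ring_axioms left_bounded gr_sub_closed(1)]
    gr_map_closed[OF NC.nonarch_seminormed_ring_axioms D.nonarch_seminormed_ring_axioms right_bounded gr_sub_closed(2)]
  by auto

lemma gr_image_closed: "IM \<subseteq> carrier (Gr DR)"
proof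
  interpret Gr: abelian_group "Gr DR" by (rule D.abelian_group_Gr)
  fix x assume "x \<in> IM"
  then obtain n :: nat and y z where n: "y \<in> {..<n} \<rightarrow> gr_sub B" "z \<in> {..<n} \<rightarrow> gr_sub C"
    "x = (\<Oplus>\<^bsub>Gr DR\<^esub>i\<in>{..<n}. gr_map DR (tensor_left A B C f g) (y i)
           \<otimes>\<^bsub>Gr DR\<^esub> gr_map DR (tensor_right A B C f g) (z i))" by (rule gr_image_cases)
  show "x \<in> carrier (Gr DR)" unfolding n(3)
    using n(1,2) by (intro Gr.finsum_closed Pi_I D.gr_mult_closed gr_map_closed_DR) auto
qed

text \<open>Bounds with exponent \<open>0\<close> are stable under sums and products, and
  homogeneous components of the two graded subrings are represented by elements of
  \<open>plus_part\<close>. The unit serves as auxiliary element, with \<open>r = 1\<close>.\<close>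

lemma gr_image_bounded:
  assumes Q: "seminorm_bounded_order DR Q"
    and lQ: "\<And>r b. 0 < r \<Longrightarrow> b \<in> plus_part B r \<Longrightarrow> (r, tensor_left A B C f g b, \<one>\<^bsub>DR\<^esub>) \<in> Q"
    and kQ: "\<And>r c. 0 < r \<Longrightarrow> c \<in> plus_part C r \<Longrightarrow> (r, tensor_right A B C f g c, \<one>\<^bsub>DR\<^esub>) \<in> Q"
    and x: "x \<in> IM" and s: "0 < s" "a \<in> x s"
  shows "(s, a, \<one>\<^bsub>DR\<^esub>) \<in> Q"
proof -
  let ?l = "tensor_left A B C f g" and ?k = "tensor_right A B C f g"
  interpret Q: seminorm_bounded_order DR Q by fact
  have one: "(0::real) < 1" "(1 / 1, \<one>\<^bsub>DR\<^esub>, \<one>\<^bsub>DR\<^esub>) \<in> Q" using Q.refl_Q[of "\<one>\<^bsub>DR\<^esub>"] by auto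
  obtain n :: nat and y z where n: "y \<in> {..<n} \<rightarrow> gr_sub B" "z \<in> {..<n} \<rightarrow> gr_sub C"
    "x = (\<Oplus>\<^bsub>Gr DR\<^esub>i\<in>{..<n}. gr_map DR ?l (y i) \<otimes>\<^bsub>Gr DR\<^esub> gr_map DR ?k (z i))" using x by (rule gr_image_cases)
  have bl: "Q.gr_bounded 1 \<one>\<^bsub>DR\<^esub> 0 (gr_map DR ?l y)" if y: "y \<in> gr_sub B" for y
    unfolding Q.gr_bounded_def
  proof (intro allI impI ballI)
    fix s a assume s: "0 < s" and a: "a \<in> gr_map DR ?l y s"
    obtain b where b: "b \<in> plus_part B s" "y s = gr_class B s b"
      by (rule affinoid_gr_component[OF BA.affinoid_seminormed_ring_axioms y s])
    have bc: "b \<in> circ B s" using b by (simp add: plus_part_def)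
    have "gr_map DR ?l y s = gr_class DR s (?l b)"
      by (rule gr_map_component[where x = y, OF NB.nonarch_seminormed_ring_axioms D.nonarch_seminormed_ring_axioms left_bounded s bc b(2)])
    then obtain h where "h \<in> circcirc DR s" "a = h \<oplus>\<^bsub>DR\<^esub> ?l b" using a D.mem_gr_class by metis
    then have "(s, a, \<one>\<^bsub>DR\<^esub>) \<in> Q" using Q.add[OF Q.circcirc_le[OF s] lQ[OF s b(1)]] by simp
    then show "(s / 1 ^ 0, a, \<one>\<^bsub>DR\<^esub> [^]\<^bsub>DR\<^esub> (0::nat)) \<in> Q" by simp
  qed
  have bk: "Q.gr_bounded 1 \<one>\<^bsub>DR\<^esub> 0 (gr_map DR ?k z)" if z: "z \<in> gr_sub C" for z
    unfolding Q.gr_bounded_def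
  proof (intro allI impI ballI)
    fix s a assume s: "0 < s" and a: "a \<in> gr_map DR ?k z s"
    obtain c where c: "c \<in> plus_part C s" "z s = gr_class C s c"
      by (rule affinoid_gr_component[OF CA.affinoid_seminormed_ring_axioms z s])
    have cc: "c \<in> circ C s" using c by (simp add: plus_part_def)
    have "gr_map DR ?k z s = gr_class DR s (?k c)"
      by (rule gr_map_component[where x = z, OF NC.nonarch_seminormed_ring_axioms D.nonarch_seminormed_ring_axioms right_bounded s cc c(2)])
    then obtain h where "h \<in> circcirc DR s" "a = h \<oplus>\<^bsub>DR\<^esub> ?k c" using a D.mem_gr_class by metis
    then have "(s, a, \<one>\<^bsub>DR\<^esub>) \<in> Q" using Q.add[OF Q.circcirc_le[OF s] kQ[OF s c(1)]] by simp
    then show "(s / 1 ^ 0, a, \<one>\<^bsub>DR\<^esub> [^]\<^bsub>DR\<^esub> (0::nat)) \<in> Q" by simp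
  qed
  have "Q.gr_bounded 1 \<one>\<^bsub>DR\<^esub> 0 x"
    unfolding n(3)
  proof (rule Q.gr_bounded_sum[OF one])
    fix i assume "i \<in> {..<n}"
    then have yz: "y i \<in> gr_sub B" "z i \<in> gr_sub C" using n(1,2) by auto
    note c = gr_map_closed_DR(1)[OF yz(1)] gr_map_closed_DR(2)[OF yz(2)]
    show "gr_map DR ?l (y i) \<otimes>\<^bsub>Gr DR\<^esub> gr_map DR ?k (z i) \<in> carrier (Gr DR) \<and>
        Q.gr_bounded 1 \<one>\<^bsub>DR\<^esub> 0 (gr_map DR ?l (y i) \<otimes>\<^bsub>Gr DR\<^esub> gr_map DR ?k (z i))"
      using D.gr_mult_closed[OF c] Q.gr_bounded_mult[OF one c bl[OF yz(1)] bk[OF yz(2)]] by simp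
  qed
  then have "(s / 1 ^ 0, a, \<one>\<^bsub>DR\<^esub> [^]\<^bsub>DR\<^esub> (0::nat)) \<in> Q" using s unfolding Q.gr_bounded_def by blast
  then show ?thesis by simp
qed

text \<open>The two restrictions bound the values of pure tensors, and sums inherit these bounds.
  Roots then give the bound on \<open>circcirc\<close>, and the estimate for integral elements gives
  the one on \<open>plus_part\<close>.\<close>

lemma spra_order_tensor:
  assumes ord: "reified_order DR Q"
    and BQ: "spra_order B (pullback B (tensor_left A B C f g) Q)"
    and CQ: "spra_order C (pullback C (tensor_right A B C f g) Q)"
    and comm: "\<And>d. d \<in> carrier DR \<Longrightarrow> (1, d, \<zero>\<^bsub>DR\<^esub>) \<notin> Q \<Longrightarrow> (\<exists>r. (r, \<one>\<^bsub>DR\<^esub>, d) \<in> Q) \<and> (\<exists>r. (r, d, \<one>\<^bsub>DR\<^esub>) \<in> Q)"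
  shows "spra_order DA Q"
proof -
  let ?l = "tensor_left A B C f g" and ?k = "tensor_right A B C f g"
  interpret Q: reified_order DR Q by fact
  have hl: "?l \<in> ring_hom B DR" and hk: "?k \<in> ring_hom C DR"
    using left_bounded right_bounded by (auto simp: bounded_hom_def)
  have l1: "?l \<one>\<^bsub>B\<^esub> = \<one>\<^bsub>DR\<^esub>" and k1: "?k \<one>\<^bsub>C\<^esub> = \<one>\<^bsub>DR\<^esub>" using ring_hom_one hl hk by auto
  have lle: "(r, ?l b, \<one>\<^bsub>DR\<^esub>) \<in> Q" if "0 < r" "b \<in> circcirc B r \<or> b \<in> plus_part B r" for r b
  proof -
    have "(r, b, \<one>\<^bsub>B\<^esub>) \<in> pullback B ?l Q" using BQ that unfolding spra_order_def by blast
    then show ?thesis by (simp add: pullback_def l1)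
  qed
  have kle: "(r, ?k c, \<one>\<^bsub>DR\<^esub>) \<in> Q" if "0 < r" "c \<in> circcirc C r \<or> c \<in> plus_part C r" for r c
  proof -
    have "(r, c, \<one>\<^bsub>C\<^esub>) \<in> pullback C ?k Q" using CQ that unfolding spra_order_def by blast
    then show ?thesis by (simp add: pullback_def k1)
  qed
  have pure_le: "(t, pure b c, \<one>\<^bsub>DR\<^esub>) \<in> Q"
    if bc: "b \<in> carrier B" "c \<in> carrier C" and t: "snorm B b * snorm C c < t" for b c t
  proof -
    have nn: "0 \<le> snorm B b" "0 \<le> snorm C c" using bc NB.snorm_nonneg NC.snorm_nonneg by auto
    \<comment> \<open>An element with seminorm below \<open>r\<close> lies in
      \<open>circcirc B r\<close>, so the strict inequality has to be distributed over the two
      factors.\<close>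
    obtain r s where rs: "snorm B b < r" "snorm C c < s" "r * s \<le> t"
    proof -
      have "\<exists>r s. snorm B b < r \<and> snorm C c < s \<and> r * s \<le> t"
      proof (rule ccontr)
        assume no: "\<not> ?thesis"
        have "t \<le> snorm B b * snorm C c"
          by (rule le_mult_limit[OF nn]) (meson no linear)
        then show False using t by simp
      qed
      then show thesis using that by blast
    qed
    then have pos: "0 < r" "0 < s" using nn by auto
    have "(r, ?l b, \<one>\<^bsub>DR\<^esub>) \<in> Q" "(s, ?k c, \<one>\<^bsub>DR\<^esub>) \<in> Q"
      using lle[OF pos(1)] kle[OF pos(2)] NB.circcircI[OF pos(1) bc(1) rs(1)] NC.circcircI[OF pos(2) bc(2) rs(2)] by auto
    from Q.mult2[OF this] have "(r * s, pure b c, \<one>\<^bsub>DR\<^esub>) \<in> Q"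
      using pure_left_right[OF bc] by (simp add: DR_simps(2)[symmetric])
    then show ?thesis by (rule Q.mono_scale[OF _ rs(3)])
  qed
  have presented_le: "(t, x, \<one>\<^bsub>DR\<^esub>) \<in> Q" if "x \<in> presented u" "u < t" "0 < t" for x u t
    using that(1)
  proof induction
    case presented_zero
    then show ?case using Q.zero[OF that(3) D.one_closed] by (simp add: DR_simps)
  next
    case (presented_add x b c)
    then have "(t, pure b c, \<one>\<^bsub>DR\<^esub>) \<in> Q" using pure_le that(2) by simp
    from Q.add[OF presented_add.IH this] show ?case by (simp add: DR_simps)
  qed
  have cc: "(r, d, \<one>\<^bsub>DR\<^esub>) \<in> Q" if r: "0 < r" and d: "d \<in> circcirc DR r" for r d
  proof -
    \<comment> \<open>Some power of \<open>d\<close> has tensor seminorm below \<open>r ^ n\<close>,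
      hence value at most \<open>r ^ n\<close>; the bound for \<open>d\<close> follows by extracting
      the root.\<close>
    obtain n :: nat where n: "n \<noteq> 0" "snorm DR (d [^]\<^bsub>DR\<^esub> n) < r ^ n" by (rule D.circcirc_pow[OF r d])
    have dc: "d \<in> carrier DR" using d by (simp add: circcirc_def)
    obtain u where u: "snorm DR (d [^]\<^bsub>DR\<^esub> n) < u" "u < r ^ n" using n(2) dense by blast
    have "d [^]\<^bsub>DR\<^esub> n \<in> carrier TR" using dc D.nat_pow_closed DR_simps(1) by blast
    then have "d [^]\<^bsub>DR\<^esub> n \<in> presented u" using snorm_less u(1) by (simp add: DR_simps)
    then have "(r ^ n, d [^]\<^bsub>DR\<^esub> n, \<one>\<^bsub>DR\<^esub> [^]\<^bsub>DR\<^esub> n) \<in> Q" using presented_le u(2) r by simp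
    then show ?thesis using Q.pow_cancel n(1) r dc by simp
  qed
  interpret QB: seminorm_bounded_order DR Q by unfold_locales (fact cc)
  show ?thesis
    unfolding spra_order_def
  proof (intro conjI allI impI ballI)
    show "reified_order DA Q"
      by (rule reified_order_cong[OF ord]) (simp_all add: DA_simps cring_DA)
    fix r :: real assume r: "0 < r"
    show "(r, a, \<one>\<^bsub>DA\<^esub>) \<in> Q" if "a \<in> circcirc DA r" for a using cc[OF r] that by (simp add: DA_cong DA_simps)
    show "(r, a, \<one>\<^bsub>DA\<^esub>) \<in> Q" if a: "a \<in> plus_part DA r" for a
    proof -
      have "(r, a, \<one>\<^bsub>DR\<^esub>) \<in> Q"
      proof (rule QB.integral_closure_bounded[OF gr_image_closed _ r])
        show "a \<in> circ DR r" "gr_homog DR r (gr_class DR r a) \<in> integral_closure (Gr DR) IM"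
          using a unfolding plus_part_DA by blast+
        show "(s, b, \<one>\<^bsub>DR\<^esub>) \<in> Q" if "x \<in> IM" "0 < s" "b \<in> x s" for x s b
          by (rule gr_image_bounded[OF QB.seminorm_bounded_order_axioms lle kle that]) simp_all
      qed
      then show ?thesis by (simp add: DA_simps)
    qed
  next
    fix a assume "a \<in> carrier DA" "(1, a, \<zero>\<^bsub>DA\<^esub>) \<notin> Q"
    then show "\<exists>r. (r, \<one>\<^bsub>DA\<^esub>, a) \<in> Q" "\<exists>r. (r, a, \<one>\<^bsub>DA\<^esub>) \<in> Q"
      using comm[of a] unfolding DA_simps by blast+
  qed
qed

end

section \<open>Almost linear forms\<close>

context cring
begin

definition linear_form :: "'i set \<Rightarrow> ('i \<Rightarrow> 'a) \<Rightarrow> ('i \<Rightarrow> 'a) \<Rightarrow> 'a" where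
  "linear_form F u v = (\<Oplus>b\<in>F. u b \<otimes> v b)"

lemma linear_form_closed: "\<lbrakk>\<And>b. b \<in> F \<Longrightarrow> u b \<in> carrier R; \<And>b. b \<in> F \<Longrightarrow> v b \<in> carrier R\<rbrakk> \<Longrightarrow> linear_form F u v \<in> carrier R"
  unfolding linear_form_def by (intro finsum_closed) auto

lemma linear_form_insert:
  assumes "finite F" "x \<notin> F" "\<And>b. b \<in> insert x F \<Longrightarrow> u b \<in> carrier R" "\<And>b. b \<in> insert x F \<Longrightarrow> v b \<in> carrier R"
  shows "linear_form (insert x F) u v = u x \<otimes> v x \<oplus> linear_form F u v"
  unfolding linear_form_def using assms by (intro finsum_insert) auto

lemma linear_form_cong:
  assumes "\<And>b. b \<in> F \<Longrightarrow> u b = u' b" "\<And>b. b \<in> F \<Longrightarrow> v b = v' b"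
    and "\<And>b. b \<in> F \<Longrightarrow> u' b \<in> carrier R" "\<And>b. b \<in> F \<Longrightarrow> v' b \<in> carrier R"
  shows "linear_form F u v = linear_form F u' v'"
  unfolding linear_form_def using assms by (intro finsum_cong') auto

lemma linear_form_scale:
  assumes "finite F" "\<And>b. b \<in> F \<Longrightarrow> u b \<in> carrier R" "\<And>b. b \<in> F \<Longrightarrow> v b \<in> carrier R" "c \<in> carrier R"
  shows "linear_form F u (\<lambda>b. c \<otimes> v b) = c \<otimes> linear_form F u v"
  using assms(1-3)
proof (induction F)
  case empty then show ?case using assms(4) by (simp add: linear_form_def)
next
  case (insert x F)
  have k: "u x \<in> carrier R" "v x \<in> carrier R" "linear_form F u v \<in> carrier R"
    using insert.prems by (auto intro!: linear_form_closed)
  have "linear_form (insert x F) u (\<lambda>b. c \<otimes> v b) = u x \<otimes> (c \<otimes> v x) \<oplus> linear_form F u (\<lambda>b. c \<otimes> v b)"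
    using insert assms(4) by (intro linear_form_insert) auto
  also have "\<dots> = c \<otimes> (u x \<otimes> v x \<oplus> linear_form F u v)"
    using insert k assms(4) by (simp add: r_distr m_lcomm)
  also have "u x \<otimes> v x \<oplus> linear_form F u v = linear_form (insert x F) u v"
    using insert by (intro linear_form_insert[symmetric]) auto
  finally show ?case .
qed

lemma linear_form_comb:
  assumes "finite F" "\<And>b. b \<in> F \<Longrightarrow> u b \<in> carrier R" "\<And>b. b \<in> F \<Longrightarrow> w b \<in> carrier R"
    "\<And>b. b \<in> F \<Longrightarrow> v b \<in> carrier R" and c: "c \<in> carrier R" "d \<in> carrier R"
  shows "linear_form F (\<lambda>b. c \<otimes> u b \<ominus> d \<otimes> w b) v = c \<otimes> linear_form F u v \<ominus> d \<otimes> linear_form F w v"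
  using assms(1-4)
proof (induction F)
  case empty then show ?case using c by (simp add: linear_form_def a_minus_def)
next
  case (insert x F)
  have k: "u x \<in> carrier R" "w x \<in> carrier R" "v x \<in> carrier R" "linear_form F u v \<in> carrier R" "linear_form F w v \<in> carrier R"
    using insert.prems by (auto intro!: linear_form_closed)
  have "linear_form (insert x F) (\<lambda>b. c \<otimes> u b \<ominus> d \<otimes> w b) v =
      (c \<otimes> u x \<ominus> d \<otimes> w x) \<otimes> v x \<oplus> linear_form F (\<lambda>b. c \<otimes> u b \<ominus> d \<otimes> w b) v"
    using insert c by (intro linear_form_insert) auto
  also have "\<dots> = (c \<otimes> u x \<ominus> d \<otimes> w x) \<otimes> v x \<oplus> (c \<otimes> linear_form F u v \<ominus> d \<otimes> linear_form F w v)"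
    using insert by simp
  also have "\<dots> = c \<otimes> (u x \<otimes> v x \<oplus> linear_form F u v) \<ominus> d \<otimes> (w x \<otimes> v x \<oplus> linear_form F w v)"
    using k c by algebra
  also have "u x \<otimes> v x \<oplus> linear_form F u v = linear_form (insert x F) u v"
    using insert by (intro linear_form_insert[symmetric]) auto
  also have "w x \<otimes> v x \<oplus> linear_form F w v = linear_form (insert x F) w v"
    using insert by (intro linear_form_insert[symmetric]) auto
  finally show ?case .
qed

definition unit_vector :: "'i \<Rightarrow> 'i \<Rightarrow> 'a" where
  "unit_vector x = (\<lambda>b. if b = x then \<one> else \<zero>)"

lemma unit_vector_closed: "unit_vector x b \<in> carrier R"
  by (simp add: unit_vector_def)

lemma linear_form_unit_vector:
  assumes "finite F" "x \<in> F" "\<And>b. b \<in> F \<Longrightarrow> v b \<in> carrier R"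
  shows "linear_form F (unit_vector x) v = v x"
proof -
  have F: "F = insert x (F - {x})" using assms(2) by blast
  have "linear_form F (unit_vector x) v = unit_vector x x \<otimes> v x \<oplus> linear_form (F - {x}) (unit_vector x) v"
    by (subst F, rule linear_form_insert) (use assms in \<open>auto simp: unit_vector_closed\<close>)
  also have "linear_form (F - {x}) (unit_vector x) v = \<zero>"
    unfolding linear_form_def
    by (subst finsum_cong'[of _ "F - {x}" "\<lambda>_. \<zero>"]) (use assms in \<open>auto simp: unit_vector_def\<close>)
  finally show ?thesis using assms by (simp add: unit_vector_def)
qed

end

context reified_order
begin

lemma supp_perturb: "\<lbrakk>(1, z, \<zero>) \<in> Q; u \<in> carrier A\<rbrakk> \<Longrightarrow> (1, u, u \<oplus> z) \<in> Q"
proof -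
  assume z: "(1, z, \<zero>) \<in> Q" and u: "u \<in> carrier A"
  have zc: "z \<in> carrier A" using z dom by blast
  have "(1, (u \<oplus> z) \<ominus> z, u \<oplus> z) \<in> Q"
    using diff[OF refl_Q[of "u \<oplus> z"] supp_le[OF z, of 1 "u \<oplus> z"]] u zc by simp
  moreover have "(u \<oplus> z) \<ominus> z = u" using u zc by (simp add: a_minus_def a_assoc r_neg)
  ultimately show ?thesis by simp
qed

text \<open>Strictness is the failure of the reverse inequality, so it survives multiplication as
  long as the factor to be cancelled is outside the support.\<close>

lemma strict_mult:
  assumes "(1 / r, y, x) \<notin> Q" "(s, u, w) \<in> Q" "(1, w, \<zero>) \<notin> Q" "0 < r" "x \<in> carrier A" "y \<in> carrier A"
  shows "(1 / (r * s), y \<otimes> w, x \<otimes> u) \<notin> Q"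
proof
  assume h: "(1 / (r * s), y \<otimes> w, x \<otimes> u) \<in> Q"
  have d: "0 < s" "u \<in> carrier A" "w \<in> carrier A" using dom assms(2) by auto
  have "(s, x \<otimes> u, x \<otimes> w) \<in> Q" using mult[OF assms(2,5)] d assms(5) by (simp add: m_comm)
  from trans[OF h this] have "(1 / r, y \<otimes> w, x \<otimes> w) \<in> Q" using d by simp
  then show False using cancel assms d by blast
qed

lemma strict_diff:
  assumes "(1, z, a) \<notin> Q" "(1, z, b) \<notin> Q" "a \<in> carrier A" "b \<in> carrier A"
  shows "(1, z, a \<ominus> b) \<notin> Q"
proof
  assume h: "(1, z, a \<ominus> b) \<in> Q"
  have "(1, a \<ominus> b, b) \<in> Q \<or> (1, a \<ominus> b, a) \<in> Q"
    using total[of 1 a b] diff[of 1 a b b] diff[of 1 a a b] refl_Q assms(3,4) by auto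
  then show False using trans[OF h, of 1 a] trans[OF h, of 1 b] assms by auto
qed

end

locale order_hom = A: cring A + B: reified_order B Q
  for A :: "('a, 'm) ring_scheme" and B :: "('b, 'n) ring_scheme" and Q +
  fixes f assumes f: "f \<in> ring_hom A B"
begin

sublocale h: ring_hom_ring A B f
  by (rule ring_hom_ringI2[OF A.ring_axioms B.ring_axioms f])

definition evaluate :: "'b set \<Rightarrow> ('b \<Rightarrow> 'a) \<Rightarrow> 'b" where
  "evaluate F y = B.linear_form F (\<lambda>b. f (y b)) (\<lambda>b. b)"

lemma evaluate_comb:
  assumes "finite F" "F \<subseteq> carrier B" "\<And>b. u b \<in> carrier A" "\<And>b. w b \<in> carrier A" "c \<in> carrier A" "d \<in> carrier A"
  shows "evaluate F (\<lambda>b. c \<otimes>\<^bsub>A\<^esub> u b \<ominus>\<^bsub>A\<^esub> d \<otimes>\<^bsub>A\<^esub> w b) = f c \<otimes>\<^bsub>B\<^esub> evaluate F u \<ominus>\<^bsub>B\<^esub> f d \<otimes>\<^bsub>B\<^esub> evaluate F w"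
proof -
  have "evaluate F (\<lambda>b. c \<otimes>\<^bsub>A\<^esub> u b \<ominus>\<^bsub>A\<^esub> d \<otimes>\<^bsub>A\<^esub> w b)
      = B.linear_form F (\<lambda>b. f c \<otimes>\<^bsub>B\<^esub> f (u b) \<ominus>\<^bsub>B\<^esub> f d \<otimes>\<^bsub>B\<^esub> f (w b)) (\<lambda>b. b)"
    unfolding evaluate_def
    by (rule B.linear_form_cong) (use assms in \<open>auto simp: a_minus_def\<close>)
  also have "\<dots> = f c \<otimes>\<^bsub>B\<^esub> evaluate F u \<ominus>\<^bsub>B\<^esub> f d \<otimes>\<^bsub>B\<^esub> evaluate F w"
    unfolding evaluate_def by (rule B.linear_form_comb) (use assms in auto)
  finally show ?thesis .
qed

lemma evaluate_closed: "\<lbrakk>F \<subseteq> carrier B; \<And>b. y b \<in> carrier A\<rbrakk> \<Longrightarrow> evaluate F y \<in> carrier B"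
  unfolding evaluate_def by (intro B.linear_form_closed) auto

lemma evaluate_insert:
  assumes "finite F" "x \<notin> F" "insert x F \<subseteq> carrier B" "\<And>b. y b \<in> carrier A"
  shows "evaluate (insert x F) y = f (y x) \<otimes>\<^bsub>B\<^esub> x \<oplus>\<^bsub>B\<^esub> evaluate F y"
  unfolding evaluate_def by (rule B.linear_form_insert) (use assms in auto)

text \<open>
  Finitely many vectors \<open>y\<close> over \<open>A\<close> impose \<open>v(\<Sum> y\<^sub>b \<lambda>\<^sub>b) / v(\<lambda>\<^bsub>b0\<^esub>) \<le> v(\<Sum> y\<^sub>b b) / v(b0)\<close> on a form
  \<open>\<lambda>\<close>. Eliminate a coordinate \<open>x\<close> with the vector \<open>y*\<close> minimizing \<open>v(\<Sum> y\<^sub>b b) / v(y\<^sub>x)\<close>, and choose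
  \<open>\<lambda>\<^sub>x\<close> so that \<open>\<Sum> y*\<^sub>b \<lambda>\<^sub>b = 0\<close>.
\<close>

lemma bounded_linear_form_exists:
  assumes "finite F" "b0 \<notin> F" "insert b0 F \<subseteq> carrier B" "(1, b0, \<zero>\<^bsub>B\<^esub>) \<notin> Q"
    and "finite Y" "\<And>y b. y \<in> Y \<Longrightarrow> y b \<in> carrier A"
  shows "\<exists>l. (\<forall>b. l b \<in> carrier A) \<and> (1, f (l b0), \<zero>\<^bsub>B\<^esub>) \<notin> Q \<and>
    (\<forall>y\<in>Y. (1, f (A.linear_form (insert b0 F) y l) \<otimes>\<^bsub>B\<^esub> b0, f (l b0) \<otimes>\<^bsub>B\<^esub> evaluate (insert b0 F) y) \<in> Q)"
  using assms(1-3,5,6)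
proof (induction F arbitrary: Y)
  case empty
  have b0: "b0 \<in> carrier B" using empty by simp
  show ?case
  proof (intro exI[of _ "\<lambda>_. \<one>\<^bsub>A\<^esub>"] conjI ballI)
    fix y assume "y \<in> Y"
    then have y: "y b \<in> carrier A" for b using empty by blast
    have "A.linear_form {b0} y (\<lambda>_. \<one>\<^bsub>A\<^esub>) = y b0" using y by (simp add: A.linear_form_def)
    moreover have "evaluate {b0} y = f (y b0) \<otimes>\<^bsub>B\<^esub> b0" using y b0 by (simp add: evaluate_def B.linear_form_def)
    ultimately show "(1, f (A.linear_form {b0} y (\<lambda>_. \<one>\<^bsub>A\<^esub>)) \<otimes>\<^bsub>B\<^esub> b0, f \<one>\<^bsub>A\<^esub> \<otimes>\<^bsub>B\<^esub> evaluate {b0} y) \<in> Q"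
      using y b0 B.refl_Q by simp
  qed (auto simp: B.nontrivial)
next
  case (insert x F)
  let ?F = "insert b0 F" and ?F2 = "insert x (insert b0 F)"
  have F2: "insert b0 (insert x F) = ?F2" by blast
  have fin: "finite ?F" and xF: "x \<notin> ?F" and F2B: "?F2 \<subseteq> carrier B" and FB: "?F \<subseteq> carrier B"
    and xB: "x \<in> carrier B" and b0B: "b0 \<in> carrier B" and b0F: "b0 \<notin> F" and b0x: "b0 \<noteq> x"
    using insert by auto
  note Y = insert.prems(4)
  let ?V = "\<lambda>y. evaluate ?F2 y"
  have Vc: "?V y \<in> carrier B" if "y \<in> Y" for y by (rule evaluate_closed[OF F2B Y[OF that]])
  have Vi: "?V y = f (y x) \<otimes>\<^bsub>B\<^esub> x \<oplus>\<^bsub>B\<^esub> evaluate ?F y" if "y \<in> Y" for y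
    by (rule evaluate_insert[OF fin xF F2B Y[OF that]])
  have Fc: "evaluate ?F y \<in> carrier B" if "y \<in> Y" for y by (rule evaluate_closed[OF FB Y[OF that]])
  \<comment> \<open>For vectors in \<open>?Y1\<close> the coordinate at \<open>x\<close> has value
    \<open>0\<close> and may be dropped up to the support; elimination concerns
    \<open>?Y2\<close>.\<close>
  let ?Y1 = "{y \<in> Y. (1, f (y x), \<zero>\<^bsub>B\<^esub>) \<in> Q}" and ?Y2 = "{y \<in> Y. (1, f (y x), \<zero>\<^bsub>B\<^esub>) \<notin> Q}"
  have le_V: "(1, evaluate ?F y, ?V y) \<in> Q" if y: "y \<in> ?Y1" for y
  proof -
    have yY: "y \<in> Y" and s: "(1, f (y x), \<zero>\<^bsub>B\<^esub>) \<in> Q" using y by auto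
    have "(1, f (y x) \<otimes>\<^bsub>B\<^esub> x, \<zero>\<^bsub>B\<^esub>) \<in> Q" using s xB B.dom[OF s] by (simp add: B.supp_mult_iff)
    from B.supp_perturb[OF this Fc[OF yY]] show ?thesis
      using Vi[OF yY] Fc[OF yY] xB B.dom[OF s] by (simp add: B.a_comm)
  qed
  show ?case
  proof (cases "?Y2 = {}")
    case True
    obtain l where l: "\<And>b. l b \<in> carrier A" "(1, f (l b0), \<zero>\<^bsub>B\<^esub>) \<notin> Q"
      "\<And>y. y \<in> Y \<Longrightarrow> (1, f (A.linear_form ?F y l) \<otimes>\<^bsub>B\<^esub> b0, f (l b0) \<otimes>\<^bsub>B\<^esub> evaluate ?F y) \<in> Q"
      using insert.IH[OF b0F FB insert.prems(3)] insert.prems(4) by blast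
    let ?l = "l(x := \<zero>\<^bsub>A\<^esub>)"
    have "(1, f (A.linear_form ?F2 y ?l) \<otimes>\<^bsub>B\<^esub> b0, f (?l b0) \<otimes>\<^bsub>B\<^esub> ?V y) \<in> Q" if y: "y \<in> Y" for y
    proof -
      have "A.linear_form ?F2 y ?l = y x \<otimes>\<^bsub>A\<^esub> ?l x \<oplus>\<^bsub>A\<^esub> A.linear_form ?F y ?l"
        by (rule A.linear_form_insert[OF fin xF]) (use Y[OF y] l in auto)
      also have "A.linear_form ?F y ?l = A.linear_form ?F y l"
        by (rule A.linear_form_cong) (use xF l Y[OF y] in auto)
      finally have e: "A.linear_form ?F2 y ?l = A.linear_form ?F y l"
        using Y[OF y] l(1) A.linear_form_closed[of ?F y l] by (simp add: fun_upd_def)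
      have "(1, evaluate ?F y \<otimes>\<^bsub>B\<^esub> f (l b0), ?V y \<otimes>\<^bsub>B\<^esub> f (l b0)) \<in> Q"
        using True y le_V[of y] l(1) by (intro B.mult) auto
      then have "(1, f (l b0) \<otimes>\<^bsub>B\<^esub> evaluate ?F y, f (l b0) \<otimes>\<^bsub>B\<^esub> ?V y) \<in> Q"
        using Fc[OF y] Vc[OF y] l(1) by (simp add: B.m_comm)
      from B.trans[OF l(3)[OF y] this] show ?thesis using e b0x by simp
    qed
    moreover have "?l b \<in> carrier A" for b using l(1) by simp
    moreover have "(1, f (?l b0), \<zero>\<^bsub>B\<^esub>) \<notin> Q" using l(2) b0x by simp
    ultimately show ?thesis unfolding F2 by blast
  next
    case False
    \<comment> \<open>The comparison of \<open>v(?V y) / v(f (y x))\<close> with denominators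
      cleared; transitivity holds through a middle vector from \<open>?Y2\<close>.\<close>
    let ?le = "\<lambda>y w. (1, f (w x) \<otimes>\<^bsub>B\<^esub> ?V y, f (y x) \<otimes>\<^bsub>B\<^esub> ?V w) \<in> Q"
    have fx: "f (y x) \<in> carrier B" if "y \<in> Y" for y using Y[OF that] by simp
    have tot: "?le y w \<or> ?le w y" if "y \<in> Y" "w \<in> Y" for y w
      using B.total[of 1 "f (w x) \<otimes>\<^bsub>B\<^esub> ?V y" "f (y x) \<otimes>\<^bsub>B\<^esub> ?V w"] fx Vc that by auto
    have tr: "?le y z" if ywz: "y \<in> Y" "w \<in> ?Y2" "z \<in> Y" "?le y w" "?le w z" for y w z
    proof -
      have wY: "w \<in> Y" "(1, f (w x), \<zero>\<^bsub>B\<^esub>) \<notin> Q" using ywz by auto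
      have "(1, (f (w x) \<otimes>\<^bsub>B\<^esub> ?V y) \<otimes>\<^bsub>B\<^esub> f (z x), (f (y x) \<otimes>\<^bsub>B\<^esub> ?V w) \<otimes>\<^bsub>B\<^esub> f (z x)) \<in> Q"
        by (rule B.mult[OF ywz(4) fx[OF ywz(3)]])
      moreover have "(1, (f (z x) \<otimes>\<^bsub>B\<^esub> ?V w) \<otimes>\<^bsub>B\<^esub> f (y x), (f (w x) \<otimes>\<^bsub>B\<^esub> ?V z) \<otimes>\<^bsub>B\<^esub> f (y x)) \<in> Q"
        by (rule B.mult[OF ywz(5) fx[OF ywz(1)]])
      moreover have "(f (y x) \<otimes>\<^bsub>B\<^esub> ?V w) \<otimes>\<^bsub>B\<^esub> f (z x) = (f (z x) \<otimes>\<^bsub>B\<^esub> ?V w) \<otimes>\<^bsub>B\<^esub> f (y x)"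
        using fx Vc ywz wY by (simp add: B.m_ac)
      ultimately have "(1 * 1, (f (w x) \<otimes>\<^bsub>B\<^esub> ?V y) \<otimes>\<^bsub>B\<^esub> f (z x), (f (w x) \<otimes>\<^bsub>B\<^esub> ?V z) \<otimes>\<^bsub>B\<^esub> f (y x)) \<in> Q"
        using B.trans by metis
      moreover have "(f (w x) \<otimes>\<^bsub>B\<^esub> ?V y) \<otimes>\<^bsub>B\<^esub> f (z x) = f (w x) \<otimes>\<^bsub>B\<^esub> (f (z x) \<otimes>\<^bsub>B\<^esub> ?V y)"
        "(f (w x) \<otimes>\<^bsub>B\<^esub> ?V z) \<otimes>\<^bsub>B\<^esub> f (y x) = f (w x) \<otimes>\<^bsub>B\<^esub> (f (y x) \<otimes>\<^bsub>B\<^esub> ?V z)"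
        using fx Vc ywz wY by (simp_all add: B.m_ac)
      ultimately show ?thesis using B.cancel_left[of 1 "f (w x)"] fx Vc ywz wY by simp
    qed
    have "\<exists>m\<in>Z. \<forall>y\<in>Z. ?le m y" if "finite Z" "Z \<noteq> {}" "Z \<subseteq> ?Y2" for Z
      using that
    proof (induction Z rule: finite_ne_induct)
      case (singleton y) then show ?case using tot[of y y] by auto
    next
      case (insert y Z)
      then obtain m where m: "m \<in> Z" "\<And>z. z \<in> Z \<Longrightarrow> ?le m z" by auto
      have yY: "y \<in> ?Y2" "m \<in> ?Y2" using insert.prems m(1) by auto
      show ?case
      proof (cases "?le m y")
        case True then show ?thesis using m by blast
      next
        case False
        then have ym: "?le y m" using tot yY by blast
        have "?le y z" if "z \<in> insert y Z" for z
        proof (cases "z = y")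
          case True then show ?thesis using tot[of y y] yY by auto
        next
          case False
          then have "z \<in> Z" "z \<in> Y" using that insert.prems by auto
          then show ?thesis using tr[of y m z] ym m(2) yY by blast
        qed
        then show ?thesis by blast
      qed
    qed
    from this[of ?Y2] obtain m where m: "m \<in> ?Y2" and min: "\<And>y. y \<in> ?Y2 \<Longrightarrow> ?le m y"
      using False insert.prems(3) by auto
    have mY: "m \<in> Y" and ms: "(1, f (m x), \<zero>\<^bsub>B\<^esub>) \<notin> Q" using m by auto
    define c where "c = m x"
    have cA: "c \<in> carrier A" using Y[OF mY] by (simp add: c_def)
    \<comment> \<open>A division-free row operation that cancels the coordinate at \<open>x\<close>
      against the pivot \<open>m\<close>.\<close>
    let ?r = "\<lambda>y b. c \<otimes>\<^bsub>A\<^esub> y b \<ominus>\<^bsub>A\<^esub> y x \<otimes>\<^bsub>A\<^esub> m b"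
    have rA: "?r y b \<in> carrier A" if "y \<in> Y" for y b using Y[OF that] Y[OF mY] cA by simp
    obtain l where l: "\<And>b. l b \<in> carrier A" "(1, f (l b0), \<zero>\<^bsub>B\<^esub>) \<notin> Q"
      "\<And>y. y \<in> ?Y1 \<union> ?r ` ?Y2 \<Longrightarrow> (1, f (A.linear_form ?F y l) \<otimes>\<^bsub>B\<^esub> b0, f (l b0) \<otimes>\<^bsub>B\<^esub> evaluate ?F y) \<in> Q"
    proof -
      have "finite (?Y1 \<union> ?r ` ?Y2)" using insert.prems(3) by simp
      moreover have "y b \<in> carrier A" if "y \<in> ?Y1 \<union> ?r ` ?Y2" for y b using that Y rA by auto
      ultimately show thesis using insert.IH[of "?Y1 \<union> ?r ` ?Y2"] b0F FB that by meson
    qed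
    let ?e = "\<lambda>y. A.linear_form ?F y l"
    have eA: "?e y \<in> carrier A" if "y \<in> Y" for y using Y[OF that] l(1) by (intro A.linear_form_closed) auto
    \<comment> \<open>The new coordinate makes the form vanish on the pivot \<open>m\<close>;
      scaling the others by \<open>c\<close> takes the place of dividing by the pivot entry.\<close>
    let ?l = "(\<lambda>b. c \<otimes>\<^bsub>A\<^esub> l b)(x := \<ominus>\<^bsub>A\<^esub> ?e m)"
    have lA: "?l b \<in> carrier A" for b using l(1) cA eA[OF mY] by simp
    have e2: "A.linear_form ?F2 y ?l = c \<otimes>\<^bsub>A\<^esub> ?e y \<ominus>\<^bsub>A\<^esub> y x \<otimes>\<^bsub>A\<^esub> ?e m" if y: "y \<in> Y" for y
    proof -
      have "A.linear_form ?F2 y ?l = y x \<otimes>\<^bsub>A\<^esub> ?l x \<oplus>\<^bsub>A\<^esub> A.linear_form ?F y ?l"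
        by (rule A.linear_form_insert[OF fin xF]) (use Y[OF y] lA in auto)
      also have "A.linear_form ?F y ?l = A.linear_form ?F y (\<lambda>b. c \<otimes>\<^bsub>A\<^esub> l b)"
        by (rule A.linear_form_cong) (use xF l cA Y[OF y] in auto)
      also have "\<dots> = c \<otimes>\<^bsub>A\<^esub> ?e y" by (rule A.linear_form_scale[OF fin]) (use Y[OF y] l cA in auto)
      finally show ?thesis
        using eA[OF y] eA[OF mY] Y[OF y, of x] cA by (simp add: fun_upd_def a_minus_def A.r_minus A.a_comm)
    qed
    have fl: "f (?l b0) = f c \<otimes>\<^bsub>B\<^esub> f (l b0)" using b0x cA l(1) by simp
    have fc: "f c \<in> carrier B" "(1, f c, \<zero>\<^bsub>B\<^esub>) \<notin> Q" using cA ms by (auto simp: c_def)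
    have fl0: "f (l b0) \<in> carrier B" using l(1) by simp
    have "(1, f (A.linear_form ?F2 y ?l) \<otimes>\<^bsub>B\<^esub> b0, f (?l b0) \<otimes>\<^bsub>B\<^esub> ?V y) \<in> Q" if y: "y \<in> Y" for y
    proof (cases "y \<in> ?Y2")
      case True
      have "?e (?r y) = c \<otimes>\<^bsub>A\<^esub> ?e y \<ominus>\<^bsub>A\<^esub> y x \<otimes>\<^bsub>A\<^esub> ?e m"
        by (rule A.linear_form_comb[OF fin]) (use Y[OF y] Y[OF mY] l cA in auto)
      then have 1: "(1, f (A.linear_form ?F2 y ?l) \<otimes>\<^bsub>B\<^esub> b0, f (l b0) \<otimes>\<^bsub>B\<^esub> evaluate ?F (?r y)) \<in> Q"
        using l(3)[of "?r y"] True e2[OF y] by auto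
      have "evaluate ?F (?r y) = f c \<otimes>\<^bsub>B\<^esub> evaluate ?F y \<ominus>\<^bsub>B\<^esub> f (y x) \<otimes>\<^bsub>B\<^esub> evaluate ?F m"
        by (rule evaluate_comb[OF fin FB]) (use Y[OF y] Y[OF mY] cA in auto)
      also have "\<dots> = f c \<otimes>\<^bsub>B\<^esub> ?V y \<ominus>\<^bsub>B\<^esub> f (y x) \<otimes>\<^bsub>B\<^esub> ?V m"
      proof -
        have m: "f (m x) = f c" by (simp add: c_def)
        show ?thesis unfolding Vi[OF y] Vi[OF mY] m
          using Fc[OF y] Fc[OF mY] fx[OF y] fc(1) xB by algebra
      qed
      finally have ev: "evaluate ?F (?r y) = f c \<otimes>\<^bsub>B\<^esub> ?V y \<ominus>\<^bsub>B\<^esub> f (y x) \<otimes>\<^bsub>B\<^esub> ?V m" .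
      \<comment> \<open>Minimality of the pivot: subtracting the multiple of \<open>m\<close> does
        not push the value above that of \<open>f c\<close> times \<open>?V y\<close>.\<close>
      have "(1, f (y x) \<otimes>\<^bsub>B\<^esub> ?V m, f c \<otimes>\<^bsub>B\<^esub> ?V y) \<in> Q" using min[OF True] by (simp add: c_def)
      then have "(1, evaluate ?F (?r y), f c \<otimes>\<^bsub>B\<^esub> ?V y) \<in> Q"
        unfolding ev using B.diff[OF B.refl_Q] fc(1) Vc[OF y] by simp
      then have "(1, evaluate ?F (?r y) \<otimes>\<^bsub>B\<^esub> f (l b0), f c \<otimes>\<^bsub>B\<^esub> ?V y \<otimes>\<^bsub>B\<^esub> f (l b0)) \<in> Q"
        using fl0 by (rule B.mult)
      moreover have "evaluate ?F (?r y) \<otimes>\<^bsub>B\<^esub> f (l b0) = f (l b0) \<otimes>\<^bsub>B\<^esub> evaluate ?F (?r y)"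
        using fl0 evaluate_closed[OF FB, of "?r y"] rA[OF y] by (simp add: B.m_comm)
      moreover have "f c \<otimes>\<^bsub>B\<^esub> ?V y \<otimes>\<^bsub>B\<^esub> f (l b0) = f (?l b0) \<otimes>\<^bsub>B\<^esub> ?V y"
        unfolding fl using fc(1) Vc[OF y] fl0 by (simp add: B.m_ac)
      ultimately have 2: "(1, f (l b0) \<otimes>\<^bsub>B\<^esub> evaluate ?F (?r y), f (?l b0) \<otimes>\<^bsub>B\<^esub> ?V y) \<in> Q" by simp
      show ?thesis using B.trans[OF 1 2] by simp
    next
      case False
      then have y1: "y \<in> ?Y1" using y by blast
      have s: "(1, f (y x), \<zero>\<^bsub>B\<^esub>) \<in> Q" using y1 by blast
      have fe: "f (?e y) \<in> carrier B" "f (?e m) \<in> carrier B" using eA[OF y] eA[OF mY] by auto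
      have "(1, f (?e y) \<otimes>\<^bsub>B\<^esub> b0, f (l b0) \<otimes>\<^bsub>B\<^esub> evaluate ?F y) \<in> Q" using l(3)[of y] y1 by blast
      moreover have "(1, f (l b0) \<otimes>\<^bsub>B\<^esub> evaluate ?F y, f (l b0) \<otimes>\<^bsub>B\<^esub> ?V y) \<in> Q"
        using B.mult[OF le_V[OF y1] fl0] Fc[OF y] Vc[OF y] fl0 by (simp add: B.m_comm)
      ultimately have "(1 * 1, f (?e y) \<otimes>\<^bsub>B\<^esub> b0, f (l b0) \<otimes>\<^bsub>B\<^esub> ?V y) \<in> Q" by (rule B.trans)
      then have "(1, (f (?e y) \<otimes>\<^bsub>B\<^esub> b0) \<otimes>\<^bsub>B\<^esub> f c, (f (l b0) \<otimes>\<^bsub>B\<^esub> ?V y) \<otimes>\<^bsub>B\<^esub> f c) \<in> Q"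
        using fc(1) by (intro B.mult) simp
      moreover have "(f (l b0) \<otimes>\<^bsub>B\<^esub> ?V y) \<otimes>\<^bsub>B\<^esub> f c = f (?l b0) \<otimes>\<^bsub>B\<^esub> ?V y"
        unfolding fl using fc(1) Vc[OF y] fl0 by (simp add: B.m_ac)
      ultimately have 1: "(1, (f (?e y) \<otimes>\<^bsub>B\<^esub> b0) \<otimes>\<^bsub>B\<^esub> f c, f (?l b0) \<otimes>\<^bsub>B\<^esub> ?V y) \<in> Q" by simp
      \<comment> \<open>For these \<open>y\<close> the pivot enters with the factor
        \<open>y x\<close> and contributes only an element of the support.\<close>
      have "(1, f (y x) \<otimes>\<^bsub>B\<^esub> (f (?e m) \<otimes>\<^bsub>B\<^esub> b0), \<zero>\<^bsub>B\<^esub>) \<in> Q"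
        using s fe b0B fx[OF y] by (simp add: B.supp_mult_iff)
      then have 2: "(1, f (y x) \<otimes>\<^bsub>B\<^esub> (f (?e m) \<otimes>\<^bsub>B\<^esub> b0), f (?l b0) \<otimes>\<^bsub>B\<^esub> ?V y) \<in> Q"
        by (rule B.supp_le) (use lA Vc[OF y] in auto)
      have "f (A.linear_form ?F2 y ?l) = f c \<otimes>\<^bsub>B\<^esub> f (?e y) \<ominus>\<^bsub>B\<^esub> f (y x) \<otimes>\<^bsub>B\<^esub> f (?e m)"
        unfolding e2[OF y] using eA[OF y] eA[OF mY] cA Y[OF y, of x] by (simp add: a_minus_def)
      then have "f (A.linear_form ?F2 y ?l) \<otimes>\<^bsub>B\<^esub> b0 =
          (f (?e y) \<otimes>\<^bsub>B\<^esub> b0) \<otimes>\<^bsub>B\<^esub> f c \<ominus>\<^bsub>B\<^esub> f (y x) \<otimes>\<^bsub>B\<^esub> (f (?e m) \<otimes>\<^bsub>B\<^esub> b0)"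
        using fe fc(1) fx[OF y] b0B by (simp only:) algebra
      then show ?thesis using B.diff[OF 1 2] by simp
    qed
    moreover have "(1, f (?l b0), \<zero>\<^bsub>B\<^esub>) \<notin> Q" unfolding fl using fc fl0 l(2) by (simp add: B.supp_mult_iff)
    ultimately show ?thesis unfolding F2 using lA by blast
  qed
qed

text \<open>A linear relation among elements of \<open>B\<close> is a vector on which
  \<open>evaluate\<close> vanishes, and the bound for the form then puts the defect of
  \<open>l\<close> into the support. On unit vectors the same bound is the inequality for
  \<open>T3\<close>.\<close>

lemma almost_linear_map_exists:
  assumes b0: "b0 \<in> carrier B" "(1, b0, \<zero>\<^bsub>B\<^esub>) \<notin> Q"
    and T1: "finite T1" "T1 \<subseteq> carrier B \<times> carrier B" and T2: "finite T2" "T2 \<subseteq> carrier A \<times> carrier B"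
    and T3: "finite T3" "T3 \<subseteq> carrier B"
  obtains l where "\<And>b. l b \<in> carrier A" "(1, f (l b0), \<zero>\<^bsub>B\<^esub>) \<notin> Q"
    "\<And>b b'. (b, b') \<in> T1 \<Longrightarrow> (1, f (l (b \<oplus>\<^bsub>B\<^esub> b') \<ominus>\<^bsub>A\<^esub> l b \<ominus>\<^bsub>A\<^esub> l b'), \<zero>\<^bsub>B\<^esub>) \<in> Q"
    "\<And>a b. (a, b) \<in> T2 \<Longrightarrow> (1, f (l (f a \<otimes>\<^bsub>B\<^esub> b) \<ominus>\<^bsub>A\<^esub> a \<otimes>\<^bsub>A\<^esub> l b), \<zero>\<^bsub>B\<^esub>) \<in> Q"
    "\<And>b. b \<in> T3 \<Longrightarrow> (1, f (l b) \<otimes>\<^bsub>B\<^esub> b0, f (l b0) \<otimes>\<^bsub>B\<^esub> b) \<in> Q"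
proof -
  \<comment> \<open>All elements of \<open>B\<close> that are mentioned serve as coordinates;
    \<open>b0\<close> is kept apart because it normalizes the bound.\<close>
  define F where "F = ((\<lambda>(b, b'). b \<oplus>\<^bsub>B\<^esub> b') ` T1 \<union> fst ` T1 \<union> snd ` T1 \<union> (\<lambda>(a, b). f a \<otimes>\<^bsub>B\<^esub> b) ` T2 \<union> snd ` T2 \<union> T3) - {b0}"
  define G where "G = insert b0 F"
  \<comment> \<open>The factors \<open>\<one>\<close> bring the vectors into the shape to which
    \<open>linear_form_comb\<close> and \<open>evaluate_comb\<close> apply.\<close>
  define y1 where "y1 = (\<lambda>(b, b') x. \<one>\<^bsub>A\<^esub> \<otimes>\<^bsub>A\<^esub> (\<one>\<^bsub>A\<^esub> \<otimes>\<^bsub>A\<^esub> A.unit_vector (b \<oplus>\<^bsub>B\<^esub> b') x \<ominus>\<^bsub>A\<^esub> \<one>\<^bsub>A\<^esub> \<otimes>\<^bsub>A\<^esub> A.unit_vector b x) \<ominus>\<^bsub>A\<^esub> \<one>\<^bsub>A\<^esub> \<otimes>\<^bsub>A\<^esub> A.unit_vector b' x)"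
  define y2 where "y2 = (\<lambda>(a, b) x. \<one>\<^bsub>A\<^esub> \<otimes>\<^bsub>A\<^esub> A.unit_vector (f a \<otimes>\<^bsub>B\<^esub> b) x \<ominus>\<^bsub>A\<^esub> a \<otimes>\<^bsub>A\<^esub> A.unit_vector b x)"
  define Y where "Y = y1 ` T1 \<union> y2 ` T2 \<union> A.unit_vector ` T3"
  have fin: "finite G" "finite F" "finite Y" using T1 T2 T3 by (auto simp: F_def G_def Y_def)
  have GB: "G \<subseteq> carrier B" using b0 T1 T2 T3 by (auto simp: F_def G_def)
  note uv = A.unit_vector_closed
  have Yc: "y b \<in> carrier A" if "y \<in> Y" for y b using that T2 by (auto simp: uv Y_def y1_def y2_def)
  have nF: "b0 \<notin> F" by (simp add: F_def)
  have FB: "insert b0 F \<subseteq> carrier B" using GB by (simp add: G_def)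
  obtain l where l: "\<And>b. l b \<in> carrier A" "(1, f (l b0), \<zero>\<^bsub>B\<^esub>) \<notin> Q"
    "\<And>y. y \<in> Y \<Longrightarrow> (1, f (A.linear_form G y l) \<otimes>\<^bsub>B\<^esub> b0, f (l b0) \<otimes>\<^bsub>B\<^esub> evaluate G y) \<in> Q"
    using bounded_linear_form_exists[of F b0 Y, OF fin(2) nF FB b0(2) fin(3)] Yc unfolding G_def[symmetric] by blast
  have lu: "A.linear_form G (A.unit_vector x) l = l x" if "x \<in> G" for x
    by (rule A.linear_form_unit_vector[OF fin(1) that]) (use l in auto)
  have eu: "evaluate G (A.unit_vector x) = x" if x: "x \<in> G" for x
  proof -
    have "evaluate G (A.unit_vector x) = B.linear_form G (B.unit_vector x) (\<lambda>b. b)"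
      unfolding evaluate_def
      by (rule B.linear_form_cong) (use GB in \<open>auto simp: A.unit_vector_def B.unit_vector_def\<close>)
    also have "\<dots> = x" by (rule B.linear_form_unit_vector[OF fin(1) x]) (use GB in auto)
    finally show ?thesis .
  qed
  have supp: "(1, f u, \<zero>\<^bsub>B\<^esub>) \<in> Q"
    if "(1, f u \<otimes>\<^bsub>B\<^esub> b0, f (l b0) \<otimes>\<^bsub>B\<^esub> z) \<in> Q" "z = \<zero>\<^bsub>B\<^esub>" "u \<in> carrier A" for u z
    using that b0 l(1) by (simp add: B.supp_mult_iff)
  show thesis
  proof (rule that[of l])
    show "l b \<in> carrier A" for b by (rule l(1))
    show "(1, f (l b0), \<zero>\<^bsub>B\<^esub>) \<notin> Q" by (rule l(2))
  next
    fix b b' assume bb: "(b, b') \<in> T1"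
    have "b \<oplus>\<^bsub>B\<^esub> b' \<in> (\<lambda>(b, b'). b \<oplus>\<^bsub>B\<^esub> b') ` T1" "b \<in> fst ` T1" "b' \<in> snd ` T1"
      using imageI[OF bb, of "\<lambda>(b, b'). b \<oplus>\<^bsub>B\<^esub> b'"] imageI[OF bb, of fst] imageI[OF bb, of snd] by simp_all
    then have F: "b \<oplus>\<^bsub>B\<^esub> b' \<in> G" "b \<in> G" "b' \<in> G" by (auto simp: G_def F_def)
    then have c: "b \<in> carrier B" "b' \<in> carrier B" using GB by auto
    let ?u = "\<lambda>x. \<one>\<^bsub>A\<^esub> \<otimes>\<^bsub>A\<^esub> A.unit_vector (b \<oplus>\<^bsub>B\<^esub> b') x \<ominus>\<^bsub>A\<^esub> \<one>\<^bsub>A\<^esub> \<otimes>\<^bsub>A\<^esub> A.unit_vector b x"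
    have "A.linear_form G ?u l = \<one>\<^bsub>A\<^esub> \<otimes>\<^bsub>A\<^esub> l (b \<oplus>\<^bsub>B\<^esub> b') \<ominus>\<^bsub>A\<^esub> \<one>\<^bsub>A\<^esub> \<otimes>\<^bsub>A\<^esub> l b"
      using A.linear_form_comb[OF fin(1), of "A.unit_vector (b \<oplus>\<^bsub>B\<^esub> b')" "A.unit_vector b" l "\<one>\<^bsub>A\<^esub>" "\<one>\<^bsub>A\<^esub>"] lu[OF F(1)] lu[OF F(2)] l(1) by (simp add: uv)
    moreover have "A.linear_form G (y1 (b, b')) l = \<one>\<^bsub>A\<^esub> \<otimes>\<^bsub>A\<^esub> A.linear_form G ?u l \<ominus>\<^bsub>A\<^esub> \<one>\<^bsub>A\<^esub> \<otimes>\<^bsub>A\<^esub> l b'"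
      using A.linear_form_comb[OF fin(1), of ?u "A.unit_vector b'" l "\<one>\<^bsub>A\<^esub>" "\<one>\<^bsub>A\<^esub>"] lu[OF F(3)] l(1) by (simp add: uv y1_def)
    ultimately have 1: "A.linear_form G (y1 (b, b')) l = l (b \<oplus>\<^bsub>B\<^esub> b') \<ominus>\<^bsub>A\<^esub> l b \<ominus>\<^bsub>A\<^esub> l b'"
      using l(1) by simp
    have "evaluate G ?u = f \<one>\<^bsub>A\<^esub> \<otimes>\<^bsub>B\<^esub> (b \<oplus>\<^bsub>B\<^esub> b') \<ominus>\<^bsub>B\<^esub> f \<one>\<^bsub>A\<^esub> \<otimes>\<^bsub>B\<^esub> b"
      using evaluate_comb[OF fin(1) GB, of "A.unit_vector (b \<oplus>\<^bsub>B\<^esub> b')" "A.unit_vector b" "\<one>\<^bsub>A\<^esub>" "\<one>\<^bsub>A\<^esub>"] eu[OF F(1)] eu[OF F(2)] by (simp add: uv)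
    moreover have "evaluate G (y1 (b, b')) = f \<one>\<^bsub>A\<^esub> \<otimes>\<^bsub>B\<^esub> evaluate G ?u \<ominus>\<^bsub>B\<^esub> f \<one>\<^bsub>A\<^esub> \<otimes>\<^bsub>B\<^esub> b'"
      using evaluate_comb[OF fin(1) GB, of ?u "A.unit_vector b'" "\<one>\<^bsub>A\<^esub>" "\<one>\<^bsub>A\<^esub>"] eu[OF F(3)] by (simp add: uv y1_def)
    ultimately have "evaluate G (y1 (b, b')) = (b \<oplus>\<^bsub>B\<^esub> b' \<ominus>\<^bsub>B\<^esub> b) \<ominus>\<^bsub>B\<^esub> b'"
      using c by simp
    also have "\<dots> = \<zero>\<^bsub>B\<^esub>" using c by algebra
    finally have 2: "evaluate G (y1 (b, b')) = \<zero>\<^bsub>B\<^esub>" .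
    have "y1 (b, b') \<in> Y" using bb unfolding Y_def by blast
    from supp[OF l(3)[OF this] 2] show "(1, f (l (b \<oplus>\<^bsub>B\<^esub> b') \<ominus>\<^bsub>A\<^esub> l b \<ominus>\<^bsub>A\<^esub> l b'), \<zero>\<^bsub>B\<^esub>) \<in> Q"
      unfolding 1 using l(1) by simp
  next
    fix a b assume ab: "(a, b) \<in> T2"
    have "f a \<otimes>\<^bsub>B\<^esub> b \<in> (\<lambda>(a, b). f a \<otimes>\<^bsub>B\<^esub> b) ` T2" "b \<in> snd ` T2"
      using imageI[OF ab, of "\<lambda>(a, b). f a \<otimes>\<^bsub>B\<^esub> b"] imageI[OF ab, of snd] by simp_all
    then have F: "f a \<otimes>\<^bsub>B\<^esub> b \<in> G" "b \<in> G" by (auto simp: G_def F_def)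
    have c: "a \<in> carrier A" "b \<in> carrier B" using ab T2 by auto
    have 1: "A.linear_form G (y2 (a, b)) l = l (f a \<otimes>\<^bsub>B\<^esub> b) \<ominus>\<^bsub>A\<^esub> a \<otimes>\<^bsub>A\<^esub> l b"
      using A.linear_form_comb[OF fin(1), of "A.unit_vector (f a \<otimes>\<^bsub>B\<^esub> b)" "A.unit_vector b" l "\<one>\<^bsub>A\<^esub>" a] lu[OF F(1)] lu[OF F(2)] l(1) c by (simp add: uv y2_def)
    have "evaluate G (y2 (a, b)) = f \<one>\<^bsub>A\<^esub> \<otimes>\<^bsub>B\<^esub> (f a \<otimes>\<^bsub>B\<^esub> b) \<ominus>\<^bsub>B\<^esub> f a \<otimes>\<^bsub>B\<^esub> b"
      using evaluate_comb[OF fin(1) GB, of "A.unit_vector (f a \<otimes>\<^bsub>B\<^esub> b)" "A.unit_vector b" "\<one>\<^bsub>A\<^esub>" a] eu[OF F(1)] eu[OF F(2)] c by (simp add: uv y2_def)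
    then have 2: "evaluate G (y2 (a, b)) = \<zero>\<^bsub>B\<^esub>" using c by (simp add: a_minus_def B.r_neg)
    have "y2 (a, b) \<in> Y" using ab unfolding Y_def by blast
    from supp[OF l(3)[OF this] 2] show "(1, f (l (f a \<otimes>\<^bsub>B\<^esub> b) \<ominus>\<^bsub>A\<^esub> a \<otimes>\<^bsub>A\<^esub> l b), \<zero>\<^bsub>B\<^esub>) \<in> Q"
      unfolding 1 using l(1) c by simp
  next
    fix b assume b: "b \<in> T3"
    then have "b \<in> G" "A.unit_vector b \<in> Y" by (auto simp: G_def F_def Y_def)
    then show "(1, f (l b) \<otimes>\<^bsub>B\<^esub> b0, f (l b0) \<otimes>\<^bsub>B\<^esub> b) \<in> Q"
      using l(3)[of "A.unit_vector b"] lu[of b] eu[of b] by simp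
  qed
qed

end

section \<open>Specializations and induced orders\<close>

context reified_order
begin

text \<open>
  Horizontal specialization: the values below every scalar become \<open>0\<close>, which restricts the value
  group to the convex hull of the scalars.
\<close>

definition negligible :: "'a \<Rightarrow> bool" where
  "negligible a \<longleftrightarrow> (\<forall>s. (s, \<one>, a) \<notin> Q)"

definition specialization :: "(real \<times> 'a \<times> 'a) set" where
  "specialization = {(r, a, b). 0 < r \<and> a \<in> carrier A \<and> b \<in> carrier A \<and> ((r, a, b) \<in> Q \<or> negligible a)}"

lemma negligible_le: "\<lbrakk>negligible a; (r, b, a) \<in> Q\<rbrakk> \<Longrightarrow> negligible b"
  unfolding negligible_def
proof (intro allI notI)
  fix s assume "\<forall>s. (s, \<one>, a) \<notin> Q" "(r, b, a) \<in> Q" "(s, \<one>, b) \<in> Q"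
  then show False using trans[of s \<one> b r a] by blast
qed

lemma not_negligible_one: "\<not> negligible \<one>"
  unfolding negligible_def using refl_Q[of \<one>] by auto

lemma negligible_supp: "(1, a, \<zero>) \<in> Q \<Longrightarrow> negligible a"
  unfolding negligible_def
proof (intro allI notI)
  fix s assume "(1, a, \<zero>) \<in> Q" "(s, \<one>, a) \<in> Q"
  then show False using le_supp nontrivial by blast
qed

lemma negligible_add:
  assumes "negligible a" "negligible b" "a \<in> carrier A" "b \<in> carrier A"
  shows "negligible (a \<oplus> b)"
proof (cases "(1, a, b) \<in> Q")
  case True
  then have "(1, a \<oplus> b, b) \<in> Q" using add refl_Q assms by blast
  then show ?thesis using negligible_le assms by blast
next
  case False
  then have "(1, b, a) \<in> Q" using total[of 1 a b] assms by simp
  then have "(1, a \<oplus> b, a) \<in> Q" using add refl_Q assms by blast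
  then show ?thesis using negligible_le assms by blast
qed

text \<open>The upper bounds make the negligible elements an ideal: a factor larger than every
  scalar could lift a negligible element out of this range.\<close>

lemma negligible_mult_iff:
  assumes bounded: "\<And>a. a \<in> carrier A \<Longrightarrow> \<exists>r. (r, a, \<one>) \<in> Q" and c: "a \<in> carrier A" "b \<in> carrier A"
  shows "negligible (a \<otimes> b) \<longleftrightarrow> negligible a \<or> negligible b"
proof
  assume n: "negligible (a \<otimes> b)"
  show "negligible a \<or> negligible b"
  proof (rule ccontr)
    assume "\<not> ?thesis"
    then obtain s t where "(s, \<one>, a) \<in> Q" "(t, \<one>, b) \<in> Q" unfolding negligible_def by blast
    from mult2[OF this] have "(s * t, \<one>, a \<otimes> b) \<in> Q" by simp
    then show False using n unfolding negligible_def by blast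
  qed
next
  have *: "negligible (x \<otimes> y)" if xy: "negligible x" "x \<in> carrier A" "y \<in> carrier A" for x y
  proof -
    obtain t where "(t, y, \<one>) \<in> Q" using bounded[OF xy(3)] by blast
    then have "(t, y \<otimes> x, \<one> \<otimes> x) \<in> Q" using that(2) by (rule mult)
    then have "(t, x \<otimes> y, x) \<in> Q" using that by (simp add: m_comm)
    then show ?thesis by (rule negligible_le[OF that(1)])
  qed
  assume "negligible a \<or> negligible b"
  then show "negligible (a \<otimes> b)" using *[OF _ c] *[OF _ c(2,1)] m_comm[OF c] by auto
qed

lemma specialization_supp: "(1, a, \<zero>) \<in> specialization \<longleftrightarrow> a \<in> carrier A \<and> negligible a"
  unfolding specialization_def using negligible_supp by auto

lemma reified_order_specialization:
  assumes bounded: "\<And>a. a \<in> carrier A \<Longrightarrow> \<exists>r. (r, a, \<one>) \<in> Q"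
  shows "reified_order A specialization"
proof (unfold_locales, goal_cases)
  case (1 r a b) then show ?case by (simp add: specialization_def)
next
  case (2 r a b) then show ?case using total[of r a b] by (auto simp: specialization_def)
next
  case (3 r a b s c)
  show ?case
  proof (cases "negligible a")
    case True then show ?thesis using 3 by (simp add: specialization_def)
  next
    case False
    then have ab: "(r, a, b) \<in> Q" using 3 by (simp add: specialization_def)
    then have "\<not> negligible b" using False negligible_le by blast
    then have "(s, b, c) \<in> Q" using 3 by (simp add: specialization_def)
    then show ?thesis using trans[OF ab] 3 by (simp add: specialization_def)
  qed
next
  case (4 r a b c)
  then show ?case using mult[of r a b c] negligible_mult_iff[OF bounded, of a c] by (auto simp: specialization_def)
next
  case (5 r a c b)
  have nc: "\<not> negligible c" using 5 specialization_supp by blast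
  then have cs: "(1, c, \<zero>) \<notin> Q" using negligible_supp by blast
  show ?case using 5 nc cancel[of r a c b, OF _ cs] negligible_mult_iff[OF bounded, of a c]
    by (auto simp: specialization_def)
next
  case (6 r a c b)
  then have pos: "0 < r" "a \<in> carrier A" "b \<in> carrier A" "c \<in> carrier A" by (auto simp: specialization_def)
  \<comment> \<open>Either \<open>x\<close> dominates \<open>y\<close> and the sum keeps the bound
    of \<open>x\<close>, or \<open>y\<close> dominates \<open>x\<close>, which is then negligible
    too.\<close>
  have mixed: "(r, x \<oplus> y, c) \<in> Q \<or> negligible (x \<oplus> y)"
    if xy: "(r, x, c) \<in> Q" "negligible y" "x \<in> carrier A" "y \<in> carrier A" for x y
  proof (cases "(1, y, x) \<in> Q")
    case True
    then have "(1, x \<oplus> y, x) \<in> Q" using add refl_Q xy by blast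
    then show ?thesis using trans[OF _ xy(1), of 1 "x \<oplus> y"] by simp
  next
    case False
    then have "(1, x, y) \<in> Q" using total[of 1 y x] xy by simp
    then have "negligible x" using negligible_le xy by blast
    then show ?thesis using negligible_add xy by blast
  qed
  consider "(r, a, c) \<in> Q" "(r, b, c) \<in> Q" | "(r, a, c) \<in> Q" "negligible b" | "(r, b, c) \<in> Q" "negligible a" | "negligible a" "negligible b"
    using 6 by (auto simp: specialization_def)
  then have "(r, a \<oplus> b, c) \<in> Q \<or> negligible (a \<oplus> b)"
  proof cases
    case 1 then show ?thesis using add by blast
  next
    case 2 then show ?thesis using mixed pos by blast
  next
    case 3 then show ?thesis using mixed[of b a] pos by (simp add: a_comm)
  next
    case 4 then show ?thesis using negligible_add pos by blast
  qed
  then show ?case using pos by (simp add: specialization_def)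
next
  case 7 then show ?case using specialization_supp not_negligible_one by blast
next
  case (8 r b) then show ?case using zero by (simp add: specialization_def)
next
  case (9 r) then show ?case using mono_one by (simp add: specialization_def)
qed

lemma specialization_bounded:
  assumes bounded: "\<And>a. a \<in> carrier A \<Longrightarrow> \<exists>r. (r, a, \<one>) \<in> Q"
    and "a \<in> carrier A" "(1, a, \<zero>) \<notin> specialization"
  shows "(\<exists>r. (r, \<one>, a) \<in> specialization) \<and> (\<exists>r. (r, a, \<one>) \<in> specialization)"
proof -
  have sub: "Q \<subseteq> specialization" using dom by (auto simp: specialization_def)
  have "\<not> negligible a" using assms specialization_supp by blast
  then obtain s where "(s, \<one>, a) \<in> Q" by (auto simp: negligible_def)
  moreover obtain r where "(r, a, \<one>) \<in> Q" using bounded assms by blast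
  ultimately show ?thesis using sub by blast
qed

end

section \<open>Valuation preorders and equality of values\<close>

locale valuation_ring_preorder =
  fixes le :: "'e::comm_ring_1 \<Rightarrow> 'e \<Rightarrow> bool"
  assumes le: "valuation_preorder le"
begin

lemmas le_axioms = le[unfolded valuation_preorder_def]
lemmas le_total = le_axioms[THEN conjunct1, rule_format]
  and le_trans = le_axioms[THEN conjunct2, THEN conjunct1, rule_format]
  and le_mult = le_axioms[THEN conjunct2, THEN conjunct2, THEN conjunct1, rule_format]
  and le_cancel = le_axioms[THEN conjunct2, THEN conjunct2, THEN conjunct2, THEN conjunct1, rule_format]
  and le_add = le_axioms[THEN conjunct2, THEN conjunct2, THEN conjunct2, THEN conjunct2, THEN conjunct1, rule_format]
  and le_nontrivial = le_axioms[THEN conjunct2, THEN conjunct2, THEN conjunct2, THEN conjunct2, THEN conjunct2, THEN conjunct1]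
  and le_zero = le_axioms[THEN conjunct2, THEN conjunct2, THEN conjunct2, THEN conjunct2, THEN conjunct2, THEN conjunct2, rule_format]

lemma le_refl: "le x x" using le_total[of x x] by simp

lemma le_mult_left: "le x y \<Longrightarrow> le (z * x) (z * y)"
  using le_mult[of x y z] by (simp add: mult.commute)

lemma le_minus:
  assumes "le x y"
  shows "le (- x) y"
proof -
  have "le (- 1) 1"
    using le_total[of "- 1" 1] le_mult[of 1 "- 1" "- 1"] by auto
  then have "le (- x) x" using le_mult[of "- 1" 1 x] by simp
  then show ?thesis using le_trans assms by blast
qed

text \<open>Equality of values. It is coarser than congruence modulo the support, and identities in
  the monomial ring are stated in this form.\<close>

definition eqv :: "'e \<Rightarrow> 'e \<Rightarrow> bool" where
  "eqv x y \<longleftrightarrow> le x y \<and> le y x"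

lemma eqv_supp: "le (x - y) 0 \<Longrightarrow> eqv x y"
proof -
  assume h: "le (x - y) 0"
  have "le (x - y) y" "le (- (x - y)) x" using le_trans[OF h le_zero] le_trans[OF le_minus[OF h] le_zero] by auto
  then show ?thesis
    using le_add[of "x - y" y y] le_add[of "- (x - y)" x x] le_refl by (auto simp: eqv_def)
qed

lemma eqv_le: "eqv x x' \<Longrightarrow> eqv y y' \<Longrightarrow> le x y \<longleftrightarrow> le x' y'"
  unfolding eqv_def using le_trans[of x x' y'] le_trans[of x' x y'] le_trans[of x' x y] le_trans[of x x' y]
    le_trans[of x y y'] le_trans[of x' y y'] le_trans[of x y' y] le_trans[of x' y' y] by blast

lemma eqv_refl: "eqv x x"
  by (simp add: eqv_def le_refl)

lemma eqv_sym: "eqv x y \<Longrightarrow> eqv y x"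
  by (simp add: eqv_def)

lemma eqv_trans: "eqv x y \<Longrightarrow> eqv y z \<Longrightarrow> eqv x z"
  using le_trans[of x y z] le_trans[of z y x] by (simp add: eqv_def)

lemma eqv_mult: "eqv x x' \<Longrightarrow> eqv y y' \<Longrightarrow> eqv (x * y) (x' * y')"
proof -
  assume h: "eqv x x'" "eqv y y'"
  have "eqv (x * y) (x' * y)" using h le_mult by (auto simp: eqv_def)
  moreover have "eqv (x' * y) (x' * y')" using h le_mult_left by (auto simp: eqv_def)
  ultimately show ?thesis by (rule eqv_trans)
qed

lemma eqv_le_supp: "eqv x y \<Longrightarrow> le x 0 \<longleftrightarrow> le y 0"
  using eqv_le[OF _ eqv_refl] .

end

text \<open>
  It suffices that \<open>j\<close> and the scalars \<open>T\<close> are multiplicative up to the support: this describes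
  valuations on \<open>R\<close> without a ring homomorphism out of \<open>R\<close>.
\<close>

lemma (in valuation_ring_preorder) reified_order_induced:
  fixes D :: "('d, 'n) ring_scheme"
  assumes "cring D"
    and j_add: "\<And>x y. x \<in> carrier D \<Longrightarrow> y \<in> carrier D \<Longrightarrow> eqv (j (x \<oplus>\<^bsub>D\<^esub> y)) (j x + j y)"
    and j_mult: "\<And>x y. x \<in> carrier D \<Longrightarrow> y \<in> carrier D \<Longrightarrow> eqv (j (x \<otimes>\<^bsub>D\<^esub> y)) (j x * j y)"
    and j_zero: "eqv (j \<zero>\<^bsub>D\<^esub>) 0" and j_one: "eqv (j \<one>\<^bsub>D\<^esub>) 1"
    and T_mult: "\<And>r s. 0 < r \<Longrightarrow> 0 < s \<Longrightarrow> eqv (T (r * s)) (T r * T s)" and T_one: "eqv (T 1) 1"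
    and T_mono: "\<And>r. 1 \<le> r \<Longrightarrow> le 1 (T r)"
  shows "reified_order D {(r, x, y). 0 < r \<and> x \<in> carrier D \<and> y \<in> carrier D \<and> le (j x) (T r * j y)}"
proof -
  interpret D: cring D by fact
  have T_inv: "eqv (T (1 / r) * T r) 1" if "0 < r" for r
    using eqv_trans[OF eqv_sym[OF T_mult[of "1 / r" r]]] T_one that by simp
  have T_one_mult: "eqv (T 1 * x) x" for x using eqv_mult[OF T_one eqv_refl, of x] by simp
  have supp: "le (j x) (T 1 * j \<zero>\<^bsub>D\<^esub>) \<longleftrightarrow> le (j x) 0" for x
    by (rule eqv_le[OF eqv_refl eqv_trans[OF T_one_mult j_zero]])
  show ?thesis
  proof (unfold_locales, goal_cases)
    case (1 r a b) then show ?case by simp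
  next
    case (2 r a b)
    show ?case
    proof (cases "le (j a) (T r * j b)")
      case True then show ?thesis using 2 by simp
    next
      case False
      then have "le (T r * j b) (j a)" using le_total by blast
      then have "le (T (1 / r) * (T r * j b)) (T (1 / r) * j a)" by (rule le_mult_left)
      moreover have "eqv (T (1 / r) * (T r * j b)) (j b)"
        using eqv_mult[OF T_inv[OF 2(1)] eqv_refl, of "j b"] by (simp add: mult.assoc)
      ultimately have "le (j b) (T (1 / r) * j a)" using eqv_le eqv_refl by blast
      then show ?thesis using 2 by simp
    qed
  next
    case (3 r a b s c)
    then have h: "0 < r" "0 < s" "le (j a) (T r * j b)" "le (j b) (T s * j c)" by auto
    have "le (j a) (T r * (T s * j c))" using le_trans[OF h(3) le_mult_left[OF h(4)]] .
    moreover have "eqv (T r * (T s * j c)) (T (r * s) * j c)"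
      using eqv_mult[OF eqv_sym[OF T_mult[OF h(1,2)]] eqv_refl, of "j c"] by (simp add: mult.assoc)
    ultimately have "le (j a) (T (r * s) * j c)" using eqv_le eqv_refl by blast
    then show ?case using 3 by simp
  next
    case (4 r a b c)
    then have h: "a \<in> carrier D" "b \<in> carrier D" "c \<in> carrier D" "le (j a) (T r * j b)" by auto
    have "le (j a * j c) (T r * j b * j c)" by (rule le_mult[OF h(4)])
    moreover have "eqv (T r * j b * j c) (T r * j (b \<otimes>\<^bsub>D\<^esub> c))"
      using eqv_mult[OF eqv_refl eqv_sym[OF j_mult[OF h(2,3)]], of "T r"] by (simp add: mult.assoc)
    ultimately have "le (j (a \<otimes>\<^bsub>D\<^esub> c)) (T r * j (b \<otimes>\<^bsub>D\<^esub> c))"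
      using eqv_le[OF eqv_sym[OF j_mult[OF h(1,3)]]] by blast
    then show ?case using 4 by simp
  next
    case (5 r a c b)
    then have h: "a \<in> carrier D" "b \<in> carrier D" "c \<in> carrier D" "le (j (a \<otimes>\<^bsub>D\<^esub> c)) (T r * j (b \<otimes>\<^bsub>D\<^esub> c))" by auto
    have "eqv (T r * j (b \<otimes>\<^bsub>D\<^esub> c)) (T r * j b * j c)"
      using eqv_mult[OF eqv_refl j_mult[OF h(2,3)], of "T r"] by (simp add: mult.assoc)
    then have "le (j a * j c) (T r * j b * j c)" using h(4) eqv_le[OF j_mult[OF h(1,3)]] by blast
    moreover have "\<not> le (j c) 0" using 5 supp by simp
    ultimately have "le (j a) (T r * j b)" by (rule le_cancel)
    then show ?case using 5 by simp
  next
    case (6 r a c b)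
    then have h: "a \<in> carrier D" "b \<in> carrier D" "le (j a + j b) (T r * j c)" using le_add by auto
    have "le (j (a \<oplus>\<^bsub>D\<^esub> b)) (T r * j c)" using h(3) eqv_le[OF j_add[OF h(1,2)] eqv_refl] by blast
    then show ?case using 6 by simp
  next
    case 7
    have "\<not> le (j \<one>\<^bsub>D\<^esub>) 0" using le_nontrivial eqv_le_supp[OF j_one] by simp
    then show ?case using supp by simp
  next
    case (8 r b)
    have "le (j \<zero>\<^bsub>D\<^esub>) (T r * j b)" using le_zero eqv_le[OF j_zero eqv_refl] by blast
    then show ?case using 8 by simp
  next
    case (9 r)
    have "le 1 (T r * j \<one>\<^bsub>D\<^esub>)" using T_mono[OF 9] eqv_le[OF eqv_refl eqv_mult[OF eqv_refl j_one, of "T r"], of 1] by simp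
    then have "le (j \<one>\<^bsub>D\<^esub>) (T r * j \<one>\<^bsub>D\<^esub>)" using eqv_le[OF j_one eqv_refl] by blast
    then show ?case using 9 by simp
  qed
qed

section \<open>Formal monomials\<close>

type_synonym ('b, 'c) formal_monomial = "'b \<times> 'c \<times> real \<times> 'b \<times> 'c"

text \<open>The two boundedness assumptions are commensurability on \<open>B\<close> and
  \<open>C\<close>; they enter when the Manis valuation is specialized.\<close>

locale amalgam = tensor A B C f g + QB: reified_order B Q + QC: reified_order C R
  for A :: "('a, 'm) ring_scheme" and B :: "('b, 'n) ring_scheme" and C :: "('c, 'k) ring_scheme" and f g Q R +
  assumes compat: "pullback A f Q = pullback A g R"
    and B_bounded: "\<lbrakk>b \<in> carrier B; (1, b, \<zero>\<^bsub>B\<^esub>) \<notin> Q\<rbrakk> \<Longrightarrow> (\<exists>r. (r, \<one>\<^bsub>B\<^esub>, b) \<in> Q) \<and> (\<exists>r. (r, b, \<one>\<^bsub>B\<^esub>) \<in> Q)"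
    and C_bounded: "\<lbrakk>c \<in> carrier C; (1, c, \<zero>\<^bsub>C\<^esub>) \<notin> R\<rbrakk> \<Longrightarrow> (\<exists>r. (r, \<one>\<^bsub>C\<^esub>, c) \<in> R) \<and> (\<exists>r. (r, c, \<one>\<^bsub>C\<^esub>) \<in> R)"
begin

sublocale hB: order_hom A B Q f by unfold_locales (rule f)
sublocale hC: order_hom A C R g by unfold_locales (rule g)

lemma compat_iff: "\<lbrakk>a \<in> carrier A; a' \<in> carrier A\<rbrakk> \<Longrightarrow> (r, f a, f a') \<in> Q \<longleftrightarrow> (r, g a, g a') \<in> R"
proof -
  assume "a \<in> carrier A" "a' \<in> carrier A"
  then have "(r, a, a') \<in> pullback A f Q \<longleftrightarrow> 0 < r \<and> (r, f a, f a') \<in> Q"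
    "(r, a, a') \<in> pullback A g R \<longleftrightarrow> 0 < r \<and> (r, g a, g a') \<in> R" by (auto simp: pullback_def)
  then show ?thesis using QB.dom[of r "f a" "f a'"] QC.dom[of r "g a" "g a'"] unfolding compat by blast
qed

lemma compat_supp: "a \<in> carrier A \<Longrightarrow> (1, f a, \<zero>\<^bsub>B\<^esub>) \<in> Q \<longleftrightarrow> (1, g a, \<zero>\<^bsub>C\<^esub>) \<in> R"
  using compat_iff[of a "\<zero>\<^bsub>A\<^esub>" 1] by simp

text \<open>
  The tuple \<open>(b, c, r, s, t)\<close> is a formal monomial of value \<open>r v(b) w(c) / (v(s) w(t))\<close>.
\<close>

definition monomials :: "('b, 'c) formal_monomial set" where
  "monomials = {(b, c, r, s, t). b \<in> carrier B \<and> c \<in> carrier C \<and> 0 < r \<and> s \<in> carrier B \<and> t \<in> carrier C \<and>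
     (1, s, \<zero>\<^bsub>B\<^esub>) \<notin> Q \<and> (1, t, \<zero>\<^bsub>C\<^esub>) \<notin> R}"

definition mono_mult :: "('b, 'c) formal_monomial \<Rightarrow> ('b, 'c) formal_monomial \<Rightarrow> ('b, 'c) formal_monomial" where
  "mono_mult m n = (case (m, n) of ((b, c, r, s, t), (b', c', r', s', t')) \<Rightarrow>
     (b \<otimes>\<^bsub>B\<^esub> b', c \<otimes>\<^bsub>C\<^esub> c', r * r', s \<otimes>\<^bsub>B\<^esub> s', t \<otimes>\<^bsub>C\<^esub> t'))"

definition mono_one :: "('b, 'c) formal_monomial" where
  "mono_one = (\<one>\<^bsub>B\<^esub>, \<one>\<^bsub>C\<^esub>, 1, \<one>\<^bsub>B\<^esub>, \<one>\<^bsub>C\<^esub>)"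

lemma mono_mult_simp: "mono_mult (b, c, r, s, t) (b', c', r', s', t') =
    (b \<otimes>\<^bsub>B\<^esub> b', c \<otimes>\<^bsub>C\<^esub> c', r * r', s \<otimes>\<^bsub>B\<^esub> s', t \<otimes>\<^bsub>C\<^esub> t')"
  by (simp add: mono_mult_def)

lemma monomials_iff: "(b, c, r, s, t) \<in> monomials \<longleftrightarrow> b \<in> carrier B \<and> c \<in> carrier C \<and> 0 < r \<and> s \<in> carrier B \<and> t \<in> carrier C \<and>
     (1, s, \<zero>\<^bsub>B\<^esub>) \<notin> Q \<and> (1, t, \<zero>\<^bsub>C\<^esub>) \<notin> R"
  by (simp add: monomials_def)

lemma mono_mult_closed: "\<lbrakk>m \<in> monomials; n \<in> monomials\<rbrakk> \<Longrightarrow> mono_mult m n \<in> monomials"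
  by (cases m; cases n) (simp add: monomials_iff mono_mult_simp QB.supp_mult_iff QC.supp_mult_iff)

lemma mono_one_closed: "mono_one \<in> monomials"
  by (simp add: mono_one_def monomials_iff QB.nontrivial QC.nontrivial)

lemma mono_mult_comm: "\<lbrakk>m \<in> monomials; n \<in> monomials\<rbrakk> \<Longrightarrow> mono_mult m n = mono_mult n m"
  by (cases m; cases n) (simp add: monomials_iff mono_mult_simp B.m_comm C.m_comm mult.commute)

lemma mono_mult_assoc:
  "\<lbrakk>m \<in> monomials; n \<in> monomials; p \<in> monomials\<rbrakk> \<Longrightarrow> mono_mult (mono_mult m n) p = mono_mult m (mono_mult n p)"
  by (cases m; cases n; cases p) (simp add: monomials_iff mono_mult_simp B.m_assoc C.m_assoc)

lemma mono_mult_one: "m \<in> monomials \<Longrightarrow> mono_mult m mono_one = m" "m \<in> monomials \<Longrightarrow> mono_mult mono_one m = m"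
  by (cases m, simp add: monomials_iff mono_mult_simp mono_one_def)+

text \<open>Acting as the identity outside \<open>monomials\<close> makes these maps commute on the
  whole type, as \<open>comp_fun_commute\<close> demands.\<close>

definition act :: "('b, 'c) formal_monomial \<Rightarrow> ('b, 'c) formal_monomial \<Rightarrow> ('b, 'c) formal_monomial" where
  "act m u = (if m \<in> monomials \<and> u \<in> monomials then mono_mult m u else u)"

lemma act_commute: "comp_fun_commute act"
proof
  fix m n
  show "act n \<circ> act m = act m \<circ> act n"
  proof
    fix u
    show "(act n \<circ> act m) u = (act m \<circ> act n) u"
    proof (cases "m \<in> monomials \<and> n \<in> monomials \<and> u \<in> monomials")
      case True
      then have "mono_mult n (mono_mult m u) = mono_mult m (mono_mult n u)"
        using mono_mult_assoc[of n m u] mono_mult_assoc[of m n u] mono_mult_comm[of m n] by simp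
      then show ?thesis using True mono_mult_closed[of m u] mono_mult_closed[of n u] by (simp add: act_def)
    qed (auto simp: act_def)
  qed
qed

definition ev :: "('b, 'c) formal_monomial multiset \<Rightarrow> ('b, 'c) formal_monomial" where
  "ev M = fold_mset act mono_one M"

lemma ev_empty: "ev {#} = mono_one"
  by (simp add: ev_def)

lemma ev_add_mset: "ev (add_mset m M) = act m (ev M)"
  unfolding ev_def by (rule comp_fun_commute.fold_mset_add_mset[OF act_commute])

lemma ev_closed: "ev M \<in> monomials"
  by (induction M) (auto simp: ev_empty ev_add_mset act_def mono_one_closed mono_mult_closed)

lemma ev_union: "ev (M + N) = mono_mult (ev M) (ev N)"
proof (induction M)
  case empty then show ?case using mono_mult_one(2)[OF ev_closed] by (simp add: ev_empty)
next
  case (add m M)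
  have "ev (add_mset m M + N) = act m (mono_mult (ev M) (ev N))" using add by (simp add: ev_add_mset)
  also have "\<dots> = mono_mult (act m (ev M)) (ev N)"
    using ev_closed mono_mult_closed mono_mult_assoc by (simp add: act_def)
  finally show ?case by (simp add: ev_add_mset)
qed

lemma ev_single: "m \<in> monomials \<Longrightarrow> ev {#m#} = m"
  using ev_add_mset[of m "{#}"] mono_mult_one mono_one_closed by (simp add: ev_empty act_def)

text \<open>The ambient ring is the integral monoid ring of the free commutative monoid on the type
  of monomials. It is a type of class \<open>comm_ring_1\<close>, as the Manis theorem above
  requires, and the intended monomial ring is its quotient by \<open>relations\<close>.\<close>

abbreviation gen :: "('b, 'c) formal_monomial \<Rightarrow> ('b, 'c) formal_monomial multiset \<Rightarrow>\<^sub>0 int" where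
  "gen m \<equiv> frag_of {#m#}"

lemma frag_of_mult: "frag_of M * frag_of N = frag_of (M + N)" for M N :: "('b, 'c) formal_monomial multiset"
  by (simp add: mult_single)

lemma frag_of_empty: "frag_of ({#} :: ('b, 'c) formal_monomial multiset) = 1"
  by (rule single_one)

text \<open>The quotient is never formed; instead this ideal is placed in the support of the
  preorder. The parameter \<open>k\<close> holds the scalar and the denominators and stays fixed in
  the additive rules; cancellation of denominators will come from exactness.\<close>

inductive_set relations :: "(('b, 'c) formal_monomial multiset \<Rightarrow>\<^sub>0 int) set" where
  rel_zero: "0 \<in> relations"
| rel_ev: "ev M = ev N \<Longrightarrow> frag_of M - frag_of N \<in> relations"
| rel_left: "\<lbrakk>(b, c, k) \<in> monomials; (b', c, k) \<in> monomials\<rbrakk> \<Longrightarrow>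
    gen (b \<oplus>\<^bsub>B\<^esub> b', c, k) - gen (b, c, k) - gen (b', c, k) \<in> relations"
| rel_right: "\<lbrakk>(b, c, k) \<in> monomials; (b, c', k) \<in> monomials\<rbrakk> \<Longrightarrow>
    gen (b, c \<oplus>\<^bsub>C\<^esub> c', k) - gen (b, c, k) - gen (b, c', k) \<in> relations"
| rel_middle: "\<lbrakk>a \<in> carrier A; (b, c, k) \<in> monomials\<rbrakk> \<Longrightarrow>
    gen (f a \<otimes>\<^bsub>B\<^esub> b, c, k) - gen (b, g a \<otimes>\<^bsub>C\<^esub> c, k) \<in> relations"
| rel_diff: "\<lbrakk>x \<in> relations; y \<in> relations\<rbrakk> \<Longrightarrow> x - y \<in> relations"

lemma rel_minus: "x \<in> relations \<Longrightarrow> - x \<in> relations"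
  using rel_diff[OF rel_zero, of x] by simp

lemma rel_add: "x \<in> relations \<Longrightarrow> y \<in> relations \<Longrightarrow> x + y \<in> relations"
  using rel_diff[OF _ rel_minus, of x y] by simp

lemma rel_gen: "m \<in> monomials \<Longrightarrow> frag_of M * gen m - gen (mono_mult (ev M) m) \<in> relations"
  unfolding frag_of_mult
  by (rule rel_ev) (simp only: ev_union ev_single mono_mult_closed ev_closed)

text \<open>By its rules \<open>relations\<close> is only a subgroup. Multiplying a rule by a
  monomial gives the same rule for the products, up to instances of \<open>rel_ev\<close>.\<close>

lemma rel_frag_of_mult:
  assumes "x \<in> relations"
  shows "frag_of M * x \<in> relations"
  using assms
proof induction
  case rel_zero then show ?case using relations.rel_zero by simp
next
  case (rel_ev N N')
  have "frag_of (M + N) - frag_of (M + N') \<in> relations" by (rule relations.rel_ev) (simp add: ev_union rel_ev)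
  then show ?case by (simp add: frag_of_mult right_diff_distrib)
next
  case (rel_left b c k b')
  obtain r s t where k: "k = (r, s, t)" by (cases k)
  obtain mb mc mr ms mt where m: "ev M = (mb, mc, mr, ms, mt)" by (cases "ev M")
  have mm: "(mb, mc, mr, ms, mt) \<in> monomials" using ev_closed[of M] m by simp
  have c3: "(b \<oplus>\<^bsub>B\<^esub> b', c, k) \<in> monomials" using rel_left k by (simp add: monomials_iff)
  note d = rel_gen[OF c3, of M] rel_gen[OF rel_left(1), of M] rel_gen[OF rel_left(2), of M]
  have "gen (mono_mult (ev M) (b \<oplus>\<^bsub>B\<^esub> b', c, k)) - gen (mono_mult (ev M) (b, c, k)) - gen (mono_mult (ev M) (b', c, k)) \<in> relations"
    using relations.rel_left[of "mb \<otimes>\<^bsub>B\<^esub> b" "mc \<otimes>\<^bsub>C\<^esub> c" "(mr * r, ms \<otimes>\<^bsub>B\<^esub> s, mt \<otimes>\<^bsub>C\<^esub> t)" "mb \<otimes>\<^bsub>B\<^esub> b'"]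
      mono_mult_closed[OF mm, of "(b, c, k)"] mono_mult_closed[OF mm, of "(b', c, k)"] rel_left mm
    by (simp add: k m mono_mult_simp monomials_iff B.r_distr)
  from rel_add[OF rel_diff[OF rel_diff[OF d(1) d(2)] d(3)] this] show ?case
    by (simp add: algebra_simps)
next
  case (rel_right b c k c')
  obtain r s t where k: "k = (r, s, t)" by (cases k)
  obtain mb mc mr ms mt where m: "ev M = (mb, mc, mr, ms, mt)" by (cases "ev M")
  have mm: "(mb, mc, mr, ms, mt) \<in> monomials" using ev_closed[of M] m by simp
  have c3: "(b, c \<oplus>\<^bsub>C\<^esub> c', k) \<in> monomials" using rel_right k by (simp add: monomials_iff)
  note d = rel_gen[OF c3, of M] rel_gen[OF rel_right(1), of M] rel_gen[OF rel_right(2), of M]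
  have "gen (mono_mult (ev M) (b, c \<oplus>\<^bsub>C\<^esub> c', k)) - gen (mono_mult (ev M) (b, c, k)) - gen (mono_mult (ev M) (b, c', k)) \<in> relations"
    using relations.rel_right[of "mb \<otimes>\<^bsub>B\<^esub> b" "mc \<otimes>\<^bsub>C\<^esub> c" "(mr * r, ms \<otimes>\<^bsub>B\<^esub> s, mt \<otimes>\<^bsub>C\<^esub> t)" "mc \<otimes>\<^bsub>C\<^esub> c'"]
      mono_mult_closed[OF mm, of "(b, c, k)"] mono_mult_closed[OF mm, of "(b, c', k)"] rel_right mm
    by (simp add: k m mono_mult_simp monomials_iff C.r_distr)
  from rel_add[OF rel_diff[OF rel_diff[OF d(1) d(2)] d(3)] this] show ?case
    by (simp add: algebra_simps)
next
  case (rel_middle a b c k)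
  obtain r s t where k: "k = (r, s, t)" by (cases k)
  obtain mb mc mr ms mt where m: "ev M = (mb, mc, mr, ms, mt)" by (cases "ev M")
  have mm: "(mb, mc, mr, ms, mt) \<in> monomials" using ev_closed[of M] m by simp
  have c2: "(f a \<otimes>\<^bsub>B\<^esub> b, c, k) \<in> monomials" "(b, g a \<otimes>\<^bsub>C\<^esub> c, k) \<in> monomials" using rel_middle k by (simp_all add: monomials_iff)
  note d = rel_gen[OF c2(1), of M] rel_gen[OF c2(2), of M]
  have "gen (mono_mult (ev M) (f a \<otimes>\<^bsub>B\<^esub> b, c, k)) - gen (mono_mult (ev M) (b, g a \<otimes>\<^bsub>C\<^esub> c, k)) \<in> relations"
    using relations.rel_middle[of a "mb \<otimes>\<^bsub>B\<^esub> b" "mc \<otimes>\<^bsub>C\<^esub> c" "(mr * r, ms \<otimes>\<^bsub>B\<^esub> s, mt \<otimes>\<^bsub>C\<^esub> t)"]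
      mono_mult_closed[OF mm, of "(b, c, k)"] rel_middle mm
    by (simp add: k m mono_mult_simp monomials_iff B.m_lcomm C.m_lcomm)
  from rel_add[OF rel_diff[OF d(1) d(2)] this] show ?case
    by (simp add: algebra_simps)
next
  case (rel_diff x y)
  then show ?case using relations.rel_diff by (simp add: right_diff_distrib)
qed

lemma rel_mult:
  assumes "x \<in> relations"
  shows "e * x \<in> relations"
proof (rule frag_induction[of e UNIV])
  show "0 * x \<in> relations" by (simp add: rel_zero)
  show "frag_of M * x \<in> relations" for M by (rule rel_frag_of_mult[OF assms])
  show "(a - b) * x \<in> relations" if "a * x \<in> relations" "b * x \<in> relations" for a b
    using rel_diff[OF that] by (simp add: left_diff_distrib)
qed simp

text \<open>
  A monomial \<open>(b, c, r, s, t)\<close> has value at most \<open>1\<close> as soon as some \<open>\<gamma> = q v(a) / v(a')\<close> in the value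
  group of \<open>A\<close> satisfies \<open>v(b) / v(s) \<le> \<gamma>\<close> and \<open>r w(c) / w(t) \<le> \<gamma>\<inverse>\<close>.
\<close>

definition scal :: "real \<Rightarrow> 'a \<Rightarrow> 'a \<Rightarrow> bool" where
  "scal q a a' \<longleftrightarrow> 0 < q \<and> a \<in> carrier A \<and> a' \<in> carrier A \<and> (1, f a, \<zero>\<^bsub>B\<^esub>) \<notin> Q \<and> (1, f a', \<zero>\<^bsub>B\<^esub>) \<notin> Q"

definition bounds :: "real \<Rightarrow> 'a \<Rightarrow> 'a \<Rightarrow> ('b, 'c) formal_monomial \<Rightarrow> bool" where
  "bounds q a a' m = (case m of (b, c, r, s, t) \<Rightarrow>
     (q, f a' \<otimes>\<^bsub>B\<^esub> b, f a \<otimes>\<^bsub>B\<^esub> s) \<in> Q \<and> (1 / (r * q), g a \<otimes>\<^bsub>C\<^esub> c, g a' \<otimes>\<^bsub>C\<^esub> t) \<in> R)"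

definition lower_B :: "real \<Rightarrow> 'a \<Rightarrow> 'a \<Rightarrow> ('b, 'c) formal_monomial \<Rightarrow> bool" where
  "lower_B q a a' m = (case m of (b, c, r, s, t) \<Rightarrow> (1 / q, f a \<otimes>\<^bsub>B\<^esub> s, f a' \<otimes>\<^bsub>B\<^esub> b) \<in> Q)"

definition lower_C :: "real \<Rightarrow> 'a \<Rightarrow> 'a \<Rightarrow> ('b, 'c) formal_monomial \<Rightarrow> bool" where
  "lower_C q a a' m = (case m of (b, c, r, s, t) \<Rightarrow> (r * q, g a' \<otimes>\<^bsub>C\<^esub> t, g a \<otimes>\<^bsub>C\<^esub> c) \<in> R)"

definition small :: "('b, 'c) formal_monomial \<Rightarrow> bool" where
  "small m \<longleftrightarrow> (\<exists>q a a'. scal q a a' \<and> bounds q a a' m)"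

definition tiny :: "('b, 'c) formal_monomial \<Rightarrow> bool" where
  "tiny m \<longleftrightarrow> (\<exists>q a a'. scal q a a' \<and> bounds q a a' m \<and> \<not> (lower_B q a a' m \<and> lower_C q a a' m))"

definition exact :: "('b, 'c) formal_monomial \<Rightarrow> bool" where
  "exact m \<longleftrightarrow> (\<exists>q a a'. scal q a a' \<and> bounds q a a' m \<and> lower_B q a a' m \<and> lower_C q a a' m)"

lemma scal_mult: "\<lbrakk>scal q a a'; scal p e e'\<rbrakk> \<Longrightarrow> scal (q * p) (a \<otimes>\<^bsub>A\<^esub> e) (a' \<otimes>\<^bsub>A\<^esub> e')"
  by (auto simp: scal_def QB.supp_mult_iff)

lemma scal_one: "scal 1 \<one>\<^bsub>A\<^esub> \<one>\<^bsub>A\<^esub>"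
  by (simp add: scal_def QB.nontrivial)

lemma scal_scalar: "0 < q \<Longrightarrow> scal q \<one>\<^bsub>A\<^esub> \<one>\<^bsub>A\<^esub>"
  by (simp add: scal_def QB.nontrivial)

lemma bounds_mult:
  assumes "m \<in> monomials" "n \<in> monomials" "scal q a a'" "scal p e e'" "bounds q a a' m" "bounds p e e' n"
  shows "bounds (q * p) (a \<otimes>\<^bsub>A\<^esub> e) (a' \<otimes>\<^bsub>A\<^esub> e') (mono_mult m n)"
proof -
  obtain b c r s t b' c' r' s' t' where m: "m = (b, c, r, s, t)" and n: "n = (b', c', r', s', t')"
    by (cases m; cases n)
  have 1: "(q * p, (f a' \<otimes>\<^bsub>B\<^esub> b) \<otimes>\<^bsub>B\<^esub> (f e' \<otimes>\<^bsub>B\<^esub> b'), (f a \<otimes>\<^bsub>B\<^esub> s) \<otimes>\<^bsub>B\<^esub> (f e \<otimes>\<^bsub>B\<^esub> s')) \<in> Q"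
    using assms(5,6) by (rule_tac QB.mult2) (simp_all add: m n bounds_def)
  have 2: "(1 / (r * q) * (1 / (r' * p)), (g a \<otimes>\<^bsub>C\<^esub> c) \<otimes>\<^bsub>C\<^esub> (g e \<otimes>\<^bsub>C\<^esub> c'), (g a' \<otimes>\<^bsub>C\<^esub> t) \<otimes>\<^bsub>C\<^esub> (g e' \<otimes>\<^bsub>C\<^esub> t')) \<in> R"
    using assms(5,6) by (rule_tac QC.mult2) (simp_all add: m n bounds_def)
  have 3: "1 / (r * q) * (1 / (r' * p)) = 1 / (r * r' * (q * p))" by (simp add: mult_ac)
  show ?thesis
    using 1 2[unfolded 3] assms(1-4) by (simp add: m n bounds_def mono_mult_simp monomials_iff scal_def B.m_ac C.m_ac)
qed

lemma lower_mult:
  assumes "m \<in> monomials" "n \<in> monomials" "scal q a a'" "scal p e e'"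
  shows "lower_B q a a' m \<Longrightarrow> lower_B p e e' n \<Longrightarrow> lower_B (q * p) (a \<otimes>\<^bsub>A\<^esub> e) (a' \<otimes>\<^bsub>A\<^esub> e') (mono_mult m n)"
    "lower_C q a a' m \<Longrightarrow> lower_C p e e' n \<Longrightarrow> lower_C (q * p) (a \<otimes>\<^bsub>A\<^esub> e) (a' \<otimes>\<^bsub>A\<^esub> e') (mono_mult m n)"
proof -
  obtain b c r s t b' c' r' s' t' where m: "m = (b, c, r, s, t)" and n: "n = (b', c', r', s', t')"
    by (cases m; cases n)
  show "lower_B (q * p) (a \<otimes>\<^bsub>A\<^esub> e) (a' \<otimes>\<^bsub>A\<^esub> e') (mono_mult m n)" if h: "lower_B q a a' m" "lower_B p e e' n"
  proof -
    have 1: "(1 / q * (1 / p), (f a \<otimes>\<^bsub>B\<^esub> s) \<otimes>\<^bsub>B\<^esub> (f e \<otimes>\<^bsub>B\<^esub> s'), (f a' \<otimes>\<^bsub>B\<^esub> b) \<otimes>\<^bsub>B\<^esub> (f e' \<otimes>\<^bsub>B\<^esub> b')) \<in> Q"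
      using h by (rule_tac QB.mult2) (simp_all add: m n lower_B_def)
    have 3: "1 / q * (1 / p) = 1 / (q * p)" by simp
    show ?thesis using 1[unfolded 3] assms(1-4) by (simp add: m n lower_B_def mono_mult_simp monomials_iff scal_def B.m_ac)
  qed
  show "lower_C (q * p) (a \<otimes>\<^bsub>A\<^esub> e) (a' \<otimes>\<^bsub>A\<^esub> e') (mono_mult m n)" if h: "lower_C q a a' m" "lower_C p e e' n"
  proof -
    have 1: "((r * q) * (r' * p), (g a' \<otimes>\<^bsub>C\<^esub> t) \<otimes>\<^bsub>C\<^esub> (g e' \<otimes>\<^bsub>C\<^esub> t'), (g a \<otimes>\<^bsub>C\<^esub> c) \<otimes>\<^bsub>C\<^esub> (g e \<otimes>\<^bsub>C\<^esub> c')) \<in> R"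
      using h by (rule_tac QC.mult2) (simp_all add: m n lower_C_def)
    have 3: "(r * q) * (r' * p) = r * r' * (q * p)" by simp
    show ?thesis using 1[unfolded 3] assms(1-4) by (simp add: m n lower_C_def mono_mult_simp monomials_iff scal_def C.m_ac)
  qed
qed

text \<open>A strict inequality stays strict after multiplication by a weak one whose larger side is
  nonzero. Here the larger sides consist of elements of \<open>A\<close> and denominators, all
  outside the supports.\<close>

lemma not_lower_mult:
  assumes "m \<in> monomials" "n \<in> monomials" "scal q a a'" "scal p e e'" "bounds p e e' n"
  shows "\<not> lower_B q a a' m \<Longrightarrow> \<not> lower_B (q * p) (a \<otimes>\<^bsub>A\<^esub> e) (a' \<otimes>\<^bsub>A\<^esub> e') (mono_mult m n)"
    "\<not> lower_C q a a' m \<Longrightarrow> \<not> lower_C (q * p) (a \<otimes>\<^bsub>A\<^esub> e) (a' \<otimes>\<^bsub>A\<^esub> e') (mono_mult m n)"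
proof -
  obtain b c r s t b' c' r' s' t' where m: "m = (b, c, r, s, t)" and n: "n = (b', c', r', s', t')"
    by (cases m; cases n)
  have gs: "(1, g e', \<zero>\<^bsub>C\<^esub>) \<notin> R" using assms(4) compat_supp[of e'] by (auto simp: scal_def)
  show "\<not> lower_B (q * p) (a \<otimes>\<^bsub>A\<^esub> e) (a' \<otimes>\<^bsub>A\<^esub> e') (mono_mult m n)" if h: "\<not> lower_B q a a' m"
  proof -
    have "(1 / (q * p), (f a \<otimes>\<^bsub>B\<^esub> s) \<otimes>\<^bsub>B\<^esub> (f e \<otimes>\<^bsub>B\<^esub> s'), (f a' \<otimes>\<^bsub>B\<^esub> b) \<otimes>\<^bsub>B\<^esub> (f e' \<otimes>\<^bsub>B\<^esub> b')) \<notin> Q"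
      using h assms by (intro QB.strict_mult) (auto simp: m n lower_B_def bounds_def monomials_iff scal_def QB.supp_mult_iff)
    then show ?thesis using assms(1-4) by (simp add: m n lower_B_def mono_mult_simp monomials_iff scal_def B.m_ac)
  qed
  show "\<not> lower_C (q * p) (a \<otimes>\<^bsub>A\<^esub> e) (a' \<otimes>\<^bsub>A\<^esub> e') (mono_mult m n)" if h: "\<not> lower_C q a a' m"
  proof -
    have "(1 / (1 / (r * q) * (1 / (r' * p))), (g a' \<otimes>\<^bsub>C\<^esub> t) \<otimes>\<^bsub>C\<^esub> (g e' \<otimes>\<^bsub>C\<^esub> t'), (g a \<otimes>\<^bsub>C\<^esub> c) \<otimes>\<^bsub>C\<^esub> (g e \<otimes>\<^bsub>C\<^esub> c')) \<notin> R"
      using h assms gs by (intro QC.strict_mult) (auto simp: m n lower_C_def bounds_def monomials_iff scal_def QC.supp_mult_iff)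
    then have "(r * r' * (q * p), (g a' \<otimes>\<^bsub>C\<^esub> t) \<otimes>\<^bsub>C\<^esub> (g e' \<otimes>\<^bsub>C\<^esub> t'), (g a \<otimes>\<^bsub>C\<^esub> c) \<otimes>\<^bsub>C\<^esub> (g e \<otimes>\<^bsub>C\<^esub> c')) \<notin> R"
      by (simp add: mult_ac)
    then show ?thesis using assms(1-4) by (simp add: m n lower_C_def mono_mult_simp monomials_iff scal_def C.m_ac)
  qed
qed

lemma small_mult: "\<lbrakk>m \<in> monomials; n \<in> monomials; small m; small n\<rbrakk> \<Longrightarrow> small (mono_mult m n)"
  unfolding small_def using bounds_mult scal_mult by meson

lemma tiny_mult: "\<lbrakk>m \<in> monomials; n \<in> monomials; tiny m; small n\<rbrakk> \<Longrightarrow> tiny (mono_mult m n)"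
  unfolding small_def tiny_def using bounds_mult scal_mult not_lower_mult by meson

lemma exact_mult: "\<lbrakk>m \<in> monomials; n \<in> monomials; exact m; exact n\<rbrakk> \<Longrightarrow> exact (mono_mult m n)"
  unfolding exact_def using bounds_mult scal_mult lower_mult by meson

lemma exact_one: "exact mono_one"
  unfolding exact_def
  using QB.refl_Q[of "\<one>\<^bsub>B\<^esub>"] QC.refl_Q[of "\<one>\<^bsub>C\<^esub>"] scal_one
  by (intro exI[of _ 1] exI[of _ "\<one>\<^bsub>A\<^esub>"]) (simp add: bounds_def lower_B_def lower_C_def mono_one_def)

lemma tiny_small: "tiny m \<Longrightarrow> small m" and exact_small: "exact m \<Longrightarrow> small m"
  unfolding tiny_def small_def exact_def by blast+

text \<open>Those instances of additivity and \<open>A\<close>-linearity of \<open>l\<close>, up to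
  the support, that a given derivation of a relation uses.\<close>

definition compatible :: "('b \<times> 'b) set \<Rightarrow> ('a \<times> 'b) set \<Rightarrow> ('b \<Rightarrow> 'a) \<Rightarrow> bool" where
  "compatible T1 T2 l \<longleftrightarrow>
     (\<forall>(b, b')\<in>T1. (1, f (l (b \<oplus>\<^bsub>B\<^esub> b') \<ominus>\<^bsub>A\<^esub> l b \<ominus>\<^bsub>A\<^esub> l b'), \<zero>\<^bsub>B\<^esub>) \<in> Q) \<and>
     (\<forall>(a, b)\<in>T2. (1, f (l (f a \<otimes>\<^bsub>B\<^esub> b) \<ominus>\<^bsub>A\<^esub> a \<otimes>\<^bsub>A\<^esub> l b), \<zero>\<^bsub>B\<^esub>) \<in> Q)"

text \<open>Monomials with another scalar or other denominators go to zero. The additive rules of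
  \<open>relations\<close> preserve \<open>k\<close>, so this projection respects them.\<close>

definition contract :: "('b \<Rightarrow> 'a) \<Rightarrow> real \<times> 'b \<times> 'c \<Rightarrow> ('b, 'c) formal_monomial \<Rightarrow> 'c" where
  "contract l k m = (case m of (b, c, k') \<Rightarrow> if k' = k then g (l b) \<otimes>\<^bsub>C\<^esub> c else \<zero>\<^bsub>C\<^esub>)"

lemma hom_diff:
  assumes h: "h \<in> hom (free_Abelian_group UNIV) (add_monoid C)"
  shows "h x \<in> carrier C" "h 0 = \<zero>\<^bsub>C\<^esub>" "h (x - y) = h x \<ominus>\<^bsub>C\<^esub> h y"
proof -
  show c: "h x \<in> carrier C" for x using hom_in_carrier[OF h, of x] by simp
  have p: "h (x + y) = h x \<oplus>\<^bsub>C\<^esub> h y" for x y using hom_mult[OF h, of x y] by simp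
  show z: "h 0 = \<zero>\<^bsub>C\<^esub>" using p[of 0 0] c[of 0] by (simp add: C.add.r_cancel_one)
  have "h x = h (x - y) \<oplus>\<^bsub>C\<^esub> h y" using p[of "x - y" y] by simp
  then show "h (x - y) = h x \<ominus>\<^bsub>C\<^esub> h y"
    using c by (simp add: a_minus_def C.a_assoc C.r_neg)
qed

text \<open>A derivation consists of finitely many rules, each of which calls for at most one
  instance of additivity or linearity of \<open>l\<close>. So the map may depend on the relation and
  has to satisfy only finitely many constraints.\<close>

lemma relation_constraints:
  assumes "x \<in> relations"
  shows "\<exists>T1 T2. finite T1 \<and> T1 \<subseteq> carrier B \<times> carrier B \<and> finite T2 \<and> T2 \<subseteq> carrier A \<times> carrier B \<and>
    (\<forall>l h. (\<forall>b. l b \<in> carrier A) \<longrightarrow> compatible T1 T2 l \<longrightarrow> h \<in> hom (free_Abelian_group UNIV) (add_monoid C) \<longrightarrow>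
      (\<forall>M. h (frag_of M) = contract l k (ev M)) \<longrightarrow> (1, h x, \<zero>\<^bsub>C\<^esub>) \<in> R)"
    (is "\<exists>T1 T2. ?P T1 T2 x")
  using assms
proof induction
  case rel_zero
  have "?P {} {} 0" by (auto simp: hom_diff(2) QC.supp_zero)
  then show ?case by blast
next
  case (rel_ev M N)
  have "?P {} {} (frag_of M - frag_of N)"
  proof (intro conjI allI impI)
    fix l h assume h: "h \<in> hom (free_Abelian_group UNIV) (add_monoid C)" "\<forall>M. h (frag_of M) = contract l k (ev M)"
    then have "h (frag_of M - frag_of N) = \<zero>\<^bsub>C\<^esub>"
      using hom_diff(3)[OF h(1), of "frag_of M" "frag_of N"] hom_diff(1)[OF h(1), of "frag_of N"] rel_ev
      by (simp add: a_minus_def C.r_neg)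
    then show "(1, h (frag_of M - frag_of N), \<zero>\<^bsub>C\<^esub>) \<in> R" using QC.supp_zero by simp
  qed simp_all
  then show ?case by blast
next
  case (rel_left b c k' b')
  obtain r s t where k': "k' = (r, s, t)" by (cases k')
  have car: "b \<in> carrier B" "b' \<in> carrier B" "c \<in> carrier C" using rel_left by (auto simp: k' monomials_iff)
  have m: "(b \<oplus>\<^bsub>B\<^esub> b', c, k') \<in> monomials" using rel_left by (simp add: k' monomials_iff)
  have "?P {(b, b')} {} (gen (b \<oplus>\<^bsub>B\<^esub> b', c, k') - gen (b, c, k') - gen (b', c, k'))"
  proof (intro conjI allI impI)
    fix l h assume l: "\<forall>b. l b \<in> carrier A" and re: "compatible {(b, b')} {} l"
      and h: "h \<in> hom (free_Abelian_group UNIV) (add_monoid C)" "\<forall>M. h (frag_of M) = contract l k (ev M)"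
    let ?u = "l (b \<oplus>\<^bsub>B\<^esub> b') \<ominus>\<^bsub>A\<^esub> l b \<ominus>\<^bsub>A\<^esub> l b'"
    have e: "h (gen (b \<oplus>\<^bsub>B\<^esub> b', c, k') - gen (b, c, k') - gen (b', c, k')) =
        contract l k (b \<oplus>\<^bsub>B\<^esub> b', c, k') \<ominus>\<^bsub>C\<^esub> contract l k (b, c, k') \<ominus>\<^bsub>C\<^esub> contract l k (b', c, k')"
      by (simp add: hom_diff(3)[OF h(1)] h(2) ev_single m rel_left)
    have uc: "?u \<in> carrier A" using l by simp
    have "(1, g ?u, \<zero>\<^bsub>C\<^esub>) \<in> R" using re compat_supp[OF uc] by (simp add: compatible_def)
    then have "(1, g ?u \<otimes>\<^bsub>C\<^esub> c, \<zero>\<^bsub>C\<^esub>) \<in> R" using uc car by (simp add: QC.supp_mult_iff)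
    moreover have "g ?u \<otimes>\<^bsub>C\<^esub> c = g (l (b \<oplus>\<^bsub>B\<^esub> b')) \<otimes>\<^bsub>C\<^esub> c \<ominus>\<^bsub>C\<^esub> g (l b) \<otimes>\<^bsub>C\<^esub> c \<ominus>\<^bsub>C\<^esub> g (l b') \<otimes>\<^bsub>C\<^esub> c"
      using l car by (simp add: a_minus_def C.l_distr C.l_minus)
    ultimately show "(1, h (gen (b \<oplus>\<^bsub>B\<^esub> b', c, k') - gen (b, c, k') - gen (b', c, k')), \<zero>\<^bsub>C\<^esub>) \<in> R"
      unfolding e contract_def using QC.supp_zero by (cases "k' = k") (simp_all add: a_minus_def)
  qed (use car in simp_all)
  then show ?case by blast
next
  case (rel_right b c k' c')
  obtain r s t where k': "k' = (r, s, t)" by (cases k')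
  have car: "b \<in> carrier B" "c \<in> carrier C" "c' \<in> carrier C" using rel_right by (auto simp: k' monomials_iff)
  have m: "(b, c \<oplus>\<^bsub>C\<^esub> c', k') \<in> monomials" using rel_right by (simp add: k' monomials_iff)
  have "?P {} {} (gen (b, c \<oplus>\<^bsub>C\<^esub> c', k') - gen (b, c, k') - gen (b, c', k'))"
  proof (intro conjI allI impI)
    fix l h assume l: "\<forall>b. l b \<in> carrier A"
      and h: "h \<in> hom (free_Abelian_group UNIV) (add_monoid C)" "\<forall>M. h (frag_of M) = contract l k (ev M)"
    have e: "h (gen (b, c \<oplus>\<^bsub>C\<^esub> c', k') - gen (b, c, k') - gen (b, c', k')) =
        contract l k (b, c \<oplus>\<^bsub>C\<^esub> c', k') \<ominus>\<^bsub>C\<^esub> contract l k (b, c, k') \<ominus>\<^bsub>C\<^esub> contract l k (b, c', k')"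
      by (simp add: hom_diff(3)[OF h(1)] h(2) ev_single m rel_right)
    have gl: "g (l b) \<in> carrier C" using l by simp
    have "g (l b) \<otimes>\<^bsub>C\<^esub> (c \<oplus>\<^bsub>C\<^esub> c') \<ominus>\<^bsub>C\<^esub> g (l b) \<otimes>\<^bsub>C\<^esub> c \<ominus>\<^bsub>C\<^esub> g (l b) \<otimes>\<^bsub>C\<^esub> c' = \<zero>\<^bsub>C\<^esub>"
      using gl car by algebra
    then show "(1, h (gen (b, c \<oplus>\<^bsub>C\<^esub> c', k') - gen (b, c, k') - gen (b, c', k')), \<zero>\<^bsub>C\<^esub>) \<in> R"
      unfolding e contract_def using QC.supp_zero by (cases "k' = k") (simp_all add: a_minus_def)
  qed simp_all
  then show ?case by blast
next
  case (rel_middle a b c k')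
  obtain r s t where k': "k' = (r, s, t)" by (cases k')
  have car: "a \<in> carrier A" "b \<in> carrier B" "c \<in> carrier C" using rel_middle by (auto simp: k' monomials_iff)
  have m: "(f a \<otimes>\<^bsub>B\<^esub> b, c, k') \<in> monomials" "(b, g a \<otimes>\<^bsub>C\<^esub> c, k') \<in> monomials"
    using rel_middle by (simp_all add: k' monomials_iff)
  have "?P {} {(a, b)} (gen (f a \<otimes>\<^bsub>B\<^esub> b, c, k') - gen (b, g a \<otimes>\<^bsub>C\<^esub> c, k'))"
  proof (intro conjI allI impI)
    fix l h assume l: "\<forall>b. l b \<in> carrier A" and re: "compatible {} {(a, b)} l"
      and h: "h \<in> hom (free_Abelian_group UNIV) (add_monoid C)" "\<forall>M. h (frag_of M) = contract l k (ev M)"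
    let ?u = "l (f a \<otimes>\<^bsub>B\<^esub> b) \<ominus>\<^bsub>A\<^esub> a \<otimes>\<^bsub>A\<^esub> l b"
    have e: "h (gen (f a \<otimes>\<^bsub>B\<^esub> b, c, k') - gen (b, g a \<otimes>\<^bsub>C\<^esub> c, k')) =
        contract l k (f a \<otimes>\<^bsub>B\<^esub> b, c, k') \<ominus>\<^bsub>C\<^esub> contract l k (b, g a \<otimes>\<^bsub>C\<^esub> c, k')"
      by (simp add: hom_diff(3)[OF h(1)] h(2) ev_single m)
    have uc: "?u \<in> carrier A" using l car by simp
    have "(1, g ?u, \<zero>\<^bsub>C\<^esub>) \<in> R" using re compat_supp[OF uc] by (simp add: compatible_def)
    then have "(1, g ?u \<otimes>\<^bsub>C\<^esub> c, \<zero>\<^bsub>C\<^esub>) \<in> R" using uc car by (simp add: QC.supp_mult_iff)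
    moreover have "g ?u \<otimes>\<^bsub>C\<^esub> c = g (l (f a \<otimes>\<^bsub>B\<^esub> b)) \<otimes>\<^bsub>C\<^esub> c \<ominus>\<^bsub>C\<^esub> g (l b) \<otimes>\<^bsub>C\<^esub> (g a \<otimes>\<^bsub>C\<^esub> c)"
    proof -
      have "g (l b) \<otimes>\<^bsub>C\<^esub> (g a \<otimes>\<^bsub>C\<^esub> c) = g a \<otimes>\<^bsub>C\<^esub> g (l b) \<otimes>\<^bsub>C\<^esub> c" using l car by (simp add: C.m_ac)
      then show ?thesis using l car by (simp add: a_minus_def C.l_distr C.l_minus)
    qed
    ultimately show "(1, h (gen (f a \<otimes>\<^bsub>B\<^esub> b, c, k') - gen (b, g a \<otimes>\<^bsub>C\<^esub> c, k')), \<zero>\<^bsub>C\<^esub>) \<in> R"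
      unfolding e contract_def using QC.supp_zero by (cases "k' = k") (simp_all add: a_minus_def)
  qed (use car in simp_all)
  then show ?case by blast
next
  case (rel_diff x y)
  obtain T1 T2 where T: "?P T1 T2 x" using rel_diff.IH(1) by (elim exE)
  obtain S1 S2 where S: "?P S1 S2 y" using rel_diff.IH(2) by (elim exE)
  have "?P (T1 \<union> S1) (T2 \<union> S2) (x - y)"
  proof (intro conjI allI impI)
    fix l h assume l: "\<forall>b. l b \<in> carrier A" and re: "compatible (T1 \<union> S1) (T2 \<union> S2) l"
      and h: "h \<in> hom (free_Abelian_group UNIV) (add_monoid C)" "\<forall>M. h (frag_of M) = contract l k (ev M)"
    have "compatible T1 T2 l" "compatible S1 S2 l" using re by (simp_all add: compatible_def ball_Un)
    then have "(1, h x, \<zero>\<^bsub>C\<^esub>) \<in> R" "(1, h y, \<zero>\<^bsub>C\<^esub>) \<in> R"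
      using T[THEN conjunct2, THEN conjunct2, THEN conjunct2, THEN conjunct2, rule_format, OF l[rule_format] _ h(1) h(2)[rule_format]]
        S[THEN conjunct2, THEN conjunct2, THEN conjunct2, THEN conjunct2, rule_format, OF l[rule_format] _ h(1) h(2)[rule_format]] by simp_all
    then show "(1, h (x - y), \<zero>\<^bsub>C\<^esub>) \<in> R" unfolding hom_diff(3)[OF h(1)] by (rule QC.diff)
  next
    show "finite (T1 \<union> S1)" "finite (T2 \<union> S2)" "T1 \<union> S1 \<subseteq> carrier B \<times> carrier B" "T2 \<union> S2 \<subseteq> carrier A \<times> carrier B"
      using T S by (simp_all only: finite_Un Un_subset_iff)
  qed
  then show ?case by (intro exI)
qed

text \<open>The bound \<open>H\<close> on \<open>l\<close> and the bounds on the monomials combine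
  in \<open>B\<close> to an inequality between elements of \<open>A\<close>. Read in
  \<open>C\<close>, it contradicts \<open>Z\<close>, because one of the two bounds of a tiny
  monomial is strict.\<close>

lemma tiny_strict:
  assumes m0: "(b0, c0, r, s, t) \<in> monomials" and ex: "scal q0 a0 a0'" "lower_B q0 a0 a0' (b0, c0, r, s, t)"
      "lower_C q0 a0 a0' (b0, c0, r, s, t)"
    and m: "(b, c, r, s, t) \<in> monomials" "tiny (b, c, r, s, t)"
    and x: "x0 \<in> carrier A" "x \<in> carrier A" "(1, f x0, \<zero>\<^bsub>B\<^esub>) \<notin> Q"
    and b0: "(1, b0, \<zero>\<^bsub>B\<^esub>) \<notin> Q" and c0: "(1, c0, \<zero>\<^bsub>C\<^esub>) \<notin> R"
    and H: "(1, f x \<otimes>\<^bsub>B\<^esub> b0, f x0 \<otimes>\<^bsub>B\<^esub> b) \<in> Q"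
  shows "(1, g x0 \<otimes>\<^bsub>C\<^esub> c0, g x \<otimes>\<^bsub>C\<^esub> c) \<notin> R"
proof
  assume Z: "(1, g x0 \<otimes>\<^bsub>C\<^esub> c0, g x \<otimes>\<^bsub>C\<^esub> c) \<in> R"
  obtain q a a' where q: "scal q a a'" "bounds q a a' (b, c, r, s, t)"
    and strict: "\<not> (lower_B q a a' (b, c, r, s, t) \<and> lower_C q a a' (b, c, r, s, t))"
    using m(2) unfolding tiny_def by blast
  have car: "b \<in> carrier B" "c \<in> carrier C" "b0 \<in> carrier B" "c0 \<in> carrier C" "s \<in> carrier B" "t \<in> carrier C"
    "a \<in> carrier A" "a' \<in> carrier A" "a0 \<in> carrier A" "a0' \<in> carrier A" and pos: "0 < r" "0 < q" "0 < q0"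
    using m0 m(1) q(1) ex(1) by (auto simp: monomials_iff scal_def)
  have fc: "f x \<in> carrier B" "f x0 \<in> carrier B" "f a \<in> carrier B" "f a' \<in> carrier B" "f a0 \<in> carrier B" "f a0' \<in> carrier B"
    and gc: "g x \<in> carrier C" "g x0 \<in> carrier C" "g a \<in> carrier C" "g a' \<in> carrier C" "g a0 \<in> carrier C" "g a0' \<in> carrier C"
    using car x by auto
  have s: "(1, s, \<zero>\<^bsub>B\<^esub>) \<notin> Q" "(1, t, \<zero>\<^bsub>C\<^esub>) \<notin> R" using m0 by (auto simp: monomials_iff)
  have fs: "(1, f a, \<zero>\<^bsub>B\<^esub>) \<notin> Q" "(1, f a', \<zero>\<^bsub>B\<^esub>) \<notin> Q" "(1, f a0, \<zero>\<^bsub>B\<^esub>) \<notin> Q" "(1, f a0', \<zero>\<^bsub>B\<^esub>) \<notin> Q"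
    using q(1) ex(1) by (auto simp: scal_def)
  have gs: "(1, g a, \<zero>\<^bsub>C\<^esub>) \<notin> R" "(1, g a', \<zero>\<^bsub>C\<^esub>) \<notin> R" "(1, g a0, \<zero>\<^bsub>C\<^esub>) \<notin> R" "(1, g a0', \<zero>\<^bsub>C\<^esub>) \<notin> R" "(1, g x0, \<zero>\<^bsub>C\<^esub>) \<notin> R"
    using fs x(3) car x(1) compat_supp by auto
  have "(1, g x \<otimes>\<^bsub>C\<^esub> c, \<zero>\<^bsub>C\<^esub>) \<notin> R"
  proof
    assume "(1, g x \<otimes>\<^bsub>C\<^esub> c, \<zero>\<^bsub>C\<^esub>) \<in> R"
    then have "(1, g x0 \<otimes>\<^bsub>C\<^esub> c0, \<zero>\<^bsub>C\<^esub>) \<in> R" by (rule QC.le_supp[OF Z])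
    then show False using gs c0 gc car by (simp add: QC.supp_mult_iff)
  qed
  then have xs: "(1, g x, \<zero>\<^bsub>C\<^esub>) \<notin> R" "(1, c, \<zero>\<^bsub>C\<^esub>) \<notin> R" using gc car by (simp_all add: QC.supp_mult_iff)
  then have fxs: "(1, f x, \<zero>\<^bsub>B\<^esub>) \<notin> Q" using compat_supp x by simp
  have bs: "(1, b, \<zero>\<^bsub>B\<^esub>) \<notin> Q"
  proof
    assume "(1, b, \<zero>\<^bsub>B\<^esub>) \<in> Q"
    then have "(1, f x0 \<otimes>\<^bsub>B\<^esub> b, \<zero>\<^bsub>B\<^esub>) \<in> Q" using fc car by (simp add: QB.supp_mult_iff)
    then have "(1, f x \<otimes>\<^bsub>B\<^esub> b0, \<zero>\<^bsub>B\<^esub>) \<in> Q" by (rule QB.le_supp[OF H])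
    then show False using fxs b0 fc car by (simp add: QB.supp_mult_iff)
  qed
  have B1: "(q, f a' \<otimes>\<^bsub>B\<^esub> b, f a \<otimes>\<^bsub>B\<^esub> s) \<in> Q" and C1: "(1 / (r * q), g a \<otimes>\<^bsub>C\<^esub> c, g a' \<otimes>\<^bsub>C\<^esub> t) \<in> R"
    using q(2) by (auto simp: bounds_def)
  have B0: "(1 / q0, f a0 \<otimes>\<^bsub>B\<^esub> s, f a0' \<otimes>\<^bsub>B\<^esub> b0) \<in> Q" and C0: "(r * q0, g a0' \<otimes>\<^bsub>C\<^esub> t, g a0 \<otimes>\<^bsub>C\<^esub> c0) \<in> R"
    using ex by (auto simp: lower_B_def lower_C_def)
  \<comment> \<open>Cross-multiplied elements of \<open>A\<close>: the chain in \<open>B\<close>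
    gives \<open>v(?u) \<le> (q / q0) v(?w)\<close> once the common factor \<open>?W\<close> is
    cancelled.\<close>
  let ?u = "x \<otimes>\<^bsub>A\<^esub> a' \<otimes>\<^bsub>A\<^esub> a0" and ?w = "x0 \<otimes>\<^bsub>A\<^esub> a \<otimes>\<^bsub>A\<^esub> a0'"
  let ?W = "b0 \<otimes>\<^bsub>B\<^esub> b \<otimes>\<^bsub>B\<^esub> s" and ?V = "c0 \<otimes>\<^bsub>C\<^esub> c \<otimes>\<^bsub>C\<^esub> t"
  have uw: "?u \<in> carrier A" "?w \<in> carrier A" using car x by auto
  have W: "?W \<in> carrier B" "(1, ?W, \<zero>\<^bsub>B\<^esub>) \<notin> Q" using car b0 bs s by (auto simp: QB.supp_mult_iff)
  have V: "?V \<in> carrier C" "(1, ?V, \<zero>\<^bsub>C\<^esub>) \<notin> R" using car c0 xs s by (auto simp: QC.supp_mult_iff)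
  have "(1 * (q * (1 / q0)), (f x \<otimes>\<^bsub>B\<^esub> b0) \<otimes>\<^bsub>B\<^esub> ((f a' \<otimes>\<^bsub>B\<^esub> b) \<otimes>\<^bsub>B\<^esub> (f a0 \<otimes>\<^bsub>B\<^esub> s)),
      (f x0 \<otimes>\<^bsub>B\<^esub> b) \<otimes>\<^bsub>B\<^esub> ((f a \<otimes>\<^bsub>B\<^esub> s) \<otimes>\<^bsub>B\<^esub> (f a0' \<otimes>\<^bsub>B\<^esub> b0))) \<in> Q"
    by (rule QB.mult2[OF H QB.mult2[OF B1 B0]])
  moreover have "(f x \<otimes>\<^bsub>B\<^esub> b0) \<otimes>\<^bsub>B\<^esub> ((f a' \<otimes>\<^bsub>B\<^esub> b) \<otimes>\<^bsub>B\<^esub> (f a0 \<otimes>\<^bsub>B\<^esub> s)) = f ?u \<otimes>\<^bsub>B\<^esub> ?W"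
    "(f x0 \<otimes>\<^bsub>B\<^esub> b) \<otimes>\<^bsub>B\<^esub> ((f a \<otimes>\<^bsub>B\<^esub> s) \<otimes>\<^bsub>B\<^esub> (f a0' \<otimes>\<^bsub>B\<^esub> b0)) = f ?w \<otimes>\<^bsub>B\<^esub> ?W"
    using car fc x by (simp_all add: B.m_ac)
  ultimately have "(q / q0, f ?u \<otimes>\<^bsub>B\<^esub> ?W, f ?w \<otimes>\<^bsub>B\<^esub> ?W) \<in> Q" by simp
  then have "(q / q0, f ?u, f ?w) \<in> Q" by (rule QB.cancel) (use W uw in auto)
  \<comment> \<open>\<open>Q\<close> and \<open>R\<close> agree on \<open>A\<close>, so the
    inequality passes to \<open>C\<close>.\<close>
  then have S: "(q / q0, g ?u, g ?w) \<in> R" using compat_iff uw by blast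
  show False
  proof (cases "lower_B q a a' (b, c, r, s, t)")
    case False
    \<comment> \<open>Strictness on the \<open>B\<close>-side makes the comparison in
      \<open>A\<close> strict, while \<open>Z\<close> with the bounds in \<open>C\<close> gives the
      reverse.\<close>
    have "(1 / (q * (1 * (1 / q0))), (f a \<otimes>\<^bsub>B\<^esub> s) \<otimes>\<^bsub>B\<^esub> ((f x0 \<otimes>\<^bsub>B\<^esub> b) \<otimes>\<^bsub>B\<^esub> (f a0' \<otimes>\<^bsub>B\<^esub> b0)),
        (f a' \<otimes>\<^bsub>B\<^esub> b) \<otimes>\<^bsub>B\<^esub> ((f x \<otimes>\<^bsub>B\<^esub> b0) \<otimes>\<^bsub>B\<^esub> (f a0 \<otimes>\<^bsub>B\<^esub> s))) \<notin> Q"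
    proof (rule QB.strict_mult[OF _ QB.mult2[OF H B0]])
      show "(1 / q, f a \<otimes>\<^bsub>B\<^esub> s, f a' \<otimes>\<^bsub>B\<^esub> b) \<notin> Q" using False by (simp add: lower_B_def)
    qed (use car fc x(3) fs bs b0 pos in \<open>simp_all add: QB.supp_mult_iff\<close>)
    moreover have "(f a' \<otimes>\<^bsub>B\<^esub> b) \<otimes>\<^bsub>B\<^esub> ((f x \<otimes>\<^bsub>B\<^esub> b0) \<otimes>\<^bsub>B\<^esub> (f a0 \<otimes>\<^bsub>B\<^esub> s)) = f ?u \<otimes>\<^bsub>B\<^esub> ?W"
      "(f a \<otimes>\<^bsub>B\<^esub> s) \<otimes>\<^bsub>B\<^esub> ((f x0 \<otimes>\<^bsub>B\<^esub> b) \<otimes>\<^bsub>B\<^esub> (f a0' \<otimes>\<^bsub>B\<^esub> b0)) = f ?w \<otimes>\<^bsub>B\<^esub> ?W"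
      using car fc x by (simp_all add: B.m_ac)
    ultimately have "(q0 / q, f ?w \<otimes>\<^bsub>B\<^esub> ?W, f ?u \<otimes>\<^bsub>B\<^esub> ?W) \<notin> Q" by simp
    then have "(q0 / q, f ?w, f ?u) \<notin> Q" using QB.mult[OF _ W(1)] by blast
    then have no: "(q0 / q, g ?w, g ?u) \<notin> R" using compat_iff uw by blast
    have "(1 * (1 / (r * q) * (r * q0)), (g x0 \<otimes>\<^bsub>C\<^esub> c0) \<otimes>\<^bsub>C\<^esub> ((g a \<otimes>\<^bsub>C\<^esub> c) \<otimes>\<^bsub>C\<^esub> (g a0' \<otimes>\<^bsub>C\<^esub> t)),
        (g x \<otimes>\<^bsub>C\<^esub> c) \<otimes>\<^bsub>C\<^esub> ((g a' \<otimes>\<^bsub>C\<^esub> t) \<otimes>\<^bsub>C\<^esub> (g a0 \<otimes>\<^bsub>C\<^esub> c0))) \<in> R"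
      by (rule QC.mult2[OF Z QC.mult2[OF C1 C0]])
    moreover have "(g x0 \<otimes>\<^bsub>C\<^esub> c0) \<otimes>\<^bsub>C\<^esub> ((g a \<otimes>\<^bsub>C\<^esub> c) \<otimes>\<^bsub>C\<^esub> (g a0' \<otimes>\<^bsub>C\<^esub> t)) = g ?w \<otimes>\<^bsub>C\<^esub> ?V"
      "(g x \<otimes>\<^bsub>C\<^esub> c) \<otimes>\<^bsub>C\<^esub> ((g a' \<otimes>\<^bsub>C\<^esub> t) \<otimes>\<^bsub>C\<^esub> (g a0 \<otimes>\<^bsub>C\<^esub> c0)) = g ?u \<otimes>\<^bsub>C\<^esub> ?V"
      using car gc x by (simp_all add: C.m_ac)
    moreover have "1 * (1 / (r * q) * (r * q0)) = q0 / q" using pos by simp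
    ultimately have "(q0 / q, g ?w \<otimes>\<^bsub>C\<^esub> ?V, g ?u \<otimes>\<^bsub>C\<^esub> ?V) \<in> R" by simp
    then have "(q0 / q, g ?w, g ?u) \<in> R" by (rule QC.cancel) (use V uw in auto)
    then show False using no by blast
  next
    case True
    \<comment> \<open>Strictness on the \<open>C\<close>-side: \<open>Z\<close>, \<open>S\<close>
      and \<open>C0\<close> multiply to the inequality that was excluded.\<close>
    then have no: "(r * q, g a' \<otimes>\<^bsub>C\<^esub> t, g a \<otimes>\<^bsub>C\<^esub> c) \<notin> R" using strict by (simp add: lower_C_def)
    let ?Y = "g x0 \<otimes>\<^bsub>C\<^esub> c0 \<otimes>\<^bsub>C\<^esub> g x \<otimes>\<^bsub>C\<^esub> g a0 \<otimes>\<^bsub>C\<^esub> g a0'"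
    have Y: "?Y \<in> carrier C" "(1, ?Y, \<zero>\<^bsub>C\<^esub>) \<notin> R" using car gc gs xs c0 by (auto simp: QC.supp_mult_iff)
    have "(1 * (q / q0 * (r * q0)), (g x0 \<otimes>\<^bsub>C\<^esub> c0) \<otimes>\<^bsub>C\<^esub> (g ?u \<otimes>\<^bsub>C\<^esub> (g a0' \<otimes>\<^bsub>C\<^esub> t)),
        (g x \<otimes>\<^bsub>C\<^esub> c) \<otimes>\<^bsub>C\<^esub> (g ?w \<otimes>\<^bsub>C\<^esub> (g a0 \<otimes>\<^bsub>C\<^esub> c0))) \<in> R"
      by (rule QC.mult2[OF Z QC.mult2[OF S C0]])
    moreover have "(g x0 \<otimes>\<^bsub>C\<^esub> c0) \<otimes>\<^bsub>C\<^esub> (g ?u \<otimes>\<^bsub>C\<^esub> (g a0' \<otimes>\<^bsub>C\<^esub> t)) = (g a' \<otimes>\<^bsub>C\<^esub> t) \<otimes>\<^bsub>C\<^esub> ?Y"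
      "(g x \<otimes>\<^bsub>C\<^esub> c) \<otimes>\<^bsub>C\<^esub> (g ?w \<otimes>\<^bsub>C\<^esub> (g a0 \<otimes>\<^bsub>C\<^esub> c0)) = (g a \<otimes>\<^bsub>C\<^esub> c) \<otimes>\<^bsub>C\<^esub> ?Y"
      using car gc x by (simp_all add: C.m_ac)
    moreover have "1 * (q / q0 * (r * q0)) = r * q" using pos by simp
    ultimately have "(r * q, (g a' \<otimes>\<^bsub>C\<^esub> t) \<otimes>\<^bsub>C\<^esub> ?Y, (g a \<otimes>\<^bsub>C\<^esub> c) \<otimes>\<^bsub>C\<^esub> ?Y) \<in> R" by simp
    then have "(r * q, g a' \<otimes>\<^bsub>C\<^esub> t, g a \<otimes>\<^bsub>C\<^esub> c) \<in> R" by (rule QC.cancel) (use Y car gc in auto)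
    then show False using no by blast
  qed
qed

text \<open>
  Assume that an exact monomial is congruent to a combination of tiny ones. The finitely many relations involved
  admit an almost \<open>A\<close>-linear map \<open>\<lambda>\<close> from \<open>B\<close> to \<open>A\<close> that is bounded on the finitely many elements of \<open>B\<close>
  involved, and applying \<open>b \<otimes> c \<mapsto> \<lambda>(b) c\<close> gives an impossible relation between values in \<open>C\<close>.
\<close>

lemma exact_not_tiny:
  assumes ex: "exact (ev M)" and e: "\<And>N. N \<in> Poly_Mapping.keys e \<Longrightarrow> tiny (ev N)" and j: "j \<in> relations"
  shows "frag_of M \<noteq> e + j"
proof
  assume eq: "frag_of M = e + j"
  obtain b0 c0 r s t where M: "ev M = (b0, c0, r, s, t)" by (cases "ev M")
  have m0: "(b0, c0, r, s, t) \<in> monomials" using ev_closed[of M] M by simp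
  obtain q0 a0 a0' where q0: "scal q0 a0 a0'" "lower_B q0 a0 a0' (b0, c0, r, s, t)" "lower_C q0 a0 a0' (b0, c0, r, s, t)"
    using ex unfolding exact_def M by blast
  have car: "b0 \<in> carrier B" "c0 \<in> carrier C" "s \<in> carrier B" "t \<in> carrier C" "a0 \<in> carrier A" "a0' \<in> carrier A"
    and ns: "(1, s, \<zero>\<^bsub>B\<^esub>) \<notin> Q" "(1, t, \<zero>\<^bsub>C\<^esub>) \<notin> R" "(1, f a0, \<zero>\<^bsub>B\<^esub>) \<notin> Q" "(1, g a0', \<zero>\<^bsub>C\<^esub>) \<notin> R"
    using m0 q0(1) compat_supp[of a0'] by (auto simp: monomials_iff scal_def)
  \<comment> \<open>An exact monomial is nonzero in both factors, since its lower bounds come from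
    elements of \<open>A\<close> and denominators outside the supports.\<close>
  have b0: "(1, b0, \<zero>\<^bsub>B\<^esub>) \<notin> Q"
  proof
    assume "(1, b0, \<zero>\<^bsub>B\<^esub>) \<in> Q"
    then have "(1, f a0' \<otimes>\<^bsub>B\<^esub> b0, \<zero>\<^bsub>B\<^esub>) \<in> Q" using car by (simp add: QB.supp_mult_iff)
    then have "(1, f a0 \<otimes>\<^bsub>B\<^esub> s, \<zero>\<^bsub>B\<^esub>) \<in> Q" using q0(2) QB.le_supp by (simp add: lower_B_def)
    then show False using ns car by (simp add: QB.supp_mult_iff)
  qed
  have c0: "(1, c0, \<zero>\<^bsub>C\<^esub>) \<notin> R"
  proof
    assume "(1, c0, \<zero>\<^bsub>C\<^esub>) \<in> R"
    then have "(1, g a0 \<otimes>\<^bsub>C\<^esub> c0, \<zero>\<^bsub>C\<^esub>) \<in> R" using car by (simp add: QC.supp_mult_iff)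
    then have "(1, g a0' \<otimes>\<^bsub>C\<^esub> t, \<zero>\<^bsub>C\<^esub>) \<in> R" using q0(3) QC.le_supp by (simp add: lower_C_def)
    then show False using ns car by (simp add: QC.supp_mult_iff)
  qed
  let ?k = "(r, s, t)"
  obtain T1 T2 where T: "finite T1" "T1 \<subseteq> carrier B \<times> carrier B" "finite T2" "T2 \<subseteq> carrier A \<times> carrier B"
    and Tj: "\<And>l h. (\<forall>b. l b \<in> carrier A) \<Longrightarrow> compatible T1 T2 l \<Longrightarrow> h \<in> hom (free_Abelian_group UNIV) (add_monoid C) \<Longrightarrow>
      (\<forall>M. h (frag_of M) = contract l ?k (ev M)) \<Longrightarrow> (1, h j, \<zero>\<^bsub>C\<^esub>) \<in> R"
    using relation_constraints[OF j, of ?k] by meson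
  \<comment> \<open>The \<open>B\<close>-parts of all tiny terms, on which \<open>l\<close> has to
    be bounded relative to \<open>b0\<close>.\<close>
  let ?T3 = "(\<lambda>N. fst (ev N)) ` Poly_Mapping.keys e"
  have "fst (ev N) \<in> carrier B" for N using ev_closed[of N] by (cases "ev N") (simp add: monomials_iff)
  then have T3: "finite ?T3" "?T3 \<subseteq> carrier B" by auto
  obtain l where l: "\<And>b. l b \<in> carrier A" "(1, f (l b0), \<zero>\<^bsub>B\<^esub>) \<notin> Q"
    and l1: "\<And>b b'. (b, b') \<in> T1 \<Longrightarrow> (1, f (l (b \<oplus>\<^bsub>B\<^esub> b') \<ominus>\<^bsub>A\<^esub> l b \<ominus>\<^bsub>A\<^esub> l b'), \<zero>\<^bsub>B\<^esub>) \<in> Q"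
    and l2: "\<And>a b. (a, b) \<in> T2 \<Longrightarrow> (1, f (l (f a \<otimes>\<^bsub>B\<^esub> b) \<ominus>\<^bsub>A\<^esub> a \<otimes>\<^bsub>A\<^esub> l b), \<zero>\<^bsub>B\<^esub>) \<in> Q"
    and l3: "\<And>b. b \<in> ?T3 \<Longrightarrow> (1, f (l b) \<otimes>\<^bsub>B\<^esub> b0, f (l b0) \<otimes>\<^bsub>B\<^esub> b) \<in> Q"
  proof (rule hB.almost_linear_map_exists[OF car(1) b0 T T3], goal_cases)
    case (1 l)
    show ?case by (rule 1(1)[of l]) (fact 1)+
  qed
  have "(\<lambda>N. contract l ?k (ev N)) ` UNIV \<subseteq> carrier (add_monoid C)"
  proof
    fix y assume "y \<in> (\<lambda>N. contract l ?k (ev N)) ` UNIV"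
    then obtain N where y: "y = contract l ?k (ev N)" by blast
    obtain b c k' where N: "ev N = (b, c, k')" by (cases "ev N")
    have "c \<in> carrier C" using ev_closed[of N] N by (cases k') (simp add: monomials_iff)
    then show "y \<in> carrier (add_monoid C)" using y N l(1) by (simp add: contract_def)
  qed
  then obtain h where h: "h \<in> hom (free_Abelian_group UNIV) (add_monoid C)" "\<And>N. h (frag_of N) = contract l ?k (ev N)"
    using comm_group.free_Abelian_group_universal[OF C.a_comm_group, of "\<lambda>N. contract l ?k (ev N)" UNIV] by auto
  have hj: "(1, h j, \<zero>\<^bsub>C\<^esub>) \<in> R"
    by (rule Tj[of l h, OF _ _ h(1)]) (use l l1 l2 h(2) in \<open>auto simp: compatible_def\<close>)
  let ?z = "g (l b0) \<otimes>\<^bsub>C\<^esub> c0"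
  have zc: "?z \<in> carrier C" using l(1) car by simp
  have zs: "(1, ?z, \<zero>\<^bsub>C\<^esub>) \<notin> R" using l car c0 compat_supp[of "l b0"] by (simp add: QC.supp_mult_iff)
  have hz: "h (frag_of M) = ?z" by (simp add: h(2) M contract_def)
  \<comment> \<open>Ultrametric induction over the combination: each contracted tiny term lies
    strictly below \<open>?z\<close>.\<close>
  have he: "(1, ?z, h e) \<notin> R"
  proof (rule frag_induction[of e "Poly_Mapping.keys e"])
    show "(1, ?z, h 0) \<notin> R" using zs hom_diff(2)[OF h(1)] by simp
    show "(1, ?z, h (frag_of N)) \<notin> R" if N: "N \<in> Poly_Mapping.keys e" for N
    proof -
      obtain b c k' where ev: "ev N = (b, c, k')" by (cases "ev N")
      show ?thesis
      proof (cases "k' = ?k")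
        case True
        have "b \<in> ?T3" using N ev by force
        from l3[OF this] show ?thesis
          using tiny_strict[OF m0 q0 _ _ l(1)[of b0] l(1)[of b] l(2) b0 c0] ev_closed[of N] e[OF N] True
          by (simp add: h(2) ev contract_def)
      next
        case False
        then show ?thesis using zs by (simp add: h(2) ev contract_def)
      qed
    qed
    show "(1, ?z, h (a - b)) \<notin> R" if "(1, ?z, h a) \<notin> R" "(1, ?z, h b) \<notin> R" for a b
      unfolding hom_diff(3)[OF h(1)] by (rule QC.strict_diff[OF that hom_diff(1)[OF h(1)] hom_diff(1)[OF h(1)]])
  qed simp
  \<comment> \<open>But \<open>h e\<close> differs from \<open>?z\<close> by an element of the
    support and so has the same value.\<close>
  have "e = frag_of M - j" using eq by simp
  then have "h e = ?z \<oplus>\<^bsub>C\<^esub> \<ominus>\<^bsub>C\<^esub> h j" using hom_diff(3)[OF h(1)] hz by (simp add: a_minus_def)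
  moreover have "(1, ?z, ?z \<oplus>\<^bsub>C\<^esub> \<ominus>\<^bsub>C\<^esub> h j) \<in> R" by (rule QC.supp_perturb[OF QC.minus[OF hj] zc])
  ultimately show False using he by simp
qed

text \<open>For \<open>small\<close> this is the ring and for \<open>tiny\<close> the ideal to which
  the Manis theorem is applied; including \<open>relations\<close> makes both independent of the
  choice of representatives.\<close>

definition combinations :: "(('b, 'c) formal_monomial \<Rightarrow> bool) \<Rightarrow> (('b, 'c) formal_monomial multiset \<Rightarrow>\<^sub>0 int) set" where
  "combinations P = {e + j | e j. (\<forall>M\<in>Poly_Mapping.keys e. P (ev M)) \<and> j \<in> relations}"

lemma combinationsI: "\<lbrakk>\<And>M. M \<in> Poly_Mapping.keys e \<Longrightarrow> P (ev M); j \<in> relations\<rbrakk> \<Longrightarrow> e + j \<in> combinations P"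
  unfolding combinations_def by blast

lemma combinationsE:
  assumes "x \<in> combinations P"
  obtains e j where "x = e + j" "\<forall>M\<in>Poly_Mapping.keys e. P (ev M)" "j \<in> relations"
  using assms unfolding combinations_def by blast

lemma relations_combinations: "j \<in> relations \<Longrightarrow> j \<in> combinations P"
  using combinationsI[of 0 P j] by simp

lemma frag_of_combinations: "P (ev M) \<Longrightarrow> frag_of M \<in> combinations P"
  using combinationsI[of "frag_of M" P 0] rel_zero by simp

text \<open>\<open>relations\<close> is an ideal and absorbs all mixed terms.\<close>

lemma combinations_mult:
  assumes P: "\<And>m n. \<lbrakk>m \<in> monomials; n \<in> monomials; P m; P' n\<rbrakk> \<Longrightarrow> P'' (mono_mult m n)"
    and x: "x \<in> combinations P" and y: "y \<in> combinations P'"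
  shows "x * y \<in> combinations P''"
proof -
  obtain e j where e: "x = e + j" "\<forall>M\<in>Poly_Mapping.keys e. P (ev M)" "j \<in> relations"
    by (rule combinationsE[OF x])
  obtain d i where d: "y = d + i" "\<forall>M\<in>Poly_Mapping.keys d. P' (ev M)" "i \<in> relations"
    by (rule combinationsE[OF y])
  have "e * d + (e * i + (d + i) * j) \<in> combinations P''"
  proof (rule combinationsI)
    fix M assume "M \<in> Poly_Mapping.keys (e * d)"
    then obtain N N' where "M = N + N'" "N \<in> Poly_Mapping.keys e" "N' \<in> Poly_Mapping.keys d"
      using keys_mult[of e d] by blast
    then show "P'' (ev M)" using P[OF ev_closed ev_closed] e(2) d(2) by (simp add: ev_union)
  qed (intro rel_add rel_mult e d)
  then show ?thesis by (simp add: e(1) d(1) algebra_simps)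
qed

lemma combinations_closed:
  assumes x: "x \<in> combinations P" and y: "y \<in> combinations P"
  shows "x + y \<in> combinations P" "x - y \<in> combinations P"
proof -
  obtain e j where e: "x = e + j" "\<forall>M\<in>Poly_Mapping.keys e. P (ev M)" "j \<in> relations"
    by (rule combinationsE[OF x])
  obtain d i where d: "y = d + i" "\<forall>M\<in>Poly_Mapping.keys d. P (ev M)" "i \<in> relations"
    by (rule combinationsE[OF y])
  have "(e + d) + (j + i) \<in> combinations P"
    by (rule combinationsI) (use keys_add[of e d] e(2) d(2) rel_add[OF e(3) d(3)] in auto)
  then show "x + y \<in> combinations P" by (simp add: e(1) d(1) algebra_simps)
  have "(e - d) + (j - i) \<in> combinations P"
    by (rule combinationsI) (use keys_diff[of e d] e(2) d(2) rel_diff[OF e(3) d(3)] in auto)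
  then show "x - y \<in> combinations P" by (simp add: e(1) d(1) algebra_simps)
qed

lemma combinations_mono: "(\<And>m. P m \<Longrightarrow> P' m) \<Longrightarrow> combinations P \<subseteq> combinations P'"
  unfolding combinations_def by blast

lemma monomial_preorder_exists:
  obtains le where "valuation_preorder le" "\<And>m. m \<in> monomials \<Longrightarrow> small m \<Longrightarrow> le (gen m) 1"
    "\<And>m. m \<in> monomials \<Longrightarrow> tiny m \<Longrightarrow> \<not> le 1 (gen m)" "\<And>m. m \<in> monomials \<Longrightarrow> exact m \<Longrightarrow> le 1 (gen m)"
    "\<And>x. x \<in> relations \<Longrightarrow> le x 0"
proof -
  \<comment> \<open>The multiplicative set to be avoided; that the tiny ideal misses it is
    \<open>exact_not_tiny\<close>.\<close>
  let ?S = "{frag_of M | M. exact (ev M)}"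
  have sub: "is_subring (combinations small)"
    unfolding is_subring_def
  proof (intro conjI ballI)
    show "1 \<in> combinations small"
      using frag_of_combinations[of small "{#}"] exact_small[OF exact_one] by (simp add: ev_empty frag_of_empty)
    show "x * y \<in> combinations small" if "x \<in> combinations small" "y \<in> combinations small" for x y
      by (rule combinations_mult[OF _ that]) (rule small_mult)
  qed (rule combinations_closed)
  have ideal: "is_ideal (combinations small) (combinations tiny)"
    unfolding is_ideal_def
  proof (intro conjI ballI)
    show "combinations tiny \<subseteq> combinations small" by (rule combinations_mono) (rule tiny_small)
    show "0 \<in> combinations tiny" by (rule relations_combinations[OF rel_zero])
    show "r * x \<in> combinations tiny" if "r \<in> combinations small" "x \<in> combinations tiny" for r x
      unfolding mult.commute[of r] by (rule combinations_mult[OF _ that(2,1)]) (rule tiny_mult)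
  qed (rule combinations_closed)
  have one: "1 \<in> ?S"
    unfolding mem_Collect_eq by (rule exI[of _ "{#}"]) (simp add: exact_one frag_of_empty ev_empty)
  have SR: "?S \<subseteq> combinations small"
  proof
    fix x assume "x \<in> ?S"
    then obtain M where "x = frag_of M" "exact (ev M)" by blast
    then show "x \<in> combinations small" using frag_of_combinations[of small M, OF exact_small] by simp
  qed
  have Smult: "x * y \<in> ?S" if xy: "x \<in> ?S" "y \<in> ?S" for x y
  proof -
    obtain M N where MN: "x = frag_of M" "y = frag_of N" "exact (ev M)" "exact (ev N)" using xy by blast
    then have "x * y = frag_of (M + N)" "exact (ev (M + N))"
      using exact_mult[OF ev_closed ev_closed] by (simp_all add: frag_of_mult ev_union)
    then show ?thesis by blast
  qed
  have disj: "combinations tiny \<inter> ?S = {}"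
  proof -
    have False if x: "x \<in> combinations tiny" "x \<in> ?S" for x
    proof -
      obtain e j where e: "x = e + j" "\<forall>M\<in>Poly_Mapping.keys e. tiny (ev M)" "j \<in> relations"
        by (rule combinationsE[OF x(1)])
      obtain M where "x = frag_of M" "exact (ev M)" using x(2) by blast
      then show False using exact_not_tiny[of M e j] e by simp
    qed
    then show ?thesis by blast
  qed
  obtain le where le: "valuation_preorder le" "\<And>x. x \<in> combinations small \<Longrightarrow> le x 1"
    "\<And>x. x \<in> combinations tiny \<Longrightarrow> \<not> le 1 x" "\<And>x. x \<in> ?S \<Longrightarrow> le 1 x" "\<And>x. (\<And>z. z * x \<in> combinations tiny) \<Longrightarrow> le x 0"
  proof (rule valuation_preorder_exists[OF sub ideal one SR Smult disj], goal_cases)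
    case (3 le)
    show ?case by (rule 3(1)[of le]) (fact 3)+
  qed
  show ?thesis
  proof (rule that[of le])
    show "valuation_preorder le" by (rule le(1))
    fix m assume m: "m \<in> monomials"
    show "le (gen m) 1" if "small m" by (intro le(2) frag_of_combinations) (simp add: ev_single m that)
    show "\<not> le 1 (gen m)" if "tiny m" by (intro le(3) frag_of_combinations) (simp add: ev_single m that)
    show "le 1 (gen m)" if "exact m"
    proof (rule le(4))
      have "exact (ev {#m#})" using that m by (simp add: ev_single)
      then show "gen m \<in> ?S" by blast
    qed
  next
    \<comment> \<open>All multiples of a relation are relations and so lie in the ideal, which
      forces the relation into the support.\<close>
    show "le x 0" if "x \<in> relations" for x
      by (rule le(5)) (rule relations_combinations[OF rel_mult[OF that]])
  qed
qed

end

section \<open>The order induced on the tensor product\<close>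

locale amalgam_preorder = amalgam A B C f g Q R + valuation_ring_preorder le
  for A :: "('a, 'm) ring_scheme" and B :: "('b, 'n) ring_scheme" and C :: "('c, 'k) ring_scheme" and f g Q R
    and le :: "(('b, 'c) formal_monomial multiset \<Rightarrow>\<^sub>0 int) \<Rightarrow> (('b, 'c) formal_monomial multiset \<Rightarrow>\<^sub>0 int) \<Rightarrow> bool" +
  assumes le_small: "\<lbrakk>m \<in> monomials; small m\<rbrakk> \<Longrightarrow> le (gen m) 1"
    and le_tiny: "\<lbrakk>m \<in> monomials; tiny m\<rbrakk> \<Longrightarrow> \<not> le 1 (gen m)"
    and le_exact: "\<lbrakk>m \<in> monomials; exact m\<rbrakk> \<Longrightarrow> le 1 (gen m)"
    and le_relations: "x \<in> relations \<Longrightarrow> le x 0"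
begin

lemma eqv_relations: "x - y \<in> relations \<Longrightarrow> eqv x y"
  by (rule eqv_supp) (rule le_relations)

lemma eqv_exact: "\<lbrakk>m \<in> monomials; exact m\<rbrakk> \<Longrightarrow> eqv (gen m) 1"
  using le_small[OF _ exact_small] le_exact by (simp add: eqv_def)

lemma eqv_gen: "\<lbrakk>m \<in> monomials; n \<in> monomials\<rbrakk> \<Longrightarrow> eqv (gen m * gen n) (gen (mono_mult m n))"
  using eqv_relations[OF rel_gen[of n "{#m#}"]] by (simp add: ev_single)

definition mono_of :: "'b \<Rightarrow> 'c \<Rightarrow> ('b, 'c) formal_monomial" where
  "mono_of b c = (b, c, 1, \<one>\<^bsub>B\<^esub>, \<one>\<^bsub>C\<^esub>)"

lemma mono_of_monomials: "\<lbrakk>b \<in> carrier B; c \<in> carrier C\<rbrakk> \<Longrightarrow> mono_of b c \<in> monomials"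
  by (simp add: mono_of_def monomials_iff QB.nontrivial QC.nontrivial)

definition scalar :: "real \<Rightarrow> ('b, 'c) formal_monomial" where
  "scalar r = (\<one>\<^bsub>B\<^esub>, \<one>\<^bsub>C\<^esub>, r, \<one>\<^bsub>B\<^esub>, \<one>\<^bsub>C\<^esub>)"

lemma scalar_monomials: "0 < r \<Longrightarrow> scalar r \<in> monomials"
  by (simp add: scalar_def monomials_iff QB.nontrivial QC.nontrivial)

definition lift_pairs :: "(('b \<times> 'c) \<Rightarrow>\<^sub>0 int) \<Rightarrow> ('b, 'c) formal_monomial multiset \<Rightarrow>\<^sub>0 int" where
  "lift_pairs p = frag_extend (\<lambda>(b, c). gen (mono_of b c)) p"

lemma lift_pairs_of: "lift_pairs (frag_of (b, c)) = gen (mono_of b c)"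
  by (simp add: lift_pairs_def)

lemma lift_pairs_diff: "lift_pairs (p - q) = lift_pairs p - lift_pairs q"
  by (simp add: lift_pairs_def frag_extend_diff)

lemmas lift_pairs_additive = frag_additive[of lift_pairs, OF lift_pairs_diff]

text \<open>With trivial denominators, \<open>rel_left\<close>, \<open>rel_right\<close> and
  \<open>rel_middle\<close> are the relations that define the tensor product.\<close>

lemma lift_pairs_kernel: "x \<in> KR \<Longrightarrow> lift_pairs x \<in> relations"
proof (induction x rule: kernel_induct)
  case zero then show ?case by (simp add: lift_pairs_additive rel_zero)
next
  case (relation r)
  then show ?case
  proof (cases rule: relation_cases)
    case (left b b' c)
    show ?thesis unfolding left(1) lift_pairs_diff lift_pairs_of mono_of_def
      by (rule rel_left) (use left mono_of_monomials in \<open>simp_all add: mono_of_def\<close>)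
  next
    case (right b c c')
    show ?thesis unfolding right(1) lift_pairs_diff lift_pairs_of mono_of_def
      by (rule rel_right) (use right mono_of_monomials in \<open>simp_all add: mono_of_def\<close>)
  next
    case (middle a b c)
    show ?thesis unfolding middle(1) lift_pairs_diff lift_pairs_of mono_of_def
      by (rule rel_middle) (use middle mono_of_monomials in \<open>simp_all add: mono_of_def\<close>)
  qed
next
  case (diff x y) then show ?case by (simp add: lift_pairs_diff rel_diff)
qed

lemma lift_pairs_mult:
  assumes "Poly_Mapping.keys p \<subseteq> pairs" "Poly_Mapping.keys q \<subseteq> pairs"
  shows "lift_pairs p * lift_pairs q - lift_pairs (pair_mult B C p q) \<in> relations"
  using assms(1)
proof (induction p rule: pair_ring_induct)
  case zero then show ?case by (simp add: pair_mult_zero lift_pairs_additive rel_zero)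
next
  case (one b c)
  show ?case using assms(2)
  proof (induction q rule: pair_ring_induct)
    case zero then show ?case by (simp add: pair_mult_zero lift_pairs_additive rel_zero)
  next
    case (one b' c')
    have "mono_mult (ev {#mono_of b c#}) (mono_of b' c') = mono_of (b \<otimes>\<^bsub>B\<^esub> b') (c \<otimes>\<^bsub>C\<^esub> c')"
      using \<open>b \<in> carrier B\<close> \<open>c \<in> carrier C\<close> by (simp add: ev_single mono_of_monomials) (simp add: mono_of_def mono_mult_simp)
    then show ?case using rel_gen[of "mono_of b' c'" "{#mono_of b c#}"] one
      by (simp add: pair_mult_of lift_pairs_of mono_of_monomials)
  next
    case (diff q q')
    from rel_diff[OF this] show ?case by (simp add: pair_mult_diff_right lift_pairs_diff algebra_simps)
  qed
next
  case (diff p p')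
  from rel_diff[OF this] show ?case by (simp add: pair_mult_diff_left lift_pairs_diff algebra_simps)
qed

text \<open>A chosen lift of a coset, hence a homomorphism only up to the support. This is why
  \<open>reified_order_induced\<close> is stated with \<open>eqv\<close>.\<close>

definition rep :: "(('b \<times> 'c) \<Rightarrow>\<^sub>0 int) set \<Rightarrow> ('b, 'c) formal_monomial multiset \<Rightarrow>\<^sub>0 int" where
  "rep x = lift_pairs (SOME p. Poly_Mapping.keys p \<subseteq> pairs \<and> x = cls p)"

lemma rep_cls:
  assumes "Poly_Mapping.keys p \<subseteq> pairs"
  shows "rep (cls p) - lift_pairs p \<in> relations"
proof -
  let ?q = "SOME q. Poly_Mapping.keys q \<subseteq> pairs \<and> cls p = cls q"
  have "Poly_Mapping.keys ?q \<subseteq> pairs \<and> cls p = cls ?q"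
    by (rule someI[of "\<lambda>q. Poly_Mapping.keys q \<subseteq> pairs \<and> cls p = cls q" p]) (simp add: assms)
  then have "cls ?q = cls p" by simp
  then have "?q - p \<in> KR" by (simp only: cls_eq)
  from lift_pairs_kernel[OF this] show ?thesis
    unfolding rep_def lift_pairs_diff .
qed

lemma rep_pure: "\<lbrakk>b \<in> carrier B; c \<in> carrier C\<rbrakk> \<Longrightarrow> eqv (rep (pure b c)) (gen (mono_of b c))"
  using eqv_relations[OF rep_cls[of "frag_of (b, c)"]] by (simp add: pure_eq lift_pairs_of)

lemma rep_add:
  assumes "x \<in> carrier TR" "y \<in> carrier TR"
  shows "eqv (rep (x \<oplus>\<^bsub>TR\<^esub> y)) (rep x + rep y)"
proof -
  obtain p q where p: "Poly_Mapping.keys p \<subseteq> pairs" "x = cls p" and q: "Poly_Mapping.keys q \<subseteq> pairs" "y = cls q"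
    using assms unfolding tensor_carrier by blast
  have s: "x \<oplus>\<^bsub>TR\<^esub> y = cls (p + q)" unfolding p q by (rule cls_simps(2)[OF p(1) q(1)])
  show ?thesis
    using rel_diff[OF rel_diff[OF rep_cls[OF keys_add_subset[OF p(1) q(1)]] rep_cls[OF p(1)]] rep_cls[OF q(1)]]
    unfolding s unfolding p q by (intro eqv_relations) (simp add: lift_pairs_additive algebra_simps)
qed

lemma rep_mult:
  assumes "x \<in> carrier TR" "y \<in> carrier TR"
  shows "eqv (rep (x \<otimes>\<^bsub>TR\<^esub> y)) (rep x * rep y)"
proof -
  obtain p q where p: "Poly_Mapping.keys p \<subseteq> pairs" "x = cls p" and q: "Poly_Mapping.keys q \<subseteq> pairs" "y = cls q"
    using assms unfolding tensor_carrier by blast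
  have s: "x \<otimes>\<^bsub>TR\<^esub> y = cls (pair_mult B C p q)" unfolding p q by (rule cls_simps(3)[OF p(1) q(1)])
  have 1: "eqv (rep (x \<otimes>\<^bsub>TR\<^esub> y)) (lift_pairs (pair_mult B C p q))"
    unfolding s by (rule eqv_relations[OF rep_cls[OF pair_mult_keys[OF p(1) q(1)]]])
  have 2: "eqv (lift_pairs (pair_mult B C p q)) (lift_pairs p * lift_pairs q)"
    by (rule eqv_sym[OF eqv_relations[OF lift_pairs_mult[OF p(1) q(1)]]])
  have 3: "eqv (lift_pairs p * lift_pairs q) (rep x * rep y)"
    unfolding p(2) q(2) by (rule eqv_sym[OF eqv_mult[OF eqv_relations[OF rep_cls[OF p(1)]] eqv_relations[OF rep_cls[OF q(1)]]]])
  show ?thesis by (rule eqv_trans[OF 1 eqv_trans[OF 2 3]])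
qed

lemma eqv_mono_one: "eqv (gen mono_one) 1"
  by (rule eqv_exact[OF mono_one_closed exact_one])

definition "Q0 = {(r, x, y). 0 < r \<and> x \<in> carrier TR \<and> y \<in> carrier TR \<and> le (rep x) (gen (scalar r) * rep y)}"

lemma scalar_one: "scalar 1 = mono_one" and mono_of_one: "mono_of \<one>\<^bsub>B\<^esub> \<one>\<^bsub>C\<^esub> = mono_one"
  by (simp_all add: scalar_def mono_one_def mono_of_def)

lemma eqv_scalar_mult: "\<lbrakk>0 < r; 0 < s\<rbrakk> \<Longrightarrow> eqv (gen (scalar (r * s))) (gen (scalar r) * gen (scalar s))"
  using eqv_sym[OF eqv_gen[OF scalar_monomials scalar_monomials, of r s]] by (simp add: scalar_def mono_mult_simp)

lemma eqv_scalar_inverse: "0 < r \<Longrightarrow> eqv (gen (scalar r) * gen (scalar (1 / r))) 1"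
  using eqv_scalar_mult[of r "1 / r"] eqv_trans[OF eqv_sym eqv_mono_one[folded scalar_one]] by simp

lemma le_scalar:
  assumes "1 \<le> r"
  shows "le 1 (gen (scalar r))"
proof -
  have pos: "0 < r" using assms by simp
  have "small (scalar (1 / r))"
    unfolding small_def scalar_def bounds_def
    using scal_one QB.refl_Q[of "\<one>\<^bsub>B\<^esub>"] QC.mono_one[OF assms] by (intro exI[of _ 1] exI[of _ "\<one>\<^bsub>A\<^esub>"]) simp
  then have "le (gen (scalar (1 / r))) 1" using pos scalar_monomials[of "1 / r"] le_small by simp
  from le_mult_left[OF this, of "gen (scalar r)"] show ?thesis
    using eqv_le[OF eqv_scalar_inverse[OF pos] eqv_refl, of "gen (scalar r)"] by simp
qed

lemma reified_order_Q0: "reified_order TR Q0"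
  unfolding Q0_def
proof (rule reified_order_induced[OF T.is_cring])
  have k: "Poly_Mapping.keys (0 :: ('b \<times> 'c) \<Rightarrow>\<^sub>0 int) \<subseteq> pairs" by simp
  show "eqv (rep \<zero>\<^bsub>TR\<^esub>) 0"
    using eqv_relations[OF rep_cls[OF k]] by (simp add: cls_zero lift_pairs_additive)
  show "eqv (rep \<one>\<^bsub>TR\<^esub>) 1"
    using eqv_trans[OF rep_pure eqv_mono_one[folded mono_of_one]] by (simp add: pure_one)
  show "eqv (gen (scalar 1)) 1" unfolding scalar_one by (rule eqv_mono_one)
qed (fact rep_add rep_mult eqv_scalar_mult le_scalar)+

sublocale O: reified_order TR Q0 by (rule reified_order_Q0)

lemma Q0_pure_iff:
  assumes "0 < r" "b1 \<in> carrier B" "c1 \<in> carrier C" "b2 \<in> carrier B" "c2 \<in> carrier C"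
  shows "(r, pure b1 c1, pure b2 c2) \<in> Q0 \<longleftrightarrow> le (gen (mono_of b1 c1)) (gen (scalar r) * gen (mono_of b2 c2))"
  using eqv_le[OF rep_pure[OF assms(2,3)] eqv_mult[OF eqv_refl rep_pure[OF assms(4,5)]], of "gen (scalar r)"] assms
  by (simp add: Q0_def pure_closed)

text \<open>This monomial stands for a fraction with equal numerator and denominator; being exact it
  has value \<open>1\<close>, which is how denominators cancel.\<close>

lemma exact_diagonal:
  assumes "(b, c, r, s, t) \<in> monomials"
  shows "exact (s, t, 1, s, t)" "(s, t, 1, s, t) \<in> monomials"
proof -
  have c: "s \<in> carrier B" "t \<in> carrier C" using assms by (auto simp: monomials_iff)
  show "exact (s, t, 1, s, t)"
    unfolding exact_def
    using QB.refl_Q[OF c(1)] QC.refl_Q[OF c(2)] scal_one c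
    by (intro exI[of _ 1] exI[of _ "\<one>\<^bsub>A\<^esub>"]) (simp add: bounds_def lower_B_def lower_C_def)
  show "(s, t, 1, s, t) \<in> monomials" using assms by (simp add: monomials_iff)
qed

text \<open>After multiplication the two sides differ by the diagonal factor, which has value
  \<open>1\<close>.\<close>

lemma eqv_fraction:
  assumes m: "(b, c, r, s, t) \<in> monomials"
  shows "eqv (gen (b, c, r, s, t) * gen (mono_of s t)) (gen (scalar r) * gen (mono_of b c))"
proof -
  have car: "b \<in> carrier B" "c \<in> carrier C" "s \<in> carrier B" "t \<in> carrier C" "0 < r" using m by (auto simp: monomials_iff)
  note mo = mono_of_monomials[OF car(1,2)] mono_of_monomials[OF car(3,4)] scalar_monomials[OF car(5)] exact_diagonal(2)[OF m]
  let ?d = "(s, t, 1, s, t)" and ?n = "mono_mult (scalar r) (mono_of b c)"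
  have 1: "eqv (gen (b, c, r, s, t) * gen (mono_of s t)) (gen (mono_mult (b, c, r, s, t) (mono_of s t)))"
    by (rule eqv_gen[OF m mo(2)])
  have 2: "mono_mult (b, c, r, s, t) (mono_of s t) = mono_mult ?n ?d"
    using car by (simp add: mono_of_def scalar_def mono_mult_simp)
  have 3: "eqv (gen (mono_mult ?n ?d)) (gen ?n * gen ?d)"
    by (rule eqv_sym[OF eqv_gen[OF mono_mult_closed[OF mo(3,1)] mo(4)]])
  have 4: "eqv (gen ?n * gen ?d) (gen ?n)"
    using eqv_mult[OF eqv_refl eqv_exact[OF mo(4) exact_diagonal(1)[OF m]], of "gen ?n"] by simp
  have 5: "eqv (gen ?n) (gen (scalar r) * gen (mono_of b c))" by (rule eqv_sym[OF eqv_gen[OF mo(3,1)]])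
  show ?thesis by (rule eqv_trans[OF 1[unfolded 2] eqv_trans[OF 3 eqv_trans[OF 4 5]]])
qed

lemma small_le:
  assumes m: "(b1, c1, 1 / r, b2, c2) \<in> monomials" "small (b1, c1, 1 / r, b2, c2)" and r: "0 < r"
  shows "(r, pure b1 c1, pure b2 c2) \<in> Q0"
proof -
  have car: "b1 \<in> carrier B" "c1 \<in> carrier C" "b2 \<in> carrier B" "c2 \<in> carrier C" using m by (auto simp: monomials_iff)
  have "le (gen (b1, c1, 1 / r, b2, c2) * gen (mono_of b2 c2)) (1 * gen (mono_of b2 c2))"
    by (rule le_mult[OF le_small[OF m]])
  then have "le (gen (scalar (1 / r)) * gen (mono_of b1 c1)) (gen (mono_of b2 c2))"
    using eqv_le[OF eqv_fraction[OF m(1)] eqv_refl] by simp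
  from le_mult_left[OF this, of "gen (scalar r)"]
  have "le (gen (scalar r) * (gen (scalar (1 / r)) * gen (mono_of b1 c1))) (gen (scalar r) * gen (mono_of b2 c2))" .
  moreover have "eqv (gen (scalar r) * (gen (scalar (1 / r)) * gen (mono_of b1 c1))) (gen (mono_of b1 c1))"
    using eqv_mult[OF eqv_scalar_inverse[OF r] eqv_refl, of "gen (mono_of b1 c1)"] by (simp only: mult.assoc mult_1_left)
  ultimately have "le (gen (mono_of b1 c1)) (gen (scalar r) * gen (mono_of b2 c2))"
    using eqv_le[OF _ eqv_refl] by blast
  then show ?thesis using Q0_pure_iff[OF r car] by simp
qed

text \<open>Cancelling the tensor \<open>pure b1 c1\<close> from the inequality would give the tiny
  monomial a value of at least \<open>1\<close>. It may be cancelled because the monomial with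
  numerators \<open>1\<close> and denominators \<open>b1\<close>, \<open>c1\<close> is its inverse
  up to value \<open>1\<close>.\<close>

lemma tiny_not_le:
  assumes m: "(b2, c2, r, b1, c1) \<in> monomials" "tiny (b2, c2, r, b1, c1)"
  shows "(r, pure b1 c1, pure b2 c2) \<notin> Q0"
proof
  have car: "b1 \<in> carrier B" "c1 \<in> carrier C" "b2 \<in> carrier B" "c2 \<in> carrier C" "0 < r"
    using m by (auto simp: monomials_iff)
  assume "(r, pure b1 c1, pure b2 c2) \<in> Q0"
  then have "le (gen (mono_of b1 c1)) (gen (scalar r) * gen (mono_of b2 c2))" using Q0_pure_iff car by simp
  then have "le (1 * gen (mono_of b1 c1)) (gen (b2, c2, r, b1, c1) * gen (mono_of b1 c1))"
    using eqv_le[OF eqv_refl eqv_fraction[OF m(1)]] by simp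
  moreover have "\<not> le (gen (mono_of b1 c1)) 0"
  proof
    let ?n = "(\<one>\<^bsub>B\<^esub>, \<one>\<^bsub>C\<^esub>, 1, b1, c1)"
    assume "le (gen (mono_of b1 c1)) 0"
    from le_mult[OF this, of "gen ?n"] have z: "le (gen (mono_of b1 c1) * gen ?n) 0" by simp
    have n: "?n \<in> monomials" using m by (simp add: monomials_iff)
    have "mono_mult (mono_of b1 c1) ?n = (b1, c1, 1, b1, c1)" using car by (simp add: mono_of_def mono_mult_simp)
    then have "eqv (gen (mono_of b1 c1) * gen ?n) (gen (b1, c1, 1, b1, c1))"
      using eqv_gen[OF mono_of_monomials[OF car(1,2)] n] by simp
    from eqv_trans[OF this eqv_exact[OF exact_diagonal(2,1)[OF m(1)]]] have "le 1 0" using z eqv_le_supp by blast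
    then show False using le_nontrivial by simp
  qed
  ultimately have "le 1 (gen (b2, c2, r, b1, c1))" by (rule le_cancel)
  then show False using le_tiny[OF m] by simp
qed

text \<open>The intermediate element \<open>\<gamma>\<close> is the scalar \<open>r\<close>, which
  leaves \<open>s\<close> for the comparison in \<open>C\<close>.\<close>

lemma pure_le:
  assumes "(r, b1, b2) \<in> Q" "(s, c1, c2) \<in> R" "(1, b2, \<zero>\<^bsub>B\<^esub>) \<notin> Q" "(1, c2, \<zero>\<^bsub>C\<^esub>) \<notin> R"
  shows "(r * s, pure b1 c1, pure b2 c2) \<in> Q0"
proof -
  have d: "0 < r" "b1 \<in> carrier B" "b2 \<in> carrier B" "0 < s" "c1 \<in> carrier C" "c2 \<in> carrier C"
    using QB.dom[OF assms(1)] QC.dom[OF assms(2)] by auto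
  show ?thesis
  proof (rule small_le)
    show "small (b1, c1, 1 / (r * s), b2, c2)"
      unfolding small_def using scal_scalar[OF d(1)] assms d
      by (intro exI[of _ r] exI[of _ "\<one>\<^bsub>A\<^esub>"]) (simp add: bounds_def)
  qed (use assms d in \<open>simp_all add: monomials_iff\<close>)
qed

text \<open>The intermediate scalar \<open>1 / r\<close> puts strictness on the
  \<open>B\<close>-side and leaves \<open>w(c2) \<le> w(c1) / s\<close> to be satisfied in
  \<open>C\<close>.\<close>

lemma pure_not_le_left:
  assumes "(r, b1, b2) \<notin> Q" "(1 / s, c2, c1) \<in> R" "(1, c1, \<zero>\<^bsub>C\<^esub>) \<notin> R" "0 < r" "b1 \<in> carrier B" "b2 \<in> carrier B"
  shows "(r * s, pure b1 c1, pure b2 c2) \<notin> Q0"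
proof -
  have d: "0 < s" "c1 \<in> carrier C" "c2 \<in> carrier C" using QC.dom[OF assms(2)] by auto
  have b: "(1, b1, \<zero>\<^bsub>B\<^esub>) \<notin> Q" "(1 / r, b2, b1) \<in> Q" using assms QB.supp_le QB.total by blast+
  show ?thesis
  proof (rule tiny_not_le)
    show "tiny (b2, c2, r * s, b1, c1)"
      unfolding tiny_def using scal_scalar[of "1 / r"] assms d b
      by (intro exI[of _ "1 / r"] exI[of _ "\<one>\<^bsub>A\<^esub>"]) (simp add: bounds_def lower_B_def)
  qed (use assms d b in \<open>simp_all add: monomials_iff\<close>)
qed

lemma pure_not_le_right:
  assumes "(s, c1, c2) \<notin> R" "(1 / r, b2, b1) \<in> Q" "(1, b1, \<zero>\<^bsub>B\<^esub>) \<notin> Q" "0 < s" "c1 \<in> carrier C" "c2 \<in> carrier C"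
  shows "(r * s, pure b1 c1, pure b2 c2) \<notin> Q0"
proof -
  have d: "0 < r" "b1 \<in> carrier B" "b2 \<in> carrier B" using QB.dom[OF assms(2)] by auto
  have c: "(1, c1, \<zero>\<^bsub>C\<^esub>) \<notin> R" "(1 / s, c2, c1) \<in> R" using assms QC.supp_le QC.total by blast+
  show ?thesis
  proof (rule tiny_not_le)
    show "tiny (b2, c2, r * s, b1, c1)"
      unfolding tiny_def using scal_scalar[of "1 / r"] assms d c
      by (intro exI[of _ "1 / r"] exI[of _ "\<one>\<^bsub>A\<^esub>"]) (simp add: bounds_def lower_C_def)
  qed (use assms d c in \<open>simp_all add: monomials_iff\<close>)
qed

lemma unit_nonsupp: "(1, \<one>\<^bsub>B\<^esub>, \<zero>\<^bsub>B\<^esub>) \<notin> Q" "(1, \<one>\<^bsub>C\<^esub>, \<zero>\<^bsub>C\<^esub>) \<notin> R"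
  by (rule QB.nontrivial QC.nontrivial)+

text \<open>On pure tensors upper bounds come from commensurability, and differences inherit the
  maximum. This is the hypothesis under which the specialization is an order.\<close>

lemma Q0_bounded:
  assumes "x \<in> carrier TR"
  shows "\<exists>r. (r, x, \<one>\<^bsub>TR\<^esub>) \<in> Q0"
  using assms
proof (induction x rule: tensor_induct)
  case zero
  show ?case using O.zero[of 1 "\<one>\<^bsub>TR\<^esub>"] by auto
next
  case (pure b c)
  have "\<exists>r. (r, b, \<one>\<^bsub>B\<^esub>) \<in> Q"
    by (cases "(1, b, \<zero>\<^bsub>B\<^esub>) \<in> Q") (use QB.supp_le[of b 1 "\<one>\<^bsub>B\<^esub>"] B_bounded[of b] pure in auto)
  moreover have "\<exists>s. (s, c, \<one>\<^bsub>C\<^esub>) \<in> R"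
    by (cases "(1, c, \<zero>\<^bsub>C\<^esub>) \<in> R") (use QC.supp_le[of c 1 "\<one>\<^bsub>C\<^esub>"] C_bounded[of c] pure in auto)
  ultimately obtain r s where "(r, b, \<one>\<^bsub>B\<^esub>) \<in> Q" "(s, c, \<one>\<^bsub>C\<^esub>) \<in> R" by auto
  from pure_le[OF this unit_nonsupp] have "(r * s, pure b c, \<one>\<^bsub>TR\<^esub>) \<in> Q0" by (simp add: pure_one)
  then show ?case by (rule exI)
next
  case (diff x y)
  obtain r s where "(r, x, \<one>\<^bsub>TR\<^esub>) \<in> Q0" "(s, y, \<one>\<^bsub>TR\<^esub>) \<in> Q0" using diff.IH by auto
  then have "(max r s, x, \<one>\<^bsub>TR\<^esub>) \<in> Q0" "(max r s, y, \<one>\<^bsub>TR\<^esub>) \<in> Q0"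
    using O.mono_scale[of r x _ "max r s"] O.mono_scale[of s y _ "max r s"] by simp_all
  then have "(max r s, x \<ominus>\<^bsub>TR\<^esub> y, \<one>\<^bsub>TR\<^esub>) \<in> Q0" by (rule O.diff)
  then show ?case by (rule exI)
qed

lemma left_iff:
  assumes "b1 \<in> carrier B" "b2 \<in> carrier B" "0 < r" "(1, b2, \<zero>\<^bsub>B\<^esub>) \<notin> Q"
  shows "(r, pure b1 \<one>\<^bsub>C\<^esub>, pure b2 \<one>\<^bsub>C\<^esub>) \<in> Q0 \<longleftrightarrow> (r, b1, b2) \<in> Q"
  using pure_le[of r b1 b2 1 "\<one>\<^bsub>C\<^esub>" "\<one>\<^bsub>C\<^esub>"] pure_not_le_left[of r b1 b2 1 "\<one>\<^bsub>C\<^esub>" "\<one>\<^bsub>C\<^esub>"]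
    QC.refl_Q[of "\<one>\<^bsub>C\<^esub>"] unit_nonsupp assms by auto

lemma right_iff:
  assumes "c1 \<in> carrier C" "c2 \<in> carrier C" "0 < r" "(1, c2, \<zero>\<^bsub>C\<^esub>) \<notin> R"
  shows "(r, pure \<one>\<^bsub>B\<^esub> c1, pure \<one>\<^bsub>B\<^esub> c2) \<in> Q0 \<longleftrightarrow> (r, c1, c2) \<in> R"
  using pure_le[of 1 "\<one>\<^bsub>B\<^esub>" "\<one>\<^bsub>B\<^esub>" r c1 c2] pure_not_le_right[of r c1 c2 1 "\<one>\<^bsub>B\<^esub>" "\<one>\<^bsub>B\<^esub>"]
    QB.refl_Q[of "\<one>\<^bsub>B\<^esub>"] unit_nonsupp assms by auto

text \<open>Covers the case that \<open>b2\<close> lies in the support, which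
  \<open>left_iff\<close> excludes: in \<open>Q0\<close> the image of such an element may have a
  nonzero, though very small, value.\<close>

lemma not_le_left:
  assumes "b1 \<in> carrier B" "b2 \<in> carrier B" "(r, b1, b2) \<notin> Q"
  shows "(r, pure b1 \<one>\<^bsub>C\<^esub>, pure b2 \<one>\<^bsub>C\<^esub>) \<notin> Q0"
  using pure_not_le_left[of r b1 b2 1 "\<one>\<^bsub>C\<^esub>" "\<one>\<^bsub>C\<^esub>"] QC.refl_Q[of "\<one>\<^bsub>C\<^esub>"] unit_nonsupp assms O.dom[of r] by auto

lemma not_le_right:
  assumes "c1 \<in> carrier C" "c2 \<in> carrier C" "(r, c1, c2) \<notin> R"
  shows "(r, pure \<one>\<^bsub>B\<^esub> c1, pure \<one>\<^bsub>B\<^esub> c2) \<notin> Q0"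
  using pure_not_le_right[of r c1 c2 1 "\<one>\<^bsub>B\<^esub>" "\<one>\<^bsub>B\<^esub>"] QB.refl_Q[of "\<one>\<^bsub>B\<^esub>"] unit_nonsupp assms O.dom[of r] by auto

text \<open>Commensurability on \<open>B\<close> places an element outside the support above some
  scalar, while tininess places one in the support below all of them. So the specialization kills
  exactly the support of \<open>Q\<close>.\<close>

lemma negligible_left:
  assumes b: "b \<in> carrier B"
  shows "O.negligible (pure b \<one>\<^bsub>C\<^esub>) \<longleftrightarrow> (1, b, \<zero>\<^bsub>B\<^esub>) \<in> Q"
proof
  assume n: "O.negligible (pure b \<one>\<^bsub>C\<^esub>)"
  show "(1, b, \<zero>\<^bsub>B\<^esub>) \<in> Q"
  proof (rule ccontr)
    assume no: "(1, b, \<zero>\<^bsub>B\<^esub>) \<notin> Q"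
    then obtain r where r: "(r, \<one>\<^bsub>B\<^esub>, b) \<in> Q" using B_bounded b by blast
    then have "(r, pure \<one>\<^bsub>B\<^esub> \<one>\<^bsub>C\<^esub>, pure b \<one>\<^bsub>C\<^esub>) \<in> Q0" using left_iff[OF _ b _ no] QB.dom[OF r] by simp
    then show False using n by (simp add: O.negligible_def pure_one)
  qed
next
  assume s: "(1, b, \<zero>\<^bsub>B\<^esub>) \<in> Q"
  have "(r, \<one>\<^bsub>B\<^esub>, b) \<notin> Q" for r using QB.le_supp[OF _ s] QB.nontrivial by blast
  then show "O.negligible (pure b \<one>\<^bsub>C\<^esub>)"
    using not_le_left[OF B.one_closed b] by (simp add: O.negligible_def pure_one)
qed

lemma negligible_right:
  assumes c: "c \<in> carrier C"
  shows "O.negligible (pure \<one>\<^bsub>B\<^esub> c) \<longleftrightarrow> (1, c, \<zero>\<^bsub>C\<^esub>) \<in> R"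
proof
  assume n: "O.negligible (pure \<one>\<^bsub>B\<^esub> c)"
  show "(1, c, \<zero>\<^bsub>C\<^esub>) \<in> R"
  proof (rule ccontr)
    assume no: "(1, c, \<zero>\<^bsub>C\<^esub>) \<notin> R"
    then obtain r where r: "(r, \<one>\<^bsub>C\<^esub>, c) \<in> R" using C_bounded c by blast
    then have "(r, pure \<one>\<^bsub>B\<^esub> \<one>\<^bsub>C\<^esub>, pure \<one>\<^bsub>B\<^esub> c) \<in> Q0" using right_iff[OF _ c _ no] QC.dom[OF r] by simp
    then show False using n by (simp add: O.negligible_def pure_one)
  qed
next
  assume s: "(1, c, \<zero>\<^bsub>C\<^esub>) \<in> R"
  have "(r, \<one>\<^bsub>C\<^esub>, c) \<notin> R" for r using QC.le_supp[OF _ s] QC.nontrivial by blast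
  then show "O.negligible (pure \<one>\<^bsub>B\<^esub> c)"
    using not_le_right[OF C.one_closed c] by (simp add: O.negligible_def pure_one)
qed

text \<open>Off the support \<open>left_iff\<close> identifies the two orders; on it,
  \<open>negligible_left\<close> makes the specialization agree with \<open>Q\<close>.\<close>

lemma pullback_left: "pullback B (tensor_left A B C f g) O.specialization = Q"
proof -
  have "(r, b1, b2) \<in> pullback B (tensor_left A B C f g) O.specialization \<longleftrightarrow> (r, b1, b2) \<in> Q" for r b1 b2
  proof (cases "0 < r \<and> b1 \<in> carrier B \<and> b2 \<in> carrier B")
    case True
    have e: "(r, b1, b2) \<in> pullback B (tensor_left A B C f g) O.specialization \<longleftrightarrow>
        (r, pure b1 \<one>\<^bsub>C\<^esub>, pure b2 \<one>\<^bsub>C\<^esub>) \<in> Q0 \<or> (1, b1, \<zero>\<^bsub>B\<^esub>) \<in> Q"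
      using True negligible_left by (simp add: pullback_def O.specialization_def tensor_left_def pure_closed)
    show ?thesis
    proof (cases "(1, b1, \<zero>\<^bsub>B\<^esub>) \<in> Q")
      case s: True
      then show ?thesis using e QB.supp_le True by simp
    next
      case s: False
      show ?thesis
      proof (cases "(1, b2, \<zero>\<^bsub>B\<^esub>) \<in> Q")
        case b2: True
        then have "(r, b1, b2) \<notin> Q" using s QB.le_supp by blast
        then show ?thesis using e s not_le_left True by simp
      next
        case False
        then show ?thesis using e s left_iff True by simp
      qed
    qed
  next
    case False
    then show ?thesis using QB.dom[of r b1 b2] by (auto simp: pullback_def)
  qed
  then show ?thesis by (simp only: set_eq_iff split_paired_All simp_thms)
qed

lemma pullback_right: "pullback C (tensor_right A B C f g) O.specialization = R"
proof -
  have "(r, c1, c2) \<in> pullback C (tensor_right A B C f g) O.specialization \<longleftrightarrow> (r, c1, c2) \<in> R" for r c1 c2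
  proof (cases "0 < r \<and> c1 \<in> carrier C \<and> c2 \<in> carrier C")
    case True
    have e: "(r, c1, c2) \<in> pullback C (tensor_right A B C f g) O.specialization \<longleftrightarrow>
        (r, pure \<one>\<^bsub>B\<^esub> c1, pure \<one>\<^bsub>B\<^esub> c2) \<in> Q0 \<or> (1, c1, \<zero>\<^bsub>C\<^esub>) \<in> R"
      using True negligible_right by (simp add: pullback_def O.specialization_def tensor_right_def pure_closed)
    show ?thesis
    proof (cases "(1, c1, \<zero>\<^bsub>C\<^esub>) \<in> R")
      case s: True
      then show ?thesis using e QC.supp_le True by simp
    next
      case s: False
      show ?thesis
      proof (cases "(1, c2, \<zero>\<^bsub>C\<^esub>) \<in> R")
        case c2: True
        then have "(r, c1, c2) \<notin> R" using s QC.le_supp by blast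
        then show ?thesis using e s not_le_right True by simp
      next
        case False
        then show ?thesis using e s right_iff True by simp
      qed
    qed
  next
    case False
    then show ?thesis using QC.dom[of r c1 c2] by (auto simp: pullback_def)
  qed
  then show ?thesis by (simp only: set_eq_iff split_paired_All simp_thms)
qed

end

lemma (in amalgam) amalgamation:
  "\<exists>P. reified_order TR P \<and> pullback B (tensor_left A B C f g) P = Q \<and> pullback C (tensor_right A B C f g) P = R \<and>
     (\<forall>d\<in>carrier TR. (1, d, \<zero>\<^bsub>TR\<^esub>) \<notin> P \<longrightarrow> (\<exists>r. (r, \<one>\<^bsub>TR\<^esub>, d) \<in> P) \<and> (\<exists>r. (r, d, \<one>\<^bsub>TR\<^esub>) \<in> P))"
proof (rule monomial_preorder_exists)
  fix le assume le: "valuation_preorder le" "\<And>m. m \<in> monomials \<Longrightarrow> small m \<Longrightarrow> le (gen m) 1"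
    "\<And>m. m \<in> monomials \<Longrightarrow> tiny m \<Longrightarrow> \<not> le 1 (gen m)" "\<And>m. m \<in> monomials \<Longrightarrow> exact m \<Longrightarrow> le 1 (gen m)"
    "\<And>x. x \<in> relations \<Longrightarrow> le x 0"
  interpret amalgam_preorder A B C f g Q R le
    by unfold_locales (fact le)+
  show ?thesis
    using O.reified_order_specialization[OF Q0_bounded] pullback_left pullback_right
      O.specialization_bounded[OF Q0_bounded] by blast
qed

theorem theorem6p5:
  fixes A :: "'a affinoid" and B :: "'b affinoid" and C :: "'c affinoid"
    and f :: "'a \<Rightarrow> 'b" and g :: "'a \<Rightarrow> 'c"
  assumes "affinoid_seminormed_ring A"
    and "affinoid_seminormed_ring B"
    and "affinoid_seminormed_ring C"
    and "affinoid_morphism A B f"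
    and "affinoid_morphism A C g"
  shows "(\<lambda>x. (spra_map B (tensor_left A B C f g) x, spra_map C (tensor_right A B C f g) x)) `
           Spra (tensor_affinoid A B C f g)
         = {(y, z). y \<in> Spra B \<and> z \<in> Spra C \<and> spra_map A f y = spra_map A g z}"
proof -
  interpret A: affinoid_seminormed_ring A by fact
  interpret B: affinoid_seminormed_ring B by fact
  interpret C: affinoid_seminormed_ring C by fact
  have hf: "f \<in> ring_hom A B" "bounded_hom A B f" and hg: "g \<in> ring_hom A C" "bounded_hom A C g"
    using assms(4,5) by (auto simp: affinoid_morphism_def bounded_hom_def)
  interpret affinoid_tensor A B C f g
    by unfold_locales (rule hf(1) hg(1))+
  note nonarch = A.nonarch_seminormed_ring_axioms B.nonarch_seminormed_ring_axioms C.nonarch_seminormed_ring_axioms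
  show ?thesis
  \<comment> \<open>The affinoid structures enter through preservation of the order conditions; the
    lift of a pair of points is the amalgamation.\<close>
  proof (rule Spra_fiber_product[OF A.is_cring B.is_cring C.is_cring cring_DA hf(1) hg(1)])
    show "tensor_left A B C f g \<in> ring_hom B DA" "tensor_right A B C f g \<in> ring_hom C DA"
      using left_bounded_DA right_bounded_DA by (auto simp: bounded_hom_def)
    show "spra_order A (pullback A f Q)" if "spra_order B Q" for Q
      by (rule spra_order_pullback[OF nonarch(1,2) hf(2) affinoid_morphism_plus_part[OF assms(1,2,4)] that])
    show "spra_order A (pullback A g Q)" if "spra_order C Q" for Q
      by (rule spra_order_pullback[OF nonarch(1,3) hg(2) affinoid_morphism_plus_part[OF assms(1,3,5)] that])
    show "spra_order B (pullback B (tensor_left A B C f g) Q)" if "spra_order DA Q" for Q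
      by (rule spra_order_pullback[OF nonarch(2) nonarch_DA left_bounded_DA left_plus_part that])
    show "spra_order C (pullback C (tensor_right A B C f g) Q)" if "spra_order DA Q" for Q
      by (rule spra_order_pullback[OF nonarch(3) nonarch_DA right_bounded_DA right_plus_part that])
    show "tensor_left A B C f g (f a) = tensor_right A B C f g (g a)" if "a \<in> carrier A" for a
      by (rule left_right_commute[OF that])
    fix Q R assume Q: "spra_order B Q" and R: "spra_order C R" and QR: "pullback A f Q = pullback A g R"
    \<comment> \<open>The commensurability clause of \<open>spra_order\<close> supplies the
      boundedness assumptions.\<close>
    interpret amalgam A B C f g Q R
      using Q R QR by (simp add: amalgam_def amalgam_axioms_def spra_order_def tensor_axioms)
    obtain P where P: "reified_order TR P" "pullback B (tensor_left A B C f g) P = Q" "pullback C (tensor_right A B C f g) P = R"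
      and bd: "\<forall>d\<in>carrier TR. (1, d, \<zero>\<^bsub>TR\<^esub>) \<notin> P \<longrightarrow> (\<exists>r. (r, \<one>\<^bsub>TR\<^esub>, d) \<in> P) \<and> (\<exists>r. (r, d, \<one>\<^bsub>TR\<^esub>) \<in> P)"
      using amalgamation by auto
    have "reified_order DR P"
      by (rule reified_order_cong[OF P(1) D.is_cring]) (simp_all add: DR_simps)
    \<comment> \<open>Boundedness and the condition on \<open>plus_part\<close> are recovered from
      the two restrictions of \<open>P\<close>.\<close>
    then have "spra_order DA P"
    proof (rule spra_order_tensor)
      show "(\<exists>r. (r, \<one>\<^bsub>DR\<^esub>, d) \<in> P) \<and> (\<exists>r. (r, d, \<one>\<^bsub>DR\<^esub>) \<in> P)" if "d \<in> carrier DR" "(1, d, \<zero>\<^bsub>DR\<^esub>) \<notin> P" for d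
        using bd that by (simp add: DR_simps)
    qed (simp_all add: P Q R)
    then show "\<exists>P. spra_order DA P \<and> pullback B (tensor_left A B C f g) P = Q \<and> pullback C (tensor_right A B C f g) P = R"
      using P by blast
  qed
qed

end
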